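(* Let $\mathcal I$ be a left rooted quiver, viewed as a category, and let $\mathcal D$ be an $\mathcal I$-diagram of Grothendieck categories admitting enough projectives such that every functor $\mathcal D_\alpha$ ($\alpha\in\mathrm{Mor}(\mathcal I)$) preserves small coproducts. Suppose that $\mathcal D$ is exact. If $(\mathcal Q_i,\mathcal W_i,\mathcal R_i)$ is a Hovey triple in $\mathcal D_i$ for each $i\in\mathrm{Ob}(\mathcal I)$, and the families $\mathcal Q=\{\mathcal Q_i\}_i$ and $\{\mathcal Q_i\cap\mathcal W_i\}_i$ are compatible with respect to $\mathcal D$, then $$(\Phi(\mathcal Q),\ \mathcal D\text{-}\mathsf{Rep}_{\mathcal W},\ \mathcal D\text{-}\mathsf{Rep}_{\mathcal R})$$ is a Hovey triple in $\mathcal D\text{-}\mathsf{Rep}$. If moreover each Hovey triple $(\mathcal Q_i,\mathcal W_i,\mathcal R_i)$ is hereditary, then this Hovey triple in $\mathcal D\text{-}\mathsf{Rep}$ is hereditary.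
   Context: Quivers. A quiver $\mathcal I$ is viewed as a category (its path category): objects are vertices, morphisms are paths. Define $V_0=\emptyset$, $V_{\chi+1}=\{i: i$ is not the target of any arrow $a$ with source $s(a)\notin\bigcup_{\mu\le\chi}V_\mu\}$, and $V_\chi=\bigcup_{\mu<\chi}V_\mu$ for limit ordinals $\chi$; $\mathcal I$ is left rooted if $V_\zeta=\mathrm{Ob}(\mathcal I)$ for some ordinal $\zeta$ (equivalently, there is no infinite sequence of arrows $\cdots\to\bullet\to\bullet\to\bullet$). Diagrams and representations. An $\mathcal I$-diagram $\mathcal D$ of categories consists of a category $\mathcal D_i$ for each object $i$, a functor $\mathcal D_\alpha:\mathcal D_i\to\mathcal D_j$ for each morphism $\alpha:i\to j$, natural isomorphisms $\eta_i:\mathrm{id}_{\mathcal D_i}\to\mathcal D_{e_i}$ ($e_i$ the identity of $i$), and natural isomorphisms $\tau_{\beta,\alpha}:\mathcal D_\beta\mathcal D_\alpha\to\mathcal D_{\beta\alpha}$ for composable $\alpha,\beta$, such that $\tau_{\gamma,\beta\alpha}\circ(\mathcal D_\gamma\tau_{\beta,\alpha})=\tau_{\gamma\beta,\alpha}\circ(\tau_{\gamma,\beta}\mathcal D_\alpha)$ and $\tau_{\alpha,e_i}\circ(\mathcal D_\alpha\eta_i)=\mathrm{id}_{\mathcal D_\alpha}=\tau_{e_j,\alpha}\circ(\eta_j\mathcal D_\alpha)$. A diagram of abelian categories is exact (right exact) if every $\mathcal D_\alpha$ is additive and exact (right exact). A representation $M$ over $\mathcal D$ consists of objects $M_i\in\mathcal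 D_i$ and morphisms $M_\alpha:\mathcal D_\alpha(M_i)\to M_j$ for $\alpha:i\to j$ such that $M_{\beta\alpha}\circ\tau_{\beta,\alpha}(M_i)=M_\beta\circ\mathcal D_\beta(M_\alpha)$ and $M_{e_i}=\eta_i(M_i)^{-1}$. A morphism $\omega:M\to M'$ is a family $\omega_i:M_i\to M'_i$ with $\omega_j M_\alpha=M'_\alpha\mathcal D_\alpha(\omega_i)$ for all $\alpha:i\to j$. The resulting category $\mathcal D\text{-}\mathsf{Rep}$ is a Grothendieck category in which exactness is componentwise. A family $\{\mathcal S_i\}_{i}$ of subcategories $\mathcal S_i\subseteq\mathcal D_i$ is compatible with respect to $\mathcal D$ if $\mathcal D_\alpha(\mathcal S_i)\subseteq\mathcal S_j$ for every $\alpha:i\to j$ in $\mathcal I$. $\mathcal D\text{-}\mathsf{Rep}_{\mathcal W}$ (resp. $\mathcal D\text{-}\mathsf{Rep}_{\mathcal R}$) is the full subcategory of representations $M$ with $M_i\in\mathcal W_i$ (resp. $\mathcal R_i$) for all $i$. For $M\in\mathcal D\text{-}\mathsf{Rep}$ and $i\in\mathrm{Ob}(\mathcal I)$ let $\varphi_i^M:\coprod_{\alpha}\mathcal D_\alpha(M_{s(\alpha)})\to M_i$ be the morphism with components $M_\alpha$, the coproduct being over all arrows $\alpha$ of the quiver with target $i$ (source $s(\alpha)$). For a family $\mathcal X=\{\mathcal X_i\}$ of full subcategories $\mathcal X_i\subseteq\mathcal D_i$, $\Phi(\mathcal X)$ is the full subcategory of those $M$ such that, for every $i$, $\varphi_i^M$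 is a monomorphism and $\mathrm{coker}(\varphi_i^M)\in\mathcal X_i$. Hovey triples. In an abelian category $\mathcal A$, for a class $\mathcal C$ put $\mathcal C^\perp=\{M:\mathrm{Ext}^1_{\mathcal A}(C,M)=0\ \forall C\in\mathcal C\}$ and ${}^\perp\mathcal C=\{M:\mathrm{Ext}^1_{\mathcal A}(M,C)=0\ \forall C\in\mathcal C\}$. A cotorsion pair $(\mathcal C,\mathcal F)$ satisfies $\mathcal C^\perp=\mathcal F$ and ${}^\perp\mathcal F=\mathcal C$. It is complete if each $M$ admits short exact sequences $0\to D\to C\to M\to0$ and $0\to M\to D'\to C'\to0$ with $C,C'\in\mathcal C$, $D,D'\in\mathcal F$; it is hereditary if $\mathcal C$ is closed under kernels of epimorphisms between its objects and $\mathcal F$ is closed under cokernels of monomorphisms between its objects. A subcategory is thick if it is closed under direct summands, extensions, kernels of epimorphisms and cokernels of monomorphisms. A Hovey triple in a bicomplete abelian category $\mathcal A$ is a triple $(\mathcal Q,\mathcal W,\mathcal R)$ of full subcategories with $\mathcal W$ thick and $(\mathcal Q,\mathcal W\cap\mathcal R)$, $(\mathcal Q\cap\mathcal W,\mathcal R)$ complete cotorsion pairs; it is hereditary if both cotorsion pairs are hereditary. *)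

theory Defs
  imports
    Main
    "HOL-Library.FuncSet"
    "HOL-Library.Equipollence"
    "HOL-Algebra.Group"
    "Graph_Theory.Arc_Walk"
begin

section \<open>Smallness\<close>

text \<open>
  Smallness is measured against a type \<open>'u\<close> playing the role of a universe: a set is small if its
  cardinality is strictly below that of \<open>'u\<close>. If the cardinality of \<open>'u\<close> is strongly inaccessible,
  this is smallness with respect to a Grothendieck universe; no such closure condition is imposed
  here, so everything is stated relative to an arbitrary \<open>'u\<close>.
\<close>

definition small :: "'u itself \<Rightarrow> 'i set \<Rightarrow> bool" where
  "small (U :: 'u itself) A \<longleftrightarrow> A \<prec> (UNIV :: 'u set)"


section \<open>Categories, functors, natural transformations\<close>

text \<open>\<open>Comp C g f\<close>, written \<open>g \<odot>\<^bsub>C\<^esub> f\<close>, is ``first \<open>f\<close>, then \<open>g\<close>''.\<close>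

record ('o, 'm) cat =
  Ob :: "'o set"
  Mor :: "'m set"
  Dom :: "'m \<Rightarrow> 'o"
  Cod :: "'m \<Rightarrow> 'o"
  Id :: "'o \<Rightarrow> 'm"
  Comp :: "'m \<Rightarrow> 'm \<Rightarrow> 'm" (infixl "\<odot>\<index>" 70)

definition Hom :: "('o, 'm, 'z) cat_scheme \<Rightarrow> 'o \<Rightarrow> 'o \<Rightarrow> 'm set" where
  "Hom C A B = {f \<in> Mor C. Dom C f = A \<and> Cod C f = B}"

locale category =
  fixes C :: "('o, 'm, 'z) cat_scheme" (structure)
  assumes Dom_in_Ob: "f \<in> Mor C \<Longrightarrow> Dom C f \<in> Ob C"
    and Cod_in_Ob: "f \<in> Mor C \<Longrightarrow> Cod C f \<in> Ob C"
    and Id_in_Hom: "A \<in> Ob C \<Longrightarrow> Id C A \<in> Hom C A A"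
    and Comp_in_Hom: "\<lbrakk>f \<in> Hom C A B; g \<in> Hom C B E\<rbrakk> \<Longrightarrow> g \<odot> f \<in> Hom C A E"
    and Comp_Id_right: "f \<in> Hom C A B \<Longrightarrow> f \<odot> Id C A = f"
    and Comp_Id_left: "f \<in> Hom C A B \<Longrightarrow> Id C B \<odot> f = f"
    and Comp_assoc:
      "\<lbrakk>f \<in> Hom C A B; g \<in> Hom C B E; h \<in> Hom C E F\<rbrakk> \<Longrightarrow> h \<odot> (g \<odot> f) = (h \<odot> g) \<odot> f"

record ('o, 'm, 'p, 'n) func =
  FOb :: "'o \<Rightarrow> 'p"
  FMor :: "'m \<Rightarrow> 'n"

locale cat_functor =
  source: category C + target: category E
  for C :: "('o, 'm, 'z) cat_scheme" and E :: "('p, 'n, 'y) cat_scheme" +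
  fixes F :: "('o, 'm, 'p, 'n) func"
  assumes FOb_in_Ob: "A \<in> Ob C \<Longrightarrow> FOb F A \<in> Ob E"
    and FMor_in_Hom: "f \<in> Hom C A B \<Longrightarrow> FMor F f \<in> Hom E (FOb F A) (FOb F B)"
    and FMor_Id: "A \<in> Ob C \<Longrightarrow> FMor F (Id C A) = Id E (FOb F A)"
    and FMor_Comp: "\<lbrakk>f \<in> Hom C A B; g \<in> Hom C B B'\<rbrakk> \<Longrightarrow>
      FMor F (g \<odot>\<^bsub>C\<^esub> f) = FMor F g \<odot>\<^bsub>E\<^esub> FMor F f"

definition id_func :: "('o, 'm, 'o, 'm) func" where
  "id_func = \<lparr>FOb = (\<lambda>A. A), FMor = (\<lambda>f. f)\<rparr>"

definition comp_func ::
    "('p, 'n, 'q, 'k) func \<Rightarrow> ('o, 'm, 'p, 'n) func \<Rightarrow> ('o, 'm, 'q, 'k) func" where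
  "comp_func G F = \<lparr>FOb = FOb G \<circ> FOb F, FMor = FMor G \<circ> FMor F\<rparr>"

definition inverse_mors :: "('o, 'm, 'z) cat_scheme \<Rightarrow> 'm \<Rightarrow> 'm \<Rightarrow> bool" where
  "inverse_mors C f g \<longleftrightarrow> f \<in> Mor C \<and> g \<in> Hom C (Cod C f) (Dom C f) \<and>
     g \<odot>\<^bsub>C\<^esub> f = Id C (Dom C f) \<and> f \<odot>\<^bsub>C\<^esub> g = Id C (Cod C f)"

definition iso_mor :: "('o, 'm, 'z) cat_scheme \<Rightarrow> 'm \<Rightarrow> bool" where
  "iso_mor C f \<longleftrightarrow> (\<exists>g. inverse_mors C f g)"

definition monic :: "('o, 'm, 'z) cat_scheme \<Rightarrow> 'm \<Rightarrow> bool" where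
  "monic C f \<longleftrightarrow> f \<in> Mor C \<and>
     (\<forall>A. \<forall>g\<in>Hom C A (Dom C f). \<forall>h\<in>Hom C A (Dom C f).
        f \<odot>\<^bsub>C\<^esub> g = f \<odot>\<^bsub>C\<^esub> h \<longrightarrow> g = h)"

definition epic :: "('o, 'm, 'z) cat_scheme \<Rightarrow> 'm \<Rightarrow> bool" where
  "epic C f \<longleftrightarrow> f \<in> Mor C \<and>
     (\<forall>A. \<forall>g\<in>Hom C (Cod C f) A. \<forall>h\<in>Hom C (Cod C f) A.
        g \<odot>\<^bsub>C\<^esub> f = h \<odot>\<^bsub>C\<^esub> f \<longrightarrow> g = h)"

definition nat_trans :: "('o, 'm, 'z) cat_scheme \<Rightarrow> ('p, 'n, 'y) cat_scheme \<Rightarrow>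
    ('o, 'm, 'p, 'n) func \<Rightarrow> ('o, 'm, 'p, 'n) func \<Rightarrow> ('o \<Rightarrow> 'n) \<Rightarrow> bool" where
  "nat_trans C E F G t \<longleftrightarrow>
     (\<forall>A\<in>Ob C. t A \<in> Hom E (FOb F A) (FOb G A)) \<and>
     (\<forall>f\<in>Mor C. t (Cod C f) \<odot>\<^bsub>E\<^esub> FMor F f = FMor G f \<odot>\<^bsub>E\<^esub> t (Dom C f))"

definition nat_iso :: "('o, 'm, 'z) cat_scheme \<Rightarrow> ('p, 'n, 'y) cat_scheme \<Rightarrow>
    ('o, 'm, 'p, 'n) func \<Rightarrow> ('o, 'm, 'p, 'n) func \<Rightarrow> ('o \<Rightarrow> 'n) \<Rightarrow> bool" where
  "nat_iso C E F G t \<longleftrightarrow> nat_trans C E F G t \<and> (\<forall>A\<in>Ob C. iso_mor E (t A))"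


section \<open>Limits and colimits\<close>

definition is_coproduct ::
    "('o, 'm, 'z) cat_scheme \<Rightarrow> 'i set \<Rightarrow> ('i \<Rightarrow> 'o) \<Rightarrow> 'o \<Rightarrow> ('i \<Rightarrow> 'm) \<Rightarrow> bool" where
  "is_coproduct C S X P u \<longleftrightarrow> P \<in> Ob C \<and> (\<forall>i\<in>S. u i \<in> Hom C (X i) P) \<and>
     (\<forall>T\<in>Ob C. \<forall>v. (\<forall>i\<in>S. v i \<in> Hom C (X i) T) \<longrightarrow>
        (\<exists>!h. h \<in> Hom C P T \<and> (\<forall>i\<in>S. h \<odot>\<^bsub>C\<^esub> u i = v i)))"

definition is_cocone :: "('j, 'k, 'y) cat_scheme \<Rightarrow> ('o, 'm, 'z) cat_scheme \<Rightarrow>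
    ('j, 'k, 'o, 'm) func \<Rightarrow> 'o \<Rightarrow> ('j \<Rightarrow> 'm) \<Rightarrow> bool" where
  "is_cocone J C F L u \<longleftrightarrow> L \<in> Ob C \<and> (\<forall>j\<in>Ob J. u j \<in> Hom C (FOb F j) L) \<and>
     (\<forall>a\<in>Mor J. u (Cod J a) \<odot>\<^bsub>C\<^esub> FMor F a = u (Dom J a))"

definition is_colimit :: "('j, 'k, 'y) cat_scheme \<Rightarrow> ('o, 'm, 'z) cat_scheme \<Rightarrow>
    ('j, 'k, 'o, 'm) func \<Rightarrow> 'o \<Rightarrow> ('j \<Rightarrow> 'm) \<Rightarrow> bool" where
  "is_colimit J C F L u \<longleftrightarrow> is_cocone J C F L u \<and>
     (\<forall>T v. is_cocone J C F T v \<longrightarrow>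
        (\<exists>!h. h \<in> Hom C L T \<and> (\<forall>j\<in>Ob J. h \<odot>\<^bsub>C\<^esub> u j = v j)))"

definition is_cone :: "('j, 'k, 'y) cat_scheme \<Rightarrow> ('o, 'm, 'z) cat_scheme \<Rightarrow>
    ('j, 'k, 'o, 'm) func \<Rightarrow> 'o \<Rightarrow> ('j \<Rightarrow> 'm) \<Rightarrow> bool" where
  "is_cone J C F L p \<longleftrightarrow> L \<in> Ob C \<and> (\<forall>j\<in>Ob J. p j \<in> Hom C L (FOb F j)) \<and>
     (\<forall>a\<in>Mor J. FMor F a \<odot>\<^bsub>C\<^esub> p (Dom J a) = p (Cod J a))"

definition is_limit :: "('j, 'k, 'y) cat_scheme \<Rightarrow> ('o, 'm, 'z) cat_scheme \<Rightarrow>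
    ('j, 'k, 'o, 'm) func \<Rightarrow> 'o \<Rightarrow> ('j \<Rightarrow> 'm) \<Rightarrow> bool" where
  "is_limit J C F L p \<longleftrightarrow> is_cone J C F L p \<and>
     (\<forall>T q. is_cone J C F T q \<longrightarrow>
        (\<exists>!h. h \<in> Hom C T L \<and> (\<forall>j\<in>Ob J. p j \<odot>\<^bsub>C\<^esub> h = q j)))"

text \<open>
  Up to isomorphism, every category with small sets of objects and of morphisms has its objects
  and morphisms in \<open>'u\<close>.
\<close>

definition small_category :: "('u, 'u) cat \<Rightarrow> bool" where
  "small_category J \<longleftrightarrow> category J \<and> small TYPE('u) (Ob J) \<and> small TYPE('u) (Mor J)"

definition cocomplete :: "'u itself \<Rightarrow> ('o, 'm, 'z) cat_scheme \<Rightarrow> bool" where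
  "cocomplete (U :: 'u itself) C \<longleftrightarrow>
     (\<forall>(J :: ('u, 'u) cat) F. small_category J \<and> cat_functor J C F \<longrightarrow>
        (\<exists>L u. is_colimit J C F L u))"

definition complete :: "'u itself \<Rightarrow> ('o, 'm, 'z) cat_scheme \<Rightarrow> bool" where
  "complete (U :: 'u itself) C \<longleftrightarrow>
     (\<forall>(J :: ('u, 'u) cat) F. small_category J \<and> cat_functor J C F \<longrightarrow>
        (\<exists>L p. is_limit J C F L p))"

definition bicomplete :: "'u itself \<Rightarrow> ('o, 'm, 'z) cat_scheme \<Rightarrow> bool" where
  "bicomplete U C \<longleftrightarrow> complete U C \<and> cocomplete U C"

definition filtered :: "('j, 'k, 'z) cat_scheme \<Rightarrow> bool" where
  "filtered J \<longleftrightarrow> Ob J \<noteq> {} \<and>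
     (\<forall>i\<in>Ob J. \<forall>j\<in>Ob J. \<exists>k. Hom J i k \<noteq> {} \<and> Hom J j k \<noteq> {}) \<and>
     (\<forall>i j. \<forall>a\<in>Hom J i j. \<forall>b\<in>Hom J i j.
        \<exists>k. \<exists>c\<in>Hom J j k. c \<odot>\<^bsub>J\<^esub> a = c \<odot>\<^bsub>J\<^esub> b)"

definition preserves_small_coproducts :: "'u itself \<Rightarrow> ('o, 'm, 'z) cat_scheme \<Rightarrow>
    ('p, 'n, 'y) cat_scheme \<Rightarrow> ('o, 'm, 'p, 'n) func \<Rightarrow> bool" where
  "preserves_small_coproducts (U :: 'u itself) C E F \<longleftrightarrow>
     (\<forall>(S :: 'u set) X P u. small U S \<and> is_coproduct C S X P u \<longrightarrow>
        is_coproduct E S (\<lambda>i. FOb F (X i)) (FOb F P) (\<lambda>i. FMor F (u i)))"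


section \<open>Abelian and Grothendieck categories\<close>

record ('o, 'm) ab_cat = "('o, 'm) cat" +
  Add :: "'m \<Rightarrow> 'm \<Rightarrow> 'm" (infixl "\<boxplus>\<index>" 65)
  Zero :: "'o \<Rightarrow> 'o \<Rightarrow> 'm"

definition hom_group :: "('o, 'm, 'z) ab_cat_scheme \<Rightarrow> 'o \<Rightarrow> 'o \<Rightarrow> 'm monoid" where
  "hom_group C A B = \<lparr>carrier = Hom C A B, monoid.mult = Add C, one = Zero C A B\<rparr>"

locale preadditive_category = category C
  for C :: "('o, 'm, 'z) ab_cat_scheme" (structure) +
  assumes hom_comm_group: "\<lbrakk>A \<in> Ob C; B \<in> Ob C\<rbrakk> \<Longrightarrow> comm_group (hom_group C A B)"
    and Comp_Add_left: "\<lbrakk>f \<in> Hom C A B; g \<in> Hom C B E; h \<in> Hom C B E\<rbrakk> \<Longrightarrow>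
      (g \<boxplus> h) \<odot> f = (g \<odot> f) \<boxplus> (h \<odot> f)"
    and Comp_Add_right: "\<lbrakk>f \<in> Hom C A B; g \<in> Hom C A B; h \<in> Hom C B E\<rbrakk> \<Longrightarrow>
      h \<odot> (f \<boxplus> g) = (h \<odot> f) \<boxplus> (h \<odot> g)"

definition zero_object :: "('o, 'm, 'z) cat_scheme \<Rightarrow> 'o \<Rightarrow> bool" where
  "zero_object C Z \<longleftrightarrow> Z \<in> Ob C \<and>
     (\<forall>A\<in>Ob C. (\<exists>!f. f \<in> Hom C A Z) \<and> (\<exists>!f. f \<in> Hom C Z A))"

definition is_direct_sum :: "('o, 'm, 'z) cat_scheme \<Rightarrow> 'o \<Rightarrow> 'o \<Rightarrow> 'o \<Rightarrow> bool" where
  "is_direct_sum C A B P \<longleftrightarrow>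
     (\<exists>u. is_coproduct C (UNIV :: bool set) (\<lambda>b. if b then A else B) P u)"

definition is_kernel :: "('o, 'm, 'z) ab_cat_scheme \<Rightarrow> 'm \<Rightarrow> 'm \<Rightarrow> bool" where
  "is_kernel C f k \<longleftrightarrow> f \<in> Mor C \<and> k \<in> Mor C \<and> Cod C k = Dom C f \<and>
     f \<odot>\<^bsub>C\<^esub> k = Zero C (Dom C k) (Cod C f) \<and>
     (\<forall>T. \<forall>g\<in>Hom C T (Dom C f). f \<odot>\<^bsub>C\<^esub> g = Zero C T (Cod C f) \<longrightarrow>
        (\<exists>!h. h \<in> Hom C T (Dom C k) \<and> k \<odot>\<^bsub>C\<^esub> h = g))"

definition is_cokernel :: "('o, 'm, 'z) ab_cat_scheme \<Rightarrow> 'm \<Rightarrow> 'm \<Rightarrow> bool" where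
  "is_cokernel C f c \<longleftrightarrow> f \<in> Mor C \<and> c \<in> Mor C \<and> Dom C c = Cod C f \<and>
     c \<odot>\<^bsub>C\<^esub> f = Zero C (Dom C f) (Cod C c) \<and>
     (\<forall>T. \<forall>g\<in>Hom C (Cod C f) T. g \<odot>\<^bsub>C\<^esub> f = Zero C (Dom C f) T \<longrightarrow>
        (\<exists>!h. h \<in> Hom C (Cod C c) T \<and> h \<odot>\<^bsub>C\<^esub> c = g))"

locale abelian_category = preadditive_category C
  for C :: "('o, 'm, 'z) ab_cat_scheme" (structure) +
  assumes ex_zero_object: "\<exists>Z. zero_object C Z"
    and ex_direct_sum: "\<lbrakk>A \<in> Ob C; B \<in> Ob C\<rbrakk> \<Longrightarrow> \<exists>P. is_direct_sum C A B P"
    and ex_kernel: "f \<in> Mor C \<Longrightarrow> \<exists>k. is_kernel C f k"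
    and ex_cokernel: "f \<in> Mor C \<Longrightarrow> \<exists>c. is_cokernel C f c"
    and monic_is_kernel: "monic C f \<Longrightarrow> \<exists>g. is_kernel C g f"
    and epic_is_cokernel: "epic C f \<Longrightarrow> \<exists>g. is_cokernel C g f"

text \<open>\<open>0 \<rightarrow> Dom f \<rightarrow> Cod f = Dom g \<rightarrow> Cod g \<rightarrow> 0\<close>\<close>

definition short_exact :: "('o, 'm, 'z) ab_cat_scheme \<Rightarrow> 'm \<Rightarrow> 'm \<Rightarrow> bool" where
  "short_exact C f g \<longleftrightarrow> is_kernel C g f \<and> is_cokernel C f g"

definition additive_functor :: "('o, 'm, 'z) ab_cat_scheme \<Rightarrow> ('p, 'n, 'y) ab_cat_scheme \<Rightarrow>
    ('o, 'm, 'p, 'n) func \<Rightarrow> bool" where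
  "additive_functor C E F \<longleftrightarrow> cat_functor C E F \<and>
     (\<forall>A B. \<forall>f\<in>Hom C A B. \<forall>g\<in>Hom C A B.
        FMor F (f \<boxplus>\<^bsub>C\<^esub> g) = FMor F f \<boxplus>\<^bsub>E\<^esub> FMor F g)"

definition exact_functor :: "('o, 'm, 'z) ab_cat_scheme \<Rightarrow> ('p, 'n, 'y) ab_cat_scheme \<Rightarrow>
    ('o, 'm, 'p, 'n) func \<Rightarrow> bool" where
  "exact_functor C E F \<longleftrightarrow> cat_functor C E F \<and>
     (\<forall>f g. short_exact C f g \<longrightarrow> short_exact E (FMor F f) (FMor F g))"

text \<open>Filtered colimits of short exact sequences are short exact (axiom AB5).\<close>

definition exact_filtered_colimits :: "'u itself \<Rightarrow> ('o, 'm, 'z) ab_cat_scheme \<Rightarrow> bool" where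
  "exact_filtered_colimits (U :: 'u itself) C \<longleftrightarrow>
     (\<forall>(J :: ('u, 'u) cat) F F' F'' s t L L' L'' u u' u'' f g.
        small_category J \<and> filtered J \<and>
        cat_functor J C F \<and> cat_functor J C F' \<and> cat_functor J C F'' \<and>
        nat_trans J C F F' s \<and> nat_trans J C F' F'' t \<and>
        (\<forall>j\<in>Ob J. short_exact C (s j) (t j)) \<and>
        is_colimit J C F L u \<and> is_colimit J C F' L' u' \<and> is_colimit J C F'' L'' u'' \<and>
        f \<in> Hom C L L' \<and> (\<forall>j\<in>Ob J. f \<odot>\<^bsub>C\<^esub> u j = u' j \<odot>\<^bsub>C\<^esub> s j) \<and>
        g \<in> Hom C L' L'' \<and> (\<forall>j\<in>Ob J. g \<odot>\<^bsub>C\<^esub> u' j = u'' j \<odot>\<^bsub>C\<^esub> t j)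
        \<longrightarrow> short_exact C f g)"

definition generator :: "('o, 'm, 'z) cat_scheme \<Rightarrow> 'o \<Rightarrow> bool" where
  "generator C G \<longleftrightarrow> G \<in> Ob C \<and>
     (\<forall>A B. \<forall>f\<in>Hom C A B. \<forall>g\<in>Hom C A B. f \<noteq> g \<longrightarrow>
        (\<exists>h\<in>Hom C G A. f \<odot>\<^bsub>C\<^esub> h \<noteq> g \<odot>\<^bsub>C\<^esub> h))"

text \<open>Hom-sets are not required to be small with respect to \<open>'u\<close>.\<close>

definition grothendieck_category :: "'u itself \<Rightarrow> ('o, 'm, 'z) ab_cat_scheme \<Rightarrow> bool" where
  "grothendieck_category U C \<longleftrightarrow> abelian_category C \<and> cocomplete U C \<and>
     exact_filtered_colimits U C \<and> (\<exists>G. generator C G)"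

definition projective :: "('o, 'm, 'z) cat_scheme \<Rightarrow> 'o \<Rightarrow> bool" where
  "projective C P \<longleftrightarrow> P \<in> Ob C \<and>
     (\<forall>e. epic C e \<longrightarrow> (\<forall>f\<in>Hom C P (Cod C e). \<exists>g\<in>Hom C P (Dom C e). e \<odot>\<^bsub>C\<^esub> g = f))"

definition enough_projectives :: "('o, 'm, 'z) cat_scheme \<Rightarrow> bool" where
  "enough_projectives C \<longleftrightarrow>
     (\<forall>A\<in>Ob C. \<exists>P e. projective C P \<and> epic C e \<and> e \<in> Hom C P A)"


section \<open>Cotorsion pairs and Hovey triples\<close>

text \<open>
  Full subcategories are given by their sets of objects. \<open>Ext\<close> is Yoneda's: \<open>Ext1 C A B\<close> is the set
  of equivalence classes of extensions \<open>0 \<rightarrow> B \<rightarrow> E \<rightarrow> A \<rightarrow> 0\<close>. As a group under the Baer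
  sum it is zero iff it has exactly one element, so its addition is not needed below.
\<close>

definition extensions :: "('o, 'm, 'z) ab_cat_scheme \<Rightarrow> 'o \<Rightarrow> 'o \<Rightarrow> ('m \<times> 'm) set" where
  "extensions C A B = {(f, g). short_exact C f g \<and> Dom C f = B \<and> Cod C g = A}"

definition ext_equiv ::
    "('o, 'm, 'z) ab_cat_scheme \<Rightarrow> 'o \<Rightarrow> 'o \<Rightarrow> (('m \<times> 'm) \<times> ('m \<times> 'm)) set" where
  "ext_equiv C A B = {((f, g), (f', g')).
     (f, g) \<in> extensions C A B \<and> (f', g') \<in> extensions C A B \<and>
     (\<exists>h. iso_mor C h \<and> h \<in> Hom C (Cod C f) (Cod C f') \<and>
        h \<odot>\<^bsub>C\<^esub> f = f' \<and> g' \<odot>\<^bsub>C\<^esub> h = g)}"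

definition Ext1 :: "('o, 'm, 'z) ab_cat_scheme \<Rightarrow> 'o \<Rightarrow> 'o \<Rightarrow> ('m \<times> 'm) set set" where
  "Ext1 C A B = extensions C A B // ext_equiv C A B"

definition Ext1_vanishes :: "('o, 'm, 'z) ab_cat_scheme \<Rightarrow> 'o \<Rightarrow> 'o \<Rightarrow> bool" where
  "Ext1_vanishes C A B \<longleftrightarrow> is_singleton (Ext1 C A B)"

definition right_orth :: "('o, 'm, 'z) ab_cat_scheme \<Rightarrow> 'o set \<Rightarrow> 'o set" where
  "right_orth C S = {M \<in> Ob C. \<forall>A\<in>S. Ext1_vanishes C A M}"

definition left_orth :: "('o, 'm, 'z) ab_cat_scheme \<Rightarrow> 'o set \<Rightarrow> 'o set" where
  "left_orth C S = {M \<in> Ob C. \<forall>A\<in>S. Ext1_vanishes C M A}"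

definition cotorsion_pair :: "('o, 'm, 'z) ab_cat_scheme \<Rightarrow> 'o set \<Rightarrow> 'o set \<Rightarrow> bool" where
  "cotorsion_pair C X Y \<longleftrightarrow> X \<subseteq> Ob C \<and> Y \<subseteq> Ob C \<and> right_orth C X = Y \<and> left_orth C Y = X"

definition complete_cotorsion_pair ::
    "('o, 'm, 'z) ab_cat_scheme \<Rightarrow> 'o set \<Rightarrow> 'o set \<Rightarrow> bool" where
  "complete_cotorsion_pair C X Y \<longleftrightarrow> cotorsion_pair C X Y \<and>
     (\<forall>M\<in>Ob C.
        (\<exists>f g. short_exact C f g \<and> Dom C f \<in> Y \<and> Cod C f \<in> X \<and> Cod C g = M) \<and>
        (\<exists>f g. short_exact C f g \<and> Dom C f = M \<and> Cod C f \<in> Y \<and> Cod C g \<in> X))"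

definition closed_kernels_of_epis :: "('o, 'm, 'z) ab_cat_scheme \<Rightarrow> 'o set \<Rightarrow> bool" where
  "closed_kernels_of_epis C S \<longleftrightarrow>
     (\<forall>g k. epic C g \<and> Dom C g \<in> S \<and> Cod C g \<in> S \<and> is_kernel C g k \<longrightarrow> Dom C k \<in> S)"

definition closed_cokernels_of_monos :: "('o, 'm, 'z) ab_cat_scheme \<Rightarrow> 'o set \<Rightarrow> bool" where
  "closed_cokernels_of_monos C S \<longleftrightarrow>
     (\<forall>f c. monic C f \<and> Dom C f \<in> S \<and> Cod C f \<in> S \<and> is_cokernel C f c \<longrightarrow> Cod C c \<in> S)"

definition hereditary_cotorsion_pair ::
    "('o, 'm, 'z) ab_cat_scheme \<Rightarrow> 'o set \<Rightarrow> 'o set \<Rightarrow> bool" where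
  "hereditary_cotorsion_pair C X Y \<longleftrightarrow> cotorsion_pair C X Y \<and>
     closed_kernels_of_epis C X \<and> closed_cokernels_of_monos C Y"

definition thick :: "('o, 'm, 'z) ab_cat_scheme \<Rightarrow> 'o set \<Rightarrow> bool" where
  "thick C W \<longleftrightarrow> W \<subseteq> Ob C \<and>
     (\<forall>A\<in>Ob C. \<forall>B\<in>Ob C. \<forall>P\<in>W. is_direct_sum C A B P \<longrightarrow> A \<in> W) \<and>
     (\<forall>f g. short_exact C f g \<and> Dom C f \<in> W \<and> Cod C g \<in> W \<longrightarrow> Cod C f \<in> W) \<and>
     closed_kernels_of_epis C W \<and> closed_cokernels_of_monos C W"

definition hovey_triple :: "'u itself \<Rightarrow> ('o, 'm, 'z) ab_cat_scheme \<Rightarrow>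
    'o set \<Rightarrow> 'o set \<Rightarrow> 'o set \<Rightarrow> bool" where
  "hovey_triple U C Q W R \<longleftrightarrow> abelian_category C \<and> bicomplete U C \<and>
     Q \<subseteq> Ob C \<and> W \<subseteq> Ob C \<and> R \<subseteq> Ob C \<and> thick C W \<and>
     complete_cotorsion_pair C Q (W \<inter> R) \<and> complete_cotorsion_pair C (Q \<inter> W) R"

definition hereditary_hovey_triple :: "'u itself \<Rightarrow> ('o, 'm, 'z) ab_cat_scheme \<Rightarrow>
    'o set \<Rightarrow> 'o set \<Rightarrow> 'o set \<Rightarrow> bool" where
  "hereditary_hovey_triple U C Q W R \<longleftrightarrow> hovey_triple U C Q W R \<and>
     hereditary_cotorsion_pair C Q (W \<inter> R) \<and> hereditary_cotorsion_pair C (Q \<inter> W) R"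


section \<open>Quivers\<close>

text \<open>
  A quiver is a \<^const>\<open>wf_digraph\<close>: loops and parallel arcs are allowed, and an arc \<open>a\<close> goes from
  \<open>tail G a\<close> to \<open>head G a\<close>. In a path \<open>(i, p, j)\<close> the list \<open>p\<close> contains the arcs in the order in
  which they are traversed.
\<close>

definition small_quiver :: "'u itself \<Rightarrow> ('v, 'a) pre_digraph \<Rightarrow> bool" where
  "small_quiver U G \<longleftrightarrow> wf_digraph G \<and> small U (verts G) \<and> small U (arcs G)"

type_synonym ('v, 'a) path = "'v \<times> 'a list \<times> 'v"

definition path_category :: "('v, 'a) pre_digraph \<Rightarrow> ('v, ('v, 'a) path) cat" where
  "path_category G =
     \<lparr>Ob = verts G,
      Mor = {(i, p, j). pre_digraph.awalk G i p j},
      Dom = (\<lambda>(i, p, j). i),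
      Cod = (\<lambda>(i, p, j). j),
      Id = (\<lambda>i. (i, [], i)),
      Comp = (\<lambda>(_, q, k) (i, p, _). (i, p @ q, k))\<rparr>"

definition arc_path :: "('v, 'a) pre_digraph \<Rightarrow> 'a \<Rightarrow> ('v, 'a) path" where
  "arc_path G a = (tail G a, [a], head G a)"

text \<open>
  Ordinals are the elements of a well-order \<open>r\<close>: \<open>\<chi>\<close> is zero if \<open>underS r \<chi>\<close> is empty, and it is the
  successor of \<open>\<pi>\<close> if \<open>underS r \<chi> = under r \<pi>\<close>.
\<close>

definition rooting_sequence ::
    "('v, 'a) pre_digraph \<Rightarrow> 'x rel \<Rightarrow> ('x \<Rightarrow> 'v set) \<Rightarrow> bool" where
  "rooting_sequence G r V \<longleftrightarrow>
     (\<forall>\<chi>\<in>Field r. underS r \<chi> = {} \<longrightarrow> V \<chi> = {}) \<and>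
     (\<forall>\<chi>\<in>Field r. \<forall>\<pi>\<in>Field r. underS r \<chi> = under r \<pi> \<longrightarrow>
        V \<chi> = {i \<in> verts G. \<not> (\<exists>a\<in>arcs G. head G a = i \<and> tail G a \<notin> (\<Union>\<mu>\<in>under r \<pi>. V \<mu>))}) \<and>
     (\<forall>\<chi>\<in>Field r. underS r \<chi> \<noteq> {} \<and> (\<forall>\<pi>\<in>Field r. underS r \<chi> \<noteq> under r \<pi>) \<longrightarrow>
        V \<chi> = (\<Union>\<mu>\<in>underS r \<chi>. V \<mu>))"

text \<open>
  Well-orders on \<open>'v set\<close> suffice: the sequence is increasing and each step before it becomes
  constant adds a vertex, so a least \<open>\<zeta>\<close> has at most as many predecessors as there are vertices.
\<close>

definition left_rooted :: "('v, 'a) pre_digraph \<Rightarrow> bool" where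
  "left_rooted G \<longleftrightarrow>
     (\<exists>(r :: 'v set rel) V. Well_order r \<and> rooting_sequence G r V \<and>
        (\<exists>\<zeta>\<in>Field r. V \<zeta> = verts G))"


section \<open>Diagrams of categories and their representations\<close>

text \<open>\<open>Tau D \<beta> \<alpha> X\<close> is the component at \<open>X\<close> of \<open>\<tau>\<close> from \<open>D\<^sub>\<beta> D\<^sub>\<alpha>\<close> to \<open>D\<^sub>\<beta>\<^sub>\<alpha>\<close>.\<close>

record ('v, 'p, 'o, 'm) diagram =
  Cat :: "'v \<Rightarrow> ('o, 'm) ab_cat"
  Fun :: "'p \<Rightarrow> ('o, 'm, 'o, 'm) func"
  Eta :: "'v \<Rightarrow> 'o \<Rightarrow> 'm"
  Tau :: "'p \<Rightarrow> 'p \<Rightarrow> 'o \<Rightarrow> 'm"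

locale cat_diagram = category I
  for I :: "('v, 'p, 'z) cat_scheme" +
  fixes D :: "('v, 'p, 'o, 'm) diagram"
  assumes Cat_category: "i \<in> Ob I \<Longrightarrow> category (Cat D i)"
    and Fun_functor: "\<alpha> \<in> Hom I i j \<Longrightarrow> cat_functor (Cat D i) (Cat D j) (Fun D \<alpha>)"
    and Eta_nat_iso:
      "i \<in> Ob I \<Longrightarrow> nat_iso (Cat D i) (Cat D i) id_func (Fun D (Id I i)) (Eta D i)"
    and Tau_nat_iso: "\<lbrakk>\<alpha> \<in> Hom I i j; \<beta> \<in> Hom I j k\<rbrakk> \<Longrightarrow>
      nat_iso (Cat D i) (Cat D k) (comp_func (Fun D \<beta>) (Fun D \<alpha>)) (Fun D (\<beta> \<odot>\<^bsub>I\<^esub> \<alpha>)) (Tau D \<beta> \<alpha>)"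
    and Tau_assoc:
      "\<lbrakk>\<alpha> \<in> Hom I i j; \<beta> \<in> Hom I j k; \<gamma> \<in> Hom I k l; X \<in> Ob (Cat D i)\<rbrakk> \<Longrightarrow>
      Tau D \<gamma> (\<beta> \<odot>\<^bsub>I\<^esub> \<alpha>) X \<odot>\<^bsub>Cat D l\<^esub> FMor (Fun D \<gamma>) (Tau D \<beta> \<alpha> X) =
      Tau D (\<gamma> \<odot>\<^bsub>I\<^esub> \<beta>) \<alpha> X \<odot>\<^bsub>Cat D l\<^esub> Tau D \<gamma> \<beta> (FOb (Fun D \<alpha>) X)"
    and Tau_Id_right: "\<lbrakk>\<alpha> \<in> Hom I i j; X \<in> Ob (Cat D i)\<rbrakk> \<Longrightarrow>
      Tau D \<alpha> (Id I i) X \<odot>\<^bsub>Cat D j\<^esub> FMor (Fun D \<alpha>) (Eta D i X) = Id (Cat D j) (FOb (Fun D \<alpha>) X)"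
    and Tau_Id_left: "\<lbrakk>\<alpha> \<in> Hom I i j; X \<in> Ob (Cat D i)\<rbrakk> \<Longrightarrow>
      Tau D (Id I j) \<alpha> X \<odot>\<^bsub>Cat D j\<^esub> Eta D j (FOb (Fun D \<alpha>) X) = Id (Cat D j) (FOb (Fun D \<alpha>) X)"

definition exact_diagram ::
    "('v, 'p, 'z) cat_scheme \<Rightarrow> ('v, 'p, 'o, 'm) diagram \<Rightarrow> bool" where
  "exact_diagram I D \<longleftrightarrow> (\<forall>\<alpha>\<in>Mor I.
     additive_functor (Cat D (Dom I \<alpha>)) (Cat D (Cod I \<alpha>)) (Fun D \<alpha>) \<and>
     exact_functor (Cat D (Dom I \<alpha>)) (Cat D (Cod I \<alpha>)) (Fun D \<alpha>))"

record ('v, 'p, 'o, 'm) rep =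
  ROb :: "'v \<Rightarrow> 'o"
  RMor :: "'p \<Rightarrow> 'm"

text \<open>
  Families indexed by the objects or morphisms of the index category are functions that are
  undefined elsewhere, so that equality of representations and of their morphisms is equality of
  families.
\<close>

definition is_representation :: "('v, 'p, 'z) cat_scheme \<Rightarrow> ('v, 'p, 'o, 'm) diagram \<Rightarrow>
    ('v, 'p, 'o, 'm) rep \<Rightarrow> bool" where
  "is_representation I D M \<longleftrightarrow>
     ROb M \<in> (\<Pi>\<^sub>E i\<in>Ob I. Ob (Cat D i)) \<and>
     RMor M \<in> (\<Pi>\<^sub>E \<alpha>\<in>Mor I. Hom (Cat D (Cod I \<alpha>))
        (FOb (Fun D \<alpha>) (ROb M (Dom I \<alpha>))) (ROb M (Cod I \<alpha>))) \<and>
     (\<forall>i j k. \<forall>\<alpha>\<in>Hom I i j. \<forall>\<beta>\<in>Hom I j k.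
        RMor M (\<beta> \<odot>\<^bsub>I\<^esub> \<alpha>) \<odot>\<^bsub>Cat D k\<^esub> Tau D \<beta> \<alpha> (ROb M i) =
        RMor M \<beta> \<odot>\<^bsub>Cat D k\<^esub> FMor (Fun D \<beta>) (RMor M \<alpha>)) \<and>
     (\<forall>i\<in>Ob I. inverse_mors (Cat D i) (Eta D i (ROb M i)) (RMor M (Id I i)))"

definition is_rep_morphism :: "('v, 'p, 'z) cat_scheme \<Rightarrow> ('v, 'p, 'o, 'm) diagram \<Rightarrow>
    ('v, 'p, 'o, 'm) rep \<Rightarrow> ('v \<Rightarrow> 'm) \<Rightarrow> ('v, 'p, 'o, 'm) rep \<Rightarrow> bool" where
  "is_rep_morphism I D M \<omega> N \<longleftrightarrow>
     \<omega> \<in> (\<Pi>\<^sub>E i\<in>Ob I. Hom (Cat D i) (ROb M i) (ROb N i)) \<and>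
     (\<forall>i j. \<forall>\<alpha>\<in>Hom I i j. \<omega> j \<odot>\<^bsub>Cat D j\<^esub> RMor M \<alpha> =
        RMor N \<alpha> \<odot>\<^bsub>Cat D j\<^esub> FMor (Fun D \<alpha>) (\<omega> i))"

type_synonym ('v, 'p, 'o, 'm) rep_mor =
  "('v, 'p, 'o, 'm) rep \<times> ('v \<Rightarrow> 'm) \<times> ('v, 'p, 'o, 'm) rep"

definition Rep :: "('v, 'p, 'z) cat_scheme \<Rightarrow> ('v, 'p, 'o, 'm) diagram \<Rightarrow>
    (('v, 'p, 'o, 'm) rep, ('v, 'p, 'o, 'm) rep_mor) ab_cat" where
  "Rep I D =
     \<lparr>Ob = {M. is_representation I D M},
      Mor = {(M, \<omega>, N). is_representation I D M \<and> is_representation I D N \<and>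
               is_rep_morphism I D M \<omega> N},
      Dom = (\<lambda>(M, \<omega>, N). M),
      Cod = (\<lambda>(M, \<omega>, N). N),
      Id = (\<lambda>M. (M, (\<lambda>i\<in>Ob I. Id (Cat D i) (ROb M i)), M)),
      Comp = (\<lambda>(_, \<theta>, P) (M, \<omega>, _). (M, (\<lambda>i\<in>Ob I. \<theta> i \<odot>\<^bsub>Cat D i\<^esub> \<omega> i), P)),
      Add = (\<lambda>(M, \<omega>, N) (_, \<theta>, _). (M, (\<lambda>i\<in>Ob I. \<omega> i \<boxplus>\<^bsub>Cat D i\<^esub> \<theta> i), N)),
      Zero = (\<lambda>M N. (M, (\<lambda>i\<in>Ob I. Zero (Cat D i) (ROb M i) (ROb N i)), N))\<rparr>"

definition compatible :: "('v, 'p, 'z) cat_scheme \<Rightarrow> ('v, 'p, 'o, 'm) diagram \<Rightarrow>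
    ('v \<Rightarrow> 'o set) \<Rightarrow> bool" where
  "compatible I D S \<longleftrightarrow> (\<forall>i j. \<forall>\<alpha>\<in>Hom I i j. FOb (Fun D \<alpha>) ` S i \<subseteq> S j)"

definition Rep_sub :: "('v, 'p, 'z) cat_scheme \<Rightarrow> ('v, 'p, 'o, 'm) diagram \<Rightarrow>
    ('v \<Rightarrow> 'o set) \<Rightarrow> ('v, 'p, 'o, 'm) rep set" where
  "Rep_sub I D S = {M \<in> Ob (Rep I D). \<forall>i\<in>Ob I. ROb M i \<in> S i}"

text \<open>
  \<open>is_phi G D M i P \<phi>\<close>: \<open>P\<close> is a coproduct of the objects \<open>D\<^sub>a M\<^sub>s\<close> (\<open>s\<close> the source of \<open>a\<close>) over the arcs \<open>a\<close>
  with target \<open>i\<close>, and \<open>\<phi>\<close>, from \<open>P\<close> to \<open>M\<^sub>i\<close>, has components \<open>M\<^sub>a\<close>.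
\<close>

definition is_phi :: "('v, 'a) pre_digraph \<Rightarrow> ('v, ('v, 'a) path, 'o, 'm) diagram \<Rightarrow>
    ('v, ('v, 'a) path, 'o, 'm) rep \<Rightarrow> 'v \<Rightarrow> 'o \<Rightarrow> 'm \<Rightarrow> bool" where
  "is_phi G D M i P \<phi> \<longleftrightarrow>
     (\<exists>u. is_coproduct (Cat D i) {a \<in> arcs G. head G a = i}
            (\<lambda>a. FOb (Fun D (arc_path G a)) (ROb M (tail G a))) P u \<and>
          \<phi> \<in> Hom (Cat D i) P (ROb M i) \<and>
          (\<forall>a\<in>arcs G. head G a = i \<longrightarrow> \<phi> \<odot>\<^bsub>Cat D i\<^esub> u a = RMor M (arc_path G a)))"

definition Phi :: "('v, 'a) pre_digraph \<Rightarrow> ('v, ('v, 'a) path, 'o, 'm) diagram \<Rightarrow>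
    ('v \<Rightarrow> 'o set) \<Rightarrow> ('v, ('v, 'a) path, 'o, 'm) rep set" where
  "Phi G D X = {M \<in> Ob (Rep (path_category G) D).
     \<forall>i\<in>verts G. \<exists>P \<phi> c. is_phi G D M i P \<phi> \<and> monic (Cat D i) \<phi> \<and>
       is_cokernel (Cat D i) \<phi> c \<and> Cod (Cat D i) c \<in> X i}"

end

theory Submission
  imports Defs
begin

text \<open>
  Choose, for a pair of families \<open>(X, Y)\<close> of complete cotorsion pairs with \<open>X\<close> compatible, all data in
  \<open>\<D>-Rep\<close> by recursion along the arrows, which is well-founded as the quiver is left rooted. At a
  vertex \<open>i\<close> everything happens in the category at \<open>i\<close> relative to the map out of the coproduct
  \<open>P\<^sub>i = \<Coprod> \<D>\<^sub>a M\<^sub>s\<close>, already determined by the vertices before \<open>i\<close>: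

  \<^item> a monomorphism has cokernel in the left orthogonal of \<open>Y\<close> iff it lifts against the epimorphisms
    with kernel \<open>Y\<close>, so a section of an extension in \<open>Rep\<^sub>Y\<close> over \<open>\<Phi>(X)\<close> extends from \<open>P\<^sub>i\<close> to \<open>M\<^sub>i\<close>;
  \<^item> a special precover is built by factoring \<open>P\<^sub>i \<rightarrow> M\<^sub>i\<close> as a monomorphism with cokernel in \<open>X\<^sub>i\<close>
    followed by an epimorphism with kernel in \<open>Y\<^sub>i\<close>;
  \<^item> a special preenvelope is built from one of the pushout of \<open>M\<^sub>i\<close> along the map that the previous
    steps induce on \<open>P\<^sub>i\<close>.

  Orthogonality, the two approximations and closure under retracts make \<open>(\<Phi>(X), Rep\<^sub>Y)\<close> a complete
  cotorsion pair, for \<open>(Q, W \<inter> R)\<close> as well as for \<open>(Q \<inter> W, R)\<close>, and thickness of \<open>W\<close> gives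
  \<open>\<Phi>(Q) \<inter> Rep\<^sub>W = \<Phi>(Q \<inter> W)\<close>. A representation amounts to arbitrary data on the arrows, so kernels,
  cokernels, limits and colimits are computed componentwise.

  A coproduct of monomorphisms with cokernels
  in \<open>X\<^sub>i\<close> is a monomorphism since every object embeds into one of \<open>Y\<^sub>i\<close>. For a complete cotorsion
  pair, closure of the right class under cokernels of monomorphisms implies closure of the left class
  under kernels of epimorphisms, so only the componentwise half of heredity is checked.
\<close>

section \<open>Preadditive and abelian categories\<close>

text \<open>Lifts, factorizations and coproducts are not unique, so the recursion along the arrows
  is a choice. Each of the three recursions states a predicate \<open>Q f i r\<close> that sees
  \<open>f\<close> only at the sources of arrows into \<open>i\<close>, and
  \<open>dependent_wf_choice\<close> glues the choices. Ext between objects does not suffice at a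
  single stage, because the values on \<open>P_i\<close> are already prescribed there. Lifting
  against epimorphisms with kernel in \<open>Y_i\<close> is the relative form of Ext vanishing; it
  makes each stage solvable and it is stable under composition. In the preenvelope the quotient has
  to be controlled as well. Pushing out along a monomorphism of coproducts keeps its cokernel
  \<open>\<Coprod> D_a E_s\<close>, with \<open>E\<close> the quotient representation; the third
  isomorphism theorem then shows that this coproduct embeds into the quotient at \<open>i\<close>
  with cokernel in \<open>X_i\<close>. Limits and colimits behave differently: \<open>D_a\<close> of
  a limit cone only has to be a cone, but \<open>D_a\<close> of a colimit has to be a colimit again.
  This is deduced from exactness and preservation of coproducts by presenting the colimit as a
  cokernel between coproducts.\<close>

lemma Hom_iff: "f \<in> Hom C A B \<longleftrightarrow> f \<in> Mor C \<and> Dom C f = A \<and> Cod C f = B"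
  by (simp add: Hom_def)

context category
begin

lemma Id_mor [simp]: "A \<in> Ob C \<Longrightarrow> Id C A \<in> Mor C"
  and Dom_Id [simp]: "A \<in> Ob C \<Longrightarrow> Dom C (Id C A) = A"
  and Cod_Id [simp]: "A \<in> Ob C \<Longrightarrow> Cod C (Id C A) = A"
  using Id_in_Hom[of A] by (auto simp: Hom_iff)

lemma comp_mor [simp]: "\<lbrakk>f \<in> Mor C; g \<in> Mor C; Dom C g = Cod C f\<rbrakk> \<Longrightarrow> g \<odot> f \<in> Mor C"
  and Dom_comp [simp]: "\<lbrakk>f \<in> Mor C; g \<in> Mor C; Dom C g = Cod C f\<rbrakk> \<Longrightarrow> Dom C (g \<odot> f) = Dom C f"
  and Cod_comp [simp]: "\<lbrakk>f \<in> Mor C; g \<in> Mor C; Dom C g = Cod C f\<rbrakk> \<Longrightarrow> Cod C (g \<odot> f) = Cod C g"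
  using Comp_in_Hom[of f "Dom C f" "Cod C f" g "Cod C g"] by (auto simp: Hom_iff)

lemma comp_assoc: "\<lbrakk>f \<in> Mor C; g \<in> Mor C; h \<in> Mor C; Dom C g = Cod C f; Dom C h = Cod C g\<rbrakk>
    \<Longrightarrow> (h \<odot> g) \<odot> f = h \<odot> (g \<odot> f)"
  using Comp_assoc[of f "Dom C f" "Cod C f" g "Cod C g" h "Cod C h"] by (auto simp: Hom_iff)

lemma comp_Id [simp]: "\<lbrakk>f \<in> Mor C; Dom C f = A\<rbrakk> \<Longrightarrow> f \<odot> Id C A = f"
  and Id_comp [simp]: "\<lbrakk>f \<in> Mor C; Cod C f = A\<rbrakk> \<Longrightarrow> Id C A \<odot> f = f"
  using Comp_Id_right Comp_Id_left by (auto simp: Hom_iff)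

lemma Dom_Ob [simp]: "f \<in> Mor C \<Longrightarrow> Dom C f \<in> Ob C"
  and Cod_Ob [simp]: "f \<in> Mor C \<Longrightarrow> Cod C f \<in> Ob C"
  using Dom_in_Ob Cod_in_Ob by auto

lemma monicD: "\<lbrakk>monic C f; f \<odot> g = f \<odot> h; g \<in> Mor C; h \<in> Mor C; Dom C h = Dom C g;
    Cod C g = Dom C f; Cod C h = Dom C f\<rbrakk> \<Longrightarrow> g = h"
  unfolding monic_def Hom_def by blast

lemma epicD: "\<lbrakk>epic C f; g \<odot> f = h \<odot> f; g \<in> Mor C; h \<in> Mor C; Cod C h = Cod C g;
    Dom C g = Cod C f; Dom C h = Cod C f\<rbrakk> \<Longrightarrow> g = h"
  unfolding epic_def Hom_def by blast

lemma monic_comp: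
  assumes "monic C f" "monic C g" "Dom C g = Cod C f"
  shows "monic C (g \<odot> f)"
proof -
  have m: "f \<in> Mor C" "g \<in> Mor C" using assms by (auto simp: monic_def)
  show ?thesis unfolding monic_def
  proof (intro conjI allI ballI impI)
    show "g \<odot> f \<in> Mor C" using m assms by simp
    fix A x y assume x: "x \<in> Hom C A (Dom C (g \<odot> f))" and y: "y \<in> Hom C A (Dom C (g \<odot> f))"
      and e: "g \<odot> f \<odot> x = g \<odot> f \<odot> y"
    have x': "x \<in> Mor C" "Dom C x = A" "Cod C x = Dom C f" "y \<in> Mor C" "Dom C y = A" "Cod C y = Dom C f"
      using x y m assms by (auto simp: Hom_iff)
    have "g \<odot> (f \<odot> x) = g \<odot> (f \<odot> y)" using e x' m assms by (simp add: comp_assoc)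
    then have "f \<odot> x = f \<odot> y" by (rule monicD[OF assms(2)]) (use x' m assms in auto)
    then show "x = y" by (rule monicD[OF assms(1)]) (use x' m assms in auto)
  qed
qed

lemma epic_comp:
  assumes "epic C f" "epic C g" "Dom C g = Cod C f"
  shows "epic C (g \<odot> f)"
proof -
  have m: "f \<in> Mor C" "g \<in> Mor C" using assms by (auto simp: epic_def)
  show ?thesis unfolding epic_def
  proof (intro conjI allI ballI impI)
    show "g \<odot> f \<in> Mor C" using m assms by simp
    fix A x y assume x: "x \<in> Hom C (Cod C (g \<odot> f)) A" and y: "y \<in> Hom C (Cod C (g \<odot> f)) A"
      and e: "x \<odot> (g \<odot> f) = y \<odot> (g \<odot> f)"
    have x': "x \<in> Mor C" "Cod C x = A" "Dom C x = Cod C g" "y \<in> Mor C" "Cod C y = A" "Dom C y = Cod C g"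
      using x y m assms by (auto simp: Hom_iff)
    have "(x \<odot> g) \<odot> f = (y \<odot> g) \<odot> f" using e x' m assms by (simp add: comp_assoc)
    then have "x \<odot> g = y \<odot> g" by (rule epicD[OF assms(1)]) (use x' m assms in auto)
    then show "x = y" by (rule epicD[OF assms(2)]) (use x' m assms in auto)
  qed
qed

lemma monic_left_factor:
  assumes "monic C (g \<odot> f)" "f \<in> Mor C" "g \<in> Mor C" "Dom C g = Cod C f"
  shows "monic C f"
  unfolding monic_def
proof (intro conjI allI ballI impI)
  fix A x y assume x: "x \<in> Hom C A (Dom C f)" and y: "y \<in> Hom C A (Dom C f)"
    and e: "f \<odot> x = f \<odot> y"
  have x': "x \<in> Mor C" "Dom C x = A" "Cod C x = Dom C f" "y \<in> Mor C" "Dom C y = A" "Cod C y = Dom C f"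
    using x y by (auto simp: Hom_iff)
  have "(g \<odot> f) \<odot> x = (g \<odot> f) \<odot> y" using x' assms e by (simp add: comp_assoc)
  then show "x = y" by (rule monicD[OF assms(1)]) (use x' assms in auto)
qed (use assms in auto)

lemma epic_right_factor:
  assumes "epic C (g \<odot> f)" "f \<in> Mor C" "g \<in> Mor C" "Dom C g = Cod C f"
  shows "epic C g"
  unfolding epic_def
proof (intro conjI allI ballI impI)
  fix A x y assume x: "x \<in> Hom C (Cod C g) A" and y: "y \<in> Hom C (Cod C g) A"
    and e: "x \<odot> g = y \<odot> g"
  have x': "x \<in> Mor C" "Cod C x = A" "Dom C x = Cod C g" "y \<in> Mor C" "Cod C y = A" "Dom C y = Cod C g"
    using x y by (auto simp: Hom_iff)
  have "x \<odot> (g \<odot> f) = y \<odot> (g \<odot> f)" using x' assms e by (simp flip: comp_assoc)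
  then show "x = y" by (rule epicD[OF assms(1)]) (use x' assms in auto)
qed (use assms in auto)

lemma iso_epic:
  assumes "iso_mor C f"
  shows "epic C f"
proof -
  obtain g where g: "f \<in> Mor C" "g \<in> Mor C" "Dom C g = Cod C f" "Cod C g = Dom C f" "f \<odot> g = Id C (Cod C f)"
    using assms by (auto simp: iso_mor_def inverse_mors_def Hom_iff)
  have "epic C (f \<odot> g)" unfolding g(5) using g(1) by (simp add: epic_def Hom_iff)
  then show ?thesis by (rule epic_right_factor) (use g in simp_all)
qed

lemma monic_Id: "A \<in> Ob C \<Longrightarrow> monic C (Id C A)"
  unfolding monic_def by (simp add: Hom_iff)

lemma epic_Id: "A \<in> Ob C \<Longrightarrow> epic C (Id C A)"
  unfolding epic_def by (simp add: Hom_iff)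

text \<open>The uniqueness half of the universal property: both maps solve the problem posed by the
  family \<open>g \<odot> u i\<close>. Equations between maps out of a coproduct are reduced to the
  injections by this rule.\<close>

lemma coproduct_ext:
  assumes "is_coproduct C S X P u" "\<And>i. i \<in> S \<Longrightarrow> f \<odot> u i = g \<odot> u i"
    "f \<in> Mor C" "g \<in> Mor C" "Dom C f = P" "Dom C g = P" "Cod C g = Cod C f"
  shows "f = g"
proof -
  have u: "u i \<in> Hom C (X i) P" if "i \<in> S" for i using assms(1) that unfolding is_coproduct_def by blast
  have v: "\<forall>i\<in>S. g \<odot> u i \<in> Hom C (X i) (Cod C f)"
    using u assms(4,6,7) by (simp add: Hom_iff)
  have P: "\<exists>!h. h \<in> Hom C P (Cod C f) \<and> (\<forall>i\<in>S. h \<odot> u i = v i)"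
    if "\<forall>i\<in>S. v i \<in> Hom C (X i) (Cod C f)" for v
    using assms(1) Cod_Ob[OF assms(3)] that unfolding is_coproduct_def by blast
  have f: "f \<in> Hom C P (Cod C f) \<and> (\<forall>i\<in>S. f \<odot> u i = g \<odot> u i)"
    and g: "g \<in> Hom C P (Cod C f) \<and> (\<forall>i\<in>S. g \<odot> u i = g \<odot> u i)"
    using assms(2-7) by (simp_all add: Hom_iff)
  show ?thesis by (rule ex1E[OF P[OF v]]) (use f g in \<open>blast\<close>)
qed

lemma coproduct_ob: "is_coproduct C S X P u \<Longrightarrow> P \<in> Ob C"
  by (simp add: is_coproduct_def)

lemma coproduct_inj:
  assumes "is_coproduct C S X P u" "i \<in> S"
  shows "u i \<in> Mor C" "Dom C (u i) = X i" "Cod C (u i) = P" "X i \<in> Ob C"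
proof -
  have "u i \<in> Hom C (X i) P" using assms unfolding is_coproduct_def by blast
  then show "u i \<in> Mor C" "Dom C (u i) = X i" "Cod C (u i) = P" "X i \<in> Ob C"
    using Dom_in_Ob[of "u i"] by (simp_all add: Hom_iff)
qed

lemma coproduct_lift:
  assumes "is_coproduct C S X P u" "T \<in> Ob C" "\<And>i. i \<in> S \<Longrightarrow> v i \<in> Hom C (X i) T"
  obtains h where "h \<in> Mor C" "Dom C h = P" "Cod C h = T" "\<And>i. i \<in> S \<Longrightarrow> h \<odot> u i = v i"
proof -
  have "\<exists>!h. h \<in> Hom C P T \<and> (\<forall>i\<in>S. h \<odot> u i = v i)"
    using assms unfolding is_coproduct_def by blast
  then obtain h where "h \<in> Hom C P T" "\<forall>i\<in>S. h \<odot> u i = v i" by blast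
  then show thesis using that[of h] by (simp add: Hom_iff)
qed

end

section \<open>Preadditive categories: zero morphisms, negatives, kernels, cokernels and
  biproducts\<close>

definition neg :: "('o, 'm, 'z) ab_cat_scheme \<Rightarrow> 'm \<Rightarrow> 'm" where
  "neg C f = m_inv (hom_group C (Dom C f) (Cod C f)) f"

context preadditive_category
begin

lemma zero_mor [simp]: "\<lbrakk>A \<in> Ob C; B \<in> Ob C\<rbrakk> \<Longrightarrow> Zero C A B \<in> Mor C"
  and Dom_zero [simp]: "\<lbrakk>A \<in> Ob C; B \<in> Ob C\<rbrakk> \<Longrightarrow> Dom C (Zero C A B) = A"
  and Cod_zero [simp]: "\<lbrakk>A \<in> Ob C; B \<in> Ob C\<rbrakk> \<Longrightarrow> Cod C (Zero C A B) = B"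
  using monoid.one_closed[OF comm_group.axioms(1)[THEN comm_monoid.axioms(1)], OF hom_comm_group, of A B]
  by (simp_all add: hom_group_def Hom_iff)

text \<open>Fixing two parallel morphisms makes their Hom-set available as a
  \<open>comm_group\<close>. Its laws are exported as auxiliary facts and then restated with
  separate conditions on domain and codomain, the form in which the simplifier can discharge
  them.\<close>

context
  fixes f g assumes fg: "f \<in> Mor C" "g \<in> Mor C" "Dom C g = Dom C f" "Cod C g = Cod C f"
begin

interpretation comm_group "hom_group C (Dom C f) (Cod C f)"
  using fg by (simp add: hom_comm_group)

lemma add_mor_aux: "f \<boxplus> g \<in> Hom C (Dom C f) (Cod C f)"
  using m_closed[of f g] fg by (simp add: hom_group_def Hom_iff)

lemma add_comm_aux: "f \<boxplus> g = g \<boxplus> f"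
  using m_comm[of f g] fg by (simp add: hom_group_def Hom_iff)

lemma add_zero_aux: "f \<boxplus> Zero C (Dom C f) (Cod C f) = f"
  using r_one[of f] fg by (simp add: hom_group_def Hom_iff)

lemma neg_mor_aux: "neg C f \<in> Hom C (Dom C f) (Cod C f)"
  unfolding neg_def using inv_closed[of f] fg by (simp add: hom_group_def Hom_iff)

lemma add_neg_aux: "f \<boxplus> neg C f = Zero C (Dom C f) (Cod C f)"
  unfolding neg_def using r_inv[of f] fg by (simp add: hom_group_def Hom_iff)

lemma add_assoc_aux: "\<lbrakk>h \<in> Mor C; Dom C h = Dom C f; Cod C h = Cod C f\<rbrakk> \<Longrightarrow>
    f \<boxplus> g \<boxplus> h = f \<boxplus> (g \<boxplus> h)"
  using m_assoc[of f g h] fg by (simp add: hom_group_def Hom_iff)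

end

lemma add_mor [simp]: "\<lbrakk>f \<in> Mor C; g \<in> Mor C; Dom C g = Dom C f; Cod C g = Cod C f\<rbrakk> \<Longrightarrow> f \<boxplus> g \<in> Mor C"
  and Dom_add [simp]: "\<lbrakk>f \<in> Mor C; g \<in> Mor C; Dom C g = Dom C f; Cod C g = Cod C f\<rbrakk> \<Longrightarrow> Dom C (f \<boxplus> g) = Dom C f"
  and Cod_add [simp]: "\<lbrakk>f \<in> Mor C; g \<in> Mor C; Dom C g = Dom C f; Cod C g = Cod C f\<rbrakk> \<Longrightarrow> Cod C (f \<boxplus> g) = Cod C f"
  using add_mor_aux by (simp_all add: Hom_iff)

lemma neg_mor [simp]: "f \<in> Mor C \<Longrightarrow> neg C f \<in> Mor C"
  and Dom_neg [simp]: "f \<in> Mor C \<Longrightarrow> Dom C (neg C f) = Dom C f"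
  and Cod_neg [simp]: "f \<in> Mor C \<Longrightarrow> Cod C (neg C f) = Cod C f"
  using neg_mor_aux[of f f] by (simp_all add: Hom_iff)

lemmas add_comm = add_comm_aux

lemma add_zero [simp]: "\<lbrakk>f \<in> Mor C; Dom C f = A; Cod C f = B\<rbrakk> \<Longrightarrow> f \<boxplus> Zero C A B = f"
  using add_zero_aux[of f f] by simp

lemma zero_add [simp]: "\<lbrakk>f \<in> Mor C; Dom C f = A; Cod C f = B\<rbrakk> \<Longrightarrow> Zero C A B \<boxplus> f = f"
  using add_comm[of f "Zero C A B"] by auto

lemma add_neg [simp]: "f \<in> Mor C \<Longrightarrow> f \<boxplus> neg C f = Zero C (Dom C f) (Cod C f)"
  using add_neg_aux[of f f] by simp

lemma neg_add [simp]: "f \<in> Mor C \<Longrightarrow> neg C f \<boxplus> f = Zero C (Dom C f) (Cod C f)"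
  using add_comm[of f "neg C f"] by simp

lemma add_assoc: "\<lbrakk>f \<in> Mor C; g \<in> Mor C; h \<in> Mor C; Dom C g = Dom C f; Cod C g = Cod C f;
    Dom C h = Dom C f; Cod C h = Cod C f\<rbrakk> \<Longrightarrow> f \<boxplus> g \<boxplus> h = f \<boxplus> (g \<boxplus> h)"
  using add_assoc_aux[of f g h] by simp

lemma comp_add: "\<lbrakk>f \<in> Mor C; g \<in> Mor C; h \<in> Mor C; Dom C g = Dom C f; Cod C g = Cod C f; Dom C h = Cod C f\<rbrakk>
    \<Longrightarrow> h \<odot> (f \<boxplus> g) = (h \<odot> f) \<boxplus> (h \<odot> g)"
  using Comp_Add_right[of f "Dom C f" "Cod C f" g h "Cod C h"] by (simp add: Hom_iff)

lemma add_comp: "\<lbrakk>f \<in> Mor C; g \<in> Mor C; h \<in> Mor C; Dom C h = Dom C g; Cod C h = Cod C g; Dom C g = Cod C f\<rbrakk>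
    \<Longrightarrow> (g \<boxplus> h) \<odot> f = (g \<odot> f) \<boxplus> (h \<odot> f)"
  using Comp_Add_left[of f "Dom C f" "Cod C f" g "Cod C g" h] by (simp add: Hom_iff)

text \<open>A group has only one idempotent. In this way additive operations, namely composition on
  either side and later \<open>FMor (Fun D \<alpha>)\<close>, are seen to preserve zero
  morphisms.\<close>

lemma add_eq_self_imp_zero:
  assumes "f \<in> Mor C" "f \<boxplus> f = f"
  shows "f = Zero C (Dom C f) (Cod C f)"
proof -
  have "f \<boxplus> (f \<boxplus> neg C f) = f \<boxplus> neg C f"
    using assms by (simp del: add_neg flip: add_assoc)
  then show ?thesis using assms by simp
qed

lemma comp_zero [simp]:
  assumes "f \<in> Mor C" "A \<in> Ob C" "B \<in> Ob C" "Dom C f = B"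
  shows "f \<odot> Zero C A B = Zero C A (Cod C f)"
  using add_eq_self_imp_zero[of "f \<odot> Zero C A B"] assms comp_add[of "Zero C A B" "Zero C A B" f] by simp

lemma zero_comp [simp]:
  assumes "f \<in> Mor C" "A \<in> Ob C" "B \<in> Ob C" "Cod C f = A"
  shows "Zero C A B \<odot> f = Zero C (Dom C f) B"
  using add_eq_self_imp_zero[of "Zero C A B \<odot> f"] assms add_comp[of f "Zero C A B" "Zero C A B"] by simp

lemma neg_unique:
  assumes "f \<in> Mor C" "g \<in> Mor C" "f \<boxplus> g = Zero C (Dom C f) (Cod C f)" "Dom C g = Dom C f" "Cod C g = Cod C f"
  shows "g = neg C f"
proof -
  have "neg C f \<boxplus> (f \<boxplus> g) = neg C f" by (simp add: assms)
  moreover have "neg C f \<boxplus> (f \<boxplus> g) = g" using assms(1,2,4,5) by (simp flip: add_assoc)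
  ultimately show ?thesis by simp
qed

lemma neg_neg [simp]: "f \<in> Mor C \<Longrightarrow> neg C (neg C f) = f"
  by (rule neg_unique[symmetric]) simp_all

lemma comp_neg:
  assumes "f \<in> Mor C" "g \<in> Mor C" "Dom C g = Cod C f"
  shows "g \<odot> neg C f = neg C (g \<odot> f)"
  by (rule neg_unique) (use comp_add[of f "neg C f" g] assms in simp_all)

lemma neg_comp:
  assumes "f \<in> Mor C" "g \<in> Mor C" "Dom C g = Cod C f"
  shows "neg C g \<odot> f = neg C (g \<odot> f)"
  by (rule neg_unique) (use add_comp[of f g "neg C g"] assms in simp_all)

lemma eq_if_diff_zero:
  assumes "f \<in> Mor C" "g \<in> Mor C" "Dom C g = Dom C f" "Cod C g = Cod C f"
    "f \<boxplus> neg C g = Zero C (Dom C f) (Cod C f)"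
  shows "f = g"
  using neg_unique[of f "neg C g"] assms by (metis neg_neg neg_mor Dom_neg Cod_neg)

lemma add_neg_cancel: "\<lbrakk>f \<in> Mor C; g \<in> Mor C; Dom C g = Dom C f; Cod C g = Cod C f\<rbrakk> \<Longrightarrow> f \<boxplus> neg C g \<boxplus> g = f"
  by (simp add: add_assoc)

lemma neg_zero [simp]: "\<lbrakk>A \<in> Ob C; B \<in> Ob C\<rbrakk> \<Longrightarrow> neg C (Zero C A B) = Zero C A B"
  by (rule neg_unique[symmetric]) simp_all

lemma zero_factor: "\<lbrakk>g \<odot> f = Zero C A B; f \<in> Mor C; g \<in> Mor C; Dom C g = Cod C f; A = Dom C f; B = Cod C g;
    x \<in> Mor C; Cod C x = Dom C f\<rbrakk> \<Longrightarrow> g \<odot> (f \<odot> x) = Zero C (Dom C x) B"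
  by (simp flip: comp_assoc)

text \<open>Two morphisms with the same composite differ by one that is killed, so cancellation has
  to be tested on zero only.\<close>

lemma monicI_zero:
  assumes "f \<in> Mor C"
    "\<And>x. \<lbrakk>x \<in> Mor C; Cod C x = Dom C f; f \<odot> x = Zero C (Dom C x) (Cod C f)\<rbrakk> \<Longrightarrow> x = Zero C (Dom C x) (Dom C f)"
  shows "monic C f"
  unfolding monic_def
proof (intro conjI allI ballI impI)
  fix A g h assume g: "g \<in> Hom C A (Dom C f)" and h: "h \<in> Hom C A (Dom C f)" and e: "f \<odot> g = f \<odot> h"
  have "f \<odot> (g \<boxplus> neg C h) = Zero C A (Cod C f)"
    using g h assms(1) by (auto simp: Hom_iff comp_add comp_neg e)
  then have "g \<boxplus> neg C h = Zero C A (Dom C f)"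
    using assms(2)[of "g \<boxplus> neg C h"] g h by (auto simp: Hom_iff)
  then show "g = h" using eq_if_diff_zero[of g h] g h by (auto simp: Hom_iff)
qed (rule assms)

lemma epicI_zero:
  assumes "f \<in> Mor C"
    "\<And>x. \<lbrakk>x \<in> Mor C; Dom C x = Cod C f; x \<odot> f = Zero C (Dom C f) (Cod C x)\<rbrakk> \<Longrightarrow> x = Zero C (Cod C f) (Cod C x)"
  shows "epic C f"
  unfolding epic_def
proof (intro conjI allI ballI impI)
  fix A g h assume g: "g \<in> Hom C (Cod C f) A" and h: "h \<in> Hom C (Cod C f) A" and e: "g \<odot> f = h \<odot> f"
  have "(g \<boxplus> neg C h) \<odot> f = Zero C (Dom C f) A"
    using g h assms(1) by (auto simp: Hom_iff add_comp neg_comp e)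
  then have "g \<boxplus> neg C h = Zero C (Cod C f) A"
    using assms(2)[of "g \<boxplus> neg C h"] g h by (auto simp: Hom_iff)
  then show "g = h" using eq_if_diff_zero[of g h] g h by (auto simp: Hom_iff)
qed (rule assms)

lemma monic_zeroD: "\<lbrakk>monic C f; f \<odot> x = Zero C (Dom C x) (Cod C f); x \<in> Mor C; Cod C x = Dom C f\<rbrakk>
    \<Longrightarrow> x = Zero C (Dom C x) (Dom C f)"
  by (rule monicD[of f]) (auto simp: monic_def)

lemma epic_zeroD: "\<lbrakk>epic C f; x \<odot> f = Zero C (Dom C f) (Cod C x); x \<in> Mor C; Dom C x = Cod C f\<rbrakk>
    \<Longrightarrow> x = Zero C (Cod C f) (Cod C x)"
  by (rule epicD[of f]) (auto simp: epic_def)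

lemma kernelD:
  assumes "is_kernel C f k"
  shows "f \<in> Mor C" "k \<in> Mor C" "Cod C k = Dom C f" "f \<odot> k = Zero C (Dom C k) (Cod C f)"
  using assms by (simp_all add: is_kernel_def)

lemma cokernelD:
  assumes "is_cokernel C f c"
  shows "f \<in> Mor C" "c \<in> Mor C" "Dom C c = Cod C f" "c \<odot> f = Zero C (Dom C f) (Cod C c)"
  using assms by (simp_all add: is_cokernel_def)

lemma kernel_monic: assumes "is_kernel C f k" shows "monic C k"
proof (rule monicI_zero)
  note k = kernelD[OF assms]
  show "k \<in> Mor C" by fact
  fix x assume x: "x \<in> Mor C" "Cod C x = Dom C k" "k \<odot> x = Zero C (Dom C x) (Cod C k)"
  let ?g = "Zero C (Dom C x) (Dom C f)"
  have "?g \<in> Hom C (Dom C x) (Dom C f)" "f \<odot> ?g = Zero C (Dom C x) (Cod C f)"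
    using k x by (simp_all add: Hom_iff)
  then have "\<exists>!h. h \<in> Hom C (Dom C x) (Dom C k) \<and> k \<odot> h = ?g"
    using assms unfolding is_kernel_def by blast
  moreover have "x \<in> Hom C (Dom C x) (Dom C k) \<and> k \<odot> x = ?g" using x k by (simp add: Hom_iff)
  moreover have "Zero C (Dom C x) (Dom C k) \<in> Hom C (Dom C x) (Dom C k) \<and> k \<odot> Zero C (Dom C x) (Dom C k) = ?g"
    using x k by (simp add: Hom_iff)
  ultimately show "x = Zero C (Dom C x) (Dom C k)" by blast
qed

lemma cokernel_epic: assumes "is_cokernel C f c" shows "epic C c"
proof (rule epicI_zero)
  note k = cokernelD[OF assms]
  show "c \<in> Mor C" by fact
  fix x assume x: "x \<in> Mor C" "Dom C x = Cod C c" "x \<odot> c = Zero C (Dom C c) (Cod C x)"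
  let ?g = "Zero C (Cod C f) (Cod C x)"
  have "?g \<in> Hom C (Cod C f) (Cod C x)" "?g \<odot> f = Zero C (Dom C f) (Cod C x)"
    using k x by (simp_all add: Hom_iff)
  then have "\<exists>!h. h \<in> Hom C (Cod C c) (Cod C x) \<and> h \<odot> c = ?g"
    using assms unfolding is_cokernel_def by blast
  moreover have "x \<in> Hom C (Cod C c) (Cod C x) \<and> x \<odot> c = ?g" using x k by (simp add: Hom_iff)
  moreover have "Zero C (Cod C c) (Cod C x) \<in> Hom C (Cod C c) (Cod C x) \<and> Zero C (Cod C c) (Cod C x) \<odot> c = ?g"
    using x k by (simp add: Hom_iff)
  ultimately show "x = Zero C (Cod C c) (Cod C x)" by blast
qed

lemma kernel_lift:
  assumes "is_kernel C f k" "g \<in> Mor C" "Cod C g = Dom C f" "f \<odot> g = Zero C (Dom C g) (Cod C f)"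
  obtains h where "h \<in> Mor C" "Dom C h = Dom C g" "Cod C h = Dom C k" "k \<odot> h = g"
proof -
  have "g \<in> Hom C (Dom C g) (Dom C f)" using assms by (simp add: Hom_iff)
  then obtain h where "h \<in> Hom C (Dom C g) (Dom C k)" "k \<odot> h = g"
    using assms(1,4) unfolding is_kernel_def by blast
  then show thesis using that[of h] by (simp add: Hom_iff)
qed

lemma cokernel_lift:
  assumes "is_cokernel C f c" "g \<in> Mor C" "Dom C g = Cod C f" "g \<odot> f = Zero C (Dom C f) (Cod C g)"
  obtains h where "h \<in> Mor C" "Cod C h = Cod C g" "Dom C h = Cod C c" "h \<odot> c = g"
proof -
  have "g \<in> Hom C (Cod C f) (Cod C g)" using assms by (simp add: Hom_iff)
  then obtain h where "h \<in> Hom C (Cod C c) (Cod C g)" "h \<odot> c = g"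
    using assms(1,4) unfolding is_cokernel_def by blast
  then show thesis using that[of h] by (simp add: Hom_iff)
qed

text \<open>Uniqueness of the factorization is delegated to \<open>monic C k\<close>, which leaves
  only existence to be checked.\<close>

lemma kernelI:
  assumes "f \<in> Mor C" "monic C k" "Cod C k = Dom C f" "f \<odot> k = Zero C (Dom C k) (Cod C f)"
    "\<And>g. \<lbrakk>g \<in> Mor C; Cod C g = Dom C f; f \<odot> g = Zero C (Dom C g) (Cod C f)\<rbrakk> \<Longrightarrow>
      \<exists>h. h \<in> Mor C \<and> Dom C h = Dom C g \<and> Cod C h = Dom C k \<and> k \<odot> h = g"
  shows "is_kernel C f k"
  unfolding is_kernel_def
proof (intro conjI allI ballI impI)
  fix T g assume g: "g \<in> Hom C T (Dom C f)" "f \<odot> g = Zero C T (Cod C f)"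
  then obtain h where h: "h \<in> Mor C" "Dom C h = T" "Cod C h = Dom C k" "k \<odot> h = g"
    using assms(5)[of g] by (auto simp: Hom_iff)
  show "\<exists>!h. h \<in> Hom C T (Dom C k) \<and> k \<odot> h = g"
  proof (rule ex1I[of _ h])
    show "h \<in> Hom C T (Dom C k) \<and> k \<odot> h = g" using h by (simp add: Hom_iff)
    fix x assume "x \<in> Hom C T (Dom C k) \<and> k \<odot> x = g"
    then show "x = h" using h monicD[OF assms(2), of x h] by (simp add: Hom_iff)
  qed
qed (use assms in \<open>auto simp: monic_def\<close>)

lemma cokernelI:
  assumes "f \<in> Mor C" "epic C c" "Dom C c = Cod C f" "c \<odot> f = Zero C (Dom C f) (Cod C c)"
    "\<And>g. \<lbrakk>g \<in> Mor C; Dom C g = Cod C f; g \<odot> f = Zero C (Dom C f) (Cod C g)\<rbrakk> \<Longrightarrow>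
      \<exists>h. h \<in> Mor C \<and> Cod C h = Cod C g \<and> Dom C h = Cod C c \<and> h \<odot> c = g"
  shows "is_cokernel C f c"
  unfolding is_cokernel_def
proof (intro conjI allI ballI impI)
  fix T g assume g: "g \<in> Hom C (Cod C f) T" "g \<odot> f = Zero C (Dom C f) T"
  then obtain h where h: "h \<in> Mor C" "Cod C h = T" "Dom C h = Cod C c" "h \<odot> c = g"
    using assms(5)[of g] by (auto simp: Hom_iff)
  show "\<exists>!h. h \<in> Hom C (Cod C c) T \<and> h \<odot> c = g"
  proof (rule ex1I[of _ h])
    show "h \<in> Hom C (Cod C c) T \<and> h \<odot> c = g" using h by (simp add: Hom_iff)
    fix x assume "x \<in> Hom C (Cod C c) T \<and> x \<odot> c = g"
    then show "x = h" using h epicD[OF assms(2), of x h] by (simp add: Hom_iff)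
  qed
qed (use assms in \<open>auto simp: epic_def\<close>)

lemma short_exactD:
  assumes "short_exact C f g"
  shows "is_kernel C g f" "is_cokernel C f g" "f \<in> Mor C" "g \<in> Mor C" "Cod C f = Dom C g"
    "g \<odot> f = Zero C (Dom C f) (Cod C g)" "monic C f" "epic C g"
  using assms kernelD[of g f] kernel_monic[of g f] cokernel_epic[of f g] by (simp_all add: short_exact_def)

lemma kernel_iso:
  assumes k: "is_kernel C f k" and k': "is_kernel C f k'"
  obtains h h' where "h \<in> Mor C" "Dom C h = Dom C k'" "Cod C h = Dom C k" "k \<odot> h = k'"
    "h' \<in> Mor C" "Dom C h' = Dom C k" "Cod C h' = Dom C k'" "k' \<odot> h' = k"
    "h \<odot> h' = Id C (Dom C k)" "h' \<odot> h = Id C (Dom C k')"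
proof -
  note K = kernelD[OF k] kernelD[OF k']
  obtain h where h: "h \<in> Mor C" "Dom C h = Dom C k'" "Cod C h = Dom C k" "k \<odot> h = k'"
    by (rule kernel_lift[OF k, of k']) (use K in simp_all)
  obtain h' where h': "h' \<in> Mor C" "Dom C h' = Dom C k" "Cod C h' = Dom C k'" "k' \<odot> h' = k"
    by (rule kernel_lift[OF k', of k]) (use K in simp_all)
  have "h \<odot> h' = Id C (Dom C k)"
    by (rule monicD[OF kernel_monic[OF k]]) (use h h' K in \<open>simp_all flip: comp_assoc\<close>)
  moreover have "h' \<odot> h = Id C (Dom C k')"
    by (rule monicD[OF kernel_monic[OF k']]) (use h h' K in \<open>simp_all flip: comp_assoc\<close>)
  ultimately show thesis using that[OF h h'] by blast
qed

lemma cokernel_iso: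
  assumes k: "is_cokernel C f k" and k': "is_cokernel C f k'"
  obtains h h' where "h \<in> Mor C" "Dom C h = Cod C k" "Cod C h = Cod C k'" "h \<odot> k = k'"
    "h' \<in> Mor C" "Dom C h' = Cod C k'" "Cod C h' = Cod C k" "h' \<odot> k' = k"
    "h \<odot> h' = Id C (Cod C k')" "h' \<odot> h = Id C (Cod C k)"
proof -
  note K = cokernelD[OF k] cokernelD[OF k']
  obtain h where h: "h \<in> Mor C" "Dom C h = Cod C k" "Cod C h = Cod C k'" "h \<odot> k = k'"
    by (rule cokernel_lift[OF k, of k']) (use K in simp_all)
  obtain h' where h': "h' \<in> Mor C" "Dom C h' = Cod C k'" "Cod C h' = Cod C k" "h' \<odot> k' = k"
    by (rule cokernel_lift[OF k', of k]) (use K in simp_all)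
  have "h \<odot> h' = Id C (Cod C k')"
    by (rule epicD[OF cokernel_epic[OF k']]) (use h h' K in \<open>simp_all add: comp_assoc\<close>)
  moreover have "h' \<odot> h = Id C (Cod C k)"
    by (rule epicD[OF cokernel_epic[OF k]]) (use h h' K in \<open>simp_all add: comp_assoc\<close>)
  ultimately show thesis using that[OF h h'] by blast
qed

text \<open>Kernels are invariant under isomorphism of their source. Together with
  \<open>kernel_iso\<close> this carries a property of one constructed kernel over to every
  kernel.\<close>

lemma kernel_comp_iso:
  assumes k': "is_kernel C f k'" and h: "h \<in> Mor C" "Dom C h = Dom C k" "Cod C h = Dom C k'"
    "h' \<in> Mor C" "Dom C h' = Dom C k'" "Cod C h' = Dom C k" "h \<odot> h' = Id C (Dom C k')" "h' \<odot> h = Id C (Dom C k)"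
    and k: "k' \<odot> h = k"
  shows "is_kernel C f k"
proof -
  note K = kernelD[OF k']
  have mh: "monic C h" by (rule monic_left_factor[of h']) (use h monic_Id[OF Dom_Ob[OF h(1)]] in simp_all)
  have mk: "monic C k" unfolding k[symmetric] by (rule monic_comp[OF mh kernel_monic[OF k']]) (use h in simp)
  have kk: "k \<in> Mor C" "Cod C k = Cod C k'" using K h k Cod_comp[of h k'] comp_mor[of h k'] by simp_all
  show ?thesis
  proof (rule kernelI[OF K(1) mk])
    show "Cod C k = Dom C f" using kk K by simp
    show "f \<odot> k = Zero C (Dom C k) (Cod C f)"
      unfolding k[symmetric] by (subst zero_factor[OF K(4)]) (use K h in simp_all)
    fix g assume g: "g \<in> Mor C" "Cod C g = Dom C f" "f \<odot> g = Zero C (Dom C g) (Cod C f)"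
    obtain t where t: "t \<in> Mor C" "Dom C t = Dom C g" "Cod C t = Dom C k'" "k' \<odot> t = g"
      by (rule kernel_lift[OF k' g])
    have "k \<odot> (h' \<odot> t) = k' \<odot> ((h \<odot> h') \<odot> t)" unfolding k[symmetric] using h(1-6) t(1-3) K by (simp add: comp_assoc)
    also have "\<dots> = g" unfolding h(7) using t by simp
    finally show "\<exists>h. h \<in> Mor C \<and> Dom C h = Dom C g \<and> Cod C h = Dom C k \<and> k \<odot> h = g"
      using t h(1-6) by (intro exI[of _ "h' \<odot> t"]) simp
  qed
qed

lemma cokernel_comp_iso:
  assumes k': "is_cokernel C f k'" and h: "h \<in> Mor C" "Dom C h = Cod C k'" "Cod C h = Cod C k"
    "h' \<in> Mor C" "Dom C h' = Cod C k" "Cod C h' = Cod C k'" "h \<odot> h' = Id C (Cod C k)" "h' \<odot> h = Id C (Cod C k')"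
    and k: "h \<odot> k' = k"
  shows "is_cokernel C f k"
proof -
  note K = cokernelD[OF k']
  have mh: "epic C h" by (rule epic_right_factor[of _ h']) (use h epic_Id[OF Cod_Ob[OF h(1)]] in simp_all)
  have mk: "epic C k" unfolding k[symmetric] by (rule epic_comp[OF cokernel_epic[OF k'] mh]) (use h in simp)
  have kk: "k \<in> Mor C" "Dom C k = Dom C k'" using K h k Dom_comp[of k' h] comp_mor[of k' h] by simp_all
  show ?thesis
  proof (rule cokernelI[OF K(1) mk])
    show "Dom C k = Cod C f" using kk K by simp
    have "k \<odot> f = h \<odot> (k' \<odot> f)" unfolding k[symmetric] by (rule comp_assoc) (use K h in simp_all)
    then show "k \<odot> f = Zero C (Dom C f) (Cod C k)" using K h by simp
    fix g assume g: "g \<in> Mor C" "Dom C g = Cod C f" "g \<odot> f = Zero C (Dom C f) (Cod C g)"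
    obtain t where t: "t \<in> Mor C" "Cod C t = Cod C g" "Dom C t = Cod C k'" "t \<odot> k' = g"
      by (rule cokernel_lift[OF k' g])
    have "(t \<odot> h') \<odot> k = t \<odot> ((h' \<odot> h) \<odot> k')" unfolding k[symmetric] using h(1-6) t(1-3) K by (simp add: comp_assoc)
    also have "\<dots> = g" unfolding h(8) using t K by simp
    finally show "\<exists>h. h \<in> Mor C \<and> Cod C h = Cod C g \<and> Dom C h = Cod C k \<and> h \<odot> k = g"
      using t h(1-6) by (intro exI[of _ "t \<odot> h'"]) simp
  qed
qed

end

text \<open>\<open>is_direct_sum\<close> is a coproduct over \<open>bool\<close>. The equational
  form with injections \<open>i\<close>, \<open>j\<close> and projections \<open>p\<close>,
  \<open>q\<close> is the one that additive functors preserve and that can be checked at each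
  vertex.\<close>

definition biproduct ::
    "('o, 'm, 'z) ab_cat_scheme \<Rightarrow> 'o \<Rightarrow> 'o \<Rightarrow> 'o \<Rightarrow> 'm \<Rightarrow> 'm \<Rightarrow> 'm \<Rightarrow> 'm \<Rightarrow> bool" where
  "biproduct C A B P i j p q \<longleftrightarrow>
     i \<in> Hom C A P \<and> j \<in> Hom C B P \<and> p \<in> Hom C P A \<and> q \<in> Hom C P B \<and>
     p \<odot>\<^bsub>C\<^esub> i = Id C A \<and> q \<odot>\<^bsub>C\<^esub> j = Id C B \<and>
     p \<odot>\<^bsub>C\<^esub> j = Zero C B A \<and> q \<odot>\<^bsub>C\<^esub> i = Zero C A B \<and>
     (i \<odot>\<^bsub>C\<^esub> p) \<boxplus>\<^bsub>C\<^esub> (j \<odot>\<^bsub>C\<^esub> q) = Id C P"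

context preadditive_category
begin

lemma comp_cancel: "\<lbrakk>g \<odot> f = Id C A; f \<in> Mor C; g \<in> Mor C; Dom C g = Cod C f; A = Dom C f; x \<in> Mor C; Cod C x = Dom C f\<rbrakk>
    \<Longrightarrow> g \<odot> (f \<odot> x) = x"
  by (simp flip: comp_assoc)

lemma biproductD:
  assumes "biproduct C A B P i j p q"
  shows "i \<in> Mor C" "Dom C i = A" "Cod C i = P" "j \<in> Mor C" "Dom C j = B" "Cod C j = P"
    "p \<in> Mor C" "Dom C p = P" "Cod C p = A" "q \<in> Mor C" "Dom C q = P" "Cod C q = B"
    "A \<in> Ob C" "B \<in> Ob C" "P \<in> Ob C"
    "p \<odot> i = Id C A" "q \<odot> j = Id C B" "p \<odot> j = Zero C B A" "q \<odot> i = Zero C A B"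
    "\<lbrakk>x \<in> Mor C; Cod C x = A\<rbrakk> \<Longrightarrow> p \<odot> (i \<odot> x) = x"
    "\<lbrakk>x \<in> Mor C; Cod C x = B\<rbrakk> \<Longrightarrow> q \<odot> (j \<odot> x) = x"
    "\<lbrakk>x \<in> Mor C; Cod C x = B\<rbrakk> \<Longrightarrow> p \<odot> (j \<odot> x) = Zero C (Dom C x) A"
    "\<lbrakk>x \<in> Mor C; Cod C x = A\<rbrakk> \<Longrightarrow> q \<odot> (i \<odot> x) = Zero C (Dom C x) B"
    "(i \<odot> p) \<boxplus> (j \<odot> q) = Id C P"
proof -
  show t: "i \<in> Mor C" "Dom C i = A" "Cod C i = P" "j \<in> Mor C" "Dom C j = B" "Cod C j = P"
    "p \<in> Mor C" "Dom C p = P" "Cod C p = A" "q \<in> Mor C" "Dom C q = P" "Cod C q = B"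
    and e: "p \<odot> i = Id C A" "q \<odot> j = Id C B" "p \<odot> j = Zero C B A" "q \<odot> i = Zero C A B"
    and "(i \<odot> p) \<boxplus> (j \<odot> q) = Id C P"
    using assms by (simp_all add: biproduct_def Hom_iff)
  show "A \<in> Ob C" "B \<in> Ob C" "P \<in> Ob C" using t Dom_Ob[of i] Dom_Ob[of j] Dom_Ob[of p] by simp_all
  show "p \<odot> (i \<odot> x) = x" if "x \<in> Mor C" "Cod C x = A" using comp_cancel[OF e(1)] t that by simp
  show "q \<odot> (j \<odot> x) = x" if "x \<in> Mor C" "Cod C x = B" using comp_cancel[OF e(2)] t that by simp
  show "p \<odot> (j \<odot> x) = Zero C (Dom C x) A" if "x \<in> Mor C" "Cod C x = B" using zero_factor[OF e(3)] t that by simp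
  show "q \<odot> (i \<odot> x) = Zero C (Dom C x) B" if "x \<in> Mor C" "Cod C x = A" using zero_factor[OF e(4)] t that by simp
qed

lemma biproduct_eqI_cod:
  assumes b: "biproduct C A B P i j p q" and x: "x \<in> Mor C" "y \<in> Mor C" "Cod C x = P" "Cod C y = P" "Dom C y = Dom C x"
    "p \<odot> x = p \<odot> y" "q \<odot> x = q \<odot> y"
  shows "x = y"
proof -
  note b = biproductD[OF b]
  have s: "z = (i \<odot> (p \<odot> z)) \<boxplus> (j \<odot> (q \<odot> z))" if "z \<in> Mor C" "Cod C z = P" for z
    using arg_cong[OF b(24), of "\<lambda>w. w \<odot> z"] that b(1-15) by (simp add: add_comp comp_assoc)
  show ?thesis using s[of x] s[of y] x by simp
qed

lemma biproduct_eqI_dom: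
  assumes b: "biproduct C A B P i j p q" and x: "x \<in> Mor C" "y \<in> Mor C" "Dom C x = P" "Dom C y = P" "Cod C y = Cod C x"
    "x \<odot> i = y \<odot> i" "x \<odot> j = y \<odot> j"
  shows "x = y"
proof -
  note b = biproductD[OF b]
  have s: "z = ((z \<odot> i) \<odot> p) \<boxplus> ((z \<odot> j) \<odot> q)" if "z \<in> Mor C" "Dom C z = P" for z
    using arg_cong[OF b(24), of "\<lambda>w. z \<odot> w"] that b(1-15) by (simp add: comp_add comp_assoc)
  show ?thesis using s[of x] s[of y] x by simp
qed

lemma direct_sum_if_biproduct:
  assumes b: "biproduct C A B P i j p q"
  shows "is_direct_sum C A B P"
  unfolding is_direct_sum_def is_coproduct_def
proof (intro exI[of _ "\<lambda>b. if b then i else j"] conjI ballI allI impI)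
  note B = biproductD[OF b]
  show "P \<in> Ob C" by (rule B)
  show "(if c then i else j) \<in> Hom C (if c then A else B) P" for c using B by (simp add: Hom_iff)
  fix T v assume T: "T \<in> Ob C" and v: "\<forall>c\<in>UNIV. v c \<in> Hom C (if c then A else B) T"
  have V: "v True \<in> Mor C" "Dom C (v True) = A" "Cod C (v True) = T"
      "v False \<in> Mor C" "Dom C (v False) = B" "Cod C (v False) = T"
    using v[rule_format, of True] v[rule_format, of False] by (simp_all add: Hom_iff)
  let ?h = "(v True \<odot> p) \<boxplus> (v False \<odot> q)"
  have h: "?h \<in> Mor C" "Dom C ?h = P" "Cod C ?h = T" "?h \<odot> i = v True" "?h \<odot> j = v False"
    using V B(1-19) by (simp_all add: add_comp comp_assoc)
  show "\<exists>!h. h \<in> Hom C P T \<and> (\<forall>c\<in>UNIV. h \<odot> (if c then i else j) = v c)"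
  proof (rule ex1I[of _ ?h])
    show "?h \<in> Hom C P T \<and> (\<forall>c\<in>UNIV. ?h \<odot> (if c then i else j) = v c)" using h by (simp add: Hom_iff)
    fix x assume x: "x \<in> Hom C P T \<and> (\<forall>c\<in>UNIV. x \<odot> (if c then i else j) = v c)"
    have "x \<odot> i = v True" "x \<odot> j = v False" using x[THEN conjunct2, rule_format, of True] x[THEN conjunct2, rule_format, of False] by simp_all
    then show "x = ?h" using biproduct_eqI_dom[OF b, of x ?h] h x by (simp add: Hom_iff)
  qed
qed

text \<open>The projections are induced by identities and zero morphisms, which gives the four
  equations for the composites. The remaining identity \<open>i p + j q = 1\<close> holds because
  both sides agree on the two injections.\<close>

lemma biproduct_if_direct_sum:
  assumes "is_direct_sum C A B P"
  obtains i j p q where "biproduct C A B P i j p q"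
proof -
  let ?X = "\<lambda>b. if b then A else B"
  obtain u where u: "is_coproduct C (UNIV :: bool set) ?X P u"
    using assms unfolding is_direct_sum_def by blast
  define i j where "i = u True" and "j = u False"
  note ui = coproduct_inj[OF u, of True] coproduct_inj[OF u, of False]
  have t: "i \<in> Mor C" "Dom C i = A" "Cod C i = P" "j \<in> Mor C" "Dom C j = B" "Cod C j = P" "A \<in> Ob C" "B \<in> Ob C" "P \<in> Ob C"
    using ui coproduct_ob[OF u] by (simp_all add: i_def j_def)
  obtain p where p: "p \<in> Mor C" "Dom C p = P" "Cod C p = A"
      "\<And>c. c \<in> UNIV \<Longrightarrow> p \<odot> u c = (if c then Id C A else Zero C B A)"
    by (rule coproduct_lift[OF u, of A "\<lambda>c. if c then Id C A else Zero C B A"]) (use t in \<open>auto simp: Hom_iff\<close>)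
  obtain q where q: "q \<in> Mor C" "Dom C q = P" "Cod C q = B"
      "\<And>c. c \<in> UNIV \<Longrightarrow> q \<odot> u c = (if c then Zero C A B else Id C B)"
    by (rule coproduct_lift[OF u, of B "\<lambda>c. if c then Zero C A B else Id C B"]) (use t in \<open>auto simp: Hom_iff\<close>)
  have e: "p \<odot> i = Id C A" "q \<odot> j = Id C B" "p \<odot> j = Zero C B A" "q \<odot> i = Zero C A B"
    using p(4) q(4) by (simp_all add: i_def j_def)
  have "(i \<odot> p) \<boxplus> (j \<odot> q) = Id C P"
  proof (rule coproduct_ext[OF u])
    fix c :: bool
    have "((i \<odot> p) \<boxplus> (j \<odot> q)) \<odot> i = Id C P \<odot> i" "((i \<odot> p) \<boxplus> (j \<odot> q)) \<odot> j = Id C P \<odot> j"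
      using t p(1-3) q(1-3) by (simp_all add: add_comp comp_assoc e)
    then show "((i \<odot> p) \<boxplus> (j \<odot> q)) \<odot> u c = Id C P \<odot> u c"
      by (cases c) (simp_all add: i_def j_def)
  qed (use t p(1-3) q(1-3) in simp_all)
  then have "biproduct C A B P i j p q" using t p(1-3) q(1-3) e by (simp add: biproduct_def Hom_iff)
  then show thesis by (rule that)
qed

lemma zero_object_cod: "\<lbrakk>zero_object C Z; f \<in> Mor C; Cod C f = Z\<rbrakk> \<Longrightarrow> f = Zero C (Dom C f) Z"
proof -
  assume a: "zero_object C Z" "f \<in> Mor C" "Cod C f = Z"
  then have "\<exists>!g. g \<in> Hom C (Dom C f) Z" "f \<in> Hom C (Dom C f) Z" "Zero C (Dom C f) Z \<in> Hom C (Dom C f) Z"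
    by (auto simp: zero_object_def Hom_iff)
  then show ?thesis by blast
qed

lemma zero_object_dom: "\<lbrakk>zero_object C Z; f \<in> Mor C; Dom C f = Z\<rbrakk> \<Longrightarrow> f = Zero C Z (Cod C f)"
proof -
  assume a: "zero_object C Z" "f \<in> Mor C" "Dom C f = Z"
  then have "\<exists>!g. g \<in> Hom C Z (Cod C f)" "f \<in> Hom C Z (Cod C f)" "Zero C Z (Cod C f) \<in> Hom C Z (Cod C f)"
    by (auto simp: zero_object_def Hom_iff)
  then show ?thesis by blast
qed

end

section \<open>Abelian categories: pullbacks, pushouts, images, and exact functors\<close>

context abelian_category
begin

text \<open>The axiom only provides some \<open>g\<close> of which \<open>f\<close> is the kernel.
  As \<open>g\<close> kills \<open>f\<close>, it factors through \<open>c\<close>; so whatever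
  \<open>c\<close> kills is killed by \<open>g\<close> and therefore factors through
  \<open>f\<close>.\<close>

lemma kernel_of_cokernel:
  assumes "monic C f" "is_cokernel C f c"
  shows "is_kernel C c f"
proof -
  obtain g where g: "is_kernel C g f" using monic_is_kernel[OF assms(1)] by blast
  note G = kernelD[OF g] and K = cokernelD[OF assms(2)]
  obtain g' where g': "g' \<in> Mor C" "Cod C g' = Cod C g" "Dom C g' = Cod C c" "g' \<odot> c = g"
    by (rule cokernel_lift[OF assms(2), of g]) (use G in simp_all)
  show ?thesis
  proof (rule kernelI)
    fix x assume x: "x \<in> Mor C" "Cod C x = Dom C c" "c \<odot> x = Zero C (Dom C x) (Cod C c)"
    have "(g' \<odot> c) \<odot> x = Zero C (Dom C x) (Cod C g)" using x g'(1-3) K by (simp add: comp_assoc)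
    then have "g \<odot> x = Zero C (Dom C x) (Cod C g)" by (simp add: g')
    then obtain h where "h \<in> Mor C" "Dom C h = Dom C x" "Cod C h = Dom C f" "f \<odot> h = x"
      by (rule kernel_lift[OF g, rotated 2]) (use x K G in simp_all)
    then show "\<exists>h. h \<in> Mor C \<and> Dom C h = Dom C x \<and> Cod C h = Dom C f \<and> f \<odot> h = x" by blast
  qed (use K assms in simp_all)
qed

lemma cokernel_of_kernel:
  assumes "epic C f" "is_kernel C f k"
  shows "is_cokernel C k f"
proof -
  obtain g where g: "is_cokernel C g f" using epic_is_cokernel[OF assms(1)] by blast
  note G = cokernelD[OF g] and K = kernelD[OF assms(2)]
  obtain g' where g': "g' \<in> Mor C" "Dom C g' = Dom C g" "Cod C g' = Dom C k" "k \<odot> g' = g"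
    by (rule kernel_lift[OF assms(2), of g]) (use G in simp_all)
  show ?thesis
  proof (rule cokernelI)
    fix x assume x: "x \<in> Mor C" "Dom C x = Cod C k" "x \<odot> k = Zero C (Dom C k) (Cod C x)"
    have "x \<odot> (k \<odot> g') = Zero C (Dom C g) (Cod C x)" using x g'(1-3) K by (simp flip: comp_assoc)
    then have "x \<odot> g = Zero C (Dom C g) (Cod C x)" by (simp add: g')
    then obtain h where "h \<in> Mor C" "Cod C h = Cod C x" "Dom C h = Cod C f" "h \<odot> f = x"
      by (rule cokernel_lift[OF g, rotated 2]) (use x K G in simp_all)
    then show "\<exists>h. h \<in> Mor C \<and> Cod C h = Cod C x \<and> Dom C h = Cod C f \<and> h \<odot> f = x" by blast
  qed (use K assms in simp_all)
qed

lemma short_exact_if_monic: "\<lbrakk>monic C f; is_cokernel C f c\<rbrakk> \<Longrightarrow> short_exact C f c"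
  by (simp add: short_exact_def kernel_of_cokernel)

lemma short_exact_if_epic: "\<lbrakk>epic C f; is_kernel C f k\<rbrakk> \<Longrightarrow> short_exact C k f"
  by (simp add: short_exact_def cokernel_of_kernel)

lemma ex_biproduct:
  assumes "A \<in> Ob C" "B \<in> Ob C"
  obtains P i j p q where "biproduct C A B P i j p q"
proof -
  obtain P where "is_direct_sum C A B P" using ex_direct_sum[OF assms] by blast
  then show thesis by (rule biproduct_if_direct_sum) (rule that)
qed

text \<open>The pullback is the kernel \<open>k\<close> of \<open>m = g p - v q\<close> on the
  biproduct. The projection \<open>q k\<close> is again epic: since \<open>m i = g\<close>,
  \<open>m\<close> is epic and hence the cokernel of \<open>k\<close>, so if \<open>x\<close> kills
  \<open>q k\<close>, then \<open>x q\<close> factors through \<open>m\<close> by some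
  \<open>n\<close>; restricting along \<open>i\<close> gives \<open>n g = 0\<close>, and
  \<open>g\<close> is epic.\<close>

lemma ex_pullback:
  assumes g: "epic C g" and v: "v \<in> Mor C" "Cod C v = Cod C g"
  obtains p e where "epic C p" "e \<in> Mor C" "p \<in> Mor C" "Cod C p = Dom C v" "Cod C e = Dom C g" "Dom C e = Dom C p"
    "g \<odot> e = v \<odot> p"
    "\<And>x y. \<lbrakk>x \<in> Mor C; y \<in> Mor C; Dom C y = Dom C x; Cod C x = Dom C g; Cod C y = Dom C v; g \<odot> x = v \<odot> y\<rbrakk> \<Longrightarrow>
       \<exists>h. h \<in> Mor C \<and> Dom C h = Dom C x \<and> Cod C h = Dom C p \<and> e \<odot> h = x \<and> p \<odot> h = y"
    "\<And>x y. \<lbrakk>x \<in> Mor C; y \<in> Mor C; Dom C y = Dom C x; Cod C x = Dom C p; Cod C y = Dom C p;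
       e \<odot> x = e \<odot> y; p \<odot> x = p \<odot> y\<rbrakk> \<Longrightarrow> x = y"
    "\<And>k. is_kernel C g k \<Longrightarrow> \<exists>k'. is_kernel C p k' \<and> Dom C k' = Dom C k \<and> e \<odot> k' = k"
proof -
  have gm: "g \<in> Mor C" using g by (simp add: epic_def)
  obtain S i j p q where b: "biproduct C (Dom C g) (Dom C v) S i j p q"
    by (rule ex_biproduct[of "Dom C g" "Dom C v"]) (use gm v in simp_all)
  note B = biproductD[OF b]
  define m where "m = (g \<odot> p) \<boxplus> neg C (v \<odot> q)"
  have m: "m \<in> Mor C" "Dom C m = S" "Cod C m = Cod C g" using gm v B(1-15) by (simp_all add: m_def)
  have mi: "m \<odot> i = g" using gm v B(1-19) by (simp add: m_def add_comp neg_comp comp_assoc)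
  obtain k where k: "is_kernel C m k" using ex_kernel[OF m(1)] by blast
  note K = kernelD[OF k]
  have em: "epic C m" by (rule epic_right_factor[of m i]) (use mi g m B in simp_all)
  let ?e = "p \<odot> k" and ?p = "q \<odot> k"
  have eq: "g \<odot> (p \<odot> k) = v \<odot> (q \<odot> k)"
  proof (rule eq_if_diff_zero)
    show "(g \<odot> (p \<odot> k)) \<boxplus> neg C (v \<odot> (q \<odot> k)) = Zero C (Dom C (g \<odot> (p \<odot> k))) (Cod C (g \<odot> (p \<odot> k)))"
      using K(4) K(1-3) gm v B(1-15) by (simp add: m_def add_comp neg_comp comp_assoc)
  qed (use gm v B(1-15) K m in simp_all)
  have ep: "epic C ?p"
  proof (rule epicI_zero)
    fix x assume x: "x \<in> Mor C" "Dom C x = Cod C ?p" "x \<odot> ?p = Zero C (Dom C ?p) (Cod C x)"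
    have x': "Dom C x = Dom C v" using x K m B(1-15) by simp
    obtain n where n: "n \<in> Mor C" "Cod C n = Cod C x" "Dom C n = Cod C m" "n \<odot> m = x \<odot> q"
      by (rule cokernel_lift[OF cokernel_of_kernel[OF em k], of "x \<odot> q"]) (use x x' K m B(1-15) in \<open>simp_all add: comp_assoc\<close>)
    have "n \<odot> (m \<odot> i) = x \<odot> (q \<odot> i)" using n(4) n(1-3) m B(1-15) x(1) x' by (simp flip: comp_assoc)
    then have "n \<odot> g = Zero C (Dom C g) (Cod C x)" using mi x x' B(1-19) by simp
    then have "n = Zero C (Cod C g) (Cod C x)" using epic_zeroD[OF g, of n] n m by simp
    then have "x \<odot> q = Zero C S (Cod C x)" using n(4)[symmetric] m x(1) gm by simp
    then have "(x \<odot> q) \<odot> j = Zero C (Dom C v) (Cod C x)" using B(1-15) x by simp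
    then have "x = Zero C (Dom C v) (Cod C x)" using B(1-19) x(1) x' by (simp add: comp_assoc)
    then show "x = Zero C (Cod C ?p) (Cod C x)" using B(1-15) K m by simp
  qed (use K m B in simp_all)
  have UP: "\<exists>h. h \<in> Mor C \<and> Dom C h = Dom C x \<and> Cod C h = Dom C ?p \<and> ?e \<odot> h = x \<and> ?p \<odot> h = y"
    if x: "x \<in> Mor C" "y \<in> Mor C" "Dom C y = Dom C x" "Cod C x = Dom C g" "Cod C y = Dom C v" "g \<odot> x = v \<odot> y" for x y
  proof -
    let ?z = "(i \<odot> x) \<boxplus> (j \<odot> y)"
    have pz: "p \<odot> ?z = x" and qz: "q \<odot> ?z = y" using x B(1-23) by (simp_all add: comp_add)
    have "m \<odot> ?z = Zero C (Dom C ?z) (Cod C m)"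
    proof -
      have "m \<odot> ?z = (g \<odot> (p \<odot> ?z)) \<boxplus> neg C (v \<odot> (q \<odot> ?z))"
        using gm v B(1-15) x(1-5) by (simp add: m_def add_comp neg_comp comp_assoc del: comp_add)
      also have "\<dots> = Zero C (Dom C ?z) (Cod C m)" using pz qz x m v gm B(1-15) by simp
      finally show ?thesis .
    qed
    then obtain h where h: "h \<in> Mor C" "Dom C h = Dom C ?z" "Cod C h = Dom C k" "k \<odot> h = ?z"
      by (rule kernel_lift[OF k, rotated 2]) (use x m B(1-15) in simp_all)
    have "?e \<odot> h = x" "?p \<odot> h = y" using h pz qz K m B(1-15) by (simp_all add: comp_assoc)
    then show ?thesis using h x B(1-15) K m by (intro exI[of _ h]) simp
  qed
  have JM: "x = y" if x: "x \<in> Mor C" "y \<in> Mor C" "Dom C y = Dom C x" "Cod C x = Dom C ?p" "Cod C y = Dom C ?p"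
      "?e \<odot> x = ?e \<odot> y" "?p \<odot> x = ?p \<odot> y" for x y
  proof (rule monicD[OF kernel_monic[OF k]])
    show "k \<odot> x = k \<odot> y"
      by (rule biproduct_eqI_cod[OF b]) (use x K m B(1-15) in \<open>simp_all add: comp_assoc\<close>)
  qed (use x K m B(1-15) in simp_all)
  have KER: "\<exists>k'. is_kernel C ?p k' \<and> Dom C k' = Dom C l \<and> ?e \<odot> k' = l" if l: "is_kernel C g l" for l
  proof -
    note L = kernelD[OF l]
    \<comment> \<open>The pair of \<open>l\<close> and zero is compatible with \<open>g\<close> and
      \<open>v\<close>, so the kernel of \<open>g\<close> maps into the pullback.\<close>
    obtain k' where k': "k' \<in> Mor C" "Dom C k' = Dom C l" "Cod C k' = Dom C ?p" "?e \<odot> k' = l" "?p \<odot> k' = Zero C (Dom C l) (Dom C v)"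
      using UP[of l "Zero C (Dom C l) (Dom C v)"] L v by auto
    have "is_kernel C ?p k'"
    proof (rule kernelI)
      show "monic C k'" by (rule monic_left_factor[of ?e]) (use k' kernel_monic[OF l] K m B(1-15) in simp_all)
      fix x assume x: "x \<in> Mor C" "Cod C x = Dom C ?p" "?p \<odot> x = Zero C (Dom C x) (Cod C ?p)"
      have "g \<odot> (?e \<odot> x) = v \<odot> (?p \<odot> x)" using eq x(1,2) gm v B(1-15) K m by (simp flip: comp_assoc)
      also have "\<dots> = Zero C (Dom C x) (Cod C g)" unfolding x(3) using x(1) v B(1-15) K m by simp
      finally have gx: "g \<odot> (?e \<odot> x) = Zero C (Dom C x) (Cod C g)" .
      obtain h where h: "h \<in> Mor C" "Dom C h = Dom C x" "Cod C h = Dom C l" "l \<odot> h = ?e \<odot> x"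
        by (rule kernel_lift[OF l, of "?e \<odot> x"]) (use gx gm x(1,2) B(1-15) K m in simp_all)
      have "k' \<odot> h = x"
      proof (rule JM)
        show "?e \<odot> (k' \<odot> h) = ?e \<odot> x" using h k' B(1-15) K m comp_assoc[of h k' ?e] by simp
        have "?p \<odot> (k' \<odot> h) = (?p \<odot> k') \<odot> h" using h(1-3) k'(1-3) B(1-15) K m comp_assoc[of h k' ?p] by simp
        then show "?p \<odot> (k' \<odot> h) = ?p \<odot> x" using k'(5) h(1-3) x B(1-15) K m L v by simp
      qed (use h k' x in simp_all)
      then show "\<exists>h. h \<in> Mor C \<and> Dom C h = Dom C x \<and> Cod C h = Dom C k' \<and> k' \<odot> h = x" using h k' by auto
    qed (use k' K m B(1-15) in simp_all)
    then show ?thesis using k' by blast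
  qed
  show thesis
    by (rule that[of ?p ?e, OF ep _ _ _ _ _ eq UP JM KER]) (use K m B(1-15) in simp_all)
qed

text \<open>The pushout is the cokernel \<open>k\<close> of \<open>m = i g - j v\<close> into the
  biproduct. Each leg has the same cokernel object as the opposite side of the square; this is what
  later keeps track of quotients when an object is enlarged along a monomorphism.\<close>

lemma ex_pushout:
  assumes g: "monic C g" and v: "v \<in> Mor C" "Dom C v = Dom C g"
  obtains p e where "monic C p" "monic C v \<Longrightarrow> monic C e" "e \<in> Mor C" "p \<in> Mor C"
    "Dom C p = Cod C v" "Dom C e = Cod C g" "Cod C e = Cod C p" "e \<odot> g = p \<odot> v"
    "\<And>c. is_cokernel C g c \<Longrightarrow> \<exists>c'. is_cokernel C p c' \<and> Cod C c' = Cod C c \<and> c' \<odot> e = c"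
    "\<And>c. is_cokernel C v c \<Longrightarrow> \<exists>c'. is_cokernel C e c' \<and> Cod C c' = Cod C c \<and> c' \<odot> p = c"
    "\<And>x y. \<lbrakk>x \<in> Mor C; y \<in> Mor C; Cod C y = Cod C x; Dom C x = Cod C g; Dom C y = Cod C v; x \<odot> g = y \<odot> v\<rbrakk> \<Longrightarrow>
       \<exists>h. h \<in> Mor C \<and> Cod C h = Cod C x \<and> Dom C h = Cod C p \<and> h \<odot> e = x \<and> h \<odot> p = y"
    "\<And>x y. \<lbrakk>x \<in> Mor C; y \<in> Mor C; Cod C y = Cod C x; Dom C x = Cod C p; Dom C y = Cod C p;
       x \<odot> e = y \<odot> e; x \<odot> p = y \<odot> p\<rbrakk> \<Longrightarrow> x = y"
proof -
  have gm: "g \<in> Mor C" using g by (simp add: monic_def)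
  obtain S i j p q where b: "biproduct C (Cod C g) (Cod C v) S i j p q"
    by (rule ex_biproduct[of "Cod C g" "Cod C v"]) (use gm v in simp_all)
  note B = biproductD[OF b]
  define m where "m = (i \<odot> g) \<boxplus> neg C (j \<odot> v)"
  have m: "m \<in> Mor C" "Cod C m = S" "Dom C m = Dom C g" using gm v B(1-15) by (simp_all add: m_def)
  have mp: "p \<odot> m = g" and mq: "q \<odot> m = neg C v" using gm v B(1-23) by (simp_all add: m_def comp_add comp_neg)
  obtain k where k: "is_cokernel C m k" using ex_cokernel[OF m(1)] by blast
  note K = cokernelD[OF k]
  have mm: "monic C m" by (rule monic_left_factor[of p m]) (use mp g m B in simp_all)
  let ?e = "k \<odot> i" and ?p = "k \<odot> j"
  have eq: "?e \<odot> g = ?p \<odot> v"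
  proof (rule eq_if_diff_zero)
    show "(?e \<odot> g) \<boxplus> neg C (?p \<odot> v) = Zero C (Dom C (?e \<odot> g)) (Cod C (?e \<odot> g))"
      using K(4) K(1-3) gm v B(1-15) by (simp add: m_def comp_add comp_neg comp_assoc)
  qed (use gm v B(1-15) K m in simp_all)
  \<comment> \<open>The common argument for both legs. If \<open>k (w x) = 0\<close>, then
    \<open>w x\<close> factors through \<open>m\<close> by some \<open>n\<close>, as
    \<open>m\<close> is the kernel of its cokernel. The other projection \<open>r\<close> kills
    \<open>w\<close> and leaves the monomorphism \<open>r m\<close>, which is \<open>g\<close> or
    minus \<open>v\<close>; so \<open>n\<close> and then \<open>x\<close> vanish.\<close>
  have component_zero: "x = Zero C (Dom C x) (Dom C w)" if w: "w \<in> Mor C" "Cod C w = S" "w' \<in> Mor C" "Dom C w' = S" "w' \<odot> w = Id C (Dom C w)"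
      "r \<in> Mor C" "Dom C r = S" "r \<odot> w = Zero C (Dom C w) (Cod C r)" "monic C (r \<odot> m)"
      and x: "x \<in> Mor C" "Cod C x = Dom C w" "k \<odot> (w \<odot> x) = Zero C (Dom C x) (Cod C k)" for w w' r x
  proof -
    obtain n where n: "n \<in> Mor C" "Dom C n = Dom C x" "Cod C n = Dom C m" "m \<odot> n = w \<odot> x"
      by (rule kernel_lift[OF kernel_of_cokernel[OF mm k], of "w \<odot> x"]) (use w(1,2) x K m in simp_all)
    have "(r \<odot> m) \<odot> n = (r \<odot> w) \<odot> x"
      using n(4) n(1-3) m w(1,2,6,7) x(1,2) by (simp add: comp_assoc)
    also have "\<dots> = Zero C (Dom C x) (Cod C r)" unfolding w(8) using w(1,2,6,7) x(1,2) by simp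
    finally have "n = Zero C (Dom C x) (Dom C m)"
      using monic_zeroD[OF w(9), of n] n m w(6,7) by simp
    then have "w \<odot> x = Zero C (Dom C x) S" using n(4)[symmetric] m x(1) gm by simp
    then have "w' \<odot> (w \<odot> x) = Zero C (Dom C x) (Cod C w')" using w(1-4) x(1) Cod_Ob[OF w(1)] by simp
    then show ?thesis using comp_cancel[OF w(5), of x] w(1-5) x(1,2) Cod_comp[of w w'] by simp
  qed
  have mon_p: "monic C ?p"
  proof (rule monicI_zero)
    fix x assume x: "x \<in> Mor C" "Cod C x = Dom C ?p" "?p \<odot> x = Zero C (Dom C x) (Cod C ?p)"
    show "x = Zero C (Dom C x) (Dom C ?p)"
      using component_zero[of j q p x] x g mp K m B(1-19) by (simp add: comp_assoc)
  qed (use K m B(1-15) in simp_all)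
  have mon_e: "monic C ?e" if v': "monic C v"
  proof (rule monicI_zero)
    have nv: "monic C (neg C v)"
    proof (rule monicI_zero)
      fix x assume x: "x \<in> Mor C" "Cod C x = Dom C (neg C v)" "neg C v \<odot> x = Zero C (Dom C x) (Cod C (neg C v))"
      have "v \<odot> x = neg C (neg C v \<odot> x)" using x(1,2) v by (simp add: neg_comp)
      then have "v \<odot> x = Zero C (Dom C x) (Cod C v)" using x(1) v by (simp add: x(3))
      then show "x = Zero C (Dom C x) (Dom C (neg C v))" using monic_zeroD[OF v', of x] x v by simp
    qed (use v in simp)
    fix x assume x: "x \<in> Mor C" "Cod C x = Dom C ?e" "?e \<odot> x = Zero C (Dom C x) (Cod C ?e)"
    show "x = Zero C (Dom C x) (Dom C ?e)"
      using component_zero[of i p q x] x nv mq K m B(1-19) by (simp add: comp_assoc)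
  qed (use K m B(1-15) in simp_all)
  have UP: "\<exists>h. h \<in> Mor C \<and> Cod C h = Cod C x \<and> Dom C h = Cod C ?p \<and> h \<odot> ?e = x \<and> h \<odot> ?p = y"
    if x: "x \<in> Mor C" "y \<in> Mor C" "Cod C y = Cod C x" "Dom C x = Cod C g" "Dom C y = Cod C v" "x \<odot> g = y \<odot> v" for x y
  proof -
    let ?z = "(x \<odot> p) \<boxplus> (y \<odot> q)"
    have pz: "?z \<odot> i = x" and qz: "?z \<odot> j = y" using x B(1-23) by (simp_all add: add_comp comp_assoc)
    have "?z \<odot> m = (x \<odot> g) \<boxplus> neg C (y \<odot> v)"
      using mp mq m gm v B(1-15) x(1-5) by (simp add: add_comp comp_assoc comp_neg)
    also have "\<dots> = Zero C (Dom C m) (Cod C ?z)" using x m v gm B(1-15) by simp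
    finally obtain h where h: "h \<in> Mor C" "Cod C h = Cod C ?z" "Dom C h = Cod C k" "h \<odot> k = ?z"
      by (rule cokernel_lift[OF k, rotated 2]) (use x m B(1-15) in simp_all)
    have "h \<odot> ?e = x" "h \<odot> ?p = y" using h pz qz K m B(1-15) by (simp_all flip: comp_assoc)
    then show ?thesis using h x B(1-15) K m by (intro exI[of _ h]) simp
  qed
  have JM: "x = y" if x: "x \<in> Mor C" "y \<in> Mor C" "Cod C y = Cod C x" "Dom C x = Cod C ?p" "Dom C y = Cod C ?p"
      "x \<odot> ?e = y \<odot> ?e" "x \<odot> ?p = y \<odot> ?p" for x y
  proof (rule epicD[OF cokernel_epic[OF k]])
    show "x \<odot> k = y \<odot> k"
      by (rule biproduct_eqI_dom[OF b]) (use x K m B(1-15) in \<open>simp_all add: comp_assoc\<close>)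
  qed (use x K m B(1-15) in simp_all)
  have COK: "\<exists>c'. is_cokernel C ?p c' \<and> Cod C c' = Cod C l \<and> c' \<odot> ?e = l" if l: "is_cokernel C g l" for l
  proof -
    note L = cokernelD[OF l]
    obtain c where c: "c \<in> Mor C" "Cod C c = Cod C l" "Dom C c = Cod C ?p" "c \<odot> ?e = l" "c \<odot> ?p = Zero C (Cod C v) (Cod C l)"
      using UP[of l "Zero C (Cod C v) (Cod C l)"] L v by auto
    have "is_cokernel C ?p c"
    proof (rule cokernelI)
      show "epic C c" by (rule epic_right_factor[of c ?e]) (use c cokernel_epic[OF l] K m B(1-15) in simp_all)
      fix x assume x: "x \<in> Mor C" "Dom C x = Cod C ?p" "x \<odot> ?p = Zero C (Dom C ?p) (Cod C x)"
      have "(x \<odot> ?e) \<odot> g = (x \<odot> ?p) \<odot> v" using eq x(1,2) gm v B(1-15) K m by (simp add: comp_assoc)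
      also have "\<dots> = Zero C (Dom C g) (Cod C x)" unfolding x(3) using x(1) v B(1-15) K m by simp
      finally have gx: "(x \<odot> ?e) \<odot> g = Zero C (Dom C g) (Cod C x)" .
      obtain h where h: "h \<in> Mor C" "Cod C h = Cod C x" "Dom C h = Cod C l" "h \<odot> l = x \<odot> ?e"
        by (rule cokernel_lift[OF l, of "x \<odot> ?e"]) (use gx gm x(1,2) B(1-15) K m in simp_all)
      have "h \<odot> c = x"
      proof (rule JM)
        show "(h \<odot> c) \<odot> ?e = x \<odot> ?e" using h c B(1-15) K m comp_assoc[of ?e c h] by simp
        have "(h \<odot> c) \<odot> ?p = h \<odot> (c \<odot> ?p)" using h(1-3) c(1-3) B(1-15) K m comp_assoc[of ?p c h] by simp
        then show "(h \<odot> c) \<odot> ?p = x \<odot> ?p" using c(5) h(1-3) x B(1-15) K m L v by simp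
      qed (use h c x in simp_all)
      then show "\<exists>h. h \<in> Mor C \<and> Cod C h = Cod C x \<and> Dom C h = Cod C c \<and> h \<odot> c = x" using h c by auto
    qed (use c K m B(1-15) in simp_all)
    then show ?thesis using c by blast
  qed
  have COK': "\<exists>c'. is_cokernel C ?e c' \<and> Cod C c' = Cod C l \<and> c' \<odot> ?p = l" if l: "is_cokernel C v l" for l
  proof -
    note L = cokernelD[OF l]
    obtain c where c: "c \<in> Mor C" "Cod C c = Cod C l" "Dom C c = Cod C ?p" "c \<odot> ?p = l" "c \<odot> ?e = Zero C (Cod C g) (Cod C l)"
      using UP[of "Zero C (Cod C g) (Cod C l)" l] L v gm by auto
    have "is_cokernel C ?e c"
    proof (rule cokernelI)
      show "epic C c" by (rule epic_right_factor[of c ?p]) (use c cokernel_epic[OF l] K m B(1-15) in simp_all)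
      fix x assume x: "x \<in> Mor C" "Dom C x = Cod C ?e" "x \<odot> ?e = Zero C (Dom C ?e) (Cod C x)"
      have "(x \<odot> ?p) \<odot> v = (x \<odot> ?e) \<odot> g" using eq x(1,2) gm v B(1-15) K m by (simp add: comp_assoc)
      also have "\<dots> = Zero C (Dom C g) (Cod C x)" unfolding x(3) using x(1) v gm B(1-15) K m by simp
      finally have gx: "(x \<odot> ?p) \<odot> v = Zero C (Dom C g) (Cod C x)" .
      obtain h where h: "h \<in> Mor C" "Cod C h = Cod C x" "Dom C h = Cod C l" "h \<odot> l = x \<odot> ?p"
        by (rule cokernel_lift[OF l, of "x \<odot> ?p"]) (use gx gm v x(1,2) B(1-15) K m in simp_all)
      have "h \<odot> c = x"
      proof (rule JM)
        show "(h \<odot> c) \<odot> ?p = x \<odot> ?p" using h c B(1-15) K m comp_assoc[of ?p c h] by simp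
        have "(h \<odot> c) \<odot> ?e = h \<odot> (c \<odot> ?e)" using h(1-3) c(1-3) B(1-15) K m comp_assoc[of ?e c h] by simp
        then show "(h \<odot> c) \<odot> ?e = x \<odot> ?e" using c(5) h(1-3) x B(1-15) K m L v gm by simp
      qed (use h c x B(1-15) K m in simp_all)
      then show "\<exists>h. h \<in> Mor C \<and> Cod C h = Cod C x \<and> Dom C h = Cod C c \<and> h \<odot> c = x" using h c by auto
    qed (use c K m B(1-15) in simp_all)
    then show ?thesis using c by blast
  qed
  show thesis
    by (rule that[of ?p ?e, OF mon_p mon_e _ _ _ _ _ eq COK COK' UP JM]) (use K m B(1-15) in simp_all)
qed

text \<open>The image is the smallest subobject through which \<open>f\<close> factors. If
  \<open>x\<close> kills \<open>e\<close>, then \<open>f\<close> factors through the subobject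
  \<open>m k\<close> with \<open>k\<close> the kernel of \<open>x\<close>. The cokernel of
  \<open>m k\<close> then kills \<open>m\<close> too, so \<open>m\<close> factors through
  \<open>m k\<close>. This yields a section \<open>t\<close> of \<open>k\<close>, and
  \<open>x = x k t = 0\<close>.\<close>

lemma image_epic:
  assumes c: "is_cokernel C f c" and m: "is_kernel C c m"
    and e: "e \<in> Mor C" "Dom C e = Dom C f" "Cod C e = Dom C m" "m \<odot> e = f"
  shows "epic C e"
proof (rule epicI_zero[OF e(1)])
  note Cc = cokernelD[OF c] and K = kernelD[OF m]
  fix x assume x: "x \<in> Mor C" "Dom C x = Cod C e" "x \<odot> e = Zero C (Dom C e) (Cod C x)"
  obtain k where k: "is_kernel C x k" using ex_kernel[OF x(1)] by blast
  note KK = kernelD[OF k]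
  obtain e' where e': "e' \<in> Mor C" "Dom C e' = Dom C e" "Cod C e' = Dom C k" "k \<odot> e' = e"
    by (rule kernel_lift[OF k e(1) _ x(3)]) (use x in simp)
  let ?m = "m \<odot> k"
  have mk: "?m \<in> Mor C" "Dom C ?m = Dom C k" "Cod C ?m = Cod C f" using K KK x e Cc by simp_all
  have mono: "monic C ?m" by (rule monic_comp[OF kernel_monic[OF k] kernel_monic[OF m]]) (use KK x e in simp)
  obtain d where d: "is_cokernel C ?m d" using ex_cokernel[OF mk(1)] by blast
  note Dd = cokernelD[OF d]
  have "d \<odot> f = (d \<odot> ?m) \<odot> e'"
    unfolding e(4)[symmetric] e'(4)[symmetric] using Dd(1-3) mk K KK x(1,2) e(1-3) e'(1-3) by (simp add: comp_assoc)
  also have "\<dots> = Zero C (Dom C f) (Cod C d)" unfolding Dd(4) using mk e' e Dd(2) KK by simp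
  finally have df: "d \<odot> f = Zero C (Dom C f) (Cod C d)" .
  obtain y where y: "y \<in> Mor C" "Cod C y = Cod C d" "Dom C y = Cod C c" "y \<odot> c = d"
    by (rule cokernel_lift[OF c Dd(2) _ df]) (use Dd mk in simp)
  have "d \<odot> m = y \<odot> (c \<odot> m)" using y K Cc comp_assoc[of m c y] by simp
  also have "\<dots> = Zero C (Dom C m) (Cod C d)" unfolding K(4) using y K(2) Cc by simp
  finally have dm: "d \<odot> m = Zero C (Dom C m) (Cod C d)" .
  obtain t where t: "t \<in> Mor C" "Dom C t = Dom C m" "Cod C t = Dom C ?m" "?m \<odot> t = m"
    by (rule kernel_lift[OF kernel_of_cokernel[OF mono d] K(2) _ dm]) (use Dd mk K Cc in simp)
  have kt: "k \<odot> t = Id C (Dom C m)"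
    by (rule monicD[OF kernel_monic[OF m]]) (use t mk K KK x e in \<open>simp_all add: comp_assoc\<close>)
  have "x = (x \<odot> k) \<odot> t" using kt x(1,2) e(1-3) KK(1-3) t(1-3) mk by (simp add: comp_assoc)
  also have "\<dots> = Zero C (Cod C e) (Cod C x)" unfolding KK(4) using t mk e x(1,2) KK(1-3) K(2) by simp
  finally show "x = Zero C (Cod C e) (Cod C x)" .
qed

end

text \<open>\<open>exact_functor\<close> only speaks of short exact sequences, and \<open>f\<close>
  need not be monic. Factor \<open>f = m e\<close> with \<open>m\<close> the kernel of
  \<open>c\<close> and \<open>e\<close> epic: the functor keeps \<open>e\<close> epic and the
  sequence of \<open>m\<close> and \<open>c\<close> short exact, so \<open>F c\<close> is a cokernel
  of \<open>F m\<close> and hence of \<open>F f\<close>.\<close>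

lemma exact_functor_cokernel:
  assumes C: "abelian_category C" and E: "abelian_category E" and F: "cat_functor C E F" "exact_functor C E F"
    and c: "is_cokernel C f c"
  shows "is_cokernel E (FMor F f) (FMor F c)"
proof -
  interpret C: abelian_category C by (rule C)
  interpret E: abelian_category E by (rule E)
  interpret F: cat_functor C E F by (rule F)
  have se: "short_exact E (FMor F g) (FMor F h)" if "short_exact C g h" for g h
    using F(2) that unfolding exact_functor_def by blast
  note Cc = C.cokernelD[OF c]
  obtain m where m: "is_kernel C c m" using C.ex_kernel[OF Cc(2)] by blast
  note K = C.kernelD[OF m]
  obtain e where e: "e \<in> Mor C" "Dom C e = Dom C f" "Cod C e = Dom C m" "m \<odot>\<^bsub>C\<^esub> e = f"
    by (rule C.kernel_lift[OF m Cc(1) _ Cc(4)]) (use Cc in simp)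
  have ee: "epic C e" by (rule C.image_epic[OF c m e])
  obtain k where k: "is_kernel C e k" using C.ex_kernel[OF e(1)] by blast
  have Fe: "epic E (FMor F e)" by (rule E.short_exactD(8)[OF se[OF C.short_exact_if_epic[OF ee k]]])
  note S = E.short_exactD[OF se[OF C.short_exact_if_epic[OF C.cokernel_epic[OF c] m]]]
  have Ff: "FMor F f = FMor F m \<odot>\<^bsub>E\<^esub> FMor F e"
    using F.FMor_Comp[of e "Dom C e" "Cod C e" m "Cod C m"] e K by (simp add: Hom_iff)
  have t: "FMor F e \<in> Mor E" "Cod E (FMor F e) = Dom E (FMor F m)"
    using Fe F.FMor_in_Hom[of e "Dom C e" "Cod C e"] F.FMor_in_Hom[of m "Dom C m" "Cod C m"] e K by (simp_all add: epic_def Hom_iff)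
  show ?thesis
  proof (rule E.cokernelI)
    show "FMor F f \<in> Mor E" unfolding Ff using t S by simp
    show "epic E (FMor F c)" by (rule S)
    show "Dom E (FMor F c) = Cod E (FMor F f)" unfolding Ff using t S by simp
    have "FMor F c \<odot>\<^bsub>E\<^esub> (FMor F m \<odot>\<^bsub>E\<^esub> FMor F e) = Zero E (Dom E (FMor F e)) (Cod E (FMor F c))"
      by (rule E.zero_factor[OF S(6)]) (use t S in simp_all)
    then show "FMor F c \<odot>\<^bsub>E\<^esub> FMor F f = Zero E (Dom E (FMor F f)) (Cod E (FMor F c))" unfolding Ff using t S by simp
    fix g assume g: "g \<in> Mor E" "Dom E g = Cod E (FMor F f)" "g \<odot>\<^bsub>E\<^esub> FMor F f = Zero E (Dom E (FMor F f)) (Cod E g)"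
    have g2: "Dom E g = Cod E (FMor F m)" using g(2) unfolding Ff using t S by simp
    have "(g \<odot>\<^bsub>E\<^esub> FMor F m) \<odot>\<^bsub>E\<^esub> FMor F e = g \<odot>\<^bsub>E\<^esub> FMor F f"
      unfolding Ff by (rule E.comp_assoc) (use t S g g2 in simp_all)
    also have "\<dots> = Zero E (Dom E (FMor F e)) (Cod E g)" using g(3) t S by (simp add: Ff)
    finally have "(g \<odot>\<^bsub>E\<^esub> FMor F m) \<odot>\<^bsub>E\<^esub> FMor F e = Zero E (Dom E (FMor F e)) (Cod E g)" .
    then have gz: "g \<odot>\<^bsub>E\<^esub> FMor F m = Zero E (Dom E (FMor F m)) (Cod E g)"
      using E.epic_zeroD[OF Fe, of "g \<odot>\<^bsub>E\<^esub> FMor F m"] t S g g2 by simp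
    obtain h where "h \<in> Mor E" "Cod E h = Cod E g" "Dom E h = Cod E (FMor F c)" "h \<odot>\<^bsub>E\<^esub> FMor F c = g"
      by (rule E.cokernel_lift[OF S(2) g(1) g2 gz])
    then show "\<exists>h. h \<in> Mor E \<and> Cod E h = Cod E g \<and> Dom E h = Cod E (FMor F c) \<and> h \<odot>\<^bsub>E\<^esub> FMor F c = g" by blast
  qed
qed

section \<open>Extensions and cotorsion pairs\<close>

context preadditive_category
begin

lemma short_exact_biproduct:
  assumes "biproduct C A B P i j p q"
  shows "short_exact C i q"
  unfolding short_exact_def
proof
  note B = biproductD[OF assms]
  show "is_kernel C q i"
  proof (rule kernelI)
    show "monic C i" by (rule monic_left_factor[of p]) (use B monic_Id in simp_all)
    fix x assume x: "x \<in> Mor C" "Cod C x = Dom C q" "q \<odot> x = Zero C (Dom C x) (Cod C q)"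
    have "i \<odot> (p \<odot> x) = x"
      by (rule biproduct_eqI_cod[OF assms]) (use x B(1-23) in simp_all)
    then show "\<exists>h. h \<in> Mor C \<and> Dom C h = Dom C x \<and> Cod C h = Dom C i \<and> i \<odot> h = x"
      using x B(1-23) by (intro exI[of _ "p \<odot> x"]) simp
  qed (use B(1-19) in simp_all)
  show "is_cokernel C i q"
  proof (rule cokernelI)
    show "epic C q" by (rule epic_right_factor[of _ j]) (use B epic_Id in simp_all)
    fix x assume x: "x \<in> Mor C" "Dom C x = Cod C i" "x \<odot> i = Zero C (Dom C i) (Cod C x)"
    have "(x \<odot> j) \<odot> q = x"
      by (rule biproduct_eqI_dom[OF assms]) (use x B(1-19) in \<open>simp_all add: comp_assoc\<close>)
    then show "\<exists>h. h \<in> Mor C \<and> Cod C h = Cod C x \<and> Dom C h = Cod C q \<and> h \<odot> q = x"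
      using x B(1-23) by (intro exI[of _ "x \<odot> j"]) simp
  qed (use B(1-19) in simp_all)
qed

text \<open>The missing projection \<open>r\<close> is obtained from \<open>1 - s g\<close>, which
  is killed by \<open>g\<close> and so factors through the kernel \<open>f\<close>.\<close>

lemma section_biproduct:
  assumes se: "short_exact C f g" and s: "s \<in> Mor C" "Dom C s = Cod C g" "Cod C s = Cod C f" "g \<odot> s = Id C (Cod C g)"
  obtains r where "biproduct C (Cod C g) (Dom C f) (Cod C f) s f g r"
proof -
  note S = short_exactD[OF se]
  have I: "Id C (Cod C f) \<in> Mor C" "Dom C (Id C (Cod C f)) = Cod C f" "Cod C (Id C (Cod C f)) = Cod C f"
    using S by simp_all
  let ?m = "Id C (Cod C f) \<boxplus> neg C (s \<odot> g)"
  have gsg: "g \<odot> (s \<odot> g) = g" by (rule comp_cancel[OF s(4)]) (use S s in simp_all)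
  have z: "g \<odot> ?m = Zero C (Dom C ?m) (Cod C g)"
    using I S(3-6) s gsg by (simp add: comp_add comp_neg)
  obtain r where r: "r \<in> Mor C" "Dom C r = Cod C f" "Cod C r = Dom C f" "f \<odot> r = ?m"
    by (rule kernel_lift[OF S(1) _ _ z]) (use I S s in simp_all)
  have rf: "r \<odot> f = Id C (Dom C f)"
  proof (rule monicD[OF S(7)])
    have "f \<odot> (r \<odot> f) = ?m \<odot> f" using r S(3) by (simp flip: comp_assoc)
    also have "\<dots> = f" using I S(3-6) s by (simp add: add_comp neg_comp comp_assoc)
    finally show "f \<odot> (r \<odot> f) = f \<odot> Id C (Dom C f)" using S(3) by simp
  qed (use r S in simp_all)
  have rs: "r \<odot> s = Zero C (Cod C g) (Dom C f)"
  proof (rule monicD[OF S(7)])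
    have "f \<odot> (r \<odot> s) = ?m \<odot> s" using r S(3) s by (simp flip: comp_assoc)
    also have "\<dots> = Zero C (Cod C g) (Cod C f)" using I S(3-6) s by (simp add: add_comp neg_comp comp_assoc)
    finally show "f \<odot> (r \<odot> s) = f \<odot> Zero C (Cod C g) (Dom C f)" using S(3-5) by simp
  qed (use r S s in simp_all)
  have "(s \<odot> g) \<boxplus> ?m = ?m \<boxplus> (s \<odot> g)" by (rule add_comm) (use I S s in simp_all)
  also have "\<dots> = Id C (Cod C f)" by (rule add_neg_cancel) (use I S s in simp_all)
  finally have "(s \<odot> g) \<boxplus> ?m = Id C (Cod C f)" .
  then have "biproduct C (Cod C g) (Dom C f) (Cod C f) s f g r"
    unfolding biproduct_def Hom_iff r(4) using S(3-6) s r(1-3) rf rs by simp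
  then show thesis by (rule that)
qed

lemma section_if_retraction:
  assumes se: "short_exact C f g" and r: "r \<in> Mor C" "Dom C r = Cod C f" "Cod C r = Dom C f" "r \<odot> f = Id C (Dom C f)"
  obtains s where "s \<in> Mor C" "Dom C s = Cod C g" "Cod C s = Cod C f" "g \<odot> s = Id C (Cod C g)"
proof -
  note S = short_exactD[OF se]
  have I: "Id C (Cod C f) \<in> Mor C" "Dom C (Id C (Cod C f)) = Cod C f" "Cod C (Id C (Cod C f)) = Cod C f"
    using S by simp_all
  let ?m = "Id C (Cod C f) \<boxplus> neg C (f \<odot> r)"
  have z: "?m \<odot> f = Zero C (Dom C f) (Cod C ?m)"
    using I S(3-6) r by (simp add: add_comp neg_comp comp_assoc)
  obtain s where s: "s \<in> Mor C" "Cod C s = Cod C f" "Dom C s = Cod C g" "s \<odot> g = ?m"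
    by (rule cokernel_lift[OF S(2) _ _ z]) (use I S r in simp_all)
  have "g \<odot> s = Id C (Cod C g)"
  proof (rule epicD[OF S(8)])
    have "(g \<odot> s) \<odot> g = g \<odot> ?m" using s S(3-5) by (simp add: comp_assoc)
    also have "\<dots> = g" using I S(3-5) r zero_factor[OF S(6), of r] by (simp add: comp_add comp_neg)
    finally show "(g \<odot> s) \<odot> g = Id C (Cod C g) \<odot> g" using S(4) by simp
  qed (use s S in simp_all)
  then show thesis using that s by simp
qed

end

context abelian_category
begin

text \<open>\<open>Ext1\<close> is a singleton iff every extension is equivalent to the split one,
  and an extension is split iff its epimorphism has a section. This criterion replaces equivalence
  classes of extensions throughout.\<close>

lemma Ext1_vanishes_iff:
  assumes A: "A \<in> Ob C" and B: "B \<in> Ob C"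
  shows "Ext1_vanishes C A B \<longleftrightarrow> (\<forall>f g. short_exact C f g \<and> Dom C f = B \<and> Cod C g = A \<longrightarrow>
    (\<exists>s. s \<in> Mor C \<and> Dom C s = A \<and> Cod C s = Cod C f \<and> g \<odot> s = Id C A))"
    (is "?L \<longleftrightarrow> ?R")
proof -
  \<comment> \<open>The split extension: it shows that the quotient is inhabited, and it is the
    class with which all others are compared.\<close>
  obtain P i j p q where b: "biproduct C B A P i j p q" by (rule ex_biproduct[OF B A])
  note b' = biproductD[OF b]
  have iq: "(i, q) \<in> extensions C A B"
    using short_exact_biproduct[OF b] b' by (simp add: extensions_def)
  have sub: "ext_equiv C A B \<subseteq> extensions C A B \<times> extensions C A B"
    unfolding ext_equiv_def by auto
  have refl: "((f, g), (f, g)) \<in> ext_equiv C A B" if fg: "(f, g) \<in> extensions C A B" for f g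
  proof -
    have se: "short_exact C f g" using fg by (simp add: extensions_def)
    note S = short_exactD[OF se]
    have "iso_mor C (Id C (Cod C f))" using S unfolding iso_mor_def inverse_mors_def
      by (intro exI[of _ "Id C (Cod C f)"]) (simp add: Hom_iff)
    then show ?thesis using fg S unfolding ext_equiv_def
      by (simp, intro exI[of _ "Id C (Cod C f)"]) (simp add: Hom_iff)
  qed
  show ?thesis
  proof
    assume ?L
    then obtain z where z: "extensions C A B // ext_equiv C A B = {z}"
      unfolding Ext1_vanishes_def Ext1_def is_singleton_def by blast
    show ?R
    proof (intro allI impI)
      fix f g assume fg: "short_exact C f g \<and> Dom C f = B \<and> Cod C g = A"
      then have fg': "(f, g) \<in> extensions C A B" by (simp add: extensions_def)
      have "ext_equiv C A B `` {(i, q)} = z" "ext_equiv C A B `` {(f, g)} = z"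
        using quotientI[OF iq, of "ext_equiv C A B"] quotientI[OF fg', of "ext_equiv C A B"] z by simp_all
      then have "((i, q), (f, g)) \<in> ext_equiv C A B" using refl[OF fg'] by blast
      then obtain h where h: "h \<in> Mor C" "Dom C h = Cod C i" "Cod C h = Cod C f" "g \<odot> h = q"
        by (auto simp: ext_equiv_def Hom_iff)
      have "g \<odot> (h \<odot> j) = (g \<odot> h) \<odot> j"
        using h(1-3) b'(1-15) short_exactD[of f g] fg by (intro comp_assoc[symmetric]) simp_all
      then have "g \<odot> (h \<odot> j) = Id C A" using h b' by simp
      then show "\<exists>s. s \<in> Mor C \<and> Dom C s = A \<and> Cod C s = Cod C f \<and> g \<odot> s = Id C A"
        using h b' by (intro exI[of _ "h \<odot> j"]) simp
    qed
  next
    assume R: ?R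
    have all: "((f, g), (f', g')) \<in> ext_equiv C A B"
      if fg: "(f, g) \<in> extensions C A B" and fg': "(f', g') \<in> extensions C A B" for f g f' g'
    proof -
      have se: "short_exact C f g" "Dom C f = B" "Cod C g = A"
        and se': "short_exact C f' g'" "Dom C f' = B" "Cod C g' = A"
        using fg fg' by (simp_all add: extensions_def)
      obtain s where s: "s \<in> Mor C" "Dom C s = A" "Cod C s = Cod C f" "g \<odot> s = Id C A" using R se by blast
      obtain s' where s': "s' \<in> Mor C" "Dom C s' = A" "Cod C s' = Cod C f'" "g' \<odot> s' = Id C A" using R se' by blast
      obtain r where b: "biproduct C A B (Cod C f) s f g r"
        using section_biproduct[OF se(1), of s] s se by auto
      obtain r' where b': "biproduct C A B (Cod C f') s' f' g' r'"
        using section_biproduct[OF se'(1), of s'] s' se' by auto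
      note b1 = biproductD[OF b] and b1' = biproductD[OF b']
      \<comment> \<open>Both middle terms are biproducts of \<open>A\<close> and \<open>B\<close>;
        \<open>?h\<close> and \<open>?h'\<close> translate one decomposition into the other and are
        therefore mutually inverse.\<close>
      let ?h = "(s' \<odot> g) \<boxplus> (f' \<odot> r)" and ?h' = "(s \<odot> g') \<boxplus> (f \<odot> r')"
      have h: "?h \<in> Mor C" "Dom C ?h = Cod C f" "Cod C ?h = Cod C f'"
          "?h' \<in> Mor C" "Dom C ?h' = Cod C f'" "Cod C ?h' = Cod C f"
        using b1(1-15) b1'(1-15) by simp_all
      have hs: "?h \<odot> s = s'" "?h \<odot> f = f'" "?h' \<odot> s' = s" "?h' \<odot> f' = f" "g' \<odot> ?h = g"
        using b1(1-23) b1'(1-23) by (simp_all add: add_comp comp_add comp_assoc)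
      have "?h' \<odot> ?h = Id C (Cod C f)"
        by (rule biproduct_eqI_dom[OF b]) (use h hs b1(1-15) b1'(1-15) in \<open>simp_all add: comp_assoc[of _ ?h ?h']\<close>)
      moreover have "?h \<odot> ?h' = Id C (Cod C f')"
        by (rule biproduct_eqI_dom[OF b']) (use h hs b1(1-15) b1'(1-15) in \<open>simp_all add: comp_assoc[of _ ?h' ?h]\<close>)
      ultimately have "iso_mor C ?h" unfolding iso_mor_def inverse_mors_def
        by (intro exI[of _ ?h']) (use h in \<open>simp add: Hom_iff\<close>)
      then show ?thesis unfolding ext_equiv_def using fg fg' h hs
        by (simp, intro exI[of _ ?h]) (simp add: Hom_iff)
    qed
    have "ext_equiv C A B `` {x} = extensions C A B" if "x \<in> extensions C A B" for x
      using all sub that by (cases x) auto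
    then have "extensions C A B // ext_equiv C A B = {extensions C A B}"
      using iq unfolding quotient_def by blast
    then show ?L unfolding Ext1_vanishes_def Ext1_def by (simp add: is_singleton_def)
  qed
qed

lemma ext_split:
  assumes "Ext1_vanishes C A B" "short_exact C f g" "Dom C f = B" "Cod C g = A"
  obtains s where "s \<in> Mor C" "Dom C s = A" "Cod C s = Cod C f" "g \<odot> s = Id C A"
proof -
  note S = short_exactD[OF assms(2)]
  have "A \<in> Ob C" "B \<in> Ob C" using S assms by auto
  then show thesis using Ext1_vanishes_iff[of A B] assms that by blast
qed

lemma Ext1_vanishesI:
  assumes "A \<in> Ob C" "B \<in> Ob C"
    "\<And>f g. \<lbrakk>short_exact C f g; Dom C f = B; Cod C g = A\<rbrakk> \<Longrightarrow>
       \<exists>s. s \<in> Mor C \<and> Dom C s = A \<and> Cod C s = Cod C f \<and> g \<odot> s = Id C A"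
  shows "Ext1_vanishes C A B"
  using Ext1_vanishes_iff[OF assms(1,2)] assms(3) by blast

end

text \<open>The left lifting property of \<open>f\<close> against every epimorphism with kernel
  object \<open>Y\<close>. For a monomorphism with cokernel \<open>A\<close> it is equivalent to the
  vanishing of \<open>Ext1\<close> of \<open>A\<close> and \<open>Y\<close>, but it also prescribes
  the lift on the source of \<open>f\<close>.\<close>

definition llp :: "('o, 'm, 'z) ab_cat_scheme \<Rightarrow> 'o \<Rightarrow> 'm \<Rightarrow> bool" where
  "llp C Y f \<longleftrightarrow> f \<in> Mor C \<and> (\<forall>k g u v. short_exact C k g \<and> Dom C k = Y \<and>
     u \<in> Hom C (Dom C f) (Cod C k) \<and> v \<in> Hom C (Cod C f) (Cod C g) \<and> g \<odot>\<^bsub>C\<^esub> u = v \<odot>\<^bsub>C\<^esub> f \<longrightarrow>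
     (\<exists>t\<in>Hom C (Cod C f) (Cod C k). g \<odot>\<^bsub>C\<^esub> t = v \<and> t \<odot>\<^bsub>C\<^esub> f = u))"

definition retract :: "('o, 'm, 'z) cat_scheme \<Rightarrow> 'o \<Rightarrow> 'o \<Rightarrow> bool" where
  "retract C A B \<longleftrightarrow> (\<exists>s\<in>Hom C A B. \<exists>r\<in>Hom C B A. r \<odot>\<^bsub>C\<^esub> s = Id C A)"

lemma llpD:
  assumes "llp C Y f" "short_exact C k g" "Dom C k = Y"
    "u \<in> Mor C" "Dom C u = Dom C f" "Cod C u = Cod C k"
    "v \<in> Mor C" "Dom C v = Cod C f" "Cod C v = Cod C g" "g \<odot>\<^bsub>C\<^esub> u = v \<odot>\<^bsub>C\<^esub> f"
  obtains t where "t \<in> Mor C" "Dom C t = Cod C f" "Cod C t = Cod C k" "g \<odot>\<^bsub>C\<^esub> t = v" "t \<odot>\<^bsub>C\<^esub> f = u"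
proof -
  have "u \<in> Hom C (Dom C f) (Cod C k)" "v \<in> Hom C (Cod C f) (Cod C g)" using assms by (simp_all add: Hom_iff)
  then obtain t where "t\<in>Hom C (Cod C f) (Cod C k)" "g \<odot>\<^bsub>C\<^esub> t = v" "t \<odot>\<^bsub>C\<^esub> f = u"
    using assms(1,2,3,10) unfolding llp_def by blast
  then show thesis using that[of t] by (simp add: Hom_iff)
qed

lemma llpI:
  assumes "f \<in> Mor C"
    "\<And>k g u v. \<lbrakk>short_exact C k g; Dom C k = Y; u \<in> Mor C; Dom C u = Dom C f; Cod C u = Cod C k;
      v \<in> Mor C; Dom C v = Cod C f; Cod C v = Cod C g; g \<odot>\<^bsub>C\<^esub> u = v \<odot>\<^bsub>C\<^esub> f\<rbrakk> \<Longrightarrow>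
      \<exists>t. t \<in> Mor C \<and> Dom C t = Cod C f \<and> Cod C t = Cod C k \<and> g \<odot>\<^bsub>C\<^esub> t = v \<and> t \<odot>\<^bsub>C\<^esub> f = u"
  shows "llp C Y f"
  unfolding llp_def
proof (intro conjI allI impI assms(1))
  fix k g u v
  assume "short_exact C k g \<and> Dom C k = Y \<and> u \<in> Hom C (Dom C f) (Cod C k) \<and>
    v \<in> Hom C (Cod C f) (Cod C g) \<and> g \<odot>\<^bsub>C\<^esub> u = v \<odot>\<^bsub>C\<^esub> f"
  then obtain t where "t \<in> Mor C" "Dom C t = Cod C f" "Cod C t = Cod C k" "g \<odot>\<^bsub>C\<^esub> t = v" "t \<odot>\<^bsub>C\<^esub> f = u"
    using assms(2)[of k g u v] by (auto simp: Hom_iff)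
  then show "\<exists>t\<in>Hom C (Cod C f) (Cod C k). g \<odot>\<^bsub>C\<^esub> t = v \<and> t \<odot>\<^bsub>C\<^esub> f = u"
    by (intro bexI[of _ t]) (simp_all add: Hom_iff)
qed

context abelian_category
begin

text \<open>Lift along \<open>f\<close> first, then along \<open>h\<close> with the first lift as
  the new upper side. Closure of left classes under extensions rests on this.\<close>

lemma llp_comp:
  assumes f: "llp C Y f" and h: "llp C Y h" and c: "Dom C h = Cod C f"
  shows "llp C Y (h \<odot> f)"
proof (rule llpI)
  have m: "f \<in> Mor C" "h \<in> Mor C" using f h by (simp_all add: llp_def)
  show "h \<odot> f \<in> Mor C" using m c by simp
  fix k g u v
  assume k: "short_exact C k g" "Dom C k = Y" and u: "u \<in> Mor C" "Dom C u = Dom C (h \<odot> f)" "Cod C u = Cod C k"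
    and v: "v \<in> Mor C" "Dom C v = Cod C (h \<odot> f)" "Cod C v = Cod C g" and e: "g \<odot> u = v \<odot> (h \<odot> f)"
  note S = short_exactD[OF k(1)]
  have e': "g \<odot> u = (v \<odot> h) \<odot> f" using e m c v by (simp add: comp_assoc)
  obtain t where t: "t \<in> Mor C" "Dom C t = Cod C f" "Cod C t = Cod C k" "g \<odot> t = v \<odot> h" "t \<odot> f = u"
    by (rule llpD[OF f k u(1) _ _ _ _ _ e']) (use m c u v in simp_all)
  obtain t' where t': "t' \<in> Mor C" "Dom C t' = Cod C h" "Cod C t' = Cod C k" "g \<odot> t' = v" "t' \<odot> h = t"
    by (rule llpD[OF h k t(1) _ _ _ _ _ t(4)]) (use m c t v in simp_all)
  have "t' \<odot> (h \<odot> f) = u" using t' t(5) m c comp_assoc[of f h t'] by simp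
  then show "\<exists>t. t \<in> Mor C \<and> Dom C t = Cod C (h \<odot> f) \<and> Cod C t = Cod C k \<and> g \<odot> t = v \<and> t \<odot> (h \<odot> f) = u"
    using t' m c by (intro exI[of _ t']) simp
qed

text \<open>Pulling back \<open>g\<close> along \<open>v\<close> and dividing by the copy of \<open>Dom f\<close> in the pullback yields an
  extension of the cokernel by the kernel; a retraction of it gives the lift.\<close>

lemma llp_if_Ext1_vanishes:
  assumes f: "monic C f" and c: "is_cokernel C f c" and ext: "Ext1_vanishes C (Cod C c) Y"
  shows "llp C Y f"
proof (rule llpI)
  note Cc = cokernelD[OF c]
  show "f \<in> Mor C" by (rule Cc)
  fix k g u v
  assume k: "short_exact C k g" "Dom C k = Y" and u: "u \<in> Mor C" "Dom C u = Dom C f" "Cod C u = Cod C k"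
    and v: "v \<in> Mor C" "Dom C v = Cod C f" "Cod C v = Cod C g" and e: "g \<odot> u = v \<odot> f"
  note S = short_exactD[OF k(1)]
  have YO: "Y \<in> Ob C" using Dom_Ob[OF S(3)] k by simp
  obtain p w where p: "epic C p" "w \<in> Mor C" "p \<in> Mor C" "Cod C p = Dom C v" "Cod C w = Dom C g" "Dom C w = Dom C p"
    "g \<odot> w = v \<odot> p"
    and UP: "\<And>x y. \<lbrakk>x \<in> Mor C; y \<in> Mor C; Dom C y = Dom C x; Cod C x = Dom C g; Cod C y = Dom C v; g \<odot> x = v \<odot> y\<rbrakk> \<Longrightarrow>
       \<exists>h. h \<in> Mor C \<and> Dom C h = Dom C x \<and> Cod C h = Dom C p \<and> w \<odot> h = x \<and> p \<odot> h = y"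
    and KER: "\<And>k. is_kernel C g k \<Longrightarrow> \<exists>k'. is_kernel C p k' \<and> Dom C k' = Dom C k \<and> w \<odot> k' = k"
    by (rule ex_pullback[OF S(8) v(1) v(3)]) blast
  obtain k' where k': "is_kernel C p k'" "Dom C k' = Y" "w \<odot> k' = k" using KER[OF S(1)] k by blast
  note K' = kernelD[OF k'(1)]
  \<comment> \<open>The commuting square makes \<open>u\<close> and \<open>f\<close> into one map to
    the pullback. It is monic because \<open>p a = f\<close> is.\<close>
  obtain a where a: "a \<in> Mor C" "Dom C a = Dom C f" "Cod C a = Dom C p" "w \<odot> a = u" "p \<odot> a = f"
    using UP[of u f] u v S e Cc by auto
  have am: "monic C a" by (rule monic_left_factor[of p]) (use a p f in simp_all)
  obtain q where q: "is_cokernel C a q" using ex_cokernel[OF a(1)] by blast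
  note Q = cokernelD[OF q]
  have z: "(c \<odot> p) \<odot> a = Zero C (Dom C a) (Cod C (c \<odot> p))" using a p v Cc by (simp add: comp_assoc)
  obtain r where r: "r \<in> Mor C" "Cod C r = Cod C c" "Dom C r = Cod C q" "r \<odot> q = c \<odot> p"
    by (rule cokernel_lift[OF q _ _ z]) (use a p v Cc in simp_all)
  \<comment> \<open>The extension of \<open>Cod C c\<close> by \<open>Y\<close> consists of
    \<open>q k'\<close> and of \<open>r\<close>, which \<open>c p\<close> induces on the quotient by
    \<open>a\<close>. The first is monic as the kernel of \<open>p\<close> meets the copy of
    \<open>Dom C f\<close> only in zero: \<open>p\<close> kills the one and is monic on the
    other.\<close>
  let ?qk = "q \<odot> k'"
  have qk: "?qk \<in> Mor C" "Dom C ?qk = Y" "Cod C ?qk = Cod C q" using Q K' k' a by simp_all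
  have mqk: "monic C ?qk"
  proof (rule monicI_zero[OF qk(1)])
    fix x assume x: "x \<in> Mor C" "Cod C x = Dom C ?qk" "?qk \<odot> x = Zero C (Dom C x) (Cod C ?qk)"
    have qkx: "q \<odot> (k' \<odot> x) = Zero C (Dom C x) (Cod C q)" using x qk Q K' k' a by (simp add: comp_assoc)
    obtain y where y: "y \<in> Mor C" "Dom C y = Dom C x" "Cod C y = Dom C a" "a \<odot> y = k' \<odot> x"
      by (rule kernel_lift[OF kernel_of_cokernel[OF am q], of "k' \<odot> x"]) (use x qk qkx Q K' k' a in simp_all)
    have "f \<odot> y = p \<odot> (a \<odot> y)" using y(1-3) a p comp_assoc[of y a p] by simp
    also have "\<dots> = (p \<odot> k') \<odot> x" using y(4) x(1,2) K'(1-3) k' qk p by (simp add: comp_assoc)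
    also have "\<dots> = Zero C (Dom C x) (Cod C f)" using K' k' x qk p v Cc YO by simp
    finally have "y = Zero C (Dom C x) (Dom C a)" using monic_zeroD[OF f, of y] y a by simp
    then have "k' \<odot> x = Zero C (Dom C x) (Cod C k')" using y(4)[symmetric] a x(1) K' Dom_Ob[OF a(1)] by simp
    then show "x = Zero C (Dom C x) (Dom C ?qk)" using monic_zeroD[OF kernel_monic[OF k'(1)], of x] x qk k' by simp
  qed
  have "is_cokernel C ?qk r"
  proof (rule cokernelI[OF qk(1)])
    have "epic C (r \<odot> q)" unfolding r(4) by (rule epic_comp[OF p(1) cokernel_epic[OF c]]) (use Cc v p in simp)
    then show "epic C r" by (rule epic_right_factor) (use r Q in simp_all)
    show "Dom C r = Cod C ?qk" using r qk by simp
    have "r \<odot> ?qk = (r \<odot> q) \<odot> k'" using r(1-3) Q K' a by (simp add: comp_assoc)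
    also have "\<dots> = Zero C (Dom C ?qk) (Cod C r)" using r(4) K' p v Cc qk k' r(2) YO by (simp add: comp_assoc)
    finally show "r \<odot> ?qk = Zero C (Dom C ?qk) (Cod C r)" .
    fix h assume h: "h \<in> Mor C" "Dom C h = Cod C ?qk" "h \<odot> ?qk = Zero C (Dom C ?qk) (Cod C h)"
    have hqk: "(h \<odot> q) \<odot> k' = Zero C (Dom C k') (Cod C h)" using h qk Q K' k' a by (simp add: comp_assoc)
    obtain m where m: "m \<in> Mor C" "Cod C m = Cod C h" "Dom C m = Cod C p" "m \<odot> p = h \<odot> q"
      by (rule cokernel_lift[OF cokernel_of_kernel[OF p(1) k'(1)], of "h \<odot> q"]) (use h hqk qk Q K' k' a in simp_all)
    have "m \<odot> f = (m \<odot> p) \<odot> a" using m(1-3) a p comp_assoc[of a p m] by simp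
    also have "\<dots> = Zero C (Dom C f) (Cod C h)" using m(4) h(1,2) qk Q a Cc(1) by (simp add: comp_assoc)
    finally have mf: "m \<odot> f = Zero C (Dom C f) (Cod C m)" using m by simp
    obtain n where n: "n \<in> Mor C" "Cod C n = Cod C m" "Dom C n = Cod C c" "n \<odot> c = m"
      by (rule cokernel_lift[OF c _ _ mf]) (use m p v in simp_all)
    have "n \<odot> r = h"
    proof (rule epicD[OF cokernel_epic[OF q]])
      have "(n \<odot> r) \<odot> q = n \<odot> (c \<odot> p)" using n(1-3) r Q comp_assoc[of q r n] by simp
      also have "\<dots> = m \<odot> p" using n Cc v p comp_assoc[of p c n] by simp
      finally show "(n \<odot> r) \<odot> q = h \<odot> q" using m by simp
    qed (use n r h m Q qk in simp_all)
    then show "\<exists>ha. ha \<in> Mor C \<and> Cod C ha = Cod C h \<and> Dom C ha = Cod C r \<and> ha \<odot> r = h"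
      using n r m h by (intro exI[of _ n]) simp
  qed
  then have se: "short_exact C ?qk r" by (rule short_exact_if_monic[OF mqk])
  obtain s where s: "s \<in> Mor C" "Dom C s = Cod C c" "Cod C s = Cod C q" "r \<odot> s = Id C (Cod C c)"
    by (rule ext_split[OF ext se]) (use qk r in simp_all)
  obtain \<rho> where "biproduct C (Cod C r) (Dom C ?qk) (Cod C ?qk) s ?qk r \<rho>"
    by (rule section_biproduct[OF se s(1)]) (use s r qk in simp_all)
  note b = biproductD[OF this]
  have \<rho>: "\<rho> \<in> Mor C" "Dom C \<rho> = Cod C q" "Cod C \<rho> = Y" "\<rho> \<odot> ?qk = Id C Y" using b qk by simp_all
  have I: "Id C (Dom C p) \<in> Mor C" "Dom C (Id C (Dom C p)) = Dom C p" "Cod C (Id C (Dom C p)) = Dom C p"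
    using p by simp_all
  \<comment> \<open>The retraction \<open>\<rho>\<close> makes \<open>k' \<rho> q\<close> a
    projection of the pullback onto the kernel of \<open>p\<close> that kills \<open>a\<close>. Its
    complement \<open>?m\<close> kills \<open>k'\<close>, hence descends along \<open>p\<close> to a
    section \<open>\<sigma>\<close>, and \<open>\<sigma> f = a\<close> because \<open>?m\<close>
    fixes \<open>a\<close>. The lift is \<open>w \<sigma>\<close>.\<close>
  let ?m = "Id C (Dom C p) \<boxplus> neg C (k' \<odot> (\<rho> \<odot> q))"
  have M: "?m \<in> Mor C" "Dom C ?m = Dom C p" "Cod C ?m = Dom C p" using I \<rho> Q K' k' a by simp_all
  have rqk: "\<rho> \<odot> (q \<odot> k') = Id C Y" by (rule \<rho>)
  have mk: "?m \<odot> k' = Zero C (Dom C k') (Cod C ?m)"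
    using I \<rho>(1-3) Q K' k' a rqk by (simp add: add_comp neg_comp comp_assoc)
  obtain \<sigma> where \<sigma>: "\<sigma> \<in> Mor C" "Cod C \<sigma> = Cod C ?m" "Dom C \<sigma> = Cod C p" "\<sigma> \<odot> p = ?m"
    by (rule cokernel_lift[OF cokernel_of_kernel[OF p(1) k'(1)] M(1) _ mk]) (use M K' in simp_all)
  have pm: "p \<odot> ?m = p"
    using I \<rho>(1-3) Q K'(1-3) k' a p v Cc(1) zero_factor[OF K'(4), of "\<rho> \<odot> q"] by (simp add: comp_add comp_neg)
  have p\<sigma>: "p \<odot> \<sigma> = Id C (Cod C p)"
    by (rule epicD[OF p(1)]) (use \<sigma> M pm p v Cc(1) in \<open>simp_all add: comp_assoc\<close>)
  have \<sigma>f: "\<sigma> \<odot> f = a"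
  proof -
    have "\<sigma> \<odot> f = ?m \<odot> a" using a(5) \<sigma> a(1-3) p comp_assoc[of a p \<sigma>] by simp
    also have "\<dots> = a" using I \<rho>(1-3) Q K' k' a Cc(1) YO by (simp add: add_comp neg_comp comp_assoc)
    finally show ?thesis .
  qed
  let ?t = "w \<odot> \<sigma>"
  have "g \<odot> ?t = (g \<odot> w) \<odot> \<sigma>" by (rule comp_assoc[symmetric]) (use p \<sigma>(1-3) M S in simp_all)
  also have "\<dots> = v" using p(2-7) \<sigma>(1-3) M v p\<sigma> by (simp add: comp_assoc)
  finally have 1: "g \<odot> ?t = v" .
  have 2: "?t \<odot> f = u" using \<sigma>f a(4) p \<sigma>(1-3) M v Cc by (simp add: comp_assoc)
  show "\<exists>t. t \<in> Mor C \<and> Dom C t = Cod C f \<and> Cod C t = Cod C k \<and> g \<odot> t = v \<and> t \<odot> f = u"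
    using 1 2 p \<sigma>(1-3) M v S by (intro exI[of _ ?t]) simp
qed

text \<open>For an extension \<open>g\<close> of the cokernel, lift the square with zero as upper
  side and \<open>c\<close> as lower side. The lift kills \<open>f\<close>, so it descends along
  \<open>c\<close> to a section of \<open>g\<close>.\<close>

lemma Ext1_vanishes_if_llp:
  assumes f: "llp C Y f" and c: "is_cokernel C f c" and Y: "Y \<in> Ob C"
  shows "Ext1_vanishes C (Cod C c) Y"
proof (rule Ext1_vanishesI)
  note Cc = cokernelD[OF c]
  show "Cod C c \<in> Ob C" "Y \<in> Ob C" using Cc Y by simp_all
  fix k g assume k: "short_exact C k g" "Dom C k = Y" "Cod C g = Cod C c"
  note S = short_exactD[OF k(1)]
  have e: "g \<odot> Zero C (Dom C f) (Cod C k) = c \<odot> f" using Cc S k by simp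
  obtain t where t: "t \<in> Mor C" "Dom C t = Cod C f" "Cod C t = Cod C k" "g \<odot> t = c"
      "t \<odot> f = Zero C (Dom C f) (Cod C k)"
    by (rule llpD[OF f k(1,2) _ _ _ _ _ _ e]) (use Cc S k in simp_all)
  obtain s where s: "s \<in> Mor C" "Cod C s = Cod C t" "Dom C s = Cod C c" "s \<odot> c = t"
    by (rule cokernel_lift[OF c, of t]) (use t in simp_all)
  have "g \<odot> s = Id C (Cod C c)"
    by (rule epicD[OF cokernel_epic[OF c]]) (use s t S Cc k in \<open>simp_all add: comp_assoc\<close>)
  then show "\<exists>s. s \<in> Mor C \<and> Dom C s = Cod C c \<and> Cod C s = Cod C k \<and> g \<odot> s = Id C (Cod C c)"
    using s t by (intro exI[of _ s]) simp
qed

end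

section \<open>Closure properties and factorizations for complete cotorsion pairs\<close>

lemma complete_cotorsion_pairD:
  assumes "complete_cotorsion_pair C X Y"
  shows "X \<subseteq> Ob C" "Y \<subseteq> Ob C" "right_orth C X = Y" "left_orth C Y = X"
    "\<lbrakk>A \<in> X; B \<in> Y\<rbrakk> \<Longrightarrow> Ext1_vanishes C A B"
    "\<lbrakk>A \<in> Ob C; \<And>B. B \<in> Y \<Longrightarrow> Ext1_vanishes C A B\<rbrakk> \<Longrightarrow> A \<in> X"
    "\<lbrakk>B \<in> Ob C; \<And>A. A \<in> X \<Longrightarrow> Ext1_vanishes C A B\<rbrakk> \<Longrightarrow> B \<in> Y"
    "M \<in> Ob C \<Longrightarrow> \<exists>f g. short_exact C f g \<and> Dom C f \<in> Y \<and> Cod C f \<in> X \<and> Cod C g = M"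
    "M \<in> Ob C \<Longrightarrow> \<exists>f g. short_exact C f g \<and> Dom C f = M \<and> Cod C f \<in> Y \<and> Cod C g \<in> X"
proof -
  show 1: "X \<subseteq> Ob C" "Y \<subseteq> Ob C" "right_orth C X = Y" "left_orth C Y = X"
    using assms by (simp_all add: complete_cotorsion_pair_def cotorsion_pair_def)
  show "Ext1_vanishes C A B" if "A \<in> X" "B \<in> Y" using 1(3) that unfolding right_orth_def by blast
  show "A \<in> X" if "A \<in> Ob C" "\<And>B. B \<in> Y \<Longrightarrow> Ext1_vanishes C A B" using 1(4) that unfolding left_orth_def by blast
  show "B \<in> Y" if "B \<in> Ob C" "\<And>A. A \<in> X \<Longrightarrow> Ext1_vanishes C A B" using 1(3) that unfolding right_orth_def by blast
  show "\<exists>f g. short_exact C f g \<and> Dom C f \<in> Y \<and> Cod C f \<in> X \<and> Cod C g = M" if "M \<in> Ob C"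
    using assms that unfolding complete_cotorsion_pair_def by blast
  show "\<exists>f g. short_exact C f g \<and> Dom C f = M \<and> Cod C f \<in> Y \<and> Cod C g \<in> X" if "M \<in> Ob C"
    using assms that unfolding complete_cotorsion_pair_def by blast
qed

context abelian_category
begin

text \<open>Degenerate sequences turn statements about objects into instances of the lifting
  property, with \<open>0 \<rightarrow> A\<close> as the monomorphism or, for
  \<open>short_exact_to_zero\<close>, \<open>A \<rightarrow> 0\<close> as the epimorphism.\<close>

lemma short_exact_from_zero:
  assumes "zero_object C Z" "A \<in> Ob C"
  shows "short_exact C (Zero C Z A) (Id C A)"
proof (rule short_exact_if_epic[OF epic_Id[OF assms(2)]])
  have Z: "Z \<in> Ob C" using assms by (simp add: zero_object_def)
  show "is_kernel C (Id C A) (Zero C Z A)"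
  proof (rule kernelI)
    show "monic C (Zero C Z A)"
    proof (rule monicI_zero)
      fix x assume "x \<in> Mor C" "Cod C x = Dom C (Zero C Z A)"
      then show "x = Zero C (Dom C x) (Dom C (Zero C Z A))" using zero_object_cod[OF assms(1), of x] Z assms(2) by simp
    qed (use Z assms in simp)
    fix x assume "x \<in> Mor C" "Cod C x = Dom C (Id C A)" "Id C A \<odot> x = Zero C (Dom C x) (Cod C (Id C A))"
    then show "\<exists>h. h \<in> Mor C \<and> Dom C h = Dom C x \<and> Cod C h = Dom C (Zero C Z A) \<and> Zero C Z A \<odot> h = x"
      using Z assms(2) by (intro exI[of _ "Zero C (Dom C x) Z"]) simp
  qed (use Z assms(2) in simp_all)
qed

lemma short_exact_to_zero:
  assumes "zero_object C Z" "A \<in> Ob C"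
  shows "short_exact C (Id C A) (Zero C A Z)"
proof (rule short_exact_if_monic[OF monic_Id[OF assms(2)]])
  have Z: "Z \<in> Ob C" using assms by (simp add: zero_object_def)
  show "is_cokernel C (Id C A) (Zero C A Z)"
  proof (rule cokernelI)
    show "epic C (Zero C A Z)"
    proof (rule epicI_zero)
      fix x assume "x \<in> Mor C" "Dom C x = Cod C (Zero C A Z)"
      then show "x = Zero C (Cod C (Zero C A Z)) (Cod C x)" using zero_object_dom[OF assms(1), of x] Z assms(2) by simp
    qed (use Z assms in simp)
    fix x assume "x \<in> Mor C" "Dom C x = Cod C (Id C A)" "x \<odot> Id C A = Zero C (Dom C (Id C A)) (Cod C x)"
    then show "\<exists>h. h \<in> Mor C \<and> Cod C h = Cod C x \<and> Dom C h = Cod C (Zero C A Z) \<and> h \<odot> Zero C A Z = x"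
      using Z assms(2) by (intro exI[of _ "Zero C Z (Cod C x)"]) simp
  qed (use Z assms(2) in simp_all)
qed

text \<open>The lifting property of \<open>f\<close> against
  \<open>Y \<rightarrow> 0\<close>.\<close>

lemma ext_extend:
  assumes ext: "Ext1_vanishes C (Cod C c) Y" and f: "monic C f" "is_cokernel C f c"
    and u: "u \<in> Mor C" "Dom C u = Dom C f" "Cod C u = Y"
  obtains t where "t \<in> Mor C" "Dom C t = Cod C f" "Cod C t = Y" "t \<odot> f = u"
proof -
  obtain Z where Z: "zero_object C Z" using ex_zero_object by blast
  have ZO: "Z \<in> Ob C" using Z by (simp add: zero_object_def)
  note F = cokernelD[OF f(2)]
  have Y: "Y \<in> Ob C" using u by auto
  have e: "Zero C Y Z \<odot> u = Zero C (Cod C f) Z \<odot> f" using u F Y ZO by simp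
  show thesis
    by (rule llpD[OF llp_if_Ext1_vanishes[OF f ext] short_exact_to_zero[OF Z Y] _ u(1,2) _ _ _ _ e])
      (use F Y ZO u that in simp_all)
qed

text \<open>The lifting property of \<open>0 \<rightarrow> A\<close> against
  \<open>g\<close>.\<close>

lemma ext_lift:
  assumes ext: "Ext1_vanishes C A Y" and g: "short_exact C k g" "Dom C k = Y"
    and v: "v \<in> Mor C" "Dom C v = A" "Cod C v = Cod C g"
  obtains t where "t \<in> Mor C" "Dom C t = A" "Cod C t = Cod C k" "g \<odot> t = v"
proof -
  obtain Z where Z: "zero_object C Z" using ex_zero_object by blast
  have ZO: "Z \<in> Ob C" using Z by (simp add: zero_object_def)
  note S = short_exactD[OF g(1)]
  have A: "A \<in> Ob C" using v by auto
  note SZ = short_exactD[OF short_exact_from_zero[OF Z A]]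
  have l: "llp C Y (Zero C Z A)" by (rule llp_if_Ext1_vanishes[OF SZ(7,2)]) (use A ext in simp)
  have e: "g \<odot> Zero C Z (Cod C k) = v \<odot> Zero C Z A" using v S A ZO by simp
  show thesis
    by (rule llpD[OF l g _ _ _ v(1) _ v(3) e]) (use S ZO A v that in simp_all)
qed

lemma llp_from_zero:
  assumes "zero_object C Z" "Ext1_vanishes C A Y" "A \<in> Ob C"
  shows "llp C Y (Zero C Z A)"
  using llp_if_Ext1_vanishes[OF short_exactD(7,2)[OF short_exact_from_zero[OF assms(1,3)]]] assms by simp

text \<open>Both \<open>0 \<rightarrow> Dom f\<close> and \<open>f\<close> have the lifting property
  against kernel \<open>Y\<close>, hence so has their composite
  \<open>0 \<rightarrow> Cod f\<close>, whose cokernel is the identity.\<close>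

lemma Ext1_vanishes_extension:
  assumes f: "monic C f" "is_cokernel C f c" and e: "Ext1_vanishes C (Dom C f) Y" "Ext1_vanishes C (Cod C c) Y"
    and Y: "Y \<in> Ob C"
  shows "Ext1_vanishes C (Cod C f) Y"
proof -
  obtain Z where Z: "zero_object C Z" using ex_zero_object by blast
  have ZO: "Z \<in> Ob C" using Z by (simp add: zero_object_def)
  note F = cokernelD[OF f(2)]
  have "llp C Y (f \<odot> Zero C Z (Dom C f))"
    by (rule llp_comp[OF llp_from_zero[OF Z e(1)] llp_if_Ext1_vanishes[OF f e(2)]]) (use F ZO in simp_all)
  then have "llp C Y (Zero C Z (Cod C f))" using F ZO by simp
  then show ?thesis
    using Ext1_vanishes_if_llp[of Y "Zero C Z (Cod C f)" "Id C (Cod C f)"]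
      short_exactD(2)[OF short_exact_from_zero[OF Z, of "Cod C f"]] Y F by simp
qed

text \<open>A section over a coproduct may be chosen on each summand separately: every injection
  lifts along \<open>g\<close>, and the lifts assemble by the universal property.\<close>

lemma Ext1_vanishes_coproduct:
  assumes P: "is_coproduct C S A P u" and e: "\<And>i. i \<in> S \<Longrightarrow> Ext1_vanishes C (A i) Y" and Y: "Y \<in> Ob C"
  shows "Ext1_vanishes C P Y"
proof (rule Ext1_vanishesI[OF coproduct_ob[OF P] Y])
  fix k g assume k: "short_exact C k g" "Dom C k = Y" "Cod C g = P"
  note S = short_exactD[OF k(1)]
  note I = coproduct_inj[OF P]
  have "\<exists>t. t \<in> Hom C (A i) (Cod C k) \<and> g \<odot> t = u i" if i: "i \<in> S" for i
    by (rule ext_lift[OF e[OF i] k(1,2) I(1)[OF i]]) (use I(2,3)[OF i] k in \<open>auto simp: Hom_iff\<close>)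
  then obtain t where t: "\<And>i. i \<in> S \<Longrightarrow> t i \<in> Hom C (A i) (Cod C k)" "\<And>i. i \<in> S \<Longrightarrow> g \<odot> t i = u i"
    by metis
  obtain T where T: "T \<in> Mor C" "Dom C T = P" "Cod C T = Cod C k" "\<And>i. i \<in> S \<Longrightarrow> T \<odot> u i = t i"
    by (rule coproduct_lift[OF P _ t(1)]) (use S in auto)
  have "g \<odot> T = Id C P"
  proof (rule coproduct_ext[OF P])
    fix i assume i: "i \<in> S"
    have "(g \<odot> T) \<odot> u i = g \<odot> (T \<odot> u i)" by (rule comp_assoc) (use I[OF i] T(1-3) S in simp_all)
    then show "(g \<odot> T) \<odot> u i = Id C P \<odot> u i" using I[OF i] T(4)[OF i] t(2)[OF i] by simp
  qed (use T(1-3) S k coproduct_ob[OF P] in simp_all)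
  then show "\<exists>s. s \<in> Mor C \<and> Dom C s = P \<and> Cod C s = Cod C k \<and> g \<odot> s = Id C P" using T by blast
qed

lemma Ext1_vanishes_retract_left:
  assumes "retract C A B" "Ext1_vanishes C B Y" "Y \<in> Ob C"
  shows "Ext1_vanishes C A Y"
proof -
  obtain s r where s: "s \<in> Mor C" "Dom C s = A" "Cod C s = B" and r: "r \<in> Mor C" "Dom C r = B" "Cod C r = A"
    and rs: "r \<odot> s = Id C A" using assms(1) by (auto simp: retract_def Hom_iff)
  have A: "A \<in> Ob C" using s by auto
  show ?thesis
  proof (rule Ext1_vanishesI[OF A assms(3)])
    fix k g assume k: "short_exact C k g" "Dom C k = Y" "Cod C g = A"
    obtain t where t: "t \<in> Mor C" "Dom C t = B" "Cod C t = Cod C k" "g \<odot> t = r"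
      by (rule ext_lift[OF assms(2) k(1,2) r(1,2)]) (use r k in simp_all)
    have "g \<odot> (t \<odot> s) = (g \<odot> t) \<odot> s" by (rule comp_assoc[symmetric]) (use t s short_exactD[OF k(1)] in simp_all)
    then show "\<exists>s. s \<in> Mor C \<and> Dom C s = A \<and> Cod C s = Cod C k \<and> g \<odot> s = Id C A"
      using t s rs by (intro exI[of _ "t \<odot> s"]) simp
  qed
qed

lemma Ext1_vanishes_retract_right:
  assumes "retract C Y Y'" "Ext1_vanishes C A Y'" "A \<in> Ob C"
  shows "Ext1_vanishes C A Y"
proof -
  obtain s r where s: "s \<in> Mor C" "Dom C s = Y" "Cod C s = Y'" and r: "r \<in> Mor C" "Dom C r = Y'" "Cod C r = Y"
    and rs: "r \<odot> s = Id C Y" using assms(1) by (auto simp: retract_def Hom_iff)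
  have Y: "Y \<in> Ob C" using s by auto
  show ?thesis
  proof (rule Ext1_vanishesI[OF assms(3) Y])
    fix k g assume k: "short_exact C k g" "Dom C k = Y" "Cod C g = A"
    note S = short_exactD[OF k(1)]
    obtain t where t: "t \<in> Mor C" "Dom C t = Cod C k" "Cod C t = Y'" "t \<odot> k = s"
      by (rule ext_extend[OF _ S(7,2) s(1)]) (use assms(2) s k in simp_all)
    have "(r \<odot> t) \<odot> k = r \<odot> (t \<odot> k)" by (rule comp_assoc) (use t r S in simp_all)
    then show "\<exists>s. s \<in> Mor C \<and> Dom C s = A \<and> Cod C s = Cod C k \<and> g \<odot> s = Id C A"
      using section_if_retraction[OF k(1), of "r \<odot> t"] t r rs k by auto
  qed
qed

text \<open>If \<open>M\<close> is orthogonal to one of the classes, the approximation sequence of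
  \<open>M\<close> whose outer term lies in that class splits. So \<open>M\<close> is a retract of
  the middle term, which lies in the other class; this gives the two inclusions that orthogonality
  does not.\<close>

lemma complete_cotorsion_pairI:
  assumes XO: "X \<subseteq> Ob C" and YO: "Y \<subseteq> Ob C"
    and orth: "\<And>A B. \<lbrakk>A \<in> X; B \<in> Y\<rbrakk> \<Longrightarrow> Ext1_vanishes C A B"
    and pre: "\<And>M. M \<in> Ob C \<Longrightarrow> \<exists>f g. short_exact C f g \<and> Dom C f \<in> Y \<and> Cod C f \<in> X \<and> Cod C g = M"
    and env: "\<And>M. M \<in> Ob C \<Longrightarrow> \<exists>f g. short_exact C f g \<and> Dom C f = M \<and> Cod C f \<in> Y \<and> Cod C g \<in> X"
    and rX: "\<And>A B. \<lbrakk>retract C A B; B \<in> X\<rbrakk> \<Longrightarrow> A \<in> X" and rY: "\<And>A B. \<lbrakk>retract C A B; B \<in> Y\<rbrakk> \<Longrightarrow> A \<in> Y"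
  shows "complete_cotorsion_pair C X Y"
proof -
  have "right_orth C X \<subseteq> Y"
  proof
    fix M assume M: "M \<in> right_orth C X"
    then obtain f g where fg: "short_exact C f g" "Dom C f = M" "Cod C f \<in> Y" "Cod C g \<in> X"
      using env[of M] by (auto simp: right_orth_def)
    note S = short_exactD[OF fg(1)]
    obtain s where s: "s \<in> Mor C" "Dom C s = Cod C g" "Cod C s = Cod C f" "g \<odot> s = Id C (Cod C g)"
      by (rule ext_split[OF _ fg(1,2) refl]) (use M fg in \<open>auto simp: right_orth_def\<close>)
    obtain r where r: "biproduct C (Cod C g) (Dom C f) (Cod C f) s f g r"
      by (rule section_biproduct[OF fg(1) s])
    then have "retract C M (Cod C f)" using fg unfolding biproduct_def retract_def by auto
    then show "M \<in> Y" using rY fg by blast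
  qed
  moreover have "left_orth C Y \<subseteq> X"
  proof
    fix M assume M: "M \<in> left_orth C Y"
    then obtain f g where fg: "short_exact C f g" "Dom C f \<in> Y" "Cod C f \<in> X" "Cod C g = M"
      using pre[of M] by (auto simp: left_orth_def)
    note S = short_exactD[OF fg(1)]
    obtain s where s: "s \<in> Mor C" "Dom C s = Cod C g" "Cod C s = Cod C f" "g \<odot> s = Id C (Cod C g)"
      by (rule ext_split[OF _ fg(1) refl refl]) (use M fg in \<open>auto simp: left_orth_def\<close>)
    have "s \<in> Hom C M (Cod C f)" "g \<in> Hom C (Cod C f) M" "g \<odot> s = Id C M" using s S fg(4) by (simp_all add: Hom_iff)
    then have "retract C M (Cod C f)" unfolding retract_def by blast
    then show "M \<in> X" using rX fg by blast
  qed
  moreover have "Y \<subseteq> right_orth C X" "X \<subseteq> left_orth C Y"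
    using orth XO YO by (auto simp: right_orth_def left_orth_def)
  ultimately have "cotorsion_pair C X Y" unfolding cotorsion_pair_def using XO YO by (simp add: subset_antisym)
  then show ?thesis unfolding complete_cotorsion_pair_def using pre env by simp
qed

lemma cotorsion_pair_retract_left:
  assumes "complete_cotorsion_pair C X Y" "retract C A B" "B \<in> X"
  shows "A \<in> X"
proof -
  note c = complete_cotorsion_pairD[OF assms(1)]
  have "A \<in> Ob C" using assms(2) by (auto simp: retract_def Hom_iff)
  then show ?thesis using c(2,5,6) Ext1_vanishes_retract_left[OF assms(2)] assms(3) by blast
qed

lemma cotorsion_pair_retract_right:
  assumes "complete_cotorsion_pair C X Y" "retract C A B" "B \<in> Y"
  shows "A \<in> Y"
proof -
  note c = complete_cotorsion_pairD[OF assms(1)]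
  have "A \<in> Ob C" using assms(2) by (auto simp: retract_def Hom_iff)
  then show ?thesis using c(1,5,7) Ext1_vanishes_retract_right[OF assms(2)] assms(3) by blast
qed

lemma cotorsion_pair_coproduct:
  assumes "complete_cotorsion_pair C X Y" "is_coproduct C S A P u" "\<And>i. i \<in> S \<Longrightarrow> A i \<in> X"
  shows "P \<in> X"
proof -
  note c = complete_cotorsion_pairD[OF assms(1)]
  show ?thesis using c(2,5,6) Ext1_vanishes_coproduct[OF assms(2)] assms(3) coproduct_ob[OF assms(2)] by blast
qed

lemma cotorsion_pair_extension:
  assumes "complete_cotorsion_pair C X Y" "monic C f" "is_cokernel C f c" "Dom C f \<in> X" "Cod C c \<in> X"
  shows "Cod C f \<in> X"
proof -
  note c = complete_cotorsion_pairD[OF assms(1)]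
  have "Cod C f \<in> Ob C" using assms(2) by (simp add: monic_def)
  then show ?thesis using c(2,5,6) Ext1_vanishes_extension[OF assms(2,3)] assms(4,5) by blast
qed

text \<open>Add a special precover \<open>g0\<close> of the target to \<open>h\<close>, so that
  \<open>\<pi>\<close>, given by \<open>h\<close> and \<open>g0\<close>, is epic on the biproduct;
  then push its kernel out along a special preenvelope \<open>y\<close>. The new kernel is
  \<open>Cod C y\<close> in \<open>Y\<close>, while the source embeds by \<open>e i\<close>, whose
  two stages have cokernels \<open>Cod C f0\<close> and \<open>Cod C d\<close> in
  \<open>X\<close>.\<close>

lemma cotorsion_pair_factorization:
  assumes cp: "complete_cotorsion_pair C X Y" and h: "h \<in> Mor C"
  obtains j q c k where "j \<in> Mor C" "q \<in> Mor C" "Dom C j = Dom C h" "Cod C q = Cod C h" "Dom C q = Cod C j" "q \<odot> j = h"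
    "monic C j" "is_cokernel C j c" "Cod C c \<in> X" "epic C q" "is_kernel C q k" "Dom C k \<in> Y"
proof -
  note cp' = complete_cotorsion_pairD[OF cp]
  obtain f0 g0 where s0: "short_exact C f0 g0" "Dom C f0 \<in> Y" "Cod C f0 \<in> X" "Cod C g0 = Cod C h"
    using cp'(8)[OF Cod_Ob[OF h]] by blast
  note S0 = short_exactD[OF s0(1)]
  obtain S i j p q where b: "biproduct C (Dom C h) (Cod C f0) S i j p q"
    by (rule ex_biproduct[of "Dom C h" "Cod C f0"]) (use h S0 in simp_all)
  note B = biproductD[OF b]
  define \<pi> where "\<pi> = (h \<odot> p) \<boxplus> (g0 \<odot> q)"
  have \<pi>: "\<pi> \<in> Mor C" "Dom C \<pi> = S" "Cod C \<pi> = Cod C h" "\<pi> \<odot> i = h" "\<pi> \<odot> j = g0"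
    using h S0(3-5) s0(4) B(1-19) by (simp_all add: \<pi>_def add_comp comp_assoc)
  have e\<pi>: "epic C \<pi>" by (rule epic_right_factor[of _ j]) (use \<pi> S0 B in simp_all)
  obtain \<kappa> where \<kappa>: "is_kernel C \<pi> \<kappa>" using ex_kernel[OF \<pi>(1)] by blast
  note K = kernelD[OF \<kappa>]
  obtain y d where y: "short_exact C y d" "Dom C y = Dom C \<kappa>" "Cod C y \<in> Y" "Cod C d \<in> X"
    using cp'(9)[OF Dom_Ob[OF K(2)]] by blast
  note Y = short_exactD[OF y(1)]
  obtain p' e where p': "monic C p'" "monic C y \<Longrightarrow> monic C e" "e \<in> Mor C" "p' \<in> Mor C"
    "Dom C p' = Cod C y" "Dom C e = Cod C \<kappa>" "Cod C e = Cod C p'"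
    "\<And>c. is_cokernel C \<kappa> c \<Longrightarrow> \<exists>c'. is_cokernel C p' c' \<and> Cod C c' = Cod C c \<and> c' \<odot> e = c"
    "\<And>c. is_cokernel C y c \<Longrightarrow> \<exists>c'. is_cokernel C e c' \<and> Cod C c' = Cod C c \<and> c' \<odot> p' = c"
    by (rule ex_pushout[OF kernel_monic[OF \<kappa>] Y(3) y(2)]) blast
  have me: "monic C e" using p'(2) Y(7) by simp
  obtain c' where c': "is_cokernel C p' c'" "Cod C c' = Cod C h" "c' \<odot> e = \<pi>"
    using p'(8)[OF cokernel_of_kernel[OF e\<pi> \<kappa>]] \<pi> by auto
  obtain d' where d': "is_cokernel C e d'" "Cod C d' = Cod C d" using p'(9)[OF Y(2)] by blast
  note C' = cokernelD[OF c'(1)] and D' = cokernelD[OF d'(1)]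
  have mei: "monic C (e \<odot> i)"
    by (rule monic_comp[OF _ me]) (use short_exactD(7)[OF short_exact_biproduct[OF b]] p' K \<pi> B in simp_all)
  have ei: "e \<odot> i \<in> Mor C" "Dom C (e \<odot> i) = Dom C h" "Cod C (e \<odot> i) = Cod C e" using p' K \<pi> B by simp_all
  obtain c where c: "is_cokernel C (e \<odot> i) c" using ex_cokernel[OF ei(1)] by blast
  have "Cod C c \<in> X"
  proof (rule cp'(6))
    show "Cod C c \<in> Ob C" using cokernelD[OF c] by simp
    fix V assume V: "V \<in> Y"
    \<comment> \<open>Membership of the cokernel of \<open>e i\<close> in \<open>X\<close> is tested
      by lifting against kernels \<open>V\<close> in \<open>Y\<close>: each of the two stages has
      its cokernel in \<open>X\<close>, so each lifts, and lifting is stable under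
      composition.\<close>
    have "llp C V i"
      by (rule llp_if_Ext1_vanishes[OF short_exactD(7,2)[OF short_exact_biproduct[OF b]]]) (use B s0 V cp'(5) in simp)
    moreover have "llp C V e" by (rule llp_if_Ext1_vanishes[OF me d'(1)]) (use d' y V cp'(5) in simp)
    ultimately have "llp C V (e \<odot> i)" by (rule llp_comp) (use p' K \<pi> B in simp)
    then show "Ext1_vanishes C (Cod C c) V" by (rule Ext1_vanishes_if_llp[OF _ c]) (use V cp'(2) in blast)
  qed
  moreover have "c' \<odot> (e \<odot> i) = h" using c'(3) \<pi>(4) comp_assoc[of i e c'] C' p'(3-7) K \<pi>(1-3) B(1-15) by simp
  ultimately show thesis
    using that[of "e \<odot> i" c' c p', OF ei(1) C'(2) ei(2) c'(2) _ _ mei c _ cokernel_epic[OF c'(1)]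
      kernel_of_cokernel[OF p'(1) c'(1)]] ei p' C' y by simp
qed

text \<open>Embed the source into an object of \<open>Y\<close> and extend
  the embedding over each summand.\<close>

lemma cotorsion_pair_coproduct_monic:
  assumes cp: "complete_cotorsion_pair C X Y" and P: "is_coproduct C S A P u" and P': "is_coproduct C S B P' u'"
    and f: "\<And>i. i \<in> S \<Longrightarrow> short_exact C (f i) (c i) \<and> Dom C (f i) = A i \<and> Cod C (f i) = B i \<and> Cod C (c i) \<in> X"
    and F: "F \<in> Mor C" "Dom C F = P" "Cod C F = P'" "\<And>i. i \<in> S \<Longrightarrow> F \<odot> u i = u' i \<odot> f i"
  shows "monic C F"
proof -
  note cp' = complete_cotorsion_pairD[OF cp]
  obtain y d where y: "short_exact C y d" "Dom C y = P" "Cod C y \<in> Y"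
    using cp'(9)[OF coproduct_ob[OF P]] by blast
  note Y = short_exactD[OF y(1)] and I = coproduct_inj[OF P] and I' = coproduct_inj[OF P']
  have "\<exists>t. t \<in> Hom C (B i) (Cod C y) \<and> t \<odot> f i = y \<odot> u i" if i: "i \<in> S" for i
  proof -
    have e: "Ext1_vanishes C (Cod C (c i)) (Cod C y)" using cp'(5) f[OF i] y by blast
    note fi = short_exactD[OF f[OF i, THEN conjunct1]]
    show ?thesis
      by (rule ext_extend[OF e fi(7,2), of "y \<odot> u i"]) (use Y I[OF i] f[OF i] y in \<open>auto simp: Hom_iff\<close>)
  qed
  then obtain t where t: "\<And>i. i \<in> S \<Longrightarrow> t i \<in> Hom C (B i) (Cod C y)" "\<And>i. i \<in> S \<Longrightarrow> t i \<odot> f i = y \<odot> u i"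
    by metis
  obtain T where T: "T \<in> Mor C" "Dom C T = P'" "Cod C T = Cod C y" "\<And>i. i \<in> S \<Longrightarrow> T \<odot> u' i = t i"
    by (rule coproduct_lift[OF P' _ t(1)]) (use Y in auto)
  have "T \<odot> F = y"
  proof (rule coproduct_ext[OF P])
    fix i assume i: "i \<in> S"
    note fi = short_exactD[OF f[OF i, THEN conjunct1]]
    have "(T \<odot> F) \<odot> u i = T \<odot> (F \<odot> u i)" by (rule comp_assoc) (use T(1-3) F(1-3) I[OF i] in simp_all)
    also have "\<dots> = (T \<odot> u' i) \<odot> f i"
      unfolding F(4)[OF i] by (rule comp_assoc[symmetric]) (use T(1-3) I'[OF i] f[OF i] fi in simp_all)
    finally show "(T \<odot> F) \<odot> u i = y \<odot> u i" using T(4)[OF i] t(2)[OF i] by simp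
  qed (use T(1-3) F(1-3) Y y in simp_all)
  \<comment> \<open>The monomorphism \<open>y\<close> factors through \<open>F\<close>, which forces
    \<open>F\<close> to be monic.\<close>
  then show ?thesis using Y(7) T F(1-3) by (intro monic_left_factor[of T F]) simp_all
qed

text \<open>Coproducts and cokernels are both colimits and hence commute. Each property of
  \<open>G\<close> is verified on the injections, where it reduces to the cokernel
  \<open>c i\<close>.\<close>

lemma coproduct_cokernel:
  assumes P: "is_coproduct C S A P u" and P': "is_coproduct C S B P' u'" and P'': "is_coproduct C S E P'' u''"
    and f: "\<And>i. i \<in> S \<Longrightarrow> is_cokernel C (f i) (c i) \<and> Dom C (f i) = A i \<and> Cod C (f i) = B i \<and> Cod C (c i) = E i"
    and F: "F \<in> Mor C" "Dom C F = P" "Cod C F = P'" "\<And>i. i \<in> S \<Longrightarrow> F \<odot> u i = u' i \<odot> f i"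
    and G: "G \<in> Mor C" "Dom C G = P'" "Cod C G = P''" "\<And>i. i \<in> S \<Longrightarrow> G \<odot> u' i = u'' i \<odot> c i"
  shows "is_cokernel C F G"
proof (rule cokernelI[OF F(1)])
  note I = coproduct_inj[OF P] and I' = coproduct_inj[OF P'] and I'' = coproduct_inj[OF P'']
  have fi: "f i \<in> Mor C" "c i \<in> Mor C" "Dom C (c i) = B i" "c i \<odot> f i = Zero C (A i) (E i)" "epic C (c i)" if "i \<in> S" for i
    using f[OF that] cokernelD[of "f i" "c i"] cokernel_epic[of "f i" "c i"] by auto
  show "epic C G"
  proof (rule epicI_zero[OF G(1)])
    fix x assume x: "x \<in> Mor C" "Dom C x = Cod C G" "x \<odot> G = Zero C (Dom C G) (Cod C x)"
    show "x = Zero C (Cod C G) (Cod C x)"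
    proof (rule coproduct_ext[OF P''])
      fix i assume i: "i \<in> S"
      have "(x \<odot> u'' i) \<odot> c i = x \<odot> (u'' i \<odot> c i)" by (rule comp_assoc) (use x G(1-3) I''[OF i] f[OF i] fi[OF i] in simp_all)
      also have "\<dots> = (x \<odot> G) \<odot> u' i"
        unfolding G(4)[OF i, symmetric] by (rule comp_assoc[symmetric]) (use x G(1-3) I'[OF i] in simp_all)
      also have "\<dots> = Zero C (B i) (Cod C x)" unfolding x(3) using x(1) G(1-3) I'[OF i] coproduct_ob[OF P'] by simp
      finally have "x \<odot> u'' i = Zero C (E i) (Cod C x)"
        using epic_zeroD[OF fi(5)[OF i], of "x \<odot> u'' i"] x(1,2) G(1-3) I''[OF i] f[OF i] fi[OF i] by simp
      then show "x \<odot> u'' i = Zero C (Cod C G) (Cod C x) \<odot> u'' i"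
        using x(1) G(1-3) I''[OF i] coproduct_ob[OF P''] by simp
    qed (use x G(1-3) coproduct_ob[OF P''] in simp_all)
  qed
  show "Dom C G = Cod C F" using F G by simp
  show "G \<odot> F = Zero C (Dom C F) (Cod C G)"
  proof (rule coproduct_ext[OF P])
    fix i assume i: "i \<in> S"
    have "(G \<odot> F) \<odot> u i = G \<odot> (F \<odot> u i)" by (rule comp_assoc) (use G(1-3) F(1-3) I[OF i] in simp_all)
    also have "\<dots> = (G \<odot> u' i) \<odot> f i"
      unfolding F(4)[OF i] by (rule comp_assoc[symmetric]) (use G(1-3) I'[OF i] f[OF i] fi[OF i] in simp_all)
    also have "\<dots> = u'' i \<odot> (c i \<odot> f i)"
      unfolding G(4)[OF i] by (rule comp_assoc) (use I''[OF i] f[OF i] fi[OF i] in simp_all)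
    also have "\<dots> = Zero C (A i) P''" unfolding fi(4)[OF i] using I''[OF i] I[OF i] by simp
    finally show "(G \<odot> F) \<odot> u i = Zero C (Dom C F) (Cod C G) \<odot> u i"
      using F(1-3) G(1-3) I[OF i] coproduct_ob[OF P] coproduct_ob[OF P''] by simp
  qed (use F(1-3) G(1-3) coproduct_ob[OF P] coproduct_ob[OF P''] in simp_all)
  fix g assume g: "g \<in> Mor C" "Dom C g = Cod C F" "g \<odot> F = Zero C (Dom C F) (Cod C g)"
  have "\<exists>t. t \<in> Hom C (E i) (Cod C g) \<and> t \<odot> c i = g \<odot> u' i" if i: "i \<in> S" for i
  proof -
    have "(g \<odot> u' i) \<odot> f i = g \<odot> (u' i \<odot> f i)" by (rule comp_assoc) (use g F(1-3) I'[OF i] f[OF i] fi[OF i] in simp_all)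
    also have "\<dots> = (g \<odot> F) \<odot> u i"
      unfolding F(4)[OF i, symmetric] by (rule comp_assoc[symmetric]) (use g F(1-3) I[OF i] in simp_all)
    also have "\<dots> = Zero C (A i) (Cod C g)" unfolding g(3) using g(1) F(1-3) I[OF i] coproduct_ob[OF P] by simp
    finally have z: "(g \<odot> u' i) \<odot> f i = Zero C (Dom C (f i)) (Cod C (g \<odot> u' i))"
      using g F(1-3) I'[OF i] f[OF i] by simp
    obtain t where "t \<in> Mor C" "Cod C t = Cod C (g \<odot> u' i)" "Dom C t = Cod C (c i)" "t \<odot> c i = g \<odot> u' i"
      by (rule cokernel_lift[OF f[OF i, THEN conjunct1] _ _ z]) (use g F(1-3) I'[OF i] f[OF i] in simp_all)
    then show ?thesis
      using g F(1-3) I'[OF i] f[OF i] by (intro exI[of _ t]) (simp add: Hom_iff)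
  qed
  then obtain t where t: "\<And>i. i \<in> S \<Longrightarrow> t i \<in> Hom C (E i) (Cod C g)" "\<And>i. i \<in> S \<Longrightarrow> t i \<odot> c i = g \<odot> u' i"
    by metis
  obtain T where T: "T \<in> Mor C" "Dom C T = P''" "Cod C T = Cod C g" "\<And>i. i \<in> S \<Longrightarrow> T \<odot> u'' i = t i"
    by (rule coproduct_lift[OF P'' _ t(1)]) (use g in auto)
  have "T \<odot> G = g"
  proof (rule coproduct_ext[OF P'])
    fix i assume i: "i \<in> S"
    have "(T \<odot> G) \<odot> u' i = T \<odot> (G \<odot> u' i)" by (rule comp_assoc) (use T(1-3) G(1-3) I'[OF i] in simp_all)
    also have "\<dots> = (T \<odot> u'' i) \<odot> c i"
      unfolding G(4)[OF i] by (rule comp_assoc[symmetric]) (use T(1-3) I''[OF i] f[OF i] fi[OF i] in simp_all)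
    finally show "(T \<odot> G) \<odot> u' i = g \<odot> u' i" using T(4)[OF i] t(2)[OF i] by simp
  qed (use T(1-3) F(1-3) G(1-3) g in simp_all)
  then show "\<exists>h. h \<in> Mor C \<and> Cod C h = Cod C g \<and> Dom C h = Cod C G \<and> h \<odot> G = g" using T G by auto
qed

text \<open>Read \<open>f\<close> and \<open>e\<close> as inclusions of subobjects, the source of
  \<open>f\<close> inside its target inside the target of \<open>e\<close>. Then \<open>h\<close>
  embeds the lower quotient into the total one, and what remains is the upper quotient.\<close>

lemma noether_third:
  assumes f: "monic C f" "is_cokernel C f c" and e: "monic C e" "is_cokernel C e d" "Dom C e = Cod C f"
    and q: "is_cokernel C (e \<odot> f) q" and h: "h \<in> Mor C" "Dom C h = Cod C c" "Cod C h = Cod C q" "h \<odot> c = q \<odot> e"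
  obtains d' where "monic C h" "is_cokernel C h d'" "Cod C d' = Cod C d"
proof -
  note Cc = cokernelD[OF f(2)] and D = cokernelD[OF e(2)] and Q = cokernelD[OF q]
  have QC: "Dom C q = Cod C e" using Q(3) Cc e D by simp
  have mh: "monic C h"
  proof (rule monicI_zero[OF h(1)])
    fix x assume x: "x \<in> Mor C" "Cod C x = Dom C h" "h \<odot> x = Zero C (Dom C x) (Cod C h)"
    have xc: "Cod C x = Cod C c" using x h by simp
    \<comment> \<open>The pullback along \<open>c\<close> replaces \<open>x\<close> by a
      representative \<open>w\<close> in the target of \<open>f\<close>, at the cost of an
      epimorphism \<open>p\<close>. The representative is sent to zero by \<open>q e\<close>, so it
      comes from the source of \<open>f\<close>, where \<open>c\<close> vanishes.\<close>
    obtain p w where p: "epic C p" "w \<in> Mor C" "p \<in> Mor C" "Cod C p = Dom C x" "Cod C w = Dom C c" "Dom C w = Dom C p"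
      "c \<odot> w = x \<odot> p"
      by (rule ex_pullback[OF cokernel_epic[OF f(2)] x(1) xc]) blast
    have "q \<odot> (e \<odot> w) = (h \<odot> c) \<odot> w"
      unfolding h(4) by (rule comp_assoc[symmetric]) (use p Q QC D Cc e in simp_all)
    also have "\<dots> = (h \<odot> x) \<odot> p" using p h(1-3) x(1,2) Cc by (simp add: comp_assoc)
    also have "\<dots> = Zero C (Dom C p) (Cod C q)" unfolding x(3) using x(1) p h Q by simp
    finally have z: "q \<odot> (e \<odot> w) = Zero C (Dom C (e \<odot> w)) (Cod C q)" using p D e Cc by simp
    obtain m where m: "m \<in> Mor C" "Dom C m = Dom C (e \<odot> w)" "Cod C m = Dom C (e \<odot> f)" "(e \<odot> f) \<odot> m = e \<odot> w"
      by (rule kernel_lift[OF kernel_of_cokernel[OF _ q] _ _ z])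
        (use p D e Cc QC monic_comp[OF f(1) e(1) e(3)] in simp_all)
    have "f \<odot> m = w"
      by (rule monicD[OF e(1)]) (use m p D e Cc in \<open>simp_all add: comp_assoc\<close>)
    then have "x \<odot> p = (c \<odot> f) \<odot> m" using p(7) m(1-3) Cc(1-3) D(1-3) e(3) p(2-6) by (simp add: comp_assoc)
    also have "\<dots> = Zero C (Dom C p) (Cod C x)" using m(1-3) Cc D e p(2-6) x(2) h(2) by simp
    finally show "x = Zero C (Dom C x) (Dom C h)" using epic_zeroD[OF p(1) _ x(1)] p x by simp
  qed
  have z: "d \<odot> (e \<odot> f) = Zero C (Dom C (e \<odot> f)) (Cod C d)"
    by (subst zero_factor[OF D(4)]) (use D Cc e in simp_all)
  obtain d' where d': "d' \<in> Mor C" "Cod C d' = Cod C d" "Dom C d' = Cod C q" "d' \<odot> q = d"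
    by (rule cokernel_lift[OF q _ _ z]) (use D Cc e in simp_all)
  have "is_cokernel C h d'"
  proof (rule cokernelI[OF h(1)])
    show "epic C d'" by (rule epic_right_factor[of d' q]) (use d' cokernel_epic[OF e(2)] Q in simp_all)
    show "Dom C d' = Cod C h" using d' h by simp
    show "d' \<odot> h = Zero C (Dom C h) (Cod C d')"
    proof (rule epicD[OF cokernel_epic[OF f(2)]])
      have "(d' \<odot> h) \<odot> c = d' \<odot> (q \<odot> e)" using h d'(1-3) Cc comp_assoc[of c h d'] by simp
      also have "\<dots> = d \<odot> e" using comp_assoc[of e q d'] Q QC D d' by simp
      also have "\<dots> = Zero C (Cod C f) (Cod C d)" using D e by simp
      finally show "(d' \<odot> h) \<odot> c = Zero C (Dom C h) (Cod C d') \<odot> c" using d' h Cc D by simp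
    qed (use d' h Cc D in simp_all)
    fix g assume g: "g \<in> Mor C" "Dom C g = Cod C h" "g \<odot> h = Zero C (Dom C h) (Cod C g)"
    have "(g \<odot> q) \<odot> e = (g \<odot> h) \<odot> c" using h g(1,2) Q QC D Cc by (simp add: comp_assoc)
    also have "\<dots> = Zero C (Dom C e) (Cod C g)" unfolding g(3) using g(1) h Cc D e by simp
    finally have z: "(g \<odot> q) \<odot> e = Zero C (Dom C e) (Cod C (g \<odot> q))" using g h Q by simp
    obtain n where n: "n \<in> Mor C" "Cod C n = Cod C (g \<odot> q)" "Dom C n = Cod C d" "n \<odot> d = g \<odot> q"
      by (rule cokernel_lift[OF e(2) _ _ z]) (use g h Q QC in simp_all)
    have "n \<odot> d' = g"
      by (rule epicD[OF cokernel_epic[OF q]]) (use n d' g h Q in \<open>simp_all add: comp_assoc\<close>)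
    then show "\<exists>ha. ha \<in> Mor C \<and> Cod C ha = Cod C g \<and> Dom C ha = Cod C d' \<and> ha \<odot> d' = g"
      using n d' g h Q by (intro exI[of _ n]) simp
  qed
  then show thesis using that mh d' by blast
qed

text \<open>Given an extension of the kernel \<open>K\<close> by \<open>B\<close> in \<open>Y\<close>, push it into an object \<open>Y\<^sub>1\<close> of \<open>Y\<close>; the induced map
  \<open>K \<rightarrow> Y\<^sub>1/B\<close> extends over the middle term and then lifts to \<open>Y\<^sub>1\<close>, which splits the extension.\<close>

lemma closed_kernels_if_closed_cokernels:
  assumes cp: "complete_cotorsion_pair C X Y" and cl: "closed_cokernels_of_monos C Y"
  shows "closed_kernels_of_epis C X"
  unfolding closed_kernels_of_epis_def
proof (intro allI impI)
  note cp' = complete_cotorsion_pairD[OF cp]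
  fix g k assume gk: "epic C g \<and> Dom C g \<in> X \<and> Cod C g \<in> X \<and> is_kernel C g k"
  then have g: "epic C g" "Dom C g \<in> X" "Cod C g \<in> X" and k: "is_kernel C g k" by simp_all
  note K = kernelD[OF k]
  show "Dom C k \<in> X"
  proof (rule cp'(6)[OF Dom_Ob[OF K(2)]])
    fix B assume B: "B \<in> Y"
    then have BO: "B \<in> Ob C" using cp'(2) by blast
    show "Ext1_vanishes C (Dom C k) B"
    proof (rule Ext1_vanishesI[OF Dom_Ob[OF K(2)] BO])
      fix f0 g0 assume s0: "short_exact C f0 g0" "Dom C f0 = B" "Cod C g0 = Dom C k"
      note S0 = short_exactD[OF s0(1)]
      obtain e d where e: "short_exact C e d" "Dom C e = Cod C f0" "Cod C e \<in> Y"
        using cp'(9)[OF Cod_Ob[OF S0(3)]] by blast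
      note E = short_exactD[OF e(1)]
      have m: "monic C (e \<odot> f0)" by (rule monic_comp[OF S0(7) E(7) e(2)])
      have m': "e \<odot> f0 \<in> Mor C" "Dom C (e \<odot> f0) = B" "Cod C (e \<odot> f0) = Cod C e" using E S0 e s0 by simp_all
      obtain c where c: "is_cokernel C (e \<odot> f0) c" using ex_cokernel[OF m'(1)] by blast
      note Cc = cokernelD[OF c]
      \<comment> \<open>The closure hypothesis enters here: \<open>e f0\<close> is a monomorphism
        from \<open>B\<close> to \<open>Cod C e\<close>, both in \<open>Y\<close>.\<close>
      have cY: "Cod C c \<in> Y" using cl[unfolded closed_cokernels_of_monos_def, rule_format, of "e \<odot> f0" c] m m' c B e by simp
      have z: "(c \<odot> e) \<odot> f0 = Zero C (Dom C f0) (Cod C (c \<odot> e))"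
        using comp_assoc[of f0 e c] Cc m' E S0 e s0 by simp
      obtain n where n: "n \<in> Mor C" "Cod C n = Cod C (c \<odot> e)" "Dom C n = Cod C g0" "n \<odot> g0 = c \<odot> e"
        by (rule cokernel_lift[OF S0(2) _ _ z]) (use Cc m' E S0 e in simp_all)
      \<comment> \<open>\<open>Cod C g\<close> is in \<open>X\<close> and \<open>Cod C c\<close> in
        \<open>Y\<close>, so \<open>n\<close> extends from the kernel to \<open>Dom C g\<close>. As
        \<open>Dom C g\<close> is in \<open>X\<close> and \<open>B\<close> in \<open>Y\<close>, the
        extension lifts along \<open>c\<close> to \<open>L\<close>.\<close>
      obtain N where N: "N \<in> Mor C" "Dom C N = Cod C k" "Cod C N = Cod C c" "N \<odot> k = n"
        by (rule ext_extend[OF cp'(5)[OF g(3) cY] kernel_monic[OF k] cokernel_of_kernel[OF g(1) k], of n])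
          (use n s0 Cc m' E in simp_all)
      have e2: "Ext1_vanishes C (Dom C g) B" by (rule cp'(5)[OF g(2) B])
      obtain L where L: "L \<in> Mor C" "Dom C L = Dom C g" "Cod C L = Cod C e" "c \<odot> L = N"
        by (rule ext_lift[OF e2 short_exact_if_monic[OF m c] m'(2) N(1)]) (use N K m' in simp_all)
      let ?x = "(L \<odot> k) \<odot> g0"
      have x: "?x \<in> Mor C" "Dom C ?x = Dom C g0" "Cod C ?x = Cod C e" using L K S0 s0 by simp_all
      have cx: "c \<odot> ?x = c \<odot> e"
      proof -
        have "c \<odot> ?x = ((c \<odot> L) \<odot> k) \<odot> g0" using L(1-3) K S0 s0 Cc m' by (simp add: comp_assoc)
        then show ?thesis using L(4) N(4) n(4) by simp
      qed
      \<comment> \<open>\<open>L k g0\<close> and \<open>e\<close> agree after \<open>c\<close>, so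
        their difference factors through the kernel \<open>e f0\<close> of \<open>c\<close> by some
        \<open>w\<close>. Restricted along \<open>f0\<close> the first term vanishes and
        \<open>- e f0\<close> remains; cancelling \<open>e f0\<close> shows that \<open>- w\<close>
        is a retraction of \<open>f0\<close>.\<close>
      let ?y = "?x \<boxplus> neg C e"
      have y: "?y \<in> Mor C" "Dom C ?y = Dom C g0" "Cod C ?y = Cod C e" using x E e S0 by simp_all
      have "c \<odot> ?y = (c \<odot> ?x) \<boxplus> neg C (c \<odot> e)"
        using comp_add[of ?x "neg C e" c] x E e S0 Cc m' by (simp add: comp_neg)
      also have "\<dots> = Zero C (Dom C g0) (Cod C c)" unfolding cx using Cc m' E e S0 by simp
      finally have cy: "c \<odot> ?y = Zero C (Dom C ?y) (Cod C c)" unfolding y(2) .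
      obtain w where w: "w \<in> Mor C" "Dom C w = Dom C ?y" "Cod C w = Dom C (e \<odot> f0)" "(e \<odot> f0) \<odot> w = ?y"
        by (rule kernel_lift[OF kernel_of_cokernel[OF m c] y(1) _ cy]) (use y Cc m' in simp_all)
      have xf: "?x \<odot> f0 = Zero C B (Cod C e)" using L(1-3) K S0 s0 BO by (simp add: comp_assoc)
      have "(e \<odot> f0) \<odot> (w \<odot> f0) = ?y \<odot> f0" unfolding w(4)[symmetric]
        by (rule comp_assoc[symmetric]) (use w(1-3) m' y S0 in simp_all)
      also have "\<dots> = (?x \<odot> f0) \<boxplus> (neg C e \<odot> f0)" by (rule add_comp) (use x E e S0 in simp_all)
      also have "\<dots> = neg C (e \<odot> f0)" unfolding xf using E e S0 s0 m' by (simp add: neg_comp)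
      finally have "(e \<odot> f0) \<odot> (w \<odot> f0) = neg C (e \<odot> f0)" .
      then have "(e \<odot> f0) \<odot> neg C (w \<odot> f0) = neg C (neg C (e \<odot> f0))"
        using comp_neg[of "w \<odot> f0" "e \<odot> f0"] w(1-3) m' y S0 by simp
      then have "(e \<odot> f0) \<odot> (neg C w \<odot> f0) = (e \<odot> f0) \<odot> Id C B"
        using neg_comp[of f0 w] w(1-3) m' y S0 by simp
      then have "neg C w \<odot> f0 = Id C B"
        by (rule monicD[OF m]) (use w(1-3) m' y S0 s0 BO in simp_all)
      then obtain s where "s \<in> Mor C" "Dom C s = Cod C g0" "Cod C s = Cod C f0" "g0 \<odot> s = Id C (Cod C g0)"
        using section_if_retraction[OF s0(1), of "neg C w"] w(1-3) m' y S0 s0 by auto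
      then show "\<exists>s. s \<in> Mor C \<and> Dom C s = Dom C k \<and> Cod C s = Cod C f0 \<and> g0 \<odot> s = Id C (Dom C k)"
        using s0 by auto
    qed
  qed
qed

end

text \<open>Two kernels are isomorphic, hence retracts of each other, and right classes are closed
  under retracts. This permits a change of the chosen kernel.\<close>

lemma (in abelian_category) cotorsion_pair_kernel_right:
  assumes cp: "complete_cotorsion_pair C X Y" and k: "is_kernel C f k" "is_kernel C f k'" and "Dom C k' \<in> Y"
  shows "Dom C k \<in> Y"
proof -
  obtain h h' where h: "h \<in> Mor C" "Dom C h = Dom C k'" "Cod C h = Dom C k" "k \<odot> h = k'"
    "h' \<in> Mor C" "Dom C h' = Dom C k" "Cod C h' = Dom C k'" "k' \<odot> h' = k"
    "h \<odot> h' = Id C (Dom C k)" "h' \<odot> h = Id C (Dom C k')"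
    by (rule kernel_iso[OF k])
  then have "h' \<in> Hom C (Dom C k) (Dom C k')" "h \<in> Hom C (Dom C k') (Dom C k)" by (simp_all add: Hom_iff)
  then have "retract C (Dom C k) (Dom C k')" unfolding retract_def using h(9) by blast
  then show ?thesis by (rule cotorsion_pair_retract_right[OF cp _ assms(4)])
qed

section \<open>Coproducts, limits and colimits\<close>

lemma small_image: "\<lbrakk>inj_on f S; small U S\<rbrakk> \<Longrightarrow> small U (f ` S)"
  unfolding small_def by (meson eq_lesspoll_trans eqpoll_sym inj_on_image_eqpoll_self)

lemma coproduct_reindex:
  assumes "inj_on f S" and P: "is_coproduct C (f ` S) (X \<circ> inv_into S f) P u"
  shows "is_coproduct C S X P (u \<circ> f)"
  unfolding is_coproduct_def
proof (intro conjI ballI allI impI)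
  have fi: "inv_into S f (f i) = i" if "i \<in> S" for i using assms(1) that by simp
  show "P \<in> Ob C" using P by (simp add: is_coproduct_def)
  show "(u \<circ> f) i \<in> Hom C (X i) P" if i: "i \<in> S" for i
  proof -
    have "\<forall>j\<in>f ` S. u j \<in> Hom C ((X \<circ> inv_into S f) j) P" using P unfolding is_coproduct_def by (elim conjE)
    then have "u (f i) \<in> Hom C ((X \<circ> inv_into S f) (f i)) P" using i by blast
    then show ?thesis using fi[OF i] by simp
  qed
  fix T v assume T: "T \<in> Ob C" and v: "\<forall>i\<in>S. v i \<in> Hom C (X i) T"
  have "\<forall>j\<in>f ` S. (v \<circ> inv_into S f) j \<in> Hom C ((X \<circ> inv_into S f) j) T" using v fi by simp
  then have "\<exists>!h. h \<in> Hom C P T \<and> (\<forall>j\<in>f ` S. h \<odot>\<^bsub>C\<^esub> u j = (v \<circ> inv_into S f) j)"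
    by (rule P[unfolded is_coproduct_def, THEN conjunct2, THEN conjunct2, THEN bspec, OF T, THEN spec, THEN mp])
  moreover have "(\<forall>j\<in>f ` S. h \<odot>\<^bsub>C\<^esub> u j = (v \<circ> inv_into S f) j) \<longleftrightarrow> (\<forall>i\<in>S. h \<odot>\<^bsub>C\<^esub> (u \<circ> f) i = v i)" for h
    using fi by simp
  ultimately show "\<exists>!h. h \<in> Hom C P T \<and> (\<forall>i\<in>S. h \<odot>\<^bsub>C\<^esub> (u \<circ> f) i = v i)" by simp
qed

context category
begin

lemma ex_small_coproduct:
  fixes U :: "'u itself" and S :: "'u set"
  assumes co: "cocomplete U C" and S: "small U S" and X: "\<And>i. i \<in> S \<Longrightarrow> X i \<in> Ob C"
  shows "\<exists>P u. is_coproduct C S X P u"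
proof -
  \<comment> \<open>The discrete category on \<open>S\<close>, each element being its own identity.
    Composable morphisms are equal, so composition may return either of them.\<close>
  define J :: "('u, 'u) cat" where "J = \<lparr>Ob = S, Mor = S, Dom = id, Cod = id, Id = id, Comp = (\<lambda>g f. f)\<rparr>"
  define F where "F = \<lparr>FOb = X, FMor = (\<lambda>i. Id C (X i))\<rparr>"
  have HJ: "f \<in> Hom J A B \<longleftrightarrow> f \<in> S \<and> A = f \<and> B = f" for f A B by (auto simp: J_def Hom_def)
  have OJ: "Ob J = S" "Mor J = S" "Id J i = i" "Comp J g f = f" for i f g by (simp_all add: J_def)
  have J: "category J" by unfold_locales (auto simp: HJ, auto simp: J_def)
  have "cat_functor J C F"
    by (intro cat_functor.intro J category_axioms cat_functor_axioms.intro)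
      (auto simp: HJ F_def OJ X Id_in_Hom)
  moreover have "small_category J" using J S unfolding small_category_def small_def by (simp add: OJ)
  ultimately obtain L u where L: "is_colimit J C F L u" using co unfolding cocomplete_def by blast
  have cone: "is_cocone J C F T v \<longleftrightarrow> T \<in> Ob C \<and> (\<forall>i\<in>S. v i \<in> Hom C (X i) T)" for T v
    unfolding is_cocone_def J_def F_def by (auto simp: Hom_iff)
  have "is_coproduct C S X L u" unfolding is_coproduct_def
    using L[unfolded is_colimit_def cone OJ(1)] by blast
  then show ?thesis by blast
qed

text \<open>Cocompleteness speaks of index categories inside \<open>'u\<close>, whereas the arcs of
  a quiver have a type of their own. Smallness supplies an injection into \<open>'u\<close> along
  which the coproduct is reindexed.\<close>

lemma ex_coproduct:
  fixes U :: "'u itself" and S :: "'i set"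
  assumes co: "cocomplete U C" and S: "small U S" and X: "\<And>i. i \<in> S \<Longrightarrow> X i \<in> Ob C"
  shows "\<exists>P u. is_coproduct C S X P u"
proof -
  obtain f :: "'i \<Rightarrow> 'u" where f: "inj_on f S"
    using S unfolding small_def lesspoll_def lepoll_def by blast
  have X': "(X \<circ> inv_into S f) j \<in> Ob C" if "j \<in> f ` S" for j using f X that by auto
  obtain P u where "is_coproduct C (f ` S) (X \<circ> inv_into S f) P u"
    using ex_small_coproduct[OF co small_image[OF f S], of "X \<circ> inv_into S f", OF X'] by blast
  from coproduct_reindex[OF f this] show ?thesis by blast
qed

lemma limit_lift:
  assumes "is_limit J C F L p" "is_cone J C F T q"
  obtains h where "h \<in> Mor C" "Dom C h = T" "Cod C h = L" "\<And>j. j \<in> Ob J \<Longrightarrow> p j \<odot> h = q j"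
proof -
  obtain h where "h \<in> Hom C T L \<and> (\<forall>j\<in>Ob J. p j \<odot> h = q j)" using assms unfolding is_limit_def by blast
  then show thesis using that[of h] by (simp add: Hom_iff)
qed

lemma colimit_lift:
  assumes "is_colimit J C F L u" "is_cocone J C F T v"
  obtains h where "h \<in> Mor C" "Dom C h = L" "Cod C h = T" "\<And>j. j \<in> Ob J \<Longrightarrow> h \<odot> u j = v j"
proof -
  obtain h where "h \<in> Hom C L T \<and> (\<forall>j\<in>Ob J. h \<odot> u j = v j)" using assms unfolding is_colimit_def by blast
  then show thesis using that[of h] by (simp add: Hom_iff)
qed

lemma functor_mor:
  assumes "cat_functor J C F" "a \<in> Mor J"
  shows "FMor F a \<in> Mor C" "Dom C (FMor F a) = FOb F (Dom J a)" "Cod C (FMor F a) = FOb F (Cod J a)"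
    "Dom J a \<in> Ob J" "Cod J a \<in> Ob J"
proof -
  interpret F: cat_functor J C F by fact
  show "FMor F a \<in> Mor C" "Dom C (FMor F a) = FOb F (Dom J a)" "Cod C (FMor F a) = FOb F (Cod J a)"
    using F.FMor_in_Hom[of a "Dom J a" "Cod J a"] assms(2) by (simp_all add: Hom_iff)
  show "Dom J a \<in> Ob J" "Cod J a \<in> Ob J" using assms(2) by simp_all
qed

lemma cone_mor:
  assumes "is_cone J C F L p" "j \<in> Ob J"
  shows "p j \<in> Mor C" "Dom C (p j) = L" "Cod C (p j) = FOb F j"
  using assms unfolding is_cone_def Hom_def by auto

lemma cocone_mor:
  assumes "is_cocone J C F L p" "j \<in> Ob J"
  shows "p j \<in> Mor C" "Cod C (p j) = L" "Dom C (p j) = FOb F j"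
  using assms unfolding is_cocone_def Hom_def by auto

lemma limit_ext:
  assumes F: "cat_functor J C F" and L: "is_limit J C F L p"
    and x: "x \<in> Mor C" "y \<in> Mor C" "Cod C x = L" "Cod C y = L" "Dom C y = Dom C x"
    and e: "\<And>j. j \<in> Ob J \<Longrightarrow> p j \<odot> x = p j \<odot> y"
  shows "x = y"
proof -
  have c: "is_cone J C F L p" using L by (simp add: is_limit_def)
  note P = cone_mor[OF c] and M = functor_mor[OF F]
  have "is_cone J C F (Dom C x) (\<lambda>j. p j \<odot> x)" unfolding is_cone_def
  proof (intro conjI ballI)
    show "p j \<odot> x \<in> Hom C (Dom C x) (FOb F j)" if "j \<in> Ob J" for j using P[OF that] x by (simp add: Hom_iff)
    fix a assume a: "a \<in> Mor J"
    have "FMor F a \<odot> (p (Dom J a) \<odot> x) = (FMor F a \<odot> p (Dom J a)) \<odot> x"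
      by (rule comp_assoc[symmetric]) (use x M[OF a] P[OF M(4)[OF a]] in simp_all)
    then show "FMor F a \<odot> (p (Dom J a) \<odot> x) = p (Cod J a) \<odot> x" using c a by (simp add: is_cone_def)
  qed (use x in simp)
  then have "\<exists>!h. h \<in> Hom C (Dom C x) L \<and> (\<forall>j\<in>Ob J. p j \<odot> h = p j \<odot> x)" using L unfolding is_limit_def by blast
  moreover have "x \<in> Hom C (Dom C x) L \<and> (\<forall>j\<in>Ob J. p j \<odot> x = p j \<odot> x)" "y \<in> Hom C (Dom C x) L \<and> (\<forall>j\<in>Ob J. p j \<odot> y = p j \<odot> x)"
    using x e by (simp_all add: Hom_iff)
  ultimately show ?thesis by (elim ex1E) blast
qed

lemma colimit_ext:
  assumes F: "cat_functor J C F" and L: "is_colimit J C F L p"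
    and x: "x \<in> Mor C" "y \<in> Mor C" "Dom C x = L" "Dom C y = L" "Cod C y = Cod C x"
    and e: "\<And>j. j \<in> Ob J \<Longrightarrow> x \<odot> p j = y \<odot> p j"
  shows "x = y"
proof -
  have c: "is_cocone J C F L p" using L by (simp add: is_colimit_def)
  note P = cocone_mor[OF c] and M = functor_mor[OF F]
  have "is_cocone J C F (Cod C x) (\<lambda>j. x \<odot> p j)" unfolding is_cocone_def
  proof (intro conjI ballI)
    show "x \<odot> p j \<in> Hom C (FOb F j) (Cod C x)" if "j \<in> Ob J" for j using P[OF that] x by (simp add: Hom_iff)
    fix a assume a: "a \<in> Mor J"
    have "(x \<odot> p (Cod J a)) \<odot> FMor F a = x \<odot> (p (Cod J a) \<odot> FMor F a)"
      by (rule comp_assoc) (use x M[OF a] P[OF M(5)[OF a]] in simp_all)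
    then show "(x \<odot> p (Cod J a)) \<odot> FMor F a = x \<odot> p (Dom J a)" using c a by (simp add: is_cocone_def)
  qed (use x in simp)
  then have "\<exists>!h. h \<in> Hom C L (Cod C x) \<and> (\<forall>j\<in>Ob J. h \<odot> p j = x \<odot> p j)" using L unfolding is_colimit_def by blast
  moreover have "x \<in> Hom C L (Cod C x) \<and> (\<forall>j\<in>Ob J. x \<odot> p j = x \<odot> p j)" "y \<in> Hom C L (Cod C x) \<and> (\<forall>j\<in>Ob J. y \<odot> p j = x \<odot> p j)"
    using x e by (simp_all add: Hom_iff)
  ultimately show ?thesis by (elim ex1E) blast
qed

end

text \<open>The colimit is the cokernel of the map between coproducts that compares, for each morphism \<open>a\<close>
  of the index category, the inclusion of the source with \<open>F a\<close> followed by that of the target.\<close>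

lemma (in preadditive_category) colimit_if_cokernel:
  assumes F: "cat_functor J C F"
    and A: "is_coproduct C (Mor J) (\<lambda>a. FOb F (Dom J a)) A u" and B: "is_coproduct C (Ob J) (FOb F) B v"
    and d: "d \<in> Mor C" "Dom C d = A" "Cod C d = B"
      "\<And>a. a \<in> Mor J \<Longrightarrow> d \<odot> u a = (v (Cod J a) \<odot> FMor F a) \<boxplus> neg C (v (Dom J a))"
    and c: "is_cokernel C d c"
  shows "is_colimit J C F (Cod C c) (\<lambda>j. c \<odot> v j)"
proof -
  note M = functor_mor[OF F] and IA = coproduct_inj[OF A] and IB = coproduct_inj[OF B] and Cc = cokernelD[OF c]
  \<comment> \<open>A map \<open>x\<close> out of the coproduct of all objects is compatible with
    the morphism \<open>a\<close> precisely if \<open>x d\<close> vanishes on the summand of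
    \<open>a\<close>. Hence cocones correspond to maps killing \<open>d\<close>.\<close>
  have cd: "x \<odot> (v (Cod J a) \<odot> FMor F a) = x \<odot> v (Dom J a) \<longleftrightarrow> (x \<odot> d) \<odot> u a = Zero C (FOb F (Dom J a)) (Cod C x)"
    if x: "x \<in> Mor C" "Dom C x = B" and a: "a \<in> Mor J" for x a
  proof -
    note t = M[OF a] IA[OF a] IB[OF M(4)[OF a]] IB[OF M(5)[OF a]]
    have "(x \<odot> d) \<odot> u a = x \<odot> (d \<odot> u a)" by (rule comp_assoc) (use x d t in simp_all)
    also have "\<dots> = (x \<odot> (v (Cod J a) \<odot> FMor F a)) \<boxplus> neg C (x \<odot> v (Dom J a))"
      unfolding d(4)[OF a] using x t by (simp add: comp_add comp_neg)
    finally have e: "(x \<odot> d) \<odot> u a = (x \<odot> (v (Cod J a) \<odot> FMor F a)) \<boxplus> neg C (x \<odot> v (Dom J a))" .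
    show ?thesis
    proof
      assume "x \<odot> (v (Cod J a) \<odot> FMor F a) = x \<odot> v (Dom J a)"
      then show "(x \<odot> d) \<odot> u a = Zero C (FOb F (Dom J a)) (Cod C x)" unfolding e using x t by simp
    next
      assume z: "(x \<odot> d) \<odot> u a = Zero C (FOb F (Dom J a)) (Cod C x)"
      show "x \<odot> (v (Cod J a) \<odot> FMor F a) = x \<odot> v (Dom J a)"
        by (rule eq_if_diff_zero) (use z[unfolded e] x t in simp_all)
    qed
  qed
  have cB: "Dom C c = B" using Cc d by simp
  have cocone: "is_cocone J C F (Cod C c) (\<lambda>j. c \<odot> v j)" unfolding is_cocone_def
  proof (intro conjI ballI)
    show "c \<odot> v j \<in> Hom C (FOb F j) (Cod C c)" if "j \<in> Ob J" for j using IB[OF that] Cc cB by (simp add: Hom_iff)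
    fix a assume a: "a \<in> Mor J"
    have "(c \<odot> d) \<odot> u a = Zero C (FOb F (Dom J a)) (Cod C c)" unfolding Cc(4) using IA[OF a] d Cc(2) Dom_Ob[OF d(1)] by simp
    then have "c \<odot> (v (Cod J a) \<odot> FMor F a) = c \<odot> v (Dom J a)" using cd[OF Cc(2) cB a] by simp
    moreover have "(c \<odot> v (Cod J a)) \<odot> FMor F a = c \<odot> (v (Cod J a) \<odot> FMor F a)"
      by (rule comp_assoc) (use Cc(2) cB M[OF a] IB[OF M(5)[OF a]] in simp_all)
    ultimately show "(c \<odot> v (Cod J a)) \<odot> FMor F a = c \<odot> v (Dom J a)" by simp
  qed (use Cc in simp)
  show ?thesis unfolding is_colimit_def
  proof (intro conjI allI impI cocone)
    fix T w assume w: "is_cocone J C F T w"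
    have T: "T \<in> Ob C" using w by (simp add: is_cocone_def)
    note W = cocone_mor[OF w]
    obtain x where x: "x \<in> Mor C" "Dom C x = B" "Cod C x = T" "\<And>j. j \<in> Ob J \<Longrightarrow> x \<odot> v j = w j"
      by (rule coproduct_lift[OF B T, of w]) (use W in \<open>simp_all add: Hom_iff\<close>)
    have "x \<odot> d = Zero C A T"
    proof (rule coproduct_ext[OF A])
      fix a assume a: "a \<in> Mor J"
      have "x \<odot> (v (Cod J a) \<odot> FMor F a) = (x \<odot> v (Cod J a)) \<odot> FMor F a"
        by (rule comp_assoc[symmetric]) (use x(1-3) M[OF a] IB[OF M(5)[OF a]] in simp_all)
      also have "\<dots> = x \<odot> v (Dom J a)" using x(4) M(4,5)[OF a] w a by (simp add: is_cocone_def)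
      finally have "(x \<odot> d) \<odot> u a = Zero C (FOb F (Dom J a)) T" using cd[OF x(1,2) a] x(3) by simp
      then show "(x \<odot> d) \<odot> u a = Zero C A T \<odot> u a" using IA[OF a] T coproduct_ob[OF A] by simp
    qed (use x(1-3) d T coproduct_ob[OF A] in simp_all)
    then have xd: "x \<odot> d = Zero C (Dom C d) (Cod C x)" using d x by simp
    obtain h where h: "h \<in> Mor C" "Cod C h = Cod C x" "Dom C h = Cod C c" "h \<odot> c = x"
      by (rule cokernel_lift[OF c x(1) _ xd]) (use x d in simp)
    have hv: "h \<odot> (c \<odot> v j) = w j" if j: "j \<in> Ob J" for j
    proof -
      have "h \<odot> (c \<odot> v j) = (h \<odot> c) \<odot> v j" by (rule comp_assoc[symmetric]) (use h Cc(2) cB IB[OF j] in simp_all)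
      then show ?thesis using h x(4)[OF j] by simp
    qed
    show "\<exists>!h. h \<in> Hom C (Cod C c) T \<and> (\<forall>j\<in>Ob J. h \<odot> (c \<odot> v j) = w j)"
    proof (rule ex1I[of _ h])
      show "h \<in> Hom C (Cod C c) T \<and> (\<forall>j\<in>Ob J. h \<odot> (c \<odot> v j) = w j)" using h x hv by (simp add: Hom_iff)
      fix g assume "g \<in> Hom C (Cod C c) T \<and> (\<forall>j\<in>Ob J. g \<odot> (c \<odot> v j) = w j)"
      then have g: "g \<in> Mor C" "Dom C g = Cod C c" "Cod C g = T" "\<And>j. j \<in> Ob J \<Longrightarrow> g \<odot> (c \<odot> v j) = w j"
        by (simp_all add: Hom_iff)
      show "g = h"
      proof (rule epicD[OF cokernel_epic[OF c]])
        show "g \<odot> c = h \<odot> c"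
        proof (rule coproduct_ext[OF B])
          fix j assume j: "j \<in> Ob J"
          have "(g \<odot> c) \<odot> v j = g \<odot> (c \<odot> v j)" by (rule comp_assoc) (use g(1-3) Cc(2) cB IB[OF j] in simp_all)
          then show "(g \<odot> c) \<odot> v j = (h \<odot> c) \<odot> v j" using g(4)[OF j] h(4) x(4)[OF j] by simp
        qed (use g(1-3) h x(1-3) Cc(2) cB in simp_all)
      qed (use g(1-3) h x(1-3) in simp_all)
    qed
  qed
qed

text \<open>The presentation of the colimit is kept, not only the colimit: a functor that preserves
  these coproducts, sums and cokernels carries the presentation, and with it the colimit, to another
  category.\<close>

lemma ex_colimit_data:
  fixes U :: "'u itself" and J :: "('u, 'u) cat"
  assumes "preadditive_category C" "abelian_category C"
    and co: "cocomplete U C" and J: "small_category J" and F: "cat_functor J C F"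
  obtains A u B v d c where
    "is_coproduct C (Mor J) (\<lambda>a. FOb F (Dom J a)) A u" "is_coproduct C (Ob J) (FOb F) B v"
    "d \<in> Mor C" "Dom C d = A" "Cod C d = B"
    "\<And>a. a \<in> Mor J \<Longrightarrow> d \<odot>\<^bsub>C\<^esub> u a = (v (Cod J a) \<odot>\<^bsub>C\<^esub> FMor F a) \<boxplus>\<^bsub>C\<^esub> neg C (v (Dom J a))"
    "is_cokernel C d c"
proof -
  interpret C: abelian_category C by fact
  interpret F: cat_functor J C F by fact
  note M = C.functor_mor[OF F]
  have sm: "small U (Ob J)" "small U (Mor J)" using J unfolding small_category_def small_def by simp_all
  obtain A u where A: "is_coproduct C (Mor J) (\<lambda>a. FOb F (Dom J a)) A u"
    using C.ex_small_coproduct[OF co sm(2), of "\<lambda>a. FOb F (Dom J a)"] M(4) F.FOb_in_Ob by auto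
  obtain B v where B: "is_coproduct C (Ob J) (FOb F) B v"
    using C.ex_small_coproduct[OF co sm(1), of "FOb F"] F.FOb_in_Ob by auto
  note IB = C.coproduct_inj[OF B]
  have t: "(v (Cod J a) \<odot>\<^bsub>C\<^esub> FMor F a) \<boxplus>\<^bsub>C\<^esub> neg C (v (Dom J a)) \<in> Hom C (FOb F (Dom J a)) B" if a: "a \<in> Mor J" for a
    using M[OF a] IB[OF M(4)[OF a]] IB[OF M(5)[OF a]] by (simp add: Hom_iff)
  obtain d where d: "d \<in> Mor C" "Dom C d = A" "Cod C d = B"
    "\<And>a. a \<in> Mor J \<Longrightarrow> d \<odot>\<^bsub>C\<^esub> u a = (v (Cod J a) \<odot>\<^bsub>C\<^esub> FMor F a) \<boxplus>\<^bsub>C\<^esub> neg C (v (Dom J a))"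
    by (rule C.coproduct_lift[OF A C.coproduct_ob[OF B] t]) (assumption, rule that)
  obtain c where c: "is_cokernel C d c" using C.ex_cokernel[OF d(1)] by blast
  show thesis by (rule that[OF A B d(1-3) _ c]) (rule d(4))
qed

section \<open>Representations from data on the arrows\<close>

lemma (in wf_digraph) Ob_path [simp]: "Ob (path_category G) = verts G"
  and Mor_path: "\<alpha> \<in> Mor (path_category G) \<longleftrightarrow> awalk (fst \<alpha>) (fst (snd \<alpha>)) (snd (snd \<alpha>))"
  and Dom_path: "Dom (path_category G) \<alpha> = fst \<alpha>"
  and Cod_path: "Cod (path_category G) \<alpha> = snd (snd \<alpha>)"
  and Id_path: "Id (path_category G) i = (i, [], i)"
  and Comp_path: "Comp (path_category G) \<beta> \<alpha> = (fst \<alpha>, fst (snd \<alpha>) @ fst (snd \<beta>), snd (snd \<beta>))"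
  by (simp_all add: path_category_def split_beta)

locale quiver_diagram = wf_digraph G + cat_diagram "path_category G" D
  for G :: "('v, 'a) pre_digraph" and D :: "('v, ('v, 'a) path, 'o, 'm) diagram" +
  assumes abelian_Cat: "i \<in> verts G \<Longrightarrow> abelian_category (Cat D i)"
    and exact: "exact_diagram (path_category G) D"
begin

abbreviation PC where "PC \<equiv> path_category G"

abbreviation arr :: "'a \<Rightarrow> ('v, 'a) path" where "arr a \<equiv> arc_path G a"

lemma arr_path [simp]: "a \<in> arcs G \<Longrightarrow> arr a \<in> Mor PC" "Dom PC (arr a) = tail G a" "Cod PC (arr a) = head G a"
  by (simp_all add: Mor_path Dom_path Cod_path arc_path_def arc_implies_awalk)

lemma Dom_PC_verts [simp]: "\<alpha> \<in> Mor PC \<Longrightarrow> Dom PC \<alpha> \<in> verts G"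
  and Cod_PC_verts [simp]: "\<alpha> \<in> Mor PC \<Longrightarrow> Cod PC \<alpha> \<in> verts G"
  using Dom_Ob[of \<alpha>] Cod_Ob[of \<alpha>] by simp_all

text \<open>Paths are taken apart at their last arc, because the functor of that arc is applied to
  the map of everything before it. This agrees with the recursion of
  \<open>path_map\<close>.\<close>

lemma path_induct [consumes 1, case_names Id Step]:
  assumes "\<alpha> \<in> Mor PC"
    and "\<And>i. i \<in> verts G \<Longrightarrow> P (Id PC i)"
    and "\<And>\<alpha> a. \<lbrakk>\<alpha> \<in> Mor PC; a \<in> arcs G; Cod PC \<alpha> = tail G a; P \<alpha>\<rbrakk> \<Longrightarrow> P (Comp PC (arr a) \<alpha>)"
  shows "P \<alpha>"
proof -
  obtain i p j where \<alpha>: "\<alpha> = (i, p, j)" by (cases \<alpha>)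
  have "awalk i p j \<Longrightarrow> P (i, p, j)"
  proof (induction p arbitrary: j rule: rev_induct)
    case Nil
    then show ?case by (auto simp: awalk_Nil_iff simp flip: Id_path intro: assms(2))
  next
    case (snoc a p)
    then have w: "awalk i p (tail G a)" "a \<in> arcs G" "head G a = j"
      by (auto simp: awalk_Cons_iff awalk_Nil_iff)
    have "P (Comp PC (arr a) (i, p, tail G a))"
      by (rule assms(3)) (use w snoc.IH in \<open>simp_all add: Mor_path Cod_path\<close>)
    then show ?case using w by (simp add: Comp_path arc_path_def)
  qed
  then show ?thesis using assms(1) \<alpha> by (simp add: Mor_path)
qed

lemmas comp_PC_simps [simp] = comp_mor Dom_comp Cod_comp

lemma cat_Cat: "i \<in> verts G \<Longrightarrow> category (Cat D i)"
  using Cat_category by simp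

lemma preadd_Cat: "i \<in> verts G \<Longrightarrow> preadditive_category (Cat D i)"
  using abelian_Cat by (simp add: abelian_category_def)

text \<open>The typing laws of all categories \<open>Cat D i\<close> at once, conditional on
  \<open>i \<in> verts G\<close>, so that morphisms at several vertices can be typed by the
  simplifier without an interpretation for each vertex.\<close>

lemmas C_simps [simp] =
  category.Id_mor[OF cat_Cat] category.Dom_Id[OF cat_Cat] category.Cod_Id[OF cat_Cat]
  category.comp_mor[OF cat_Cat] category.Dom_comp[OF cat_Cat] category.Cod_comp[OF cat_Cat]
  category.comp_Id[OF cat_Cat] category.Id_comp[OF cat_Cat]
  category.Dom_Ob[OF cat_Cat] category.Cod_Ob[OF cat_Cat]
  preadditive_category.zero_mor[OF preadd_Cat] preadditive_category.Dom_zero[OF preadd_Cat]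
  preadditive_category.Cod_zero[OF preadd_Cat]
  preadditive_category.add_mor[OF preadd_Cat] preadditive_category.Dom_add[OF preadd_Cat]
  preadditive_category.Cod_add[OF preadd_Cat]
  preadditive_category.add_zero[OF preadd_Cat] preadditive_category.zero_add[OF preadd_Cat]
  preadditive_category.comp_zero[OF preadd_Cat] preadditive_category.zero_comp[OF preadd_Cat]

lemmas C_assoc = category.comp_assoc[OF cat_Cat]

lemma path_functor: "\<alpha> \<in> Mor PC \<Longrightarrow> cat_functor (Cat D (Dom PC \<alpha>)) (Cat D (Cod PC \<alpha>)) (Fun D \<alpha>)"
  using Fun_functor[of \<alpha> "Dom PC \<alpha>" "Cod PC \<alpha>"] by (simp add: Hom_iff)

lemma Fun_Ob [simp]: "\<lbrakk>\<alpha> \<in> Mor PC; Cod PC \<alpha> = j; X \<in> Ob (Cat D (Dom PC \<alpha>))\<rbrakk> \<Longrightarrow> FOb (Fun D \<alpha>) X \<in> Ob (Cat D j)"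
  using cat_functor.FOb_in_Ob[OF path_functor] by blast

lemma Fun_mor [simp]:
  assumes "\<alpha> \<in> Mor PC" "Cod PC \<alpha> = j" "f \<in> Mor (Cat D (Dom PC \<alpha>))"
  shows "FMor (Fun D \<alpha>) f \<in> Mor (Cat D j)"
    "Dom (Cat D j) (FMor (Fun D \<alpha>) f) = FOb (Fun D \<alpha>) (Dom (Cat D (Dom PC \<alpha>)) f)"
    "Cod (Cat D j) (FMor (Fun D \<alpha>) f) = FOb (Fun D \<alpha>) (Cod (Cat D (Dom PC \<alpha>)) f)"
  using cat_functor.FMor_in_Hom[OF path_functor, of \<alpha> f "Dom (Cat D (Dom PC \<alpha>)) f" "Cod (Cat D (Dom PC \<alpha>)) f"] assms
  by (auto simp: Hom_iff)

lemma Fun_Id: "\<lbrakk>\<alpha> \<in> Mor PC; X \<in> Ob (Cat D (Dom PC \<alpha>))\<rbrakk> \<Longrightarrow>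
    FMor (Fun D \<alpha>) (Id (Cat D (Dom PC \<alpha>)) X) = Id (Cat D (Cod PC \<alpha>)) (FOb (Fun D \<alpha>) X)"
  using cat_functor.FMor_Id[OF path_functor] by blast

lemma Fun_comp:
  assumes "\<alpha> \<in> Mor PC" "Dom PC \<alpha> = i" "Cod PC \<alpha> = j"
    "f \<in> Mor (Cat D i)" "g \<in> Mor (Cat D i)" "Dom (Cat D i) g = Cod (Cat D i) f"
  shows "FMor (Fun D \<alpha>) (g \<odot>\<^bsub>Cat D i\<^esub> f) = FMor (Fun D \<alpha>) g \<odot>\<^bsub>Cat D j\<^esub> FMor (Fun D \<alpha>) f"
  using cat_functor.FMor_Comp[OF path_functor[OF assms(1)], of f "Dom (Cat D i) f" "Cod (Cat D i) f" g "Cod (Cat D i) g"] assms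
  by (auto simp: Hom_iff)

definition inv_of where "inv_of C f = (SOME g. inverse_mors C f g)"

lemma inv_of: "iso_mor C f \<Longrightarrow> inverse_mors C f (inv_of C f)"
  unfolding inv_of_def iso_mor_def by (rule someI_ex)

lemma Eta_props:
  assumes "i \<in> verts G" "X \<in> Ob (Cat D i)"
  shows "Eta D i X \<in> Mor (Cat D i)" "Dom (Cat D i) (Eta D i X) = X"
    "Cod (Cat D i) (Eta D i X) = FOb (Fun D (Id PC i)) X" "iso_mor (Cat D i) (Eta D i X)"
  using Eta_nat_iso[of i] assms by (auto simp: nat_iso_def nat_trans_def id_func_def Hom_iff)

lemma Eta_natural:
  assumes "i \<in> verts G" "f \<in> Mor (Cat D i)"
  shows "Eta D i (Cod (Cat D i) f) \<odot>\<^bsub>Cat D i\<^esub> f = FMor (Fun D (Id PC i)) f \<odot>\<^bsub>Cat D i\<^esub> Eta D i (Dom (Cat D i) f)"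
  using Eta_nat_iso[of i] assms by (simp add: nat_iso_def nat_trans_def id_func_def)

lemma Tau_props:
  assumes "\<alpha> \<in> Mor PC" "\<beta> \<in> Mor PC" "Dom PC \<beta> = Cod PC \<alpha>" "X \<in> Ob (Cat D (Dom PC \<alpha>))" "k = Cod PC \<beta>"
  shows "Tau D \<beta> \<alpha> X \<in> Mor (Cat D k)"
    "Dom (Cat D k) (Tau D \<beta> \<alpha> X) = FOb (Fun D \<beta>) (FOb (Fun D \<alpha>) X)"
    "Cod (Cat D k) (Tau D \<beta> \<alpha> X) = FOb (Fun D (Comp PC \<beta> \<alpha>)) X"
    "iso_mor (Cat D k) (Tau D \<beta> \<alpha> X)"
  using Tau_nat_iso[of \<alpha> "Dom PC \<alpha>" "Cod PC \<alpha>" \<beta> "Cod PC \<beta>"] assms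
  by (auto simp: nat_iso_def nat_trans_def comp_func_def Hom_iff)

lemma Tau_natural:
  assumes "\<alpha> \<in> Mor PC" "\<beta> \<in> Mor PC" "Dom PC \<beta> = Cod PC \<alpha>" "f \<in> Mor (Cat D (Dom PC \<alpha>))" "k = Cod PC \<beta>"
  shows "Tau D \<beta> \<alpha> (Cod (Cat D (Dom PC \<alpha>)) f) \<odot>\<^bsub>Cat D k\<^esub> FMor (Fun D \<beta>) (FMor (Fun D \<alpha>) f) =
    FMor (Fun D (Comp PC \<beta> \<alpha>)) f \<odot>\<^bsub>Cat D k\<^esub> Tau D \<beta> \<alpha> (Dom (Cat D (Dom PC \<alpha>)) f)"
  using Tau_nat_iso[of \<alpha> "Dom PC \<alpha>" "Cod PC \<alpha>" \<beta> "Cod PC \<beta>"] assms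
  by (simp add: nat_iso_def nat_trans_def comp_func_def Hom_iff)

lemma inverse_morsD:
  assumes "inverse_mors C f g"
  shows "f \<in> Mor C" "g \<in> Mor C" "Dom C g = Cod C f" "Cod C g = Dom C f" "g \<odot>\<^bsub>C\<^esub> f = Id C (Dom C f)" "f \<odot>\<^bsub>C\<^esub> g = Id C (Cod C f)"
  using assms by (simp_all add: inverse_mors_def Hom_iff)

text \<open>The list of arcs is traversed backwards: its head is the last arc of the path.\<close>

primrec path_map :: "('v \<Rightarrow> 'o) \<Rightarrow> ('a \<Rightarrow> 'm) \<Rightarrow> 'v \<Rightarrow> 'a list \<Rightarrow> 'm" where
  "path_map X m i [] = inv_of (Cat D i) (Eta D i (X i))"
| "path_map X m i (a # p) = m a \<odot>\<^bsub>Cat D (head G a)\<^esub> (FMor (Fun D (arr a)) (path_map X m i p) \<odot>\<^bsub>Cat D (head G a)\<^esub>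
     inv_of (Cat D (head G a)) (Tau D (arr a) (i, rev p, tail G a) (X i)))"

text \<open>The values are forced by the axioms: trivial paths carry the inverse of
  \<open>\<eta>\<close>, and the law for the composite of \<open>\<alpha>\<close> with an arc
  \<open>a\<close>, solved for its value, gives \<open>m_a\<close>, after \<open>D_a\<close> of the
  value at \<open>\<alpha>\<close>, after the inverse of \<open>\<tau>\<close>.\<close>

definition rep_mor :: "('v \<Rightarrow> 'o) \<Rightarrow> ('a \<Rightarrow> 'm) \<Rightarrow> ('v, 'a) path \<Rightarrow> 'm" where
  "rep_mor X m \<alpha> = path_map X m (fst \<alpha>) (rev (fst (snd \<alpha>)))"

context
  fixes X :: "'v \<Rightarrow> 'o" and m :: "'a \<Rightarrow> 'm"
  assumes X: "\<And>i. i \<in> verts G \<Longrightarrow> X i \<in> Ob (Cat D i)"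
    and m: "\<And>a. a \<in> arcs G \<Longrightarrow> m a \<in> Hom (Cat D (head G a)) (FOb (Fun D (arr a)) (X (tail G a))) (X (head G a))"
begin

lemma rep_mor_Id: "i \<in> verts G \<Longrightarrow> inverse_mors (Cat D i) (Eta D i (X i)) (rep_mor X m (Id PC i))"
  unfolding rep_mor_def Id_path using inv_of[OF Eta_props(4)] X by simp

lemma rep_mor_step:
  assumes "\<alpha> \<in> Mor PC" "a \<in> arcs G" "Cod PC \<alpha> = tail G a"
  shows "rep_mor X m (Comp PC (arr a) \<alpha>) = m a \<odot>\<^bsub>Cat D (head G a)\<^esub> (FMor (Fun D (arr a)) (rep_mor X m \<alpha>) \<odot>\<^bsub>Cat D (head G a)\<^esub>
     inv_of (Cat D (head G a)) (Tau D (arr a) \<alpha> (X (Dom PC \<alpha>))))"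
proof -
  have "\<alpha> = (fst \<alpha>, fst (snd \<alpha>), tail G a)" using assms by (simp add: Cod_path prod_eq_iff)
  then show ?thesis unfolding rep_mor_def by (cases \<alpha>) (simp add: Comp_path arc_path_def Dom_path)
qed

lemma m_props [simp]:
  assumes "a \<in> arcs G" "head G a = j"
  shows "m a \<in> Mor (Cat D j)" "Dom (Cat D j) (m a) = FOb (Fun D (arr a)) (X (tail G a))" "Cod (Cat D j) (m a) = X j"
  using m[of a] assms by (simp_all add: Hom_iff)

lemma inv_Tau:
  assumes "\<alpha> \<in> Mor PC" "\<beta> \<in> Mor PC" "Dom PC \<beta> = Cod PC \<alpha>" "Y \<in> Ob (Cat D (Dom PC \<alpha>))" "k = Cod PC \<beta>"
  defines "t \<equiv> inv_of (Cat D k) (Tau D \<beta> \<alpha> Y)"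
  shows "t \<in> Mor (Cat D k)" "Cod (Cat D k) t = FOb (Fun D \<beta>) (FOb (Fun D \<alpha>) Y)"
    "Dom (Cat D k) t = FOb (Fun D (Comp PC \<beta> \<alpha>)) Y"
    "t \<odot>\<^bsub>Cat D k\<^esub> Tau D \<beta> \<alpha> Y = Id (Cat D k) (FOb (Fun D \<beta>) (FOb (Fun D \<alpha>) Y))"
    "Tau D \<beta> \<alpha> Y \<odot>\<^bsub>Cat D k\<^esub> t = Id (Cat D k) (FOb (Fun D (Comp PC \<beta> \<alpha>)) Y)"
  using inverse_morsD[OF inv_of[OF Tau_props(4)[OF assms(1-5)]]] Tau_props[OF assms(1-5)]
  unfolding t_def by simp_all

lemma rep_mor_type:
  assumes "\<alpha> \<in> Mor PC"
  shows "rep_mor X m \<alpha> \<in> Hom (Cat D (Cod PC \<alpha>)) (FOb (Fun D \<alpha>) (X (Dom PC \<alpha>))) (X (Cod PC \<alpha>))"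
  using assms
proof (induction rule: path_induct)
  case (Id i)
  then show ?case using inverse_morsD[OF rep_mor_Id[OF Id]] Eta_props[OF Id X[OF Id]] by (simp add: Hom_iff)
next
  case (Step \<alpha> a)
  have t: "Dom PC (arr a) = Cod PC \<alpha>" "head G a = Cod PC (arr a)" "X (Dom PC \<alpha>) \<in> Ob (Cat D (Dom PC \<alpha>))" using Step X by simp_all
  show ?case
    using Step inv_Tau[OF Step(1) _ t(1) t(3) t(2)] by (simp add: rep_mor_step Hom_iff)
qed

lemma rep_mor_props [simp]:
  assumes "\<alpha> \<in> Mor PC" "Cod PC \<alpha> = j"
  shows "rep_mor X m \<alpha> \<in> Mor (Cat D j)" "Dom (Cat D j) (rep_mor X m \<alpha>) = FOb (Fun D \<alpha>) (X (Dom PC \<alpha>))"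
    "Cod (Cat D j) (rep_mor X m \<alpha>) = X j"
  using rep_mor_type[of \<alpha>] assms by (simp_all add: Hom_iff)

text \<open>The definition enforces the law only when the second path is a single arc. The general
  case follows by induction on \<open>\<beta>\<close>, where the coherence conditions on
  \<open>\<tau>\<close> and \<open>\<eta>\<close> compare the two ways of composing.\<close>

lemma rep_mor_comp:
  assumes "\<alpha> \<in> Mor PC" "\<beta> \<in> Mor PC" "Dom PC \<beta> = Cod PC \<alpha>"
  shows "rep_mor X m (Comp PC \<beta> \<alpha>) \<odot>\<^bsub>Cat D (Cod PC \<beta>)\<^esub> Tau D \<beta> \<alpha> (X (Dom PC \<alpha>)) =
    rep_mor X m \<beta> \<odot>\<^bsub>Cat D (Cod PC \<beta>)\<^esub> FMor (Fun D \<beta>) (rep_mor X m \<alpha>)"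
  using assms(2,3)
proof (induction rule: path_induct)
  case (Id i)
  let ?C = "Cat D i" and ?f = "rep_mor X m \<alpha>" and ?Y = "FOb (Fun D \<alpha>) (X (Dom PC \<alpha>))"
  have i: "Cod PC \<alpha> = i" "i \<in> verts G" using Id assms(1) by simp_all
  have X\<alpha>: "X (Dom PC \<alpha>) \<in> Ob (Cat D (Dom PC \<alpha>))" using X assms(1) by simp
  have Y: "?Y \<in> Ob ?C" using X\<alpha> assms(1) i by simp
  note E = Eta_props[OF i(2) Y] Eta_props[OF i(2) X[OF i(2)]]
  note J = inverse_morsD[OF rep_mor_Id[OF i(2)]]
  have c: "Comp PC (cat.Id PC i) \<alpha> = \<alpha>" using assms(1) i by simp
  have i': "Id PC i \<in> Mor PC" "Cod PC (Id PC i) = i" "Dom PC (Id PC i) = i" "Dom PC (Id PC i) = Cod PC \<alpha>" using i by simp_all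
  note T = Tau_props[OF assms(1) i'(1,4) X\<alpha> i'(2)[symmetric], unfolded c]
  have \<alpha>: "\<alpha> \<in> Hom PC (Dom PC \<alpha>) i" using assms(1) i by (simp add: Hom_iff)
  have TE: "Tau D (Id PC i) \<alpha> (X (Dom PC \<alpha>)) \<odot>\<^bsub>?C\<^esub> Eta D i ?Y = Id ?C ?Y"
    by (rule Tau_Id_left[OF \<alpha> X\<alpha>])
  have nat: "Eta D i (X i) \<odot>\<^bsub>?C\<^esub> ?f = FMor (Fun D (Id PC i)) ?f \<odot>\<^bsub>?C\<^esub> Eta D i ?Y"
    using Eta_natural[OF i(2), of ?f] assms(1) i by simp
  have f: "?f \<in> Mor ?C" "Dom ?C ?f = ?Y" "Cod ?C ?f = X i" using assms(1) i by simp_all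
  \<comment> \<open>Cancelling the isomorphism \<open>\<eta>\<close> on the right reduces the
    equation to \<open>Tau_Id_left\<close> on one side and to naturality of \<open>\<eta>\<close> on
    the other.\<close>
  have "?f \<odot>\<^bsub>?C\<^esub> Tau D (Id PC i) \<alpha> (X (Dom PC \<alpha>)) = rep_mor X m (Id PC i) \<odot>\<^bsub>?C\<^esub> FMor (Fun D (Id PC i)) ?f"
  proof (rule category.epicD[OF cat_Cat[OF i(2)] category.iso_epic[OF cat_Cat[OF i(2)] E(4)]])
    have "(?f \<odot>\<^bsub>?C\<^esub> Tau D (Id PC i) \<alpha> (X (Dom PC \<alpha>))) \<odot>\<^bsub>?C\<^esub> Eta D i ?Y = ?f"
      using f T E i TE by (simp add: C_assoc)
    also have "\<dots> = (rep_mor X m (Id PC i) \<odot>\<^bsub>?C\<^esub> Eta D i (X i)) \<odot>\<^bsub>?C\<^esub> ?f"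
      unfolding J(5) using f E i by simp
    also have "\<dots> = (rep_mor X m (Id PC i) \<odot>\<^bsub>?C\<^esub> FMor (Fun D (Id PC i)) ?f) \<odot>\<^bsub>?C\<^esub> Eta D i ?Y"
      using f J(1-4) E i i' nat by (simp add: C_assoc)
    finally show "(?f \<odot>\<^bsub>?C\<^esub> Tau D (Id PC i) \<alpha> (X (Dom PC \<alpha>))) \<odot>\<^bsub>?C\<^esub> Eta D i ?Y =
      (rep_mor X m (Id PC i) \<odot>\<^bsub>?C\<^esub> FMor (Fun D (Id PC i)) ?f) \<odot>\<^bsub>?C\<^esub> Eta D i ?Y" .
  qed (use f T E J(1-4) i i' in simp_all)
  then show ?case using c i' by simp
next
  case (Step \<beta> a)
  let ?k = "head G a" and ?i = "Dom PC \<alpha>" and ?j = "Cod PC \<alpha>" and ?l = "tail G a"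
  let ?C = "Cat D ?k" and ?f = "rep_mor X m \<alpha>"
  have \<beta>: "Dom PC \<beta> = ?j" "Cod PC \<beta> = ?l" "\<beta> \<in> Mor PC" and a: "a \<in> arcs G" and k: "?k \<in> verts G" using Step by simp_all
  have X\<alpha>: "X ?i \<in> Ob (Cat D ?i)" "X ?j \<in> Ob (Cat D ?j)" using X assms(1) by simp_all
  let ?ba = "Comp PC \<beta> \<alpha>" and ?ab = "Comp PC (arr a) \<beta>"
  have ba: "?ba \<in> Mor PC" "Dom PC ?ba = ?i" "Cod PC ?ba = ?l" "?ab \<in> Mor PC" "Dom PC ?ab = ?j" "Cod PC ?ab = ?k"
    using \<beta> a assms(1) by simp_all
  have as: "Comp PC ?ab \<alpha> = Comp PC (arr a) ?ba" using \<beta> a assms(1) by (simp add: comp_assoc)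
  let ?t = "Tau D (arr a) \<beta> (FOb (Fun D \<alpha>) (X ?i))"
  have Y: "FOb (Fun D \<alpha>) (X ?i) \<in> Ob (Cat D (Dom PC \<beta>))" using X\<alpha> assms(1) \<beta> by simp
  note T1 = Tau_props[OF \<beta>(3) arr_path(1)[OF a] _ Y arr_path(3)[symmetric], unfolded arr_path(2) \<beta>(2), OF refl]
  have T2: "Tau D ?ab \<alpha> (X ?i) \<in> Mor ?C" "Dom ?C (Tau D ?ab \<alpha> (X ?i)) = FOb (Fun D ?ab) (FOb (Fun D \<alpha>) (X ?i))"
    "Cod ?C (Tau D ?ab \<alpha> (X ?i)) = FOb (Fun D (Comp PC (arr a) ?ba)) (X ?i)"
    using Tau_props[OF assms(1) ba(4) ba(5) X\<alpha>(1) ba(6)[symmetric]] as by simp_all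
  have T3: "Tau D \<beta> \<alpha> (X ?i) \<in> Mor (Cat D ?l)" "Dom (Cat D ?l) (Tau D \<beta> \<alpha> (X ?i)) = FOb (Fun D \<beta>) (FOb (Fun D \<alpha>) (X ?i))"
    "Cod (Cat D ?l) (Tau D \<beta> \<alpha> (X ?i)) = FOb (Fun D ?ba) (X ?i)"
    using Tau_props[OF assms(1) \<beta>(3) \<beta>(1) X\<alpha>(1) \<beta>(2)[symmetric]] by simp_all
  have T4: "Tau D (arr a) ?ba (X ?i) \<in> Mor ?C" "Dom ?C (Tau D (arr a) ?ba (X ?i)) = FOb (Fun D (arr a)) (FOb (Fun D ?ba) (X ?i))"
    "Cod ?C (Tau D (arr a) ?ba (X ?i)) = FOb (Fun D (Comp PC (arr a) ?ba)) (X ?i)"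
    using Tau_props[OF ba(1) arr_path(1)[OF a] _ _ arr_path(3)[symmetric], of "X ?i"] ba a X\<alpha> by simp_all
  have T5: "Tau D (arr a) \<beta> (X ?j) \<in> Mor ?C" "Dom ?C (Tau D (arr a) \<beta> (X ?j)) = FOb (Fun D (arr a)) (FOb (Fun D \<beta>) (X ?j))"
    "Cod ?C (Tau D (arr a) \<beta> (X ?j)) = FOb (Fun D ?ab) (X ?j)"
    using Tau_props[OF \<beta>(3) arr_path(1)[OF a] _ _ arr_path(3)[symmetric], of "X ?j"] \<beta> a X\<alpha> by simp_all
  have t6: "Dom PC (arr a) = Cod PC ?ba" "X ?i \<in> Ob (Cat D (Dom PC ?ba))" "Dom PC (arr a) = Cod PC \<beta>" "X ?j \<in> Ob (Cat D (Dom PC \<beta>))"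
    using ba a X\<alpha> \<beta> by simp_all
  note T6 = inv_Tau[OF ba(1) arr_path(1)[OF a] t6(1,2) arr_path(3)[symmetric]]
  note T7 = inv_Tau[OF \<beta>(3) arr_path(1)[OF a] t6(3,4) arr_path(3)[symmetric]]
  let ?v6 = "inv_of ?C (Tau D (arr a) ?ba (X ?i))" and ?v7 = "inv_of ?C (Tau D (arr a) \<beta> (X ?j))"
  have f: "?f \<in> Mor (Cat D ?j)" "Dom (Cat D ?j) ?f = FOb (Fun D \<alpha>) (X ?i)" "Cod (Cat D ?j) ?f = X ?j" using assms(1) by simp_all
  have Mb: "rep_mor X m \<beta> \<in> Mor (Cat D ?l)" "Dom (Cat D ?l) (rep_mor X m \<beta>) = FOb (Fun D \<beta>) (X ?j)" "Cod (Cat D ?l) (rep_mor X m \<beta>) = X ?l"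
    using \<beta> by simp_all
  have Mba: "rep_mor X m ?ba \<in> Mor (Cat D ?l)" "Dom (Cat D ?l) (rep_mor X m ?ba) = FOb (Fun D ?ba) (X ?i)" "Cod (Cat D ?l) (rep_mor X m ?ba) = X ?l"
    using ba by simp_all
  have Ma: "m a \<in> Mor ?C" "Dom ?C (m a) = FOb (Fun D (arr a)) (X ?l)" "Cod ?C (m a) = X ?k" using a by simp_all
  have h: "\<alpha> \<in> Hom PC ?i ?j" "\<beta> \<in> Hom PC ?j ?l" "arr a \<in> Hom PC ?l ?k" using assms(1) \<beta> a by (simp_all add: Hom_iff)
  note assoc = Tau_assoc[OF h X\<alpha>(1)]
  have nat: "Tau D (arr a) \<beta> (X ?j) \<odot>\<^bsub>?C\<^esub> FMor (Fun D (arr a)) (FMor (Fun D \<beta>) ?f) = FMor (Fun D ?ab) ?f \<odot>\<^bsub>?C\<^esub> ?t"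
    using Tau_natural[OF \<beta>(3) arr_path(1)[OF a] t6(3) _ arr_path(3)[symmetric], of ?f] f \<beta> by simp
  have IH: "rep_mor X m ?ba \<odot>\<^bsub>Cat D ?l\<^esub> Tau D \<beta> \<alpha> (X ?i) = rep_mor X m \<beta> \<odot>\<^bsub>Cat D ?l\<^esub> FMor (Fun D \<beta>) ?f"
    using Step \<beta> by simp
  have ab: "rep_mor X m (Comp PC (arr a) ?ba) = m a \<odot>\<^bsub>?C\<^esub> (FMor (Fun D (arr a)) (rep_mor X m ?ba) \<odot>\<^bsub>?C\<^esub> ?v6)"
    "rep_mor X m ?ab = m a \<odot>\<^bsub>?C\<^esub> (FMor (Fun D (arr a)) (rep_mor X m \<beta>) \<odot>\<^bsub>?C\<^esub> ?v7)"
    using rep_mor_step[OF ba(1) a ba(3)] rep_mor_step[OF \<beta>(3) a \<beta>(2)] ba \<beta> by simp_all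
  \<comment> \<open>Precomposition with the isomorphism \<open>?t\<close> makes the left side of the
    form to which \<open>Tau_assoc\<close> applies; then the inverse of \<open>\<tau>\<close> hidden
    in \<open>rep_mor\<close> cancels, the induction hypothesis is used under \<open>D_a\<close>,
    and naturality of \<open>\<tau>\<close> leads to the right side.\<close>
  have "rep_mor X m (Comp PC (arr a) ?ba) \<odot>\<^bsub>?C\<^esub> Tau D ?ab \<alpha> (X ?i) = rep_mor X m ?ab \<odot>\<^bsub>?C\<^esub> FMor (Fun D ?ab) ?f"
  proof (rule category.epicD[OF cat_Cat[OF k] category.iso_epic[OF cat_Cat[OF k] T1(4)]])
    have F1: "FMor (Fun D (arr a)) (rep_mor X m ?ba) \<odot>\<^bsub>?C\<^esub> FMor (Fun D (arr a)) (Tau D \<beta> \<alpha> (X ?i)) =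
        FMor (Fun D (arr a)) (rep_mor X m \<beta>) \<odot>\<^bsub>?C\<^esub> FMor (Fun D (arr a)) (FMor (Fun D \<beta>) ?f)"
    proof -
      have "FMor (Fun D (arr a)) (rep_mor X m ?ba) \<odot>\<^bsub>?C\<^esub> FMor (Fun D (arr a)) (Tau D \<beta> \<alpha> (X ?i)) =
          FMor (Fun D (arr a)) (rep_mor X m ?ba \<odot>\<^bsub>Cat D ?l\<^esub> Tau D \<beta> \<alpha> (X ?i))"
        by (rule Fun_comp[symmetric]) (use a Mba T3 in simp_all)
      also have "\<dots> = FMor (Fun D (arr a)) (rep_mor X m \<beta>) \<odot>\<^bsub>?C\<^esub> FMor (Fun D (arr a)) (FMor (Fun D \<beta>) ?f)"
        unfolding IH by (rule Fun_comp) (use a Mb f \<beta> in simp_all)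
      finally show ?thesis .
    qed
    have "(rep_mor X m (Comp PC (arr a) ?ba) \<odot>\<^bsub>?C\<^esub> Tau D ?ab \<alpha> (X ?i)) \<odot>\<^bsub>?C\<^esub> ?t =
      m a \<odot>\<^bsub>?C\<^esub> (FMor (Fun D (arr a)) (rep_mor X m ?ba) \<odot>\<^bsub>?C\<^esub> (?v6 \<odot>\<^bsub>?C\<^esub> (Tau D ?ab \<alpha> (X ?i) \<odot>\<^bsub>?C\<^esub> ?t)))"
      unfolding ab using T1 T2 T6(1-3) Mba Ma a ba k by (simp add: C_assoc)
    also have "?v6 \<odot>\<^bsub>?C\<^esub> (Tau D ?ab \<alpha> (X ?i) \<odot>\<^bsub>?C\<^esub> ?t) =
      (?v6 \<odot>\<^bsub>?C\<^esub> Tau D (arr a) ?ba (X ?i)) \<odot>\<^bsub>?C\<^esub> FMor (Fun D (arr a)) (Tau D \<beta> \<alpha> (X ?i))"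
      unfolding assoc[symmetric] by (rule C_assoc[symmetric]) (use T3 T4 T6(1-3) a k in simp_all)
    also have "\<dots> = FMor (Fun D (arr a)) (Tau D \<beta> \<alpha> (X ?i))" unfolding T6(4) using T3 a k by simp
    also have "m a \<odot>\<^bsub>?C\<^esub> (FMor (Fun D (arr a)) (rep_mor X m ?ba) \<odot>\<^bsub>?C\<^esub> \<dots>) =
      m a \<odot>\<^bsub>?C\<^esub> (FMor (Fun D (arr a)) (rep_mor X m \<beta>) \<odot>\<^bsub>?C\<^esub> FMor (Fun D (arr a)) (FMor (Fun D \<beta>) ?f))"
      unfolding F1 ..
    also have "FMor (Fun D (arr a)) (FMor (Fun D \<beta>) ?f) =
      (?v7 \<odot>\<^bsub>?C\<^esub> Tau D (arr a) \<beta> (X ?j)) \<odot>\<^bsub>?C\<^esub> FMor (Fun D (arr a)) (FMor (Fun D \<beta>) ?f)"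
      unfolding T7(4) using f a k \<beta> by simp
    also have "\<dots> = ?v7 \<odot>\<^bsub>?C\<^esub> (FMor (Fun D ?ab) ?f \<odot>\<^bsub>?C\<^esub> ?t)"
      unfolding nat[symmetric] by (rule C_assoc) (use T5 T7(1-3) f a k \<beta> in simp_all)
    also have "m a \<odot>\<^bsub>?C\<^esub> (FMor (Fun D (arr a)) (rep_mor X m \<beta>) \<odot>\<^bsub>?C\<^esub> \<dots>) =
       (rep_mor X m ?ab \<odot>\<^bsub>?C\<^esub> FMor (Fun D ?ab) ?f) \<odot>\<^bsub>?C\<^esub> ?t"
      unfolding ab using T1 T7(1-3) Mb Ma f a ba k \<beta> by (simp add: C_assoc)
    finally show "(rep_mor X m (Comp PC (arr a) ?ba) \<odot>\<^bsub>?C\<^esub> Tau D ?ab \<alpha> (X ?i)) \<odot>\<^bsub>?C\<^esub> ?t =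
      (rep_mor X m ?ab \<odot>\<^bsub>?C\<^esub> FMor (Fun D ?ab) ?f) \<odot>\<^bsub>?C\<^esub> ?t" .
  qed (use T1 T2 f a k ba assms(1) \<beta> in simp_all)
  then show ?case unfolding as ba(6) .
qed

text \<open>Not immediate, since the recursion reaches a single arc through the trivial path and so
  inserts inverses of \<open>\<eta>\<close> and \<open>\<tau>\<close>. The unit law makes them
  cancel.\<close>

lemma rep_mor_arr:
  assumes "a \<in> arcs G"
  shows "rep_mor X m (arr a) = m a"
proof -
  let ?k = "head G a" and ?l = "tail G a"
  let ?C = "Cat D ?k"
  have l: "?l \<in> verts G" "?k \<in> verts G" using assms by simp_all
  have c: "Comp PC (arr a) (Id PC ?l) = arr a" using assms by simp
  have I: "Id PC ?l \<in> Mor PC" "Cod PC (Id PC ?l) = ?l" "Dom PC (Id PC ?l) = ?l" using l by simp_all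
  have t: "Dom PC (arr a) = Cod PC (Id PC ?l)" "X ?l \<in> Ob (Cat D (Dom PC (Id PC ?l)))" using assms I X l by simp_all
  note V = inv_Tau[OF I(1) arr_path(1)[OF assms] t arr_path(3)[symmetric], unfolded c]
  note T = Tau_props[OF I(1) arr_path(1)[OF assms] t arr_path(3)[symmetric], unfolded c]
  let ?v = "inv_of ?C (Tau D (arr a) (Id PC ?l) (X ?l))" and ?J = "rep_mor X m (Id PC ?l)"
  have J: "?J \<in> Mor (Cat D ?l)" "Dom (Cat D ?l) ?J = FOb (Fun D (Id PC ?l)) (X ?l)" "Cod (Cat D ?l) ?J = X ?l" using I by simp_all
  note E = Eta_props[OF l(1) X[OF l(1)]]
  have ar: "arr a \<in> Hom PC ?l ?k" using assms by (simp add: Hom_iff)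
  have tr: "Tau D (arr a) (Id PC ?l) (X ?l) \<odot>\<^bsub>?C\<^esub> FMor (Fun D (arr a)) (Eta D ?l (X ?l)) = Id ?C (FOb (Fun D (arr a)) (X ?l))"
    by (rule Tau_Id_right[OF ar X[OF l(1)]])
  have Xa: "FOb (Fun D (arr a)) (X ?l) \<in> Ob ?C" using X l assms by simp
  \<comment> \<open>By the unit law \<open>\<tau>\<close> after \<open>D_a \<eta>\<close> is the
    identity, and \<open>\<tau>\<close> is invertible, so \<open>D_a \<eta>\<close> is its
    inverse.\<close>
  have FE: "FMor (Fun D (arr a)) (Eta D ?l (X ?l)) = ?v"
  proof -
    have "FMor (Fun D (arr a)) (Eta D ?l (X ?l)) = (?v \<odot>\<^bsub>?C\<^esub> Tau D (arr a) (Id PC ?l) (X ?l)) \<odot>\<^bsub>?C\<^esub> FMor (Fun D (arr a)) (Eta D ?l (X ?l))"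
      unfolding V(4) using E assms l I by simp
    also have "\<dots> = ?v \<odot>\<^bsub>?C\<^esub> (Tau D (arr a) (Id PC ?l) (X ?l) \<odot>\<^bsub>?C\<^esub> FMor (Fun D (arr a)) (Eta D ?l (X ?l)))"
      by (rule C_assoc) (use V(1-3) T E assms l I in simp_all)
    also have "\<dots> = ?v" unfolding tr using V(1-3) l I Xa by simp
    finally show ?thesis .
  qed
  have "rep_mor X m (arr a) = m a \<odot>\<^bsub>?C\<^esub> (FMor (Fun D (arr a)) ?J \<odot>\<^bsub>?C\<^esub> FMor (Fun D (arr a)) (Eta D ?l (X ?l)))"
    using rep_mor_step[OF I(1) assms I(2)] FE c I by simp
  also have "FMor (Fun D (arr a)) ?J \<odot>\<^bsub>?C\<^esub> FMor (Fun D (arr a)) (Eta D ?l (X ?l)) = FMor (Fun D (arr a)) (?J \<odot>\<^bsub>Cat D ?l\<^esub> Eta D ?l (X ?l))"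
    by (rule Fun_comp[symmetric]) (use assms J E in simp_all)
  also have "\<dots> = Id ?C (FOb (Fun D (arr a)) (X ?l))"
    using inverse_morsD(5)[OF rep_mor_Id[OF l(1)]] Fun_Id[OF arr_path(1)[OF assms], of "X ?l"] X l assms E by simp
  also have "m a \<odot>\<^bsub>?C\<^esub> \<dots> = m a" using assms l by simp
  finally show ?thesis .
qed

text \<open>All later constructions produce only objects and maps along arcs; the coherence over
  arbitrary paths is settled here once and for all. The restrictions in the witness are due to the
  extensional function spaces in \<open>is_representation\<close>.\<close>

lemma ex_rep_of_arrows:
  obtains M where "is_representation PC D M" "\<And>i. i \<in> verts G \<Longrightarrow> ROb M i = X i" "\<And>a. a \<in> arcs G \<Longrightarrow> RMor M (arr a) = m a"
proof
  let ?M = "\<lparr>ROb = restrict X (verts G), RMor = restrict (rep_mor X m) (Mor PC)\<rparr>"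
  show "is_representation PC D ?M" unfolding is_representation_def
  proof (intro conjI allI ballI)
    show "ROb ?M \<in> (\<Pi>\<^sub>E i\<in>Ob PC. Ob (Cat D i))" using X by auto
    show "RMor ?M \<in> (\<Pi>\<^sub>E \<alpha>\<in>Mor PC. Hom (Cat D (Cod PC \<alpha>)) (FOb (Fun D \<alpha>) (ROb ?M (Dom PC \<alpha>))) (ROb ?M (Cod PC \<alpha>)))"
      using rep_mor_type by auto
    show "RMor ?M (Comp PC \<beta> \<alpha>) \<odot>\<^bsub>Cat D k\<^esub> Tau D \<beta> \<alpha> (ROb ?M i) = RMor ?M \<beta> \<odot>\<^bsub>Cat D k\<^esub> FMor (Fun D \<beta>) (RMor ?M \<alpha>)"
      if "\<alpha> \<in> Hom PC i j" "\<beta> \<in> Hom PC j k" for i j k \<alpha> \<beta>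
      using rep_mor_comp[of \<alpha> \<beta>] that by (auto simp: Hom_iff)
    show "inverse_mors (Cat D i) (Eta D i (ROb ?M i)) (RMor ?M (Id PC i))" if "i \<in> Ob PC" for i
      using rep_mor_Id[of i] that by simp
  qed
  show "ROb ?M i = X i" if "i \<in> verts G" for i using that by simp
  show "RMor ?M (arr a) = m a" if "a \<in> arcs G" for a using that rep_mor_arr by simp
qed

end

section \<open>The category of representations\<close>

abbreviation RC where "RC \<equiv> Rep PC D"

abbreviation cm :: "('v, ('v, 'a) path, 'o, 'm) rep_mor \<Rightarrow> 'v \<Rightarrow> 'm" where "cm f \<equiv> fst (snd f)"

definition mk :: "('v, ('v, 'a) path, 'o, 'm) rep \<Rightarrow> ('v \<Rightarrow> 'm) \<Rightarrow> ('v, ('v, 'a) path, 'o, 'm) rep \<Rightarrow> ('v, ('v, 'a) path, 'o, 'm) rep_mor"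
  where "mk M w N = (M, restrict w (verts G), N)"

abbreviation isrep where "isrep \<equiv> is_representation PC D"

lemma rep_Ob [simp]: "\<lbrakk>isrep M; i \<in> verts G\<rbrakk> \<Longrightarrow> ROb M i \<in> Ob (Cat D i)"
  unfolding is_representation_def by auto

lemma rep_mors [simp]:
  assumes "isrep M" "\<alpha> \<in> Mor PC" "Cod PC \<alpha> = j"
  shows "RMor M \<alpha> \<in> Mor (Cat D j)" "Dom (Cat D j) (RMor M \<alpha>) = FOb (Fun D \<alpha>) (ROb M (Dom PC \<alpha>))"
    "Cod (Cat D j) (RMor M \<alpha>) = ROb M j"
proof -
  have "RMor M \<alpha> \<in> Hom (Cat D (Cod PC \<alpha>)) (FOb (Fun D \<alpha>) (ROb M (Dom PC \<alpha>))) (ROb M (Cod PC \<alpha>))"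
    using assms(1,2) unfolding is_representation_def by (meson PiE_mem)
  then show "RMor M \<alpha> \<in> Mor (Cat D j)" "Dom (Cat D j) (RMor M \<alpha>) = FOb (Fun D \<alpha>) (ROb M (Dom PC \<alpha>))"
    "Cod (Cat D j) (RMor M \<alpha>) = ROb M j" using assms(3) by (simp_all add: Hom_iff)
qed

lemma rep_comp:
  assumes "isrep M" "\<alpha> \<in> Mor PC" "\<beta> \<in> Mor PC" "Dom PC \<beta> = Cod PC \<alpha>"
  shows "RMor M (Comp PC \<beta> \<alpha>) \<odot>\<^bsub>Cat D (Cod PC \<beta>)\<^esub> Tau D \<beta> \<alpha> (ROb M (Dom PC \<alpha>)) =
        RMor M \<beta> \<odot>\<^bsub>Cat D (Cod PC \<beta>)\<^esub> FMor (Fun D \<beta>) (RMor M \<alpha>)"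
proof -
  have "\<alpha> \<in> Hom PC (Dom PC \<alpha>) (Cod PC \<alpha>)" "\<beta> \<in> Hom PC (Cod PC \<alpha>) (Cod PC \<beta>)" using assms by (simp_all add: Hom_iff)
  then show ?thesis using assms(1) unfolding is_representation_def by blast
qed

lemma rep_Id: "\<lbrakk>isrep M; i \<in> verts G\<rbrakk> \<Longrightarrow> inverse_mors (Cat D i) (Eta D i (ROb M i)) (RMor M (Id PC i))"
  unfolding is_representation_def by simp

text \<open>Squares for arcs paste to squares for paths by naturality of \<open>\<eta>\<close> and
  \<open>\<tau>\<close>. In the inductive step the isomorphism \<open>\<tau>\<close> is cancelled on
  the right, which turns the value of a composite path into a composite of values.\<close>

lemma rep_morphism_if_arrows:
  assumes M: "isrep M" and N: "isrep N"
    and w: "\<And>i. i \<in> verts G \<Longrightarrow> w i \<in> Mor (Cat D i) \<and> Dom (Cat D i) (w i) = ROb M i \<and> Cod (Cat D i) (w i) = ROb N i"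
    and arrows: "\<And>a. a \<in> arcs G \<Longrightarrow> w (head G a) \<odot>\<^bsub>Cat D (head G a)\<^esub> RMor M (arr a) =
      RMor N (arr a) \<odot>\<^bsub>Cat D (head G a)\<^esub> FMor (Fun D (arr a)) (w (tail G a))"
    and \<alpha>: "\<alpha> \<in> Mor PC"
  shows "w (Cod PC \<alpha>) \<odot>\<^bsub>Cat D (Cod PC \<alpha>)\<^esub> RMor M \<alpha> = RMor N \<alpha> \<odot>\<^bsub>Cat D (Cod PC \<alpha>)\<^esub> FMor (Fun D \<alpha>) (w (Dom PC \<alpha>))"
  using \<alpha>
proof (induction rule: path_induct)
  case (Id i)
  let ?C = "Cat D i"
  note EM = Eta_props[OF Id rep_Ob[OF M Id]] and EN = Eta_props[OF Id rep_Ob[OF N Id]]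
  note JM = inverse_morsD[OF rep_Id[OF M Id]] and JN = inverse_morsD[OF rep_Id[OF N Id]]
  have i': "Id PC i \<in> Mor PC" "Cod PC (Id PC i) = i" "Dom PC (Id PC i) = i" using Id by simp_all
  note W = w[OF Id]
  have nat: "Eta D i (ROb N i) \<odot>\<^bsub>?C\<^esub> w i = FMor (Fun D (Id PC i)) (w i) \<odot>\<^bsub>?C\<^esub> Eta D i (ROb M i)"
    using Eta_natural[OF Id, of "w i"] W by simp
  have "w i \<odot>\<^bsub>?C\<^esub> RMor M (Id PC i) = ((RMor N (Id PC i) \<odot>\<^bsub>?C\<^esub> Eta D i (ROb N i)) \<odot>\<^bsub>?C\<^esub> w i) \<odot>\<^bsub>?C\<^esub> RMor M (Id PC i)"
    unfolding JN(5) using W Id EN by simp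
  also have "\<dots> = RMor N (Id PC i) \<odot>\<^bsub>?C\<^esub> ((Eta D i (ROb N i) \<odot>\<^bsub>?C\<^esub> w i) \<odot>\<^bsub>?C\<^esub> RMor M (Id PC i))"
    using W Id EN JN(1-4) JM(1-4) EM by (simp add: C_assoc)
  also have "\<dots> = (RMor N (Id PC i) \<odot>\<^bsub>?C\<^esub> FMor (Fun D (Id PC i)) (w i)) \<odot>\<^bsub>?C\<^esub> (Eta D i (ROb M i) \<odot>\<^bsub>?C\<^esub> RMor M (Id PC i))"
    unfolding nat using W Id EN JN(1-4) JM(1-4) EM i' by (simp add: C_assoc)
  also have "\<dots> = RMor N (Id PC i) \<odot>\<^bsub>?C\<^esub> FMor (Fun D (Id PC i)) (w i)"
    unfolding JM(6) using W Id EN JN(1-4) EM i' by simp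
  finally show ?case unfolding i' .
next
  case (Step \<alpha> a)
  let ?k = "head G a" and ?i = "Dom PC \<alpha>" and ?l = "tail G a"
  let ?C = "Cat D ?k" and ?aa = "Comp PC (arr a) \<alpha>" and ?F = "FMor (Fun D (arr a))"
  let ?t = "Tau D (arr a) \<alpha> (ROb M ?i)"
  have v: "?k \<in> verts G" "?i \<in> verts G" "?l \<in> verts G" using Step by simp_all
  have A: "arr a \<in> Mor PC" "Dom PC (arr a) = Cod PC \<alpha>" "Dom PC (arr a) = ?l" using Step by simp_all
  have aa: "?aa \<in> Mor PC" "Dom PC ?aa = ?i" "Cod PC ?aa = ?k" using Step by simp_all
  note T = Tau_props[OF Step(1) A(1,2) rep_Ob[OF M v(2)] arr_path(3)[symmetric]]
  have nat: "Tau D (arr a) \<alpha> (ROb N ?i) \<odot>\<^bsub>?C\<^esub> ?F (FMor (Fun D \<alpha>) (w ?i)) = FMor (Fun D ?aa) (w ?i) \<odot>\<^bsub>?C\<^esub> ?t"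
    using Tau_natural[OF Step(1) A(1,2) _ arr_path(3)[symmetric], of "w ?i"] w[OF v(2)] by simp
  note TN = Tau_props[OF Step(1) A(1,2) rep_Ob[OF N v(2)] arr_path(3)[symmetric]]
  have cM: "RMor M ?aa \<odot>\<^bsub>?C\<^esub> ?t = RMor M (arr a) \<odot>\<^bsub>?C\<^esub> ?F (RMor M \<alpha>)"
    using rep_comp[OF M Step(1) A(1,2)] by simp
  have cN: "RMor N ?aa \<odot>\<^bsub>?C\<^esub> Tau D (arr a) \<alpha> (ROb N ?i) = RMor N (arr a) \<odot>\<^bsub>?C\<^esub> ?F (RMor N \<alpha>)"
    using rep_comp[OF N Step(1) A(1,2)] by simp
  have IH: "w ?l \<odot>\<^bsub>Cat D ?l\<^esub> RMor M \<alpha> = RMor N \<alpha> \<odot>\<^bsub>Cat D ?l\<^esub> FMor (Fun D \<alpha>) (w ?i)" using Step by simp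
  have F1: "?F (w ?l) \<odot>\<^bsub>?C\<^esub> ?F (RMor M \<alpha>) = ?F (RMor N \<alpha>) \<odot>\<^bsub>?C\<^esub> ?F (FMor (Fun D \<alpha>) (w ?i))"
  proof -
    have "?F (w ?l) \<odot>\<^bsub>?C\<^esub> ?F (RMor M \<alpha>) = ?F (w ?l \<odot>\<^bsub>Cat D ?l\<^esub> RMor M \<alpha>)"
      by (rule Fun_comp[symmetric]) (use Step v w[OF v(3)] M in simp_all)
    also have "\<dots> = ?F (RMor N \<alpha>) \<odot>\<^bsub>?C\<^esub> ?F (FMor (Fun D \<alpha>) (w ?i))"
      unfolding IH by (rule Fun_comp) (use Step v w[OF v(2)] N in simp_all)
    finally show ?thesis .
  qed
  have "w ?k \<odot>\<^bsub>?C\<^esub> RMor M ?aa = RMor N ?aa \<odot>\<^bsub>?C\<^esub> FMor (Fun D ?aa) (w ?i)"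
  proof (rule category.epicD[OF cat_Cat[OF v(1)] category.iso_epic[OF cat_Cat[OF v(1)] T(4)]])
    have "(w ?k \<odot>\<^bsub>?C\<^esub> RMor M ?aa) \<odot>\<^bsub>?C\<^esub> ?t = w ?k \<odot>\<^bsub>?C\<^esub> (RMor M ?aa \<odot>\<^bsub>?C\<^esub> ?t)"
      by (rule C_assoc) (use v w[OF v(1)] T aa M Step in simp_all)
    also have "\<dots> = (w ?k \<odot>\<^bsub>?C\<^esub> RMor M (arr a)) \<odot>\<^bsub>?C\<^esub> ?F (RMor M \<alpha>)"
      unfolding cM by (rule C_assoc[symmetric]) (use v w[OF v(1)] aa M Step in simp_all)
    also have "\<dots> = RMor N (arr a) \<odot>\<^bsub>?C\<^esub> (?F (w ?l) \<odot>\<^bsub>?C\<^esub> ?F (RMor M \<alpha>))"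
      unfolding arrows[OF Step(2)] by (rule C_assoc) (use v w[OF v(3)] aa M N Step in simp_all)
    also have "\<dots> = (RMor N (arr a) \<odot>\<^bsub>?C\<^esub> ?F (RMor N \<alpha>)) \<odot>\<^bsub>?C\<^esub> ?F (FMor (Fun D \<alpha>) (w ?i))"
      unfolding F1 by (rule C_assoc[symmetric]) (use v w[OF v(2)] aa N Step in simp_all)
    also have "\<dots> = RMor N ?aa \<odot>\<^bsub>?C\<^esub> (Tau D (arr a) \<alpha> (ROb N ?i) \<odot>\<^bsub>?C\<^esub> ?F (FMor (Fun D \<alpha>) (w ?i)))"
      unfolding cN[symmetric] by (rule C_assoc) (use v w[OF v(2)] aa N Step TN in simp_all)
    also have "\<dots> = (RMor N ?aa \<odot>\<^bsub>?C\<^esub> FMor (Fun D ?aa) (w ?i)) \<odot>\<^bsub>?C\<^esub> ?t"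
      unfolding nat by (rule C_assoc[symmetric]) (use v w[OF v(2)] aa N Step T in simp_all)
    finally show "(w ?k \<odot>\<^bsub>?C\<^esub> RMor M ?aa) \<odot>\<^bsub>?C\<^esub> ?t = (RMor N ?aa \<odot>\<^bsub>?C\<^esub> FMor (Fun D ?aa) (w ?i)) \<odot>\<^bsub>?C\<^esub> ?t" .
  qed (use v w[OF v(2)] w[OF v(1)] aa M N Step T in simp_all)
  then show ?case unfolding aa .
qed

lemma RC_Ob [simp]: "M \<in> Ob RC \<longleftrightarrow> isrep M"
  and RC_Dom: "Dom RC f = fst f" and RC_Cod: "Cod RC f = snd (snd f)"
  by (simp_all add: Rep_def split_beta)

lemma cm_simps [simp]:
  assumes "i \<in> verts G"
  shows "cm (Id RC M) i = Id (Cat D i) (ROb M i)"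
    "cm (Comp RC g f) i = cm g i \<odot>\<^bsub>Cat D i\<^esub> cm f i"
    "cm (Add RC f g) i = cm f i \<boxplus>\<^bsub>Cat D i\<^esub> cm g i"
    "cm (Zero RC M N) i = Zero (Cat D i) (ROb M i) (ROb N i)"
    "cm (mk M w N) i = w i"
  using assms by (simp_all add: Rep_def split_beta mk_def)

lemma mk_Dom [simp]: "Dom RC (mk M w N) = M" and mk_Cod [simp]: "Cod RC (mk M w N) = N"
  by (simp_all add: RC_Dom RC_Cod mk_def)

lemma RC_Mor: "f \<in> Mor RC \<longleftrightarrow> isrep (Dom RC f) \<and> isrep (Cod RC f) \<and> is_rep_morphism PC D (Dom RC f) (cm f) (Cod RC f)"
  by (cases f) (simp add: Rep_def split_beta)

lemma mk_Mor:
  assumes "isrep M" "isrep N"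
    "\<And>i. i \<in> verts G \<Longrightarrow> w i \<in> Mor (Cat D i) \<and> Dom (Cat D i) (w i) = ROb M i \<and> Cod (Cat D i) (w i) = ROb N i"
    "\<And>a. a \<in> arcs G \<Longrightarrow> w (head G a) \<odot>\<^bsub>Cat D (head G a)\<^esub> RMor M (arr a) =
      RMor N (arr a) \<odot>\<^bsub>Cat D (head G a)\<^esub> FMor (Fun D (arr a)) (w (tail G a))"
  shows "mk M w N \<in> Mor RC"
  unfolding RC_Mor is_rep_morphism_def
proof (intro conjI allI ballI)
  show "cm (mk M w N) \<in> (\<Pi>\<^sub>E i\<in>Ob PC. Hom (Cat D i) (ROb (Dom RC (mk M w N)) i) (ROb (Cod RC (mk M w N)) i))"
    using assms(3) by (auto simp: mk_def RC_Dom RC_Cod Hom_iff)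
  fix i j \<alpha> assume "\<alpha> \<in> Hom PC i j"
  then have \<alpha>: "\<alpha> \<in> Mor PC" "Dom PC \<alpha> = i" "Cod PC \<alpha> = j" "i \<in> verts G" "j \<in> verts G" by (auto simp: Hom_iff)
  show "cm (mk M w N) j \<odot>\<^bsub>Cat D j\<^esub> RMor (Dom RC (mk M w N)) \<alpha> =
        RMor (Cod RC (mk M w N)) \<alpha> \<odot>\<^bsub>Cat D j\<^esub> FMor (Fun D \<alpha>) (cm (mk M w N) i)"
    using rep_morphism_if_arrows[OF assms \<alpha>(1)] \<alpha> by simp
qed (use assms in simp_all)

lemma RC_MorD:
  assumes "f \<in> Mor RC"
  shows "isrep (Dom RC f)" "isrep (Cod RC f)"
    "i \<in> verts G \<Longrightarrow> cm f i \<in> Mor (Cat D i)"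
    "i \<in> verts G \<Longrightarrow> Dom (Cat D i) (cm f i) = ROb (Dom RC f) i"
    "i \<in> verts G \<Longrightarrow> Cod (Cat D i) (cm f i) = ROb (Cod RC f) i"
    "a \<in> arcs G \<Longrightarrow> cm f (head G a) \<odot>\<^bsub>Cat D (head G a)\<^esub> RMor (Dom RC f) (arr a) =
      RMor (Cod RC f) (arr a) \<odot>\<^bsub>Cat D (head G a)\<^esub> FMor (Fun D (arr a)) (cm f (tail G a))"
proof -
  have 1: "isrep (Dom RC f)" "isrep (Cod RC f)" "is_rep_morphism PC D (Dom RC f) (cm f) (Cod RC f)" using assms RC_Mor by blast+
  show "isrep (Dom RC f)" "isrep (Cod RC f)" by fact+
  have "cm f i \<in> Hom (Cat D i) (ROb (Dom RC f) i) (ROb (Cod RC f) i)" if "i \<in> verts G" for i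
    using 1(3) that unfolding is_rep_morphism_def by auto
  then show "i \<in> verts G \<Longrightarrow> cm f i \<in> Mor (Cat D i)"
    "i \<in> verts G \<Longrightarrow> Dom (Cat D i) (cm f i) = ROb (Dom RC f) i"
    "i \<in> verts G \<Longrightarrow> Cod (Cat D i) (cm f i) = ROb (Cod RC f) i" by (auto simp: Hom_iff)
  assume "a \<in> arcs G"
  then have "arr a \<in> Hom PC (tail G a) (head G a)" by (simp add: Hom_iff)
  then show "cm f (head G a) \<odot>\<^bsub>Cat D (head G a)\<^esub> RMor (Dom RC f) (arr a) =
      RMor (Cod RC f) (arr a) \<odot>\<^bsub>Cat D (head G a)\<^esub> FMor (Fun D (arr a)) (cm f (tail G a))"
    using 1(3) unfolding is_rep_morphism_def by blast
qed

lemma RC_ext: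
  assumes "f \<in> Mor RC" "g \<in> Mor RC" "Dom RC g = Dom RC f" "Cod RC g = Cod RC f" "\<And>i. i \<in> verts G \<Longrightarrow> cm f i = cm g i"
  shows "f = g"
proof -
  have "cm f \<in> extensional (verts G)" "cm g \<in> extensional (verts G)"
    using assms(1,2) unfolding RC_Mor is_rep_morphism_def by (auto simp: PiE_def)
  then have "cm f = cm g" using assms(5) by (rule extensionalityI)
  then show ?thesis using assms(3,4) by (simp add: RC_Dom RC_Cod prod_eq_iff)
qed

lemma RC_Id_mk: "Id RC M = mk M (\<lambda>i. Id (Cat D i) (ROb M i)) M"
  and RC_Comp_mk: "Comp RC g f = mk (Dom RC f) (\<lambda>i. cm g i \<odot>\<^bsub>Cat D i\<^esub> cm f i) (Cod RC g)"
  and RC_Add_mk: "Add RC f g = mk (Dom RC f) (\<lambda>i. cm f i \<boxplus>\<^bsub>Cat D i\<^esub> cm g i) (Cod RC f)"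
  and RC_Zero_mk: "Zero RC M N = mk M (\<lambda>i. Zero (Cat D i) (ROb M i) (ROb N i)) N"
  by (simp_all add: Rep_def mk_def split_beta)

lemma Fun_add:
  assumes "\<alpha> \<in> Mor PC" "Dom PC \<alpha> = i" "Cod PC \<alpha> = j"
    "f \<in> Mor (Cat D i)" "g \<in> Mor (Cat D i)" "Dom (Cat D i) g = Dom (Cat D i) f" "Cod (Cat D i) g = Cod (Cat D i) f"
  shows "FMor (Fun D \<alpha>) (f \<boxplus>\<^bsub>Cat D i\<^esub> g) = FMor (Fun D \<alpha>) f \<boxplus>\<^bsub>Cat D j\<^esub> FMor (Fun D \<alpha>) g"
proof -
  have "f \<in> Hom (Cat D i) (Dom (Cat D i) f) (Cod (Cat D i) f)" "g \<in> Hom (Cat D i) (Dom (Cat D i) f) (Cod (Cat D i) f)"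
    using assms by (simp_all add: Hom_iff)
  then show ?thesis using exact assms(1-3) unfolding exact_diagram_def additive_functor_def by blast
qed

lemma Fun_zero:
  assumes "\<alpha> \<in> Mor PC" "Dom PC \<alpha> = i" "Cod PC \<alpha> = j" "A \<in> Ob (Cat D i)" "B \<in> Ob (Cat D i)"
  shows "FMor (Fun D \<alpha>) (Zero (Cat D i) A B) = Zero (Cat D j) (FOb (Fun D \<alpha>) A) (FOb (Fun D \<alpha>) B)"
proof -
  have v: "i \<in> verts G" "j \<in> verts G" using assms by auto
  have "FMor (Fun D \<alpha>) (Zero (Cat D i) A B) \<boxplus>\<^bsub>Cat D j\<^esub> FMor (Fun D \<alpha>) (Zero (Cat D i) A B) = FMor (Fun D \<alpha>) (Zero (Cat D i) A B)"
    using Fun_add[OF assms(1-3), of "Zero (Cat D i) A B" "Zero (Cat D i) A B"] v assms by simp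
  then show ?thesis
    using preadditive_category.add_eq_self_imp_zero[OF preadd_Cat[OF v(2)], of "FMor (Fun D \<alpha>) (Zero (Cat D i) A B)"] v assms by simp
qed

lemma Fun_neg:
  assumes "\<alpha> \<in> Mor PC" "Dom PC \<alpha> = i" "Cod PC \<alpha> = j" "f \<in> Mor (Cat D i)"
  shows "FMor (Fun D \<alpha>) (neg (Cat D i) f) = neg (Cat D j) (FMor (Fun D \<alpha>) f)"
proof -
  have v: "i \<in> verts G" "j \<in> verts G" using assms by auto
  interpret I: preadditive_category "Cat D i" by (rule preadd_Cat[OF v(1)])
  interpret J: preadditive_category "Cat D j" by (rule preadd_Cat[OF v(2)])
  show ?thesis
  proof (rule J.neg_unique)
    have "FMor (Fun D \<alpha>) (f \<boxplus>\<^bsub>Cat D i\<^esub> neg (Cat D i) f) = FMor (Fun D \<alpha>) f \<boxplus>\<^bsub>Cat D j\<^esub> FMor (Fun D \<alpha>) (neg (Cat D i) f)"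
      by (rule Fun_add) (use assms in simp_all)
    then show "FMor (Fun D \<alpha>) f \<boxplus>\<^bsub>Cat D j\<^esub> FMor (Fun D \<alpha>) (neg (Cat D i) f) =
      Zero (Cat D j) (Dom (Cat D j) (FMor (Fun D \<alpha>) f)) (Cod (Cat D j) (FMor (Fun D \<alpha>) f))"
      using Fun_zero[OF assms(1-3)] assms by simp
  qed (use assms in simp_all)
qed

lemma Fun_cokernel:
  assumes "\<alpha> \<in> Mor PC" "Dom PC \<alpha> = i" "Cod PC \<alpha> = j" "is_cokernel (Cat D i) f c"
  shows "is_cokernel (Cat D j) (FMor (Fun D \<alpha>) f) (FMor (Fun D \<alpha>) c)"
proof -
  have v: "i \<in> verts G" "j \<in> verts G" using assms by auto
  have "exact_functor (Cat D i) (Cat D j) (Fun D \<alpha>)" using exact assms(1-3) unfolding exact_diagram_def by blast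
  then show ?thesis
    using exact_functor_cokernel[OF abelian_Cat[OF v(1)] abelian_Cat[OF v(2)] path_functor[OF assms(1), unfolded assms(2,3)] _ assms(4)] by blast
qed

lemma Fun_short_exact:
  assumes "\<alpha> \<in> Mor PC" "Dom PC \<alpha> = i" "Cod PC \<alpha> = j" "short_exact (Cat D i) f c"
  shows "short_exact (Cat D j) (FMor (Fun D \<alpha>) f) (FMor (Fun D \<alpha>) c)"
  using exact assms unfolding exact_diagram_def exact_functor_def by blast

lemma Id_RC: "isrep M \<Longrightarrow> Id RC M \<in> Mor RC"
  unfolding RC_Id_mk by (rule mk_Mor) (simp_all add: Fun_Id[of "arr _", simplified])

lemma Comp_RC:
  assumes "f \<in> Mor RC" "g \<in> Mor RC" "Dom RC g = Cod RC f"
  shows "Comp RC g f \<in> Mor RC"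
  unfolding RC_Comp_mk
proof (rule mk_Mor)
  note f = RC_MorD[OF assms(1)] and g = RC_MorD[OF assms(2), unfolded assms(3)]
  show "isrep (Dom RC f)" "isrep (Cod RC g)" using f g by simp_all
  show "cm g i \<odot>\<^bsub>Cat D i\<^esub> cm f i \<in> Mor (Cat D i) \<and> Dom (Cat D i) (cm g i \<odot>\<^bsub>Cat D i\<^esub> cm f i) = ROb (Dom RC f) i \<and>
     Cod (Cat D i) (cm g i \<odot>\<^bsub>Cat D i\<^esub> cm f i) = ROb (Cod RC g) i" if "i \<in> verts G" for i
    using that f(3-5) g(3-5) by simp
  fix a assume a: "a \<in> arcs G"
  let ?k = "head G a" and ?l = "tail G a" and ?F = "FMor (Fun D (arr a))"
  let ?C = "Cat D ?k"
  have v: "?k \<in> verts G" "?l \<in> verts G" using a by simp_all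
  note F = f(1,2) f(3-5)[OF v(1)] f(3-5)[OF v(2)] and GG = g(1,2) g(3-5)[OF v(1)] g(3-5)[OF v(2)]
  have "(cm g ?k \<odot>\<^bsub>?C\<^esub> cm f ?k) \<odot>\<^bsub>?C\<^esub> RMor (Dom RC f) (arr a) = cm g ?k \<odot>\<^bsub>?C\<^esub> (cm f ?k \<odot>\<^bsub>?C\<^esub> RMor (Dom RC f) (arr a))"
    by (rule C_assoc) (use v a F GG in simp_all)
  also have "\<dots> = (cm g ?k \<odot>\<^bsub>?C\<^esub> RMor (Cod RC f) (arr a)) \<odot>\<^bsub>?C\<^esub> ?F (cm f ?l)"
    unfolding f(6)[OF a] by (rule C_assoc[symmetric]) (use v a F GG in simp_all)
  also have "\<dots> = RMor (Cod RC g) (arr a) \<odot>\<^bsub>?C\<^esub> (?F (cm g ?l) \<odot>\<^bsub>?C\<^esub> ?F (cm f ?l))"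
    unfolding g(6)[OF a] by (rule C_assoc) (use v a F GG in simp_all)
  also have "?F (cm g ?l) \<odot>\<^bsub>?C\<^esub> ?F (cm f ?l) = ?F (cm g ?l \<odot>\<^bsub>Cat D ?l\<^esub> cm f ?l)"
    by (rule Fun_comp[symmetric]) (use v a F GG in simp_all)
  finally show "(cm g ?k \<odot>\<^bsub>?C\<^esub> cm f ?k) \<odot>\<^bsub>?C\<^esub> RMor (Dom RC f) (arr a) =
    RMor (Cod RC g) (arr a) \<odot>\<^bsub>?C\<^esub> ?F (cm g ?l \<odot>\<^bsub>Cat D ?l\<^esub> cm f ?l)" .
qed

end

section \<open>Preadditive structure on representations; kernels and cokernels at the
  vertices\<close>

context quiver_diagram
begin

lemma RC_category: "category RC"
proof
  show "Dom RC f \<in> Ob RC" "Cod RC f \<in> Ob RC" if "f \<in> Mor RC" for f using RC_MorD[OF that] by simp_all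
  show "Id RC A \<in> Hom RC A A" if "A \<in> Ob RC" for A
    using that Id_RC[of A] by (simp add: Hom_iff) (simp add: RC_Id_mk)
  show "Comp RC g f \<in> Hom RC A E" if "f \<in> Hom RC A B" "g \<in> Hom RC B E" for f g A B E
    using that Comp_RC[of f g] by (simp add: Hom_iff) (simp add: RC_Comp_mk)
  show "Comp RC f (Id RC A) = f" if "f \<in> Hom RC A B" for f A B
  proof (rule RC_ext)
    have f: "f \<in> Mor RC" "Dom RC f = A" "Cod RC f = B" using that by (simp_all add: Hom_iff)
    note F = RC_MorD[OF f(1), unfolded f(2,3)]
    show "Comp RC f (Id RC A) \<in> Mor RC" using Comp_RC[of "Id RC A" f] Id_RC F f by (simp add: RC_Id_mk)
    show "f \<in> Mor RC" "Dom RC f = Dom RC (Comp RC f (Id RC A))" "Cod RC f = Cod RC (Comp RC f (Id RC A))"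
      using f by (simp_all add: RC_Id_mk RC_Comp_mk)
    show "cm (Comp RC f (Id RC A)) i = cm f i" if "i \<in> verts G" for i using that F(3-5)[OF that] by simp
  qed
  show "Comp RC (Id RC B) f = f" if "f \<in> Hom RC A B" for f A B
  proof (rule RC_ext)
    have f: "f \<in> Mor RC" "Dom RC f = A" "Cod RC f = B" using that by (simp_all add: Hom_iff)
    note F = RC_MorD[OF f(1), unfolded f(2,3)]
    show "Comp RC (Id RC B) f \<in> Mor RC" using Comp_RC[of f "Id RC B"] Id_RC F f by (simp add: RC_Id_mk)
    show "f \<in> Mor RC" "Dom RC f = Dom RC (Comp RC (Id RC B) f)" "Cod RC f = Cod RC (Comp RC (Id RC B) f)"
      using f by (simp_all add: RC_Id_mk RC_Comp_mk)
    show "cm (Comp RC (Id RC B) f) i = cm f i" if "i \<in> verts G" for i using that F(3-5)[OF that] by simp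
  qed
  show "Comp RC h (Comp RC g f) = Comp RC (Comp RC h g) f"
    if "f \<in> Hom RC A B" "g \<in> Hom RC B E" "h \<in> Hom RC E F" for f g h A B E F
  proof (rule RC_ext)
    have f: "f \<in> Mor RC" "Dom RC f = A" "Cod RC f = B" and g: "g \<in> Mor RC" "Dom RC g = B" "Cod RC g = E"
      and h: "h \<in> Mor RC" "Dom RC h = E" "Cod RC h = F" using that by (simp_all add: Hom_iff)
    have [simp]: "Dom RC (Comp RC y x) = Dom RC x" "Cod RC (Comp RC y x) = Cod RC y" for x y by (simp_all add: RC_Comp_mk)
    show "Comp RC h (Comp RC g f) \<in> Mor RC" "Comp RC (Comp RC h g) f \<in> Mor RC"
      using f g h by (auto intro!: Comp_RC)
    show "Dom RC (Comp RC (Comp RC h g) f) = Dom RC (Comp RC h (Comp RC g f))"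
      "Cod RC (Comp RC (Comp RC h g) f) = Cod RC (Comp RC h (Comp RC g f))" by simp_all
    show "cm (Comp RC h (Comp RC g f)) i = cm (Comp RC (Comp RC h g) f) i" if i: "i \<in> verts G" for i
      using i RC_MorD(3-5)[OF f(1) i] RC_MorD(3-5)[OF g(1) i] RC_MorD(3-5)[OF h(1) i] f g h by (simp add: C_assoc)
  qed
qed

lemma Add_RC:
  assumes "f \<in> Mor RC" "g \<in> Mor RC" "Dom RC g = Dom RC f" "Cod RC g = Cod RC f"
  shows "Add RC f g \<in> Mor RC"
  unfolding RC_Add_mk
proof (rule mk_Mor)
  note f = RC_MorD[OF assms(1)] and g = RC_MorD[OF assms(2), unfolded assms(3,4)]
  show "isrep (Dom RC f)" "isrep (Cod RC f)" using f by simp_all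
  show "cm f i \<boxplus>\<^bsub>Cat D i\<^esub> cm g i \<in> Mor (Cat D i) \<and> Dom (Cat D i) (cm f i \<boxplus>\<^bsub>Cat D i\<^esub> cm g i) = ROb (Dom RC f) i \<and>
     Cod (Cat D i) (cm f i \<boxplus>\<^bsub>Cat D i\<^esub> cm g i) = ROb (Cod RC f) i" if "i \<in> verts G" for i
    using that f(3-5) g(3-5) by simp
  fix a assume a: "a \<in> arcs G"
  have v: "head G a \<in> verts G" "tail G a \<in> verts G" using a by simp_all
  interpret H: preadditive_category "Cat D (head G a)" by (rule preadd_Cat[OF v(1)])
  note F = f(1,2) f(3-5)[OF v(1)] f(3-5)[OF v(2)] and GG = g(1,2) g(3-5)[OF v(1)] g(3-5)[OF v(2)]
  show "(cm f (head G a) \<boxplus>\<^bsub>Cat D (head G a)\<^esub> cm g (head G a)) \<odot>\<^bsub>Cat D (head G a)\<^esub> RMor (Dom RC f) (arr a) =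
    RMor (Cod RC f) (arr a) \<odot>\<^bsub>Cat D (head G a)\<^esub> FMor (Fun D (arr a)) (cm f (tail G a) \<boxplus>\<^bsub>Cat D (tail G a)\<^esub> cm g (tail G a))"
    using a v F GG f(6)[OF a] g(6)[OF a] by (simp add: H.add_comp H.comp_add Fun_add[OF _ arr_path(2,3)])
qed

lemma Zero_RC:
  assumes "isrep M" "isrep N"
  shows "Zero RC M N \<in> Mor RC"
  unfolding RC_Zero_mk by (rule mk_Mor) (use assms in \<open>simp_all add: Fun_zero[OF _ arr_path(2,3)]\<close>)

text \<open>Given by components, because \<open>neg RC\<close> is an inverse in a Hom-group of
  representations, and the group structure is only being established.\<close>

definition rneg where "rneg f = mk (Dom RC f) (\<lambda>i. neg (Cat D i) (cm f i)) (Cod RC f)"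

lemma rneg_RC:
  assumes "f \<in> Mor RC"
  shows "rneg f \<in> Mor RC"
  unfolding rneg_def
proof (rule mk_Mor)
  note f = RC_MorD[OF assms(1)]
  show "isrep (Dom RC f)" "isrep (Cod RC f)" using f by simp_all
  show "neg (Cat D i) (cm f i) \<in> Mor (Cat D i) \<and> Dom (Cat D i) (neg (Cat D i) (cm f i)) = ROb (Dom RC f) i \<and>
     Cod (Cat D i) (neg (Cat D i) (cm f i)) = ROb (Cod RC f) i" if "i \<in> verts G" for i
  proof -
    interpret preadditive_category "Cat D i" by (rule preadd_Cat[OF that])
    show ?thesis using f(3-5)[OF that] by simp
  qed
  fix a assume a: "a \<in> arcs G"
  have v: "head G a \<in> verts G" "tail G a \<in> verts G" using a by simp_all
  interpret H: preadditive_category "Cat D (head G a)" by (rule preadd_Cat[OF v(1)])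
  note F = f(1,2) f(3-5)[OF v(1)] f(3-5)[OF v(2)]
  show "neg (Cat D (head G a)) (cm f (head G a)) \<odot>\<^bsub>Cat D (head G a)\<^esub> RMor (Dom RC f) (arr a) =
    RMor (Cod RC f) (arr a) \<odot>\<^bsub>Cat D (head G a)\<^esub> FMor (Fun D (arr a)) (neg (Cat D (tail G a)) (cm f (tail G a)))"
    using a v F f(6)[OF a] by (simp add: H.neg_comp H.comp_neg Fun_neg[OF _ arr_path(2,3)])
qed

lemma RC_preadditive: "preadditive_category RC"
proof (intro preadditive_category.intro preadditive_category_axioms.intro RC_category)
  have DC [simp]: "Dom RC (Comp RC y x) = Dom RC x" "Cod RC (Comp RC y x) = Cod RC y"
    "Dom RC (Add RC x y) = Dom RC x" "Cod RC (Add RC x y) = Cod RC x"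
    "Dom RC (Zero RC M N) = M" "Cod RC (Zero RC M N) = N" "Dom RC (rneg x) = Dom RC x" "Cod RC (rneg x) = Cod RC x" for x y M N
    by (simp_all add: RC_Comp_mk RC_Add_mk RC_Zero_mk rneg_def)
  show "comm_group (hom_group RC M N)" if "M \<in> Ob RC" "N \<in> Ob RC" for M N
  proof (rule comm_groupI; unfold hom_group_def, simp_all only: monoid.simps partial_object.simps)
    have MN: "isrep M" "isrep N" using that by simp_all
    show "Add RC x y \<in> Hom RC M N" if "x \<in> Hom RC M N" "y \<in> Hom RC M N" for x y
      using that Add_RC[of x y] by (simp add: Hom_iff)
    show "Zero RC M N \<in> Hom RC M N" using Zero_RC[OF MN] by (simp add: Hom_iff)
    show "Add RC (Add RC x y) z = Add RC x (Add RC y z)" if "x \<in> Hom RC M N" "y \<in> Hom RC M N" "z \<in> Hom RC M N" for x y z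
    proof (rule RC_ext)
      have x: "x \<in> Mor RC" "Dom RC x = M" "Cod RC x = N" "y \<in> Mor RC" "Dom RC y = M" "Cod RC y = N" "z \<in> Mor RC" "Dom RC z = M" "Cod RC z = N"
        using that by (simp_all add: Hom_iff)
      show "Add RC (Add RC x y) z \<in> Mor RC" "Add RC x (Add RC y z) \<in> Mor RC" using x by (auto intro!: Add_RC)
      show "Dom RC (Add RC x (Add RC y z)) = Dom RC (Add RC (Add RC x y) z)" "Cod RC (Add RC x (Add RC y z)) = Cod RC (Add RC (Add RC x y) z)" by simp_all
      fix i assume i: "i \<in> verts G"
      interpret C: preadditive_category "Cat D i" by (rule preadd_Cat[OF i])
      show "cm (Add RC (Add RC x y) z) i = cm (Add RC x (Add RC y z)) i"
        using i RC_MorD(3-5)[OF x(1) i] RC_MorD(3-5)[OF x(4) i] RC_MorD(3-5)[OF x(7) i] x by (simp add: C.add_assoc)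
    qed
    show "Add RC x y = Add RC y x" if "x \<in> Hom RC M N" "y \<in> Hom RC M N" for x y
    proof (rule RC_ext)
      have x: "x \<in> Mor RC" "Dom RC x = M" "Cod RC x = N" "y \<in> Mor RC" "Dom RC y = M" "Cod RC y = N"
        using that by (simp_all add: Hom_iff)
      show "Add RC x y \<in> Mor RC" "Add RC y x \<in> Mor RC" using x by (auto intro!: Add_RC)
      show "Dom RC (Add RC y x) = Dom RC (Add RC x y)" "Cod RC (Add RC y x) = Cod RC (Add RC x y)" using x by simp_all
      fix i assume i: "i \<in> verts G"
      interpret C: preadditive_category "Cat D i" by (rule preadd_Cat[OF i])
      have "cm x i \<boxplus>\<^bsub>Cat D i\<^esub> cm y i = cm y i \<boxplus>\<^bsub>Cat D i\<^esub> cm x i"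
        by (rule C.add_comm) (use RC_MorD(3-5)[OF x(1) i] RC_MorD(3-5)[OF x(4) i] x in simp_all)
      then show "cm (Add RC x y) i = cm (Add RC y x) i" using i by simp
    qed
    show "Add RC (Zero RC M N) x = x" if "x \<in> Hom RC M N" for x
    proof (rule RC_ext)
      have x: "x \<in> Mor RC" "Dom RC x = M" "Cod RC x = N" using that by (simp_all add: Hom_iff)
      show "Add RC (Zero RC M N) x \<in> Mor RC" using x Zero_RC[OF MN] by (auto intro!: Add_RC)
      show "x \<in> Mor RC" "Dom RC x = Dom RC (Add RC (Zero RC M N) x)" "Cod RC x = Cod RC (Add RC (Zero RC M N) x)" using x by simp_all
      show "cm (Add RC (Zero RC M N) x) i = cm x i" if i: "i \<in> verts G" for i
        using i RC_MorD(3-5)[OF x(1) i] x by simp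
    qed
    show "\<exists>y\<in>Hom RC M N. Add RC y x = Zero RC M N" if "x \<in> Hom RC M N" for x
    proof
      have x: "x \<in> Mor RC" "Dom RC x = M" "Cod RC x = N" using that by (simp_all add: Hom_iff)
      show "rneg x \<in> Hom RC M N" using rneg_RC[of x] x by (simp add: Hom_iff)
      show "Add RC (rneg x) x = Zero RC M N"
      proof (rule RC_ext)
        show "Add RC (rneg x) x \<in> Mor RC" using x rneg_RC[OF x(1)] by (auto intro!: Add_RC)
        show "Zero RC M N \<in> Mor RC" by (rule Zero_RC[OF MN])
        show "Dom RC (Zero RC M N) = Dom RC (Add RC (rneg x) x)" "Cod RC (Zero RC M N) = Cod RC (Add RC (rneg x) x)" using x by simp_all
        fix i assume i: "i \<in> verts G"
        interpret C: preadditive_category "Cat D i" by (rule preadd_Cat[OF i])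
        show "cm (Add RC (rneg x) x) i = cm (Zero RC M N) i"
          using i RC_MorD(3-5)[OF x(1) i] x by (simp add: rneg_def)
      qed
    qed
  qed
  show "Comp RC (Add RC g h) f = Add RC (Comp RC g f) (Comp RC h f)"
    if "f \<in> Hom RC A B" "g \<in> Hom RC B E" "h \<in> Hom RC B E" for f g h A B E
  proof (rule RC_ext)
    have f: "f \<in> Mor RC" "Dom RC f = A" "Cod RC f = B" and g: "g \<in> Mor RC" "Dom RC g = B" "Cod RC g = E"
      and h: "h \<in> Mor RC" "Dom RC h = B" "Cod RC h = E" using that by (simp_all add: Hom_iff)
    show "Comp RC (Add RC g h) f \<in> Mor RC" "Add RC (Comp RC g f) (Comp RC h f) \<in> Mor RC"
      using f g h by (auto intro!: Comp_RC Add_RC)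
    show "Dom RC (Add RC (Comp RC g f) (Comp RC h f)) = Dom RC (Comp RC (Add RC g h) f)"
      "Cod RC (Add RC (Comp RC g f) (Comp RC h f)) = Cod RC (Comp RC (Add RC g h) f)" by simp_all
    fix i assume i: "i \<in> verts G"
    interpret C: preadditive_category "Cat D i" by (rule preadd_Cat[OF i])
    show "cm (Comp RC (Add RC g h) f) i = cm (Add RC (Comp RC g f) (Comp RC h f)) i"
      using i RC_MorD(3-5)[OF f(1) i] RC_MorD(3-5)[OF g(1) i] RC_MorD(3-5)[OF h(1) i] f g h by (simp add: C.add_comp)
  qed
  show "Comp RC h (Add RC f g) = Add RC (Comp RC h f) (Comp RC h g)"
    if "f \<in> Hom RC A B" "g \<in> Hom RC A B" "h \<in> Hom RC B E" for f g h A B E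
  proof (rule RC_ext)
    have f: "f \<in> Mor RC" "Dom RC f = A" "Cod RC f = B" and g: "g \<in> Mor RC" "Dom RC g = A" "Cod RC g = B"
      and h: "h \<in> Mor RC" "Dom RC h = B" "Cod RC h = E" using that by (simp_all add: Hom_iff)
    show "Comp RC h (Add RC f g) \<in> Mor RC" "Add RC (Comp RC h f) (Comp RC h g) \<in> Mor RC"
      using f g h by (auto intro!: Comp_RC Add_RC)
    show "Dom RC (Add RC (Comp RC h f) (Comp RC h g)) = Dom RC (Comp RC h (Add RC f g))"
      "Cod RC (Add RC (Comp RC h f) (Comp RC h g)) = Cod RC (Comp RC h (Add RC f g))" by simp_all
    fix i assume i: "i \<in> verts G"
    interpret C: preadditive_category "Cat D i" by (rule preadd_Cat[OF i])
    show "cm (Comp RC h (Add RC f g)) i = cm (Add RC (Comp RC h f) (Comp RC h g)) i"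
      using i RC_MorD(3-5)[OF f(1) i] RC_MorD(3-5)[OF g(1) i] RC_MorD(3-5)[OF h(1) i] f g h by (simp add: C.comp_add)
  qed
qed

sublocale RC: preadditive_category RC by (rule RC_preadditive)

lemma RC_monicI:
  assumes f: "f \<in> Mor RC" and m: "\<And>i. i \<in> verts G \<Longrightarrow> monic (Cat D i) (cm f i)"
  shows "monic RC f"
proof (rule RC.monicI_zero[OF f])
  note F = RC_MorD[OF f]
  fix x assume x: "x \<in> Mor RC" "Cod RC x = Dom RC f" "Comp RC f x = Zero RC (Dom RC x) (Cod RC f)"
  note X = RC_MorD[OF x(1)]
  show "x = Zero RC (Dom RC x) (Dom RC f)"
  proof (rule RC_ext[OF x(1)])
    show "Zero RC (Dom RC x) (Dom RC f) \<in> Mor RC" using X F by simp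
    fix i assume i: "i \<in> verts G"
    interpret C: preadditive_category "Cat D i" by (rule preadd_Cat[OF i])
    have "cm (Comp RC f x) i = cm (Zero RC (Dom RC x) (Cod RC f)) i" using x(3) by simp
    then have "cm f i \<odot>\<^bsub>Cat D i\<^esub> cm x i = Zero (Cat D i) (ROb (Dom RC x) i) (ROb (Cod RC f) i)" using i by simp
    then show "cm x i = cm (Zero RC (Dom RC x) (Dom RC f)) i"
      using C.monic_zeroD[OF m[OF i], of "cm x i"] i X(3-5)[OF i] F(3-5)[OF i] x(2) by simp
  qed (use X F x in simp_all)
qed

lemma RC_epicI:
  assumes f: "f \<in> Mor RC" and m: "\<And>i. i \<in> verts G \<Longrightarrow> epic (Cat D i) (cm f i)"
  shows "epic RC f"
proof (rule RC.epicI_zero[OF f])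
  note F = RC_MorD[OF f]
  fix x assume x: "x \<in> Mor RC" "Dom RC x = Cod RC f" "Comp RC x f = Zero RC (Dom RC f) (Cod RC x)"
  note X = RC_MorD[OF x(1)]
  show "x = Zero RC (Cod RC f) (Cod RC x)"
  proof (rule RC_ext[OF x(1)])
    show "Zero RC (Cod RC f) (Cod RC x) \<in> Mor RC" using X F by simp
    fix i assume i: "i \<in> verts G"
    interpret C: preadditive_category "Cat D i" by (rule preadd_Cat[OF i])
    have "cm (Comp RC x f) i = cm (Zero RC (Dom RC f) (Cod RC x)) i" using x(3) by simp
    then have "cm x i \<odot>\<^bsub>Cat D i\<^esub> cm f i = Zero (Cat D i) (ROb (Dom RC f) i) (ROb (Cod RC x) i)" using i by simp
    then show "cm x i = cm (Zero RC (Cod RC f) (Cod RC x)) i"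
      using C.epic_zeroD[OF m[OF i], of "cm x i"] i X(3-5)[OF i] F(3-5)[OF i] x(2) by simp
  qed (use X F x in simp_all)
qed

text \<open>The factorizations at the vertices form a morphism of representations: both sides of the
  square of an arc agree after composition with the component of \<open>k\<close>, which is
  monic.\<close>

lemma RC_kernelI:
  assumes f: "f \<in> Mor RC" and k: "k \<in> Mor RC" "Cod RC k = Dom RC f"
    and K: "\<And>i. i \<in> verts G \<Longrightarrow> is_kernel (Cat D i) (cm f i) (cm k i)"
  shows "is_kernel RC f k"
proof (rule RC.kernelI[OF f _ k(2)])
  note F = RC_MorD[OF f] and KK = RC_MorD[OF k(1)]
  show "monic RC k" by (rule RC_monicI[OF k(1)]) (rule preadditive_category.kernel_monic[OF preadd_Cat K])
  show "Comp RC f k = Zero RC (Dom RC k) (Cod RC f)"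
  proof (rule RC_ext)
    fix i assume i: "i \<in> verts G"
    show "cm (Comp RC f k) i = cm (Zero RC (Dom RC k) (Cod RC f)) i"
      using preadditive_category.kernelD(4)[OF preadd_Cat[OF i] K[OF i]] i F(3-5)[OF i] KK(3-5)[OF i] k(2) by simp
  qed (use F KK f k in simp_all)
  fix g assume g: "g \<in> Mor RC" "Cod RC g = Dom RC f" "Comp RC f g = Zero RC (Dom RC g) (Cod RC f)"
  note GG = RC_MorD[OF g(1)]
  have "\<exists>t. t \<in> Mor (Cat D i) \<and> Dom (Cat D i) t = ROb (Dom RC g) i \<and> Cod (Cat D i) t = ROb (Dom RC k) i \<and>
      cm k i \<odot>\<^bsub>Cat D i\<^esub> t = cm g i" if i: "i \<in> verts G" for i
  proof -
    interpret C: preadditive_category "Cat D i" by (rule preadd_Cat[OF i])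
    have "cm (Comp RC f g) i = cm (Zero RC (Dom RC g) (Cod RC f)) i" using g(3) by simp
    then have z: "cm f i \<odot>\<^bsub>Cat D i\<^esub> cm g i = Zero (Cat D i) (Dom (Cat D i) (cm g i)) (Cod (Cat D i) (cm f i))"
      using i F(3-5)[OF i] GG(3-5)[OF i] by simp
    show ?thesis
      by (rule C.kernel_lift[OF K[OF i] _ _ z]) (use i F(3-5)[OF i] GG(3-5)[OF i] KK(3-5)[OF i] g(2) in auto)
  qed
  then obtain t where t: "\<And>i. i \<in> verts G \<Longrightarrow> t i \<in> Mor (Cat D i) \<and> Dom (Cat D i) (t i) = ROb (Dom RC g) i \<and> Cod (Cat D i) (t i) = ROb (Dom RC k) i \<and>
      cm k i \<odot>\<^bsub>Cat D i\<^esub> t i = cm g i" by metis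
  let ?t = "mk (Dom RC g) t (Dom RC k)"
  have T: "?t \<in> Mor RC"
  proof (rule mk_Mor)
    fix a assume a: "a \<in> arcs G"
    let ?k = "head G a" and ?l = "tail G a" and ?F = "FMor (Fun D (arr a))"
    let ?C = "Cat D ?k"
    have v: "?k \<in> verts G" "?l \<in> verts G" using a by simp_all
    interpret C: preadditive_category ?C by (rule preadd_Cat[OF v(1)])
    show "t ?k \<odot>\<^bsub>?C\<^esub> RMor (Dom RC g) (arr a) = RMor (Dom RC k) (arr a) \<odot>\<^bsub>?C\<^esub> ?F (t ?l)"
    proof (rule C.monicD[OF C.kernel_monic[OF K[OF v(1)]]])
      have "cm k ?k \<odot>\<^bsub>?C\<^esub> (t ?k \<odot>\<^bsub>?C\<^esub> RMor (Dom RC g) (arr a)) = (cm k ?k \<odot>\<^bsub>?C\<^esub> t ?k) \<odot>\<^bsub>?C\<^esub> RMor (Dom RC g) (arr a)"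
        by (rule C.comp_assoc[symmetric]) (use a v t[OF v(1)] KK(3-5)[OF v(1)] GG(1) in simp_all)
      also have "\<dots> = RMor (Dom RC f) (arr a) \<odot>\<^bsub>?C\<^esub> ?F (cm g ?l)" using t[OF v(1)] GG(6)[OF a] g(2) by simp
      also have "?F (cm g ?l) = ?F (cm k ?l) \<odot>\<^bsub>?C\<^esub> ?F (t ?l)"
        using Fun_comp[of "arr a" ?l ?k "t ?l" "cm k ?l"] a v t[OF v(2)] KK(3-5)[OF v(2)] by simp
      also have "RMor (Dom RC f) (arr a) \<odot>\<^bsub>?C\<^esub> \<dots> = (RMor (Dom RC f) (arr a) \<odot>\<^bsub>?C\<^esub> ?F (cm k ?l)) \<odot>\<^bsub>?C\<^esub> ?F (t ?l)"
        by (rule C.comp_assoc[symmetric]) (use a v t[OF v(2)] KK(3-5)[OF v(2)] F(1) k(2) in simp_all)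
      also have "\<dots> = (cm k ?k \<odot>\<^bsub>?C\<^esub> RMor (Dom RC k) (arr a)) \<odot>\<^bsub>?C\<^esub> ?F (t ?l)" using KK(6)[OF a] k(2) by simp
      also have "\<dots> = cm k ?k \<odot>\<^bsub>?C\<^esub> (RMor (Dom RC k) (arr a) \<odot>\<^bsub>?C\<^esub> ?F (t ?l))"
        by (rule C.comp_assoc) (use a v t[OF v(2)] KK(1) KK(3-5)[OF v(1)] in simp_all)
      finally show "cm k ?k \<odot>\<^bsub>?C\<^esub> (t ?k \<odot>\<^bsub>?C\<^esub> RMor (Dom RC g) (arr a)) = cm k ?k \<odot>\<^bsub>?C\<^esub> (RMor (Dom RC k) (arr a) \<odot>\<^bsub>?C\<^esub> ?F (t ?l))" .
    qed (use a v t[OF v(1)] t[OF v(2)] KK(1) KK(3-5)[OF v(1)] GG(1) in simp_all)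
  qed (use t GG KK in simp_all)
  have "Comp RC k ?t = g"
    by (rule RC_ext) (use T k g t in simp_all)
  then show "\<exists>h. h \<in> Mor RC \<and> Dom RC h = Dom RC g \<and> Cod RC h = Dom RC k \<and> Comp RC k h = g"
    using T by (intro exI[of _ ?t]) simp
qed

text \<open>Here the square of an arc is tested by precomposition with \<open>D_a\<close> of the
  component of \<open>k\<close> at the tail. It is epic because \<open>D_a\<close> preserves
  cokernels, which is where exactness of the diagram enters.\<close>

lemma RC_cokernelI:
  assumes f: "f \<in> Mor RC" and k: "k \<in> Mor RC" "Dom RC k = Cod RC f"
    and K: "\<And>i. i \<in> verts G \<Longrightarrow> is_cokernel (Cat D i) (cm f i) (cm k i)"
  shows "is_cokernel RC f k"
proof (rule RC.cokernelI[OF f _ k(2)])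
  note F = RC_MorD[OF f] and KK = RC_MorD[OF k(1)]
  show "epic RC k" by (rule RC_epicI[OF k(1)]) (rule preadditive_category.cokernel_epic[OF preadd_Cat K])
  show "Comp RC k f = Zero RC (Dom RC f) (Cod RC k)"
  proof (rule RC_ext)
    fix i assume i: "i \<in> verts G"
    show "cm (Comp RC k f) i = cm (Zero RC (Dom RC f) (Cod RC k)) i"
      using preadditive_category.cokernelD(4)[OF preadd_Cat[OF i] K[OF i]] i F(3-5)[OF i] KK(3-5)[OF i] k(2) by simp
  qed (use F KK f k in simp_all)
  fix g assume g: "g \<in> Mor RC" "Dom RC g = Cod RC f" "Comp RC g f = Zero RC (Dom RC f) (Cod RC g)"
  note GG = RC_MorD[OF g(1)]
  have "\<exists>t. t \<in> Mor (Cat D i) \<and> Cod (Cat D i) t = ROb (Cod RC g) i \<and> Dom (Cat D i) t = ROb (Cod RC k) i \<and>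
      t \<odot>\<^bsub>Cat D i\<^esub> cm k i = cm g i" if i: "i \<in> verts G" for i
  proof -
    interpret C: preadditive_category "Cat D i" by (rule preadd_Cat[OF i])
    have "cm (Comp RC g f) i = cm (Zero RC (Dom RC f) (Cod RC g)) i" using g(3) by simp
    then have z: "cm g i \<odot>\<^bsub>Cat D i\<^esub> cm f i = Zero (Cat D i) (Dom (Cat D i) (cm f i)) (Cod (Cat D i) (cm g i))"
      using i F(3-5)[OF i] GG(3-5)[OF i] by simp
    show ?thesis
      by (rule C.cokernel_lift[OF K[OF i] _ _ z]) (use i F(3-5)[OF i] GG(3-5)[OF i] KK(3-5)[OF i] g(2) in auto)
  qed
  then obtain t where t: "\<And>i. i \<in> verts G \<Longrightarrow> t i \<in> Mor (Cat D i) \<and> Cod (Cat D i) (t i) = ROb (Cod RC g) i \<and> Dom (Cat D i) (t i) = ROb (Cod RC k) i \<and>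
      t i \<odot>\<^bsub>Cat D i\<^esub> cm k i = cm g i" by metis
  let ?t = "mk (Cod RC k) t (Cod RC g)"
  have T: "?t \<in> Mor RC"
  proof (rule mk_Mor)
    fix a assume a: "a \<in> arcs G"
    let ?k = "head G a" and ?l = "tail G a" and ?F = "FMor (Fun D (arr a))"
    let ?C = "Cat D ?k"
    have v: "?k \<in> verts G" "?l \<in> verts G" using a by simp_all
    interpret C: preadditive_category ?C by (rule preadd_Cat[OF v(1)])
    have ek: "epic ?C (?F (cm k ?l))"
      by (rule C.cokernel_epic[OF Fun_cokernel[OF arr_path(1)[OF a] arr_path(2,3) K[OF v(2)]]])
    show "t ?k \<odot>\<^bsub>?C\<^esub> RMor (Cod RC k) (arr a) = RMor (Cod RC g) (arr a) \<odot>\<^bsub>?C\<^esub> ?F (t ?l)"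
    proof (rule C.epicD[OF ek])
      have "(t ?k \<odot>\<^bsub>?C\<^esub> RMor (Cod RC k) (arr a)) \<odot>\<^bsub>?C\<^esub> ?F (cm k ?l) = t ?k \<odot>\<^bsub>?C\<^esub> (RMor (Cod RC k) (arr a) \<odot>\<^bsub>?C\<^esub> ?F (cm k ?l))"
        by (rule C.comp_assoc) (use a v t[OF v(1)] KK(1,2) KK(3-5)[OF v(2)] in simp_all)
      also have "\<dots> = (t ?k \<odot>\<^bsub>?C\<^esub> cm k ?k) \<odot>\<^bsub>?C\<^esub> RMor (Cod RC f) (arr a)"
        unfolding KK(6)[OF a, symmetric] k(2) by (rule C.comp_assoc[symmetric]) (use a v t[OF v(1)] KK(3-5)[OF v(1)] F(2) k(2) in simp_all)
      also have "\<dots> = RMor (Cod RC g) (arr a) \<odot>\<^bsub>?C\<^esub> ?F (cm g ?l)" using t[OF v(1)] GG(6)[OF a] g(2) by simp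
      also have "?F (cm g ?l) = ?F (t ?l) \<odot>\<^bsub>?C\<^esub> ?F (cm k ?l)"
        using Fun_comp[of "arr a" ?l ?k "cm k ?l" "t ?l"] a v t[OF v(2)] KK(3-5)[OF v(2)] by simp
      also have "RMor (Cod RC g) (arr a) \<odot>\<^bsub>?C\<^esub> \<dots> = (RMor (Cod RC g) (arr a) \<odot>\<^bsub>?C\<^esub> ?F (t ?l)) \<odot>\<^bsub>?C\<^esub> ?F (cm k ?l)"
        by (rule C.comp_assoc[symmetric]) (use a v t[OF v(2)] KK(3-5)[OF v(2)] GG(2) in simp_all)
      finally show "(t ?k \<odot>\<^bsub>?C\<^esub> RMor (Cod RC k) (arr a)) \<odot>\<^bsub>?C\<^esub> ?F (cm k ?l) = (RMor (Cod RC g) (arr a) \<odot>\<^bsub>?C\<^esub> ?F (t ?l)) \<odot>\<^bsub>?C\<^esub> ?F (cm k ?l)" .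
    qed (use a v t[OF v(1)] t[OF v(2)] KK(2) KK(3-5)[OF v(2)] GG(2) in simp_all)
  qed (use t GG KK in simp_all)
  have "Comp RC ?t k = g"
    by (rule RC_ext) (use T k g t in simp_all)
  then show "\<exists>h. h \<in> Mor RC \<and> Cod RC h = Cod RC g \<and> Dom RC h = Cod RC k \<and> Comp RC h k = g"
    using T by (intro exI[of _ ?t]) simp
qed

text \<open>The map along an arc \<open>a\<close> is induced by the kernel at the head:
  \<open>D_a\<close> of the kernel at the tail, followed by the structure map, is killed by the
  component of \<open>f\<close> there.\<close>

lemma ex_RC_kernel:
  assumes f: "f \<in> Mor RC"
  obtains k where "k \<in> Mor RC" "Cod RC k = Dom RC f" "\<And>i. i \<in> verts G \<Longrightarrow> is_kernel (Cat D i) (cm f i) (cm k i)"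
proof -
  note F = RC_MorD[OF f]
  have "\<exists>k. is_kernel (Cat D i) (cm f i) k" if i: "i \<in> verts G" for i
    using abelian_category.ex_kernel[OF abelian_Cat[OF i] F(3)[OF i]] .
  then obtain k where k: "\<And>i. i \<in> verts G \<Longrightarrow> is_kernel (Cat D i) (cm f i) (k i)" by metis
  have K: "k i \<in> Mor (Cat D i)" "Cod (Cat D i) (k i) = ROb (Dom RC f) i"
    "cm f i \<odot>\<^bsub>Cat D i\<^esub> k i = Zero (Cat D i) (Dom (Cat D i) (k i)) (ROb (Cod RC f) i)" if i: "i \<in> verts G" for i
    using preadditive_category.kernelD[OF preadd_Cat[OF i] k[OF i]] F(3-5)[OF i] by simp_all
  let ?X = "\<lambda>i. Dom (Cat D i) (k i)"
  have "\<exists>t. t \<in> Hom (Cat D (head G a)) (FOb (Fun D (arr a)) (?X (tail G a))) (?X (head G a)) \<and>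
      k (head G a) \<odot>\<^bsub>Cat D (head G a)\<^esub> t = RMor (Dom RC f) (arr a) \<odot>\<^bsub>Cat D (head G a)\<^esub> FMor (Fun D (arr a)) (k (tail G a))"
    if a: "a \<in> arcs G" for a
  proof -
    let ?k = "head G a" and ?l = "tail G a" and ?F = "FMor (Fun D (arr a))"
    let ?C = "Cat D ?k"
    have v: "?k \<in> verts G" "?l \<in> verts G" using a by simp_all
    interpret C: preadditive_category ?C by (rule preadd_Cat[OF v(1)])
    have "cm f ?k \<odot>\<^bsub>?C\<^esub> (RMor (Dom RC f) (arr a) \<odot>\<^bsub>?C\<^esub> ?F (k ?l)) = (cm f ?k \<odot>\<^bsub>?C\<^esub> RMor (Dom RC f) (arr a)) \<odot>\<^bsub>?C\<^esub> ?F (k ?l)"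
      by (rule C.comp_assoc[symmetric]) (use a v F(1) F(3-5)[OF v(1)] K[OF v(2)] in simp_all)
    also have "\<dots> = RMor (Cod RC f) (arr a) \<odot>\<^bsub>?C\<^esub> (?F (cm f ?l) \<odot>\<^bsub>?C\<^esub> ?F (k ?l))"
      unfolding F(6)[OF a] by (rule C.comp_assoc) (use a v F(2) F(3-5)[OF v(2)] K[OF v(2)] in simp_all)
    also have "?F (cm f ?l) \<odot>\<^bsub>?C\<^esub> ?F (k ?l) = ?F (Zero (Cat D ?l) (?X ?l) (ROb (Cod RC f) ?l))"
      unfolding K(3)[OF v(2), symmetric] by (rule Fun_comp[symmetric]) (use a v F(3-5)[OF v(2)] K[OF v(2)] in simp_all)
    also have "RMor (Cod RC f) (arr a) \<odot>\<^bsub>?C\<^esub> \<dots> = Zero ?C (FOb (Fun D (arr a)) (?X ?l)) (ROb (Cod RC f) ?k)"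
      using a v F(2) K(1)[OF v(2)] by (simp add: Fun_zero[OF _ arr_path(2,3)])
    finally have z: "cm f ?k \<odot>\<^bsub>?C\<^esub> (RMor (Dom RC f) (arr a) \<odot>\<^bsub>?C\<^esub> ?F (k ?l)) =
      Zero ?C (Dom ?C (RMor (Dom RC f) (arr a) \<odot>\<^bsub>?C\<^esub> ?F (k ?l))) (Cod ?C (cm f ?k))"
      using a v F(1) F(3-5)[OF v(1)] K[OF v(2)] by simp
    show ?thesis
      by (rule C.kernel_lift[OF k[OF v(1)] _ _ z]) (use a v F(1) F(3-5)[OF v(1)] K[OF v(2)] in \<open>auto simp: Hom_iff\<close>)
  qed
  then obtain t where t: "\<And>a. a \<in> arcs G \<Longrightarrow> t a \<in> Hom (Cat D (head G a)) (FOb (Fun D (arr a)) (?X (tail G a))) (?X (head G a))"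
      "\<And>a. a \<in> arcs G \<Longrightarrow> k (head G a) \<odot>\<^bsub>Cat D (head G a)\<^esub> t a = RMor (Dom RC f) (arr a) \<odot>\<^bsub>Cat D (head G a)\<^esub> FMor (Fun D (arr a)) (k (tail G a))"
    by metis
  obtain L where L: "isrep L" "\<And>i. i \<in> verts G \<Longrightarrow> ROb L i = ?X i" "\<And>a. a \<in> arcs G \<Longrightarrow> RMor L (arr a) = t a"
    by (rule ex_rep_of_arrows[of ?X t]) (use K(1) t(1) in simp_all)
  have "mk L k (Dom RC f) \<in> Mor RC" by (rule mk_Mor) (use L F K t in simp_all)
  then show thesis by (rule that) (use k in simp_all)
qed

text \<open>The map along an arc \<open>a\<close> has to start from \<open>D_a\<close> of the
  cokernel at the tail, so that it is induced by the universal property of the cokernel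
  \<open>D_a k\<close> of \<open>D_a f\<close>.\<close>

lemma ex_RC_cokernel:
  assumes f: "f \<in> Mor RC"
  obtains k where "k \<in> Mor RC" "Dom RC k = Cod RC f" "\<And>i. i \<in> verts G \<Longrightarrow> is_cokernel (Cat D i) (cm f i) (cm k i)"
proof -
  note F = RC_MorD[OF f]
  have "\<exists>k. is_cokernel (Cat D i) (cm f i) k" if i: "i \<in> verts G" for i
    using abelian_category.ex_cokernel[OF abelian_Cat[OF i] F(3)[OF i]] .
  then obtain k where k: "\<And>i. i \<in> verts G \<Longrightarrow> is_cokernel (Cat D i) (cm f i) (k i)" by metis
  have K: "k i \<in> Mor (Cat D i)" "Dom (Cat D i) (k i) = ROb (Cod RC f) i"
    "k i \<odot>\<^bsub>Cat D i\<^esub> cm f i = Zero (Cat D i) (ROb (Dom RC f) i) (Cod (Cat D i) (k i))" if i: "i \<in> verts G" for i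
    using preadditive_category.cokernelD[OF preadd_Cat[OF i] k[OF i]] F(3-5)[OF i] by simp_all
  let ?X = "\<lambda>i. Cod (Cat D i) (k i)"
  have "\<exists>t. t \<in> Hom (Cat D (head G a)) (FOb (Fun D (arr a)) (?X (tail G a))) (?X (head G a)) \<and>
      k (head G a) \<odot>\<^bsub>Cat D (head G a)\<^esub> RMor (Cod RC f) (arr a) = t \<odot>\<^bsub>Cat D (head G a)\<^esub> FMor (Fun D (arr a)) (k (tail G a))"
    if a: "a \<in> arcs G" for a
  proof -
    let ?k = "head G a" and ?l = "tail G a" and ?F = "FMor (Fun D (arr a))"
    let ?C = "Cat D ?k"
    have v: "?k \<in> verts G" "?l \<in> verts G" using a by simp_all
    interpret C: preadditive_category ?C by (rule preadd_Cat[OF v(1)])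
    have ck: "is_cokernel ?C (?F (cm f ?l)) (?F (k ?l))"
      by (rule Fun_cokernel[OF _ _ _ k[OF v(2)]]) (use a in simp_all)
    let ?g = "k ?k \<odot>\<^bsub>?C\<^esub> RMor (Cod RC f) (arr a)"
    have "?g \<odot>\<^bsub>?C\<^esub> ?F (cm f ?l) = k ?k \<odot>\<^bsub>?C\<^esub> (RMor (Cod RC f) (arr a) \<odot>\<^bsub>?C\<^esub> ?F (cm f ?l))"
      by (rule C.comp_assoc) (use a v F(2) F(3-5)[OF v(2)] K[OF v(1)] in simp_all)
    also have "\<dots> = (k ?k \<odot>\<^bsub>?C\<^esub> cm f ?k) \<odot>\<^bsub>?C\<^esub> RMor (Dom RC f) (arr a)"
      unfolding F(6)[OF a, symmetric] by (rule C.comp_assoc[symmetric]) (use a v F(1) F(3-5)[OF v(1)] K[OF v(1)] in simp_all)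
    also have "\<dots> = Zero ?C (Dom ?C (?F (cm f ?l))) (Cod ?C ?g)"
      unfolding K(3)[OF v(1)] using a v F(1,2) F(3-5)[OF v(2)] K(1,2)[OF v(1)] by simp
    finally have z: "?g \<odot>\<^bsub>?C\<^esub> ?F (cm f ?l) = Zero ?C (Dom ?C (?F (cm f ?l))) (Cod ?C ?g)" .
    obtain t where t: "t \<in> Mor ?C" "Cod ?C t = Cod ?C ?g" "Dom ?C t = Cod ?C (?F (k ?l))" "t \<odot>\<^bsub>?C\<^esub> ?F (k ?l) = ?g"
      by (rule C.cokernel_lift[OF ck _ _ z]) (use a v F(2) F(3-5)[OF v(2)] K[OF v(1)] in simp_all)
    then show ?thesis using a v F(2) K[OF v(1)] K[OF v(2)] by (intro exI[of _ t]) (simp add: Hom_iff)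
  qed
  then obtain t where t: "\<And>a. a \<in> arcs G \<Longrightarrow> t a \<in> Hom (Cat D (head G a)) (FOb (Fun D (arr a)) (?X (tail G a))) (?X (head G a))"
      "\<And>a. a \<in> arcs G \<Longrightarrow> k (head G a) \<odot>\<^bsub>Cat D (head G a)\<^esub> RMor (Cod RC f) (arr a) = t a \<odot>\<^bsub>Cat D (head G a)\<^esub> FMor (Fun D (arr a)) (k (tail G a))"
    by metis
  obtain L where L: "isrep L" "\<And>i. i \<in> verts G \<Longrightarrow> ROb L i = ?X i" "\<And>a. a \<in> arcs G \<Longrightarrow> RMor L (arr a) = t a"
    by (rule ex_rep_of_arrows[of ?X t]) (use K(1) t(1) in simp_all)
  have "mk (Cod RC f) k L \<in> Mor RC" by (rule mk_Mor) (use L F K t in simp_all)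
  then show thesis by (rule that) (use k in simp_all)
qed

text \<open>An arbitrary kernel of representations is isomorphic to the one built at the vertices,
  and evaluation at a vertex carries the isomorphism to one in \<open>Cat D i\<close>.\<close>

lemma RC_kernelD:
  assumes "is_kernel RC f k" "i \<in> verts G"
  shows "is_kernel (Cat D i) (cm f i) (cm k i)"
proof -
  note K = RC.kernelD[OF assms(1)]
  obtain k' where k': "k' \<in> Mor RC" "Cod RC k' = Dom RC f" "\<And>i. i \<in> verts G \<Longrightarrow> is_kernel (Cat D i) (cm f i) (cm k' i)"
    by (rule ex_RC_kernel[OF K(1)]) (rule that)
  obtain h h' where h: "h \<in> Mor RC" "Dom RC h = Dom RC k" "Cod RC h = Dom RC k'" "Comp RC k' h = k"
    "h' \<in> Mor RC" "Dom RC h' = Dom RC k'" "Cod RC h' = Dom RC k"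
    "Comp RC h h' = Id RC (Dom RC k')" "Comp RC h' h = Id RC (Dom RC k)"
    by (rule RC.kernel_iso[OF RC_kernelI[OF K(1) k'] assms(1)])
  interpret C: preadditive_category "Cat D i" by (rule preadd_Cat[OF assms(2)])
  note H = RC_MorD(3-5)[OF h(1) assms(2)] RC_MorD(3-5)[OF h(5) assms(2)] RC_MorD(3-5)[OF K(2) assms(2)] RC_MorD(3-5)[OF k'(1) assms(2)]
  show ?thesis
  proof (rule C.kernel_comp_iso[OF k'(3)[OF assms(2)], of "cm h i" _ "cm h' i"])
    show "cm k' i \<odot>\<^bsub>Cat D i\<^esub> cm h i = cm k i" using arg_cong[OF h(4), of "\<lambda>x. cm x i"] assms(2) by simp
    show "cm h i \<odot>\<^bsub>Cat D i\<^esub> cm h' i = Id (Cat D i) (Dom (Cat D i) (cm k' i))"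
      using arg_cong[OF h(8), of "\<lambda>x. cm x i"] assms(2) H by simp
    show "cm h' i \<odot>\<^bsub>Cat D i\<^esub> cm h i = Id (Cat D i) (Dom (Cat D i) (cm k i))"
      using arg_cong[OF h(9), of "\<lambda>x. cm x i"] assms(2) H by simp
  qed (use H h in simp_all)
qed

lemma RC_cokernelD:
  assumes "is_cokernel RC f k" "i \<in> verts G"
  shows "is_cokernel (Cat D i) (cm f i) (cm k i)"
proof -
  note K = RC.cokernelD[OF assms(1)]
  obtain k' where k': "k' \<in> Mor RC" "Dom RC k' = Cod RC f" "\<And>i. i \<in> verts G \<Longrightarrow> is_cokernel (Cat D i) (cm f i) (cm k' i)"
    by (rule ex_RC_cokernel[OF K(1)]) (rule that)
  obtain h h' where h: "h \<in> Mor RC" "Dom RC h = Cod RC k'" "Cod RC h = Cod RC k" "Comp RC h k' = k"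
    "h' \<in> Mor RC" "Dom RC h' = Cod RC k" "Cod RC h' = Cod RC k'"
    "Comp RC h h' = Id RC (Cod RC k)" "Comp RC h' h = Id RC (Cod RC k')"
    by (rule RC.cokernel_iso[OF RC_cokernelI[OF K(1) k'] assms(1)])
  interpret C: preadditive_category "Cat D i" by (rule preadd_Cat[OF assms(2)])
  note H = RC_MorD(3-5)[OF h(1) assms(2)] RC_MorD(3-5)[OF h(5) assms(2)] RC_MorD(3-5)[OF K(2) assms(2)] RC_MorD(3-5)[OF k'(1) assms(2)]
  show ?thesis
  proof (rule C.cokernel_comp_iso[OF k'(3)[OF assms(2)], of "cm h i" _ "cm h' i"])
    show "cm h i \<odot>\<^bsub>Cat D i\<^esub> cm k' i = cm k i" using arg_cong[OF h(4), of "\<lambda>x. cm x i"] assms(2) by simp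
    show "cm h i \<odot>\<^bsub>Cat D i\<^esub> cm h' i = Id (Cat D i) (Cod (Cat D i) (cm k i))"
      using arg_cong[OF h(8), of "\<lambda>x. cm x i"] assms(2) H by simp
    show "cm h' i \<odot>\<^bsub>Cat D i\<^esub> cm h i = Id (Cat D i) (Cod (Cat D i) (cm k' i))"
      using arg_cong[OF h(9), of "\<lambda>x. cm x i"] assms(2) H by simp
  qed (use H h in simp_all)
qed

lemma RC_short_exact_iff:
  "short_exact RC f g \<longleftrightarrow> f \<in> Mor RC \<and> g \<in> Mor RC \<and> Cod RC f = Dom RC g \<and>
     (\<forall>i\<in>verts G. short_exact (Cat D i) (cm f i) (cm g i))"
proof
  assume "short_exact RC f g"
  note S = RC.short_exactD[OF this]
  show "f \<in> Mor RC \<and> g \<in> Mor RC \<and> Cod RC f = Dom RC g \<and> (\<forall>i\<in>verts G. short_exact (Cat D i) (cm f i) (cm g i))"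
    using RC_kernelD[OF S(1)] RC_cokernelD[OF S(2)] S(3-5) by (simp add: short_exact_def)
next
  assume "f \<in> Mor RC \<and> g \<in> Mor RC \<and> Cod RC f = Dom RC g \<and> (\<forall>i\<in>verts G. short_exact (Cat D i) (cm f i) (cm g i))"
  then show "short_exact RC f g"
    using RC_kernelI[of g f] RC_cokernelI[of f g] by (simp add: short_exact_def)
qed

end

section \<open>Representations form an abelian category; thick subcategories\<close>

context quiver_diagram
begin

text \<open>The kernel of a monomorphism is the zero morphism. As a kernel it can be taken at the
  vertices, so every component of \<open>f\<close> has zero kernel.\<close>

lemma RC_monicD:
  assumes "monic RC f" "i \<in> verts G"
  shows "monic (Cat D i) (cm f i)"
proof -
  have f: "f \<in> Mor RC" using assms by (simp add: monic_def)
  note F = RC_MorD[OF f]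
  interpret C: preadditive_category "Cat D i" by (rule preadd_Cat[OF assms(2)])
  obtain k where k: "k \<in> Mor RC" "Cod RC k = Dom RC f" "\<And>i. i \<in> verts G \<Longrightarrow> is_kernel (Cat D i) (cm f i) (cm k i)"
    by (rule ex_RC_kernel[OF f]) (rule that)
  note K = RC_MorD[OF k(1)]
  have "Comp RC f k = Zero RC (Dom RC k) (Cod RC f)" using RC.kernelD[OF RC_kernelI[OF f k]] by simp
  then have "k = Zero RC (Dom RC k) (Dom RC f)" using RC.monic_zeroD[OF assms(1) _ k(1,2)] by simp
  then have "cm k i = cm (Zero RC (Dom RC k) (Dom RC f)) i" by simp
  then have kz: "cm k i = Zero (Cat D i) (ROb (Dom RC k) i) (ROb (Dom RC f) i)" using assms(2) by simp
  show ?thesis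
  proof (rule C.monicI_zero[OF F(3)[OF assms(2)]])
    fix x assume x: "x \<in> Mor (Cat D i)" "Cod (Cat D i) x = Dom (Cat D i) (cm f i)"
      "cm f i \<odot>\<^bsub>Cat D i\<^esub> x = Zero (Cat D i) (Dom (Cat D i) x) (Cod (Cat D i) (cm f i))"
    obtain h where h: "h \<in> Mor (Cat D i)" "Dom (Cat D i) h = Dom (Cat D i) x" "Cod (Cat D i) h = Dom (Cat D i) (cm k i)"
        "cm k i \<odot>\<^bsub>Cat D i\<^esub> h = x"
      by (rule C.kernel_lift[OF k(3)[OF assms(2)] x])
    have "cm k i \<odot>\<^bsub>Cat D i\<^esub> h = Zero (Cat D i) (Dom (Cat D i) x) (Dom (Cat D i) (cm f i))"
      unfolding kz using h(1-3) K(1) K(4)[OF assms(2)] F(1,4) assms(2) by simp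
    then show "x = Zero (Cat D i) (Dom (Cat D i) x) (Dom (Cat D i) (cm f i))" unfolding h(4) .
  qed
qed

lemma RC_epicD:
  assumes "epic RC f" "i \<in> verts G"
  shows "epic (Cat D i) (cm f i)"
proof -
  have f: "f \<in> Mor RC" using assms by (simp add: epic_def)
  note F = RC_MorD[OF f]
  interpret C: preadditive_category "Cat D i" by (rule preadd_Cat[OF assms(2)])
  obtain k where k: "k \<in> Mor RC" "Dom RC k = Cod RC f" "\<And>i. i \<in> verts G \<Longrightarrow> is_cokernel (Cat D i) (cm f i) (cm k i)"
    by (rule ex_RC_cokernel[OF f]) (rule that)
  note K = RC_MorD[OF k(1)]
  have "Comp RC k f = Zero RC (Dom RC f) (Cod RC k)" using RC.cokernelD[OF RC_cokernelI[OF f k]] by simp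
  then have "k = Zero RC (Cod RC f) (Cod RC k)" using RC.epic_zeroD[OF assms(1) _ k(1,2)] by simp
  then have "cm k i = cm (Zero RC (Cod RC f) (Cod RC k)) i" by simp
  then have kz: "cm k i = Zero (Cat D i) (ROb (Cod RC f) i) (ROb (Cod RC k) i)" using assms(2) by simp
  show ?thesis
  proof (rule C.epicI_zero[OF F(3)[OF assms(2)]])
    fix x assume x: "x \<in> Mor (Cat D i)" "Dom (Cat D i) x = Cod (Cat D i) (cm f i)"
      "x \<odot>\<^bsub>Cat D i\<^esub> cm f i = Zero (Cat D i) (Dom (Cat D i) (cm f i)) (Cod (Cat D i) x)"
    obtain h where h: "h \<in> Mor (Cat D i)" "Cod (Cat D i) h = Cod (Cat D i) x" "Dom (Cat D i) h = Cod (Cat D i) (cm k i)"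
        "h \<odot>\<^bsub>Cat D i\<^esub> cm k i = x"
      by (rule C.cokernel_lift[OF k(3)[OF assms(2)] x])
    have "h \<odot>\<^bsub>Cat D i\<^esub> cm k i = Zero (Cat D i) (Cod (Cat D i) (cm f i)) (Cod (Cat D i) x)"
      unfolding kz using h(1-3) K(2) K(5)[OF assms(2)] F(2,5) assms(2) by simp
    then show "x = Zero (Cat D i) (Cod (Cat D i) (cm f i)) (Cod (Cat D i) x)" unfolding h(4) .
  qed
qed

lemma RC_biproductD:
  assumes "biproduct RC A B P i j p q" "v \<in> verts G"
  shows "biproduct (Cat D v) (ROb A v) (ROb B v) (ROb P v) (cm i v) (cm j v) (cm p v) (cm q v)"
proof -
  note B = RC.biproductD[OF assms(1)]
  note t = RC_MorD(3-5)[OF B(1) assms(2)] RC_MorD(3-5)[OF B(4) assms(2)] RC_MorD(3-5)[OF B(7) assms(2)] RC_MorD(3-5)[OF B(10) assms(2)]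
  have "cm (Comp RC p i) v = cm (Id RC A) v" "cm (Comp RC q j) v = cm (Id RC B) v"
    "cm (Comp RC p j) v = cm (Zero RC B A) v" "cm (Comp RC q i) v = cm (Zero RC A B) v"
    "cm (Add RC (Comp RC i p) (Comp RC j q)) v = cm (Id RC P) v"
    unfolding B(16-19,24) by simp_all
  then show ?thesis unfolding biproduct_def Hom_iff using t B(1-12) assms(2) by simp
qed

lemma ex_RC_biproduct:
  assumes A: "isrep A" and B: "isrep B"
  obtains P i j p q where "biproduct RC A B P i j p q"
proof -
  have "\<exists>P i j p q. biproduct (Cat D v) (ROb A v) (ROb B v) P i j p q" if v: "v \<in> verts G" for v
    by (rule abelian_category.ex_biproduct[OF abelian_Cat[OF v], of "ROb A v" "ROb B v"]) (use A B v in \<open>simp_all, blast\<close>)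
  then obtain P i j p q where b: "\<And>v. v \<in> verts G \<Longrightarrow> biproduct (Cat D v) (ROb A v) (ROb B v) (P v) (i v) (j v) (p v) (q v)"
    by metis
  let ?F = "\<lambda>a. FMor (Fun D (arr a))" and ?C = "\<lambda>a. Cat D (head G a)"
  \<comment> \<open>The diagonal map of the two structure maps, written with injections and
    projections. It commutes with all four because additive functors preserve the equations of a
    biproduct.\<close>
  define m where "m a = (i (head G a) \<odot>\<^bsub>?C a\<^esub> (RMor A (arr a) \<odot>\<^bsub>?C a\<^esub> ?F a (p (tail G a)))) \<boxplus>\<^bsub>?C a\<^esub>
     (j (head G a) \<odot>\<^bsub>?C a\<^esub> (RMor B (arr a) \<odot>\<^bsub>?C a\<^esub> ?F a (q (tail G a))))" for a
  note Bp = preadditive_category.biproductD[OF preadd_Cat b]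
  have PO: "\<And>v. v \<in> verts G \<Longrightarrow> P v \<in> Ob (Cat D v)" using Bp(15) by blast
  have m: "m a \<in> Hom (?C a) (FOb (Fun D (arr a)) (P (tail G a))) (P (head G a))" if a: "a \<in> arcs G" for a
  proof -
    have v: "head G a \<in> verts G" "tail G a \<in> verts G" using a by simp_all
    show ?thesis using a v A B Bp(1-15)[OF v(1) v(1)] Bp(1-15)[OF v(2) v(2)] by (simp add: m_def Hom_iff)
  qed
  obtain M where M: "isrep M" "\<And>v. v \<in> verts G \<Longrightarrow> ROb M v = P v" "\<And>a. a \<in> arcs G \<Longrightarrow> RMor M (arr a) = m a"
    by (rule ex_rep_of_arrows[of P m]) (use PO m in simp_all)
  have arrows: "i (head G a) \<odot>\<^bsub>?C a\<^esub> RMor A (arr a) = RMor M (arr a) \<odot>\<^bsub>?C a\<^esub> ?F a (i (tail G a))"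
      "j (head G a) \<odot>\<^bsub>?C a\<^esub> RMor B (arr a) = RMor M (arr a) \<odot>\<^bsub>?C a\<^esub> ?F a (j (tail G a))"
      "p (head G a) \<odot>\<^bsub>?C a\<^esub> RMor M (arr a) = RMor A (arr a) \<odot>\<^bsub>?C a\<^esub> ?F a (p (tail G a))"
      "q (head G a) \<odot>\<^bsub>?C a\<^esub> RMor M (arr a) = RMor B (arr a) \<odot>\<^bsub>?C a\<^esub> ?F a (q (tail G a))" if a: "a \<in> arcs G" for a
  proof -
    let ?k = "head G a" and ?l = "tail G a"
    have v: "head G a \<in> verts G" "tail G a \<in> verts G" using a by simp_all
    interpret C: preadditive_category "?C a" by (rule preadd_Cat[OF v(1)])
    note Bk = Bp[OF v(1) v(1)] and Bl = Bp[OF v(2) v(2)]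
    have comp: "?F a x \<odot>\<^bsub>?C a\<^esub> ?F a y = ?F a (x \<odot>\<^bsub>Cat D ?l\<^esub> y)"
      if "y \<in> Mor (Cat D ?l)" "x \<in> Mor (Cat D ?l)" "Dom (Cat D ?l) x = Cod (Cat D ?l) y" for x y
      by (rule Fun_comp[symmetric]) (use a that in simp_all)
    have F: "?F a (p ?l) \<odot>\<^bsub>?C a\<^esub> ?F a (i ?l) = Id (?C a) (FOb (Fun D (arr a)) (ROb A ?l))"
      "?F a (q ?l) \<odot>\<^bsub>?C a\<^esub> ?F a (j ?l) = Id (?C a) (FOb (Fun D (arr a)) (ROb B ?l))"
      "?F a (p ?l) \<odot>\<^bsub>?C a\<^esub> ?F a (j ?l) = Zero (?C a) (FOb (Fun D (arr a)) (ROb B ?l)) (FOb (Fun D (arr a)) (ROb A ?l))"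
      "?F a (q ?l) \<odot>\<^bsub>?C a\<^esub> ?F a (i ?l) = Zero (?C a) (FOb (Fun D (arr a)) (ROb A ?l)) (FOb (Fun D (arr a)) (ROb B ?l))"
      using Bl(1-19) a v Fun_Id[of "arr a"] Fun_zero[OF arr_path(1)[OF a] arr_path(2,3)] A B by (simp_all add: comp)
    have t: "?F a (i ?l) \<in> Mor (?C a)" "Dom (?C a) (?F a (i ?l)) = FOb (Fun D (arr a)) (ROb A ?l)" "Cod (?C a) (?F a (i ?l)) = FOb (Fun D (arr a)) (P ?l)"
      "?F a (j ?l) \<in> Mor (?C a)" "Dom (?C a) (?F a (j ?l)) = FOb (Fun D (arr a)) (ROb B ?l)" "Cod (?C a) (?F a (j ?l)) = FOb (Fun D (arr a)) (P ?l)"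
      "?F a (p ?l) \<in> Mor (?C a)" "Dom (?C a) (?F a (p ?l)) = FOb (Fun D (arr a)) (P ?l)" "Cod (?C a) (?F a (p ?l)) = FOb (Fun D (arr a)) (ROb A ?l)"
      "?F a (q ?l) \<in> Mor (?C a)" "Dom (?C a) (?F a (q ?l)) = FOb (Fun D (arr a)) (P ?l)" "Cod (?C a) (?F a (q ?l)) = FOb (Fun D (arr a)) (ROb B ?l)"
      "RMor A (arr a) \<in> Mor (?C a)" "Dom (?C a) (RMor A (arr a)) = FOb (Fun D (arr a)) (ROb A ?l)" "Cod (?C a) (RMor A (arr a)) = ROb A ?k"
      "RMor B (arr a) \<in> Mor (?C a)" "Dom (?C a) (RMor B (arr a)) = FOb (Fun D (arr a)) (ROb B ?l)" "Cod (?C a) (RMor B (arr a)) = ROb B ?k"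
      "FOb (Fun D (arr a)) (ROb A ?l) \<in> Ob (?C a)" "FOb (Fun D (arr a)) (ROb B ?l) \<in> Ob (?C a)" "FOb (Fun D (arr a)) (P ?l) \<in> Ob (?C a)"
      using Bl(1-15) a v A B by simp_all
    show "i ?k \<odot>\<^bsub>?C a\<^esub> RMor A (arr a) = RMor M (arr a) \<odot>\<^bsub>?C a\<^esub> ?F a (i ?l)"
      "j ?k \<odot>\<^bsub>?C a\<^esub> RMor B (arr a) = RMor M (arr a) \<odot>\<^bsub>?C a\<^esub> ?F a (j ?l)"
      "p ?k \<odot>\<^bsub>?C a\<^esub> RMor M (arr a) = RMor A (arr a) \<odot>\<^bsub>?C a\<^esub> ?F a (p ?l)"
      "q ?k \<odot>\<^bsub>?C a\<^esub> RMor M (arr a) = RMor B (arr a) \<odot>\<^bsub>?C a\<^esub> ?F a (q ?l)"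
      unfolding M(3)[OF a] m_def using Bk(1-23) t F by (simp_all add: C.comp_add C.add_comp C.comp_assoc)
  qed
  let ?i = "mk A i M" and ?j = "mk B j M" and ?p = "mk M p A" and ?q = "mk M q B"
  have mor: "?i \<in> Mor RC" "?j \<in> Mor RC" "?p \<in> Mor RC" "?q \<in> Mor RC"
    by (rule mk_Mor; use A B M(1,2) Bp(1-12) arrows in simp)+
  have DC: "Dom RC (Add RC x y) = Dom RC x" "Cod RC (Add RC x y) = Cod RC x" for x y
    by (simp_all add: RC_Add_mk)
  have e: "Comp RC ?p ?i = Id RC A" "Comp RC ?q ?j = Id RC B" "Comp RC ?p ?j = Zero RC B A" "Comp RC ?q ?i = Zero RC A B"
    "Add RC (Comp RC ?i ?p) (Comp RC ?j ?q) = Id RC M"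
    by (rule RC_ext; use mor A B M(1,2) Bp(16-19,24) in \<open>simp add: DC\<close>)+
  have "biproduct RC A B M ?i ?j ?p ?q" unfolding biproduct_def Hom_iff using mor e by simp
  then show thesis by (rule that)
qed

lemma RC_abelian: "abelian_category RC"
proof (intro abelian_category.intro abelian_category_axioms.intro RC_preadditive)
  have "\<exists>Z. zero_object (Cat D v) Z" if v: "v \<in> verts G" for v
    using abelian_category.ex_zero_object[OF abelian_Cat[OF v]] .
  then obtain Z where Z: "\<And>v. v \<in> verts G \<Longrightarrow> zero_object (Cat D v) (Z v)" by metis
  have ZO: "\<And>v. v \<in> verts G \<Longrightarrow> Z v \<in> Ob (Cat D v)" using Z by (simp add: zero_object_def)
  obtain M where M: "isrep M" "\<And>v. v \<in> verts G \<Longrightarrow> ROb M v = Z v"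
    by (rule ex_rep_of_arrows[of Z "\<lambda>a. Zero (Cat D (head G a)) (FOb (Fun D (arr a)) (Z (tail G a))) (Z (head G a))"])
      (use ZO in \<open>simp_all add: Hom_iff\<close>)
  have to_M: "f = Zero RC A M" if "f \<in> Hom RC A M" for f A
  proof (rule RC_ext)
    have f: "f \<in> Mor RC" "Dom RC f = A" "Cod RC f = M" using that by (simp_all add: Hom_iff)
    note F = RC_MorD[OF f(1), unfolded f(2,3)]
    show "f \<in> Mor RC" "Zero RC A M \<in> Mor RC" "Dom RC (Zero RC A M) = Dom RC f" "Cod RC (Zero RC A M) = Cod RC f"
      using f F M by simp_all
    show "cm f v = cm (Zero RC A M) v" if v: "v \<in> verts G" for v
      using preadditive_category.zero_object_cod[OF preadd_Cat[OF v] Z[OF v], of "cm f v"] F(3-5)[OF v] M(2)[OF v] v by simp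
  qed
  have from_M: "f = Zero RC M A" if "f \<in> Hom RC M A" for f A
  proof (rule RC_ext)
    have f: "f \<in> Mor RC" "Dom RC f = M" "Cod RC f = A" using that by (simp_all add: Hom_iff)
    note F = RC_MorD[OF f(1), unfolded f(2,3)]
    show "f \<in> Mor RC" "Zero RC M A \<in> Mor RC" "Dom RC (Zero RC M A) = Dom RC f" "Cod RC (Zero RC M A) = Cod RC f"
      using f F M by simp_all
    show "cm f v = cm (Zero RC M A) v" if v: "v \<in> verts G" for v
      using preadditive_category.zero_object_dom[OF preadd_Cat[OF v] Z[OF v], of "cm f v"] F(3-5)[OF v] M(2)[OF v] v by simp
  qed
  have "zero_object RC M" unfolding zero_object_def
  proof (intro conjI ballI)
    fix A assume A: "A \<in> Ob RC"
    show "\<exists>!f. f \<in> Hom RC A M"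
      by (rule ex1I[OF _ to_M]) (use A M(1) in \<open>simp_all add: Hom_iff\<close>)
    show "\<exists>!f. f \<in> Hom RC M A"
      by (rule ex1I[OF _ from_M]) (use A M(1) in \<open>simp_all add: Hom_iff\<close>)
  qed (use M in simp)
  then show "\<exists>Z. zero_object RC Z" by blast
  show "\<exists>P. is_direct_sum RC A B P" if "A \<in> Ob RC" "B \<in> Ob RC" for A B
  proof -
    obtain P i j p q where "biproduct RC A B P i j p q" by (rule ex_RC_biproduct[of A B]) (use \<open>A \<in> Ob RC\<close> \<open>B \<in> Ob RC\<close> in simp_all)
    then show ?thesis using RC.direct_sum_if_biproduct by blast
  qed
  show "\<exists>k. is_kernel RC f k" if f: "f \<in> Mor RC" for f
  proof -
    obtain k where "k \<in> Mor RC" "Cod RC k = Dom RC f" "\<And>i. i \<in> verts G \<Longrightarrow> is_kernel (Cat D i) (cm f i) (cm k i)"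
      by (rule ex_RC_kernel[OF f]) (rule that)
    then show ?thesis using RC_kernelI[OF f] by blast
  qed
  show "\<exists>k. is_cokernel RC f k" if f: "f \<in> Mor RC" for f
  proof -
    obtain k where "k \<in> Mor RC" "Dom RC k = Cod RC f" "\<And>i. i \<in> verts G \<Longrightarrow> is_cokernel (Cat D i) (cm f i) (cm k i)"
      by (rule ex_RC_cokernel[OF f]) (rule that)
    then show ?thesis using RC_cokernelI[OF f] by blast
  qed
  show "\<exists>g. is_kernel RC g f" if f: "monic RC f" for f
  proof -
    have fm: "f \<in> Mor RC" using f by (simp add: monic_def)
    obtain c where c: "c \<in> Mor RC" "Dom RC c = Cod RC f" "\<And>i. i \<in> verts G \<Longrightarrow> is_cokernel (Cat D i) (cm f i) (cm c i)"
      by (rule ex_RC_cokernel[OF fm]) (rule that)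
    have "is_kernel RC c f"
      by (rule RC_kernelI[OF c(1) fm c(2)[symmetric]]) (rule abelian_category.kernel_of_cokernel[OF abelian_Cat RC_monicD[OF f] c(3)])
    then show ?thesis by blast
  qed
  show "\<exists>g. is_cokernel RC g f" if f: "epic RC f" for f
  proof -
    have fm: "f \<in> Mor RC" using f by (simp add: epic_def)
    obtain c where c: "c \<in> Mor RC" "Cod RC c = Dom RC f" "\<And>i. i \<in> verts G \<Longrightarrow> is_kernel (Cat D i) (cm f i) (cm c i)"
      by (rule ex_RC_kernel[OF fm]) (rule that)
    have "is_cokernel RC c f"
      by (rule RC_cokernelI[OF c(1) fm c(2)[symmetric]]) (rule abelian_category.cokernel_of_kernel[OF abelian_Cat RC_epicD[OF f] c(3)])
    then show ?thesis by blast
  qed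
qed

sublocale RC: abelian_category RC by (rule RC_abelian)

lemma Rep_sub_iff [simp]: "M \<in> Rep_sub PC D S \<longleftrightarrow> isrep M \<and> (\<forall>i\<in>verts G. ROb M i \<in> S i)"
  by (simp add: Rep_sub_def)

lemma Rep_sub_closed_kernels:
  assumes "\<And>i. i \<in> verts G \<Longrightarrow> closed_kernels_of_epis (Cat D i) (S i)"
  shows "closed_kernels_of_epis RC (Rep_sub PC D S)"
  unfolding closed_kernels_of_epis_def
proof (intro allI impI)
  fix g k assume a: "epic RC g \<and> Dom RC g \<in> Rep_sub PC D S \<and> Cod RC g \<in> Rep_sub PC D S \<and> is_kernel RC g k"
  then have g: "g \<in> Mor RC" and k: "k \<in> Mor RC" using RC.kernelD[of g k] by simp_all
  have "ROb (Dom RC k) i \<in> S i" if i: "i \<in> verts G" for i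
    using assms[OF i] a RC_epicD[of g i] RC_kernelD[of g k i] i RC_MorD(4,5)[OF g i] RC_MorD(4)[OF k i]
    unfolding closed_kernels_of_epis_def by (metis Rep_sub_iff)
  then show "Dom RC k \<in> Rep_sub PC D S" using RC_MorD(1)[OF k] by simp
qed

lemma Rep_sub_closed_cokernels:
  assumes "\<And>i. i \<in> verts G \<Longrightarrow> closed_cokernels_of_monos (Cat D i) (S i)"
  shows "closed_cokernels_of_monos RC (Rep_sub PC D S)"
  unfolding closed_cokernels_of_monos_def
proof (intro allI impI)
  fix g k assume a: "monic RC g \<and> Dom RC g \<in> Rep_sub PC D S \<and> Cod RC g \<in> Rep_sub PC D S \<and> is_cokernel RC g k"
  then have g: "g \<in> Mor RC" and k: "k \<in> Mor RC" using RC.cokernelD[of g k] by simp_all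
  have "ROb (Cod RC k) i \<in> S i" if i: "i \<in> verts G" for i
    using assms[OF i] a RC_monicD[of g i] RC_cokernelD[of g k i] i RC_MorD(4,5)[OF g i] RC_MorD(5)[OF k i]
    unfolding closed_cokernels_of_monos_def by (metis Rep_sub_iff)
  then show "Cod RC k \<in> Rep_sub PC D S" using RC_MorD(2)[OF k] by simp
qed

lemma Rep_sub_thick:
  assumes W: "\<And>i. i \<in> verts G \<Longrightarrow> thick (Cat D i) (S i)"
  shows "thick RC (Rep_sub PC D S)"
  unfolding thick_def
proof (intro conjI allI ballI impI)
  show "Rep_sub PC D S \<subseteq> Ob RC" by auto
  show "A \<in> Rep_sub PC D S" if "A \<in> Ob RC" "B \<in> Ob RC" "P \<in> Rep_sub PC D S" and d: "is_direct_sum RC A B P" for A B P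
  proof -
    \<comment> \<open>A coproduct diagram says nothing about single vertices; the equations of a
      biproduct do, and at each vertex they yield a direct sum again.\<close>
    obtain i j p q where b: "biproduct RC A B P i j p q" by (rule RC.biproduct_if_direct_sum[OF d])
    have "ROb A v \<in> S v" if v: "v \<in> verts G" for v
    proof -
      interpret C: preadditive_category "Cat D v" by (rule preadd_Cat[OF v])
      have "is_direct_sum (Cat D v) (ROb A v) (ROb B v) (ROb P v)"
        by (rule C.direct_sum_if_biproduct[OF RC_biproductD[OF b v]])
      moreover have "ROb A v \<in> Ob (Cat D v)" "ROb B v \<in> Ob (Cat D v)" "ROb P v \<in> S v"
        using v \<open>A \<in> Ob RC\<close> \<open>B \<in> Ob RC\<close> \<open>P \<in> Rep_sub PC D S\<close> by simp_all
      ultimately show ?thesis using W[OF v] unfolding thick_def by blast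
    qed
    then show ?thesis using \<open>A \<in> Ob RC\<close> by simp
  qed
  fix f g assume a: "short_exact RC f g \<and> Dom RC f \<in> Rep_sub PC D S \<and> Cod RC g \<in> Rep_sub PC D S"
  then have fg: "f \<in> Mor RC" "g \<in> Mor RC" "\<forall>i\<in>verts G. short_exact (Cat D i) (cm f i) (cm g i)"
    by (simp_all add: RC_short_exact_iff)
  have "ROb (Cod RC f) v \<in> S v" if v: "v \<in> verts G" for v
    using W[OF v] fg(3) a v RC_MorD(4,5)[OF fg(1) v] RC_MorD(5)[OF fg(2) v] unfolding thick_def by (metis Rep_sub_iff)
  then show "Cod RC f \<in> Rep_sub PC D S" using RC_MorD(2)[OF fg(1)] by simp
qed (use W in \<open>auto intro!: Rep_sub_closed_kernels Rep_sub_closed_cokernels simp: thick_def\<close>)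

section \<open>Limits and colimits of representations\<close>

definition comp_at :: "('j, 'k, ('v, ('v, 'a) path, 'o, 'm) rep, ('v, ('v, 'a) path, 'o, 'm) rep_mor) func \<Rightarrow> 'v \<Rightarrow> ('j, 'k, 'o, 'm) func" where
  "comp_at F i = \<lparr>FOb = (\<lambda>j. ROb (FOb F j) i), FMor = (\<lambda>a. cm (FMor F a) i)\<rparr>"

lemma comp_at_simps [simp]: "FOb (comp_at F i) j = ROb (FOb F j) i" "FMor (comp_at F i) a = cm (FMor F a) i"
  by (simp_all add: comp_at_def)

lemma comp_at_functor:
  assumes F: "cat_functor J RC F" and i: "i \<in> verts G"
  shows "cat_functor J (Cat D i) (comp_at F i)"
proof -
  interpret F: cat_functor J RC F by fact
  show ?thesis
  proof (intro cat_functor.intro F.source.category_axioms cat_Cat i cat_functor_axioms.intro)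
    show "FOb (comp_at F i) A \<in> Ob (Cat D i)" if "A \<in> Ob J" for A using F.FOb_in_Ob[OF that] i by simp
    show "FMor (comp_at F i) f \<in> Hom (Cat D i) (FOb (comp_at F i) A) (FOb (comp_at F i) B)" if "f \<in> Hom J A B" for f A B
    proof -
      have f: "FMor F f \<in> Mor RC" "Dom RC (FMor F f) = FOb F A" "Cod RC (FMor F f) = FOb F B"
        using F.FMor_in_Hom[OF that] by (simp_all add: Hom_iff)
      show ?thesis using RC_MorD(3-5)[OF f(1) i] f by (simp add: Hom_iff)
    qed
    show "FMor (comp_at F i) (Id J A) = Id (Cat D i) (FOb (comp_at F i) A)" if "A \<in> Ob J" for A
      using F.FMor_Id[OF that] i by simp
    show "FMor (comp_at F i) (Comp J g f) = FMor (comp_at F i) g \<odot>\<^bsub>Cat D i\<^esub> FMor (comp_at F i) f"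
      if "f \<in> Hom J A B" "g \<in> Hom J B B'" for f g A B B'
      using F.FMor_Comp[OF that] i by simp
  qed
qed

lemma RC_functor_mor:
  assumes F: "cat_functor J RC F" and b: "b \<in> Mor J"
  shows "FMor F b \<in> Mor RC" "Dom RC (FMor F b) = FOb F (Dom J b)" "Cod RC (FMor F b) = FOb F (Cod J b)"
    "isrep (FOb F (Dom J b))" "isrep (FOb F (Cod J b))"
  using RC.functor_mor[OF F b] RC_MorD(1,2)[of "FMor F b"] by simp_all

text \<open>Take limits at all vertices. \<open>D_a\<close> applied to the limit cone at the tail,
  followed by the structure maps, is a cone at the head, and the limit there supplies the map along
  \<open>a\<close>.\<close>

lemma RC_complete:
  assumes co: "\<And>i. i \<in> verts G \<Longrightarrow> complete (U :: 'u itself) (Cat D i)"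
  shows "complete U RC"
  unfolding complete_def
proof (intro allI impI)
  fix J :: "('u, 'u) cat" and F
  assume "small_category J \<and> cat_functor J RC F"
  then have J: "small_category J" and F: "cat_functor J RC F" by simp_all
  interpret F: cat_functor J RC F by fact
  note Fi = comp_at_functor[OF F]
  have FO: "isrep (FOb F j)" if "j \<in> Ob J" for j using F.FOb_in_Ob[OF that] by simp
  have "\<exists>L p. is_limit J (Cat D i) (comp_at F i) L p" if i: "i \<in> verts G" for i
    using co[OF i] J Fi[OF i] unfolding complete_def by blast
  then obtain L p where lim: "\<And>i. i \<in> verts G \<Longrightarrow> is_limit J (Cat D i) (comp_at F i) (L i) (p i)" by metis
  have cone: "is_cone J (Cat D i) (comp_at F i) (L i) (p i)" if "i \<in> verts G" for i
    using lim[OF that] by (simp add: is_limit_def)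
  have LO: "L i \<in> Ob (Cat D i)" if "i \<in> verts G" for i using cone[OF that] by (simp add: is_cone_def)
  have p: "p i j \<in> Mor (Cat D i)" "Dom (Cat D i) (p i j) = L i" "Cod (Cat D i) (p i j) = ROb (FOb F j) i"
    if "i \<in> verts G" "j \<in> Ob J" for i j
    using category.cone_mor[OF cat_Cat[OF that(1)] cone[OF that(1)] that(2)] by simp_all
  have pc: "cm (FMor F b) i \<odot>\<^bsub>Cat D i\<^esub> p i (Dom J b) = p i (Cod J b)" if "i \<in> verts G" "b \<in> Mor J" for i b
    using cone[OF that(1)] that(2) by (simp add: is_cone_def)
  have "\<exists>m. m \<in> Hom (Cat D (head G a)) (FOb (Fun D (arr a)) (L (tail G a))) (L (head G a)) \<and>
     (\<forall>j\<in>Ob J. p (head G a) j \<odot>\<^bsub>Cat D (head G a)\<^esub> m = RMor (FOb F j) (arr a) \<odot>\<^bsub>Cat D (head G a)\<^esub> FMor (Fun D (arr a)) (p (tail G a) j))"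
    if a: "a \<in> arcs G" for a
  proof -
    let ?k = "head G a" and ?l = "tail G a" and ?F = "FMor (Fun D (arr a))"
    let ?C = "Cat D ?k" and ?q = "\<lambda>j. RMor (FOb F j) (arr a) \<odot>\<^bsub>Cat D (head G a)\<^esub> FMor (Fun D (arr a)) (p (tail G a) j)"
    have v: "?k \<in> verts G" "?l \<in> verts G" using a by simp_all
    have "is_cone J ?C (comp_at F ?k) (FOb (Fun D (arr a)) (L ?l)) ?q" unfolding is_cone_def
    proof (intro conjI ballI)
      show "FOb (Fun D (arr a)) (L ?l) \<in> Ob ?C" using a v LO by simp
      show "?q j \<in> Hom ?C (FOb (Fun D (arr a)) (L ?l)) (FOb (comp_at F ?k) j)" if "j \<in> Ob J" for j
        using a v p[OF v(2) that] FO[OF that] by (simp add: Hom_iff)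
      fix b assume b: "b \<in> Mor J"
      note B = RC_functor_mor[OF F b] and jj = RC.functor_mor(4,5)[OF F b]
      note M = RC_MorD[OF B(1), unfolded B(2,3)]
      have "cm (FMor F b) ?k \<odot>\<^bsub>?C\<^esub> ?q (Dom J b) = (cm (FMor F b) ?k \<odot>\<^bsub>?C\<^esub> RMor (FOb F (Dom J b)) (arr a)) \<odot>\<^bsub>?C\<^esub> ?F (p ?l (Dom J b))"
        by (rule C_assoc[symmetric]) (use a v p[OF v(2) jj(1)] M(1,2) M(3-5)[OF v(1)] in simp_all)
      also have "\<dots> = RMor (FOb F (Cod J b)) (arr a) \<odot>\<^bsub>?C\<^esub> (?F (cm (FMor F b) ?l) \<odot>\<^bsub>?C\<^esub> ?F (p ?l (Dom J b)))"
        unfolding M(6)[OF a] by (rule C_assoc) (use a v p[OF v(2) jj(1)] M(1,2) M(3-5)[OF v(2)] in simp_all)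
      also have "?F (cm (FMor F b) ?l) \<odot>\<^bsub>?C\<^esub> ?F (p ?l (Dom J b)) = ?F (p ?l (Cod J b))"
        unfolding pc[OF v(2) b, symmetric] by (rule Fun_comp[symmetric]) (use a v p[OF v(2) jj(1)] M(3-5)[OF v(2)] in simp_all)
      finally show "FMor (comp_at F ?k) b \<odot>\<^bsub>?C\<^esub> ?q (Dom J b) = ?q (Cod J b)" by simp
    qed
    from category.limit_lift[OF cat_Cat[OF v(1)] lim[OF v(1)] this]
    obtain m where "m \<in> Mor ?C" "Dom ?C m = FOb (Fun D (arr a)) (L ?l)" "Cod ?C m = L ?k"
        "\<And>j. j \<in> Ob J \<Longrightarrow> p ?k j \<odot>\<^bsub>?C\<^esub> m = ?q j" by blast
    then show ?thesis by (intro exI[of _ m]) (simp add: Hom_iff)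
  qed
  then obtain m where m: "\<And>a. a \<in> arcs G \<Longrightarrow> m a \<in> Hom (Cat D (head G a)) (FOb (Fun D (arr a)) (L (tail G a))) (L (head G a))"
     "\<And>a j. \<lbrakk>a \<in> arcs G; j \<in> Ob J\<rbrakk> \<Longrightarrow> p (head G a) j \<odot>\<^bsub>Cat D (head G a)\<^esub> m a = RMor (FOb F j) (arr a) \<odot>\<^bsub>Cat D (head G a)\<^esub> FMor (Fun D (arr a)) (p (tail G a) j)"
    by metis
  obtain M where M: "isrep M" "\<And>i. i \<in> verts G \<Longrightarrow> ROb M i = L i" "\<And>a. a \<in> arcs G \<Longrightarrow> RMor M (arr a) = m a"
    by (rule ex_rep_of_arrows[of L m]) (use LO m(1) in simp_all)
  let ?p = "\<lambda>j. mk M (\<lambda>i. p i j) (FOb F j)"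
  have pm: "?p j \<in> Mor RC" if j: "j \<in> Ob J" for j
    by (rule mk_Mor) (use M FO[OF j] p j m(2) in simp_all)
  have "is_limit J RC F M ?p" unfolding is_limit_def
  proof (intro conjI allI impI)
    show "is_cone J RC F M ?p" unfolding is_cone_def
    proof (intro conjI ballI)
      show "?p j \<in> Hom RC M (FOb F j)" if "j \<in> Ob J" for j using pm[OF that] by (simp add: Hom_iff)
      fix b assume b: "b \<in> Mor J"
      note B = RC_functor_mor[OF F b] and jj = RC.functor_mor(4,5)[OF F b]
      show "Comp RC (FMor F b) (?p (Dom J b)) = ?p (Cod J b)"
        by (rule RC_ext) (use pm[OF jj(1)] pm[OF jj(2)] B pc b in simp_all)
    qed (use M in simp)
    fix T q assume q: "is_cone J RC F T q"
    have T: "isrep T" using q by (simp add: is_cone_def)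
    note Q = RC.cone_mor[OF q]
    have qc: "Comp RC (FMor F b) (q (Dom J b)) = q (Cod J b)" if "b \<in> Mor J" for b using q that by (simp add: is_cone_def)
    have "\<exists>h. h \<in> Mor (Cat D i) \<and> Dom (Cat D i) h = ROb T i \<and> Cod (Cat D i) h = L i \<and> (\<forall>j\<in>Ob J. p i j \<odot>\<^bsub>Cat D i\<^esub> h = cm (q j) i)"
      if i: "i \<in> verts G" for i
    proof -
      have "is_cone J (Cat D i) (comp_at F i) (ROb T i) (\<lambda>j. cm (q j) i)" unfolding is_cone_def
      proof (intro conjI ballI)
        show "cm (q j) i \<in> Hom (Cat D i) (ROb T i) (FOb (comp_at F i) j)" if "j \<in> Ob J" for j
          using RC_MorD(3-5)[OF Q(1)[OF that] i] Q(2,3)[OF that] by (simp add: Hom_iff)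
        fix b assume "b \<in> Mor J"
        from arg_cong[OF qc[OF this], of "\<lambda>x. cm x i"] show "FMor (comp_at F i) b \<odot>\<^bsub>Cat D i\<^esub> cm (q (Dom J b)) i = cm (q (Cod J b)) i"
          using i by simp
      qed (use T i in simp)
      then obtain h where "h \<in> Mor (Cat D i)" "Dom (Cat D i) h = ROb T i" "Cod (Cat D i) h = L i" "\<And>j. j \<in> Ob J \<Longrightarrow> p i j \<odot>\<^bsub>Cat D i\<^esub> h = cm (q j) i"
        by (rule category.limit_lift[OF cat_Cat[OF i] lim[OF i]]) (rule that)
      then show ?thesis by (intro exI[of _ h]) simp
    qed
    then obtain h where h: "\<And>i. i \<in> verts G \<Longrightarrow> h i \<in> Mor (Cat D i) \<and> Dom (Cat D i) (h i) = ROb T i \<and> Cod (Cat D i) (h i) = L i"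
        "\<And>i j. \<lbrakk>i \<in> verts G; j \<in> Ob J\<rbrakk> \<Longrightarrow> p i j \<odot>\<^bsub>Cat D i\<^esub> h i = cm (q j) i" by metis
    have H: "mk T h M \<in> Mor RC"
    proof (rule mk_Mor[OF T M(1)])
      show "h i \<in> Mor (Cat D i) \<and> Dom (Cat D i) (h i) = ROb T i \<and> Cod (Cat D i) (h i) = ROb M i" if "i \<in> verts G" for i
        using h(1)[OF that] M(2)[OF that] by simp
      fix a assume a: "a \<in> arcs G"
      let ?k = "head G a" and ?l = "tail G a" and ?F = "FMor (Fun D (arr a))"
      let ?C = "Cat D ?k"
      have v: "?k \<in> verts G" "?l \<in> verts G" using a by simp_all
      have ma: "m a \<in> Mor ?C" "Dom ?C (m a) = FOb (Fun D (arr a)) (L ?l)" "Cod ?C (m a) = L ?k" using m(1)[OF a] by (simp_all add: Hom_iff)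
      show "h ?k \<odot>\<^bsub>?C\<^esub> RMor T (arr a) = RMor M (arr a) \<odot>\<^bsub>?C\<^esub> ?F (h ?l)"
      proof (rule category.limit_ext[OF cat_Cat[OF v(1)] Fi[OF v(1)] lim[OF v(1)]])
        fix j assume j: "j \<in> Ob J"
        note qj = RC_MorD[OF Q(1)[OF j], unfolded Q(2,3)[OF j]]
        have "p ?k j \<odot>\<^bsub>?C\<^esub> (h ?k \<odot>\<^bsub>?C\<^esub> RMor T (arr a)) = (p ?k j \<odot>\<^bsub>?C\<^esub> h ?k) \<odot>\<^bsub>?C\<^esub> RMor T (arr a)"
          by (rule C_assoc[symmetric]) (use a v T h(1)[OF v(1)] p[OF v(1) j] in simp_all)
        also have "\<dots> = RMor (FOb F j) (arr a) \<odot>\<^bsub>?C\<^esub> ?F (cm (q j) ?l)" using h(2)[OF v(1) j] qj(6)[OF a] by simp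
        also have "?F (cm (q j) ?l) = ?F (p ?l j) \<odot>\<^bsub>?C\<^esub> ?F (h ?l)"
          unfolding h(2)[OF v(2) j, symmetric] by (rule Fun_comp) (use a v h(1)[OF v(2)] p[OF v(2) j] in simp_all)
        also have "RMor (FOb F j) (arr a) \<odot>\<^bsub>?C\<^esub> \<dots> = (RMor (FOb F j) (arr a) \<odot>\<^bsub>?C\<^esub> ?F (p ?l j)) \<odot>\<^bsub>?C\<^esub> ?F (h ?l)"
          by (rule C_assoc[symmetric]) (use a v FO[OF j] h(1)[OF v(2)] p[OF v(2) j] in simp_all)
        also have "\<dots> = p ?k j \<odot>\<^bsub>?C\<^esub> (m a \<odot>\<^bsub>?C\<^esub> ?F (h ?l))"
          unfolding m(2)[OF a j, symmetric] by (rule C_assoc) (use a v ma h(1)[OF v(2)] p[OF v(1) j] in simp_all)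
        finally show "p ?k j \<odot>\<^bsub>?C\<^esub> (h ?k \<odot>\<^bsub>?C\<^esub> RMor T (arr a)) = p ?k j \<odot>\<^bsub>?C\<^esub> (RMor M (arr a) \<odot>\<^bsub>?C\<^esub> ?F (h ?l))"
          unfolding M(3)[OF a] .
      qed (use a v T ma M h(1)[OF v(1)] h(1)[OF v(2)] in simp_all)
    qed
    show "\<exists>!h. h \<in> Hom RC T M \<and> (\<forall>j\<in>Ob J. Comp RC (?p j) h = q j)"
    proof (rule ex1I[of _ "mk T h M"])
      have "Comp RC (?p j) (mk T h M) = q j" if j: "j \<in> Ob J" for j
        by (rule RC_ext) (use pm[OF j] H Q[OF j] h(2) j in simp_all)
      then show "mk T h M \<in> Hom RC T M \<and> (\<forall>j\<in>Ob J. Comp RC (?p j) (mk T h M) = q j)" using H by (simp add: Hom_iff)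
      fix g assume g0: "g \<in> Hom RC T M \<and> (\<forall>j\<in>Ob J. Comp RC (?p j) g = q j)"
      then have g: "g \<in> Mor RC" "Dom RC g = T" "Cod RC g = M" by (simp_all add: Hom_iff)
      show "g = mk T h M"
      proof (rule RC_ext)
        fix i assume i: "i \<in> verts G"
        note gi = RC_MorD(3-5)[OF g(1) i]
        show "cm g i = cm (mk T h M) i"
        proof (rule category.limit_ext[OF cat_Cat[OF i] Fi[OF i] lim[OF i]])
          fix j assume j: "j \<in> Ob J"
          have "cm (Comp RC (?p j) g) i = cm (q j) i" using g0 j by simp
          then show "p i j \<odot>\<^bsub>Cat D i\<^esub> cm g i = p i j \<odot>\<^bsub>Cat D i\<^esub> cm (mk T h M) i" using i h(2)[OF i j] by simp
        qed (use gi g h(1)[OF i] M i in simp_all)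
      qed (use g H in simp_all)
    qed
  qed
  then show "\<exists>L p. is_limit J RC F L p" by blast
qed

text \<open>The map along \<open>a\<close> has to start from \<open>D_a\<close> of the colimit at
  the tail, so this object must be a colimit itself. It is one because \<open>D_a\<close> respects
  the presentation of the colimit as a cokernel of a map between small coproducts.\<close>

lemma RC_cocomplete:
  assumes co: "\<And>i. i \<in> verts G \<Longrightarrow> cocomplete (U :: 'u itself) (Cat D i)"
    and pres: "\<And>a. a \<in> arcs G \<Longrightarrow> preserves_small_coproducts U (Cat D (tail G a)) (Cat D (head G a)) (Fun D (arr a))"
  shows "cocomplete U RC"
  unfolding cocomplete_def
proof (intro allI impI)
  fix J :: "('u, 'u) cat" and F
  assume "small_category J \<and> cat_functor J RC F"
  then have J: "small_category J" and F: "cat_functor J RC F" by simp_all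
  interpret F: cat_functor J RC F by fact
  have sm: "small U (Ob J)" "small U (Mor J)" using J unfolding small_category_def small_def by simp_all
  note Fi = comp_at_functor[OF F]
  have FO: "isrep (FOb F j)" if "j \<in> Ob J" for j using F.FOb_in_Ob[OF that] by simp
  \<comment> \<open>The data of the presentation are packed into one tuple, so that they can be
    chosen at all vertices simultaneously and taken apart afterwards.\<close>
  define good where "good i = (\<lambda>(A, u, B, v, d, c).
     is_coproduct (Cat D i) (Mor J) (\<lambda>a. ROb (FOb F (Dom J a)) i) A u \<and> is_coproduct (Cat D i) (Ob J) (\<lambda>j. ROb (FOb F j) i) B v \<and>
     d \<in> Mor (Cat D i) \<and> Dom (Cat D i) d = A \<and> Cod (Cat D i) d = B \<and>
     (\<forall>a\<in>Mor J. d \<odot>\<^bsub>Cat D i\<^esub> u a = (v (Cod J a) \<odot>\<^bsub>Cat D i\<^esub> cm (FMor F a) i) \<boxplus>\<^bsub>Cat D i\<^esub> neg (Cat D i) (v (Dom J a))) \<and>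
     is_cokernel (Cat D i) d c)" for i
  have "\<exists>x. good i x" if i: "i \<in> verts G" for i
  proof -
    obtain A u B v d c where *: "is_coproduct (Cat D i) (Mor J) (\<lambda>a. FOb (comp_at F i) (Dom J a)) A u" "is_coproduct (Cat D i) (Ob J) (FOb (comp_at F i)) B v"
      "d \<in> Mor (Cat D i)" "Dom (Cat D i) d = A" "Cod (Cat D i) d = B"
      "\<And>a. a \<in> Mor J \<Longrightarrow> d \<odot>\<^bsub>Cat D i\<^esub> u a = (v (Cod J a) \<odot>\<^bsub>Cat D i\<^esub> FMor (comp_at F i) a) \<boxplus>\<^bsub>Cat D i\<^esub> neg (Cat D i) (v (Dom J a))"
      "is_cokernel (Cat D i) d c"
      by (rule ex_colimit_data[OF preadd_Cat[OF i] abelian_Cat[OF i] co[OF i] J Fi[OF i]]) (rule that)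
    have "FOb (comp_at F i) = (\<lambda>j. ROb (FOb F j) i)" by auto
    then have "good i (A, u, B, v, d, c)" unfolding good_def using * by simp
    then show ?thesis by blast
  qed
  then obtain x where x: "\<And>i. i \<in> verts G \<Longrightarrow> good i (x i)" by metis
  define A u B v d c where "A i = fst (x i)" and "u i = fst (snd (x i))" and "B i = fst (snd (snd (x i)))"
    and "v i = fst (snd (snd (snd (x i))))" and "d i = fst (snd (snd (snd (snd (x i)))))" and "c i = snd (snd (snd (snd (snd (x i)))))" for i
  have gd: "is_coproduct (Cat D i) (Mor J) (\<lambda>a. ROb (FOb F (Dom J a)) i) (A i) (u i)" "is_coproduct (Cat D i) (Ob J) (\<lambda>j. ROb (FOb F j) i) (B i) (v i)"
     "d i \<in> Mor (Cat D i)" "Dom (Cat D i) (d i) = A i" "Cod (Cat D i) (d i) = B i"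
     "\<And>a. a\<in>Mor J \<Longrightarrow> d i \<odot>\<^bsub>Cat D i\<^esub> u i a = (v i (Cod J a) \<odot>\<^bsub>Cat D i\<^esub> cm (FMor F a) i) \<boxplus>\<^bsub>Cat D i\<^esub> neg (Cat D i) (v i (Dom J a))"
     "is_cokernel (Cat D i) (d i) (c i)" if "i \<in> verts G" for i
    using x[OF that] unfolding good_def A_def u_def B_def v_def d_def c_def by (simp_all add: split_beta)
  define L p where "L i = Cod (Cat D i) (c i)" and "p i j = c i \<odot>\<^bsub>Cat D i\<^esub> v i j" for i j
  have FOb_eta: "FOb (comp_at F i) = (\<lambda>j. ROb (FOb F j) i)" for i by auto
  have lim: "is_colimit J (Cat D i) (comp_at F i) (L i) (p i)" if i: "i \<in> verts G" for i
    unfolding L_def p_def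
    by (rule preadditive_category.colimit_if_cokernel[OF preadd_Cat[OF i] Fi[OF i], unfolded comp_at_simps FOb_eta, OF gd(1,2,3,4,5)[OF i] gd(6)[OF i] gd(7)[OF i]])
  have cocone: "is_cocone J (Cat D i) (comp_at F i) (L i) (p i)" if "i \<in> verts G" for i
    using lim[OF that] by (simp add: is_colimit_def)
  have LO: "L i \<in> Ob (Cat D i)" if "i \<in> verts G" for i using cocone[OF that] by (simp add: is_cocone_def)
  have p: "p i j \<in> Mor (Cat D i)" "Cod (Cat D i) (p i j) = L i" "Dom (Cat D i) (p i j) = ROb (FOb F j) i"
    if "i \<in> verts G" "j \<in> Ob J" for i j
    using category.cocone_mor[OF cat_Cat[OF that(1)] cocone[OF that(1)] that(2)] by simp_all
  have pc: "p i (Cod J b) \<odot>\<^bsub>Cat D i\<^esub> cm (FMor F b) i = p i (Dom J b)" if "i \<in> verts G" "b \<in> Mor J" for i b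
    using cocone[OF that(1)] that(2) by (simp add: is_cocone_def)
  \<comment> \<open>The diagram at the tail of \<open>a\<close>, moved to the head by
    \<open>D_a\<close>. Its colimit is the source of the map along \<open>a\<close> that is to be
    constructed.\<close>
  define FF where "FF a = \<lparr>FOb = (\<lambda>j. FOb (Fun D (arr a)) (ROb (FOb F j) (tail G a))), FMor = (\<lambda>b. FMor (Fun D (arr a)) (cm (FMor F b) (tail G a)))\<rparr>" for a
  have FFf: "cat_functor J (Cat D (head G a)) (FF a)" if a: "a \<in> arcs G" for a
  proof (intro cat_functor.intro F.source.category_axioms cat_Cat cat_functor_axioms.intro)
    have v: "head G a \<in> verts G" "tail G a \<in> verts G" using a by simp_all
    show "head G a \<in> verts G" by (rule v)
    interpret T: cat_functor J "Cat D (tail G a)" "comp_at F (tail G a)" by (rule Fi[OF v(2)])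
    show "FOb (FF a) j \<in> Ob (Cat D (head G a))" if "j \<in> Ob J" for j using a v FO[OF that] by (simp add: FF_def)
    have t: "cm (FMor F f) (tail G a) \<in> Mor (Cat D (tail G a)) \<and> Dom (Cat D (tail G a)) (cm (FMor F f) (tail G a)) = ROb (FOb F X) (tail G a) \<and>
      Cod (Cat D (tail G a)) (cm (FMor F f) (tail G a)) = ROb (FOb F Y) (tail G a)"
      if "f \<in> Hom J X Y" for f X Y using T.FMor_in_Hom[OF that] by (simp add: Hom_iff)
    show "FMor (FF a) f \<in> Hom (Cat D (head G a)) (FOb (FF a) X) (FOb (FF a) Y)" if "f \<in> Hom J X Y" for f X Y
      using t[OF that] a by (simp add: FF_def Hom_iff)
    show "FMor (FF a) (Id J X) = Id (Cat D (head G a)) (FOb (FF a) X)" if "X \<in> Ob J" for X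
      using T.FMor_Id[OF that] Fun_Id[of "arr a"] a v FO[OF that] by (simp add: FF_def)
    show "FMor (FF a) (Comp J g f) = FMor (FF a) g \<odot>\<^bsub>Cat D (head G a)\<^esub> FMor (FF a) f" if "f \<in> Hom J X Y" "g \<in> Hom J Y Z" for f g X Y Z
      using T.FMor_Comp[OF that] t[OF that(1)] t[OF that(2)] Fun_comp[of "arr a" "tail G a" "head G a"] a by (simp add: FF_def)
  qed
  have Flim: "is_colimit J (Cat D (head G a)) (FF a) (FOb (Fun D (arr a)) (L (tail G a))) (\<lambda>j. FMor (Fun D (arr a)) (p (tail G a) j))" if a: "a \<in> arcs G" for a
  proof -
    let ?k = "head G a" and ?l = "tail G a" and ?F = "FMor (Fun D (arr a))"
    let ?C = "Cat D ?k"
    have v: "?k \<in> verts G" "?l \<in> verts G" using a by simp_all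
    interpret L: preadditive_category "Cat D ?l" by (rule preadd_Cat[OF v(2)])
    note g = gd[OF v(2)]
    have P: "is_coproduct ?C S (\<lambda>i. FOb (Fun D (arr a)) (X i)) (FOb (Fun D (arr a)) P) (\<lambda>i. ?F (w i))"
      if "small U S" "is_coproduct (Cat D ?l) S X P w" for S :: "'u set" and X P w
      using pres[OF a] that unfolding preserves_small_coproducts_def by blast
    note IA = L.coproduct_inj[OF g(1)] and IB = L.coproduct_inj[OF g(2)]
    have "is_colimit J ?C (FF a) (Cod ?C (?F (c ?l))) (\<lambda>j. ?F (c ?l) \<odot>\<^bsub>?C\<^esub> ?F (v ?l j))"
    proof (rule preadditive_category.colimit_if_cokernel[OF preadd_Cat[OF v(1)] FFf[OF a]])
      show "is_coproduct ?C (Mor J) (\<lambda>b. FOb (FF a) (Dom J b)) (FOb (Fun D (arr a)) (A ?l)) (\<lambda>b. ?F (u ?l b))"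
        using P[OF sm(2) g(1)] by (simp add: FF_def)
      show "is_coproduct ?C (Ob J) (FOb (FF a)) (FOb (Fun D (arr a)) (B ?l)) (\<lambda>b. ?F (v ?l b))"
        using P[OF sm(1) g(2)] by (simp add: FF_def)
      show "?F (d ?l) \<in> Mor ?C" "Dom ?C (?F (d ?l)) = FOb (Fun D (arr a)) (A ?l)" "Cod ?C (?F (d ?l)) = FOb (Fun D (arr a)) (B ?l)"
        using a g(3-5) by simp_all
      show "is_cokernel ?C (?F (d ?l)) (?F (c ?l))" by (rule Fun_cokernel[OF _ _ _ g(7)]) (use a in simp_all)
      fix b assume b: "b \<in> Mor J"
      note M = RC_MorD(3-5)[OF RC_functor_mor(1)[OF F b] v(2), unfolded RC_functor_mor(2,3)[OF F b]]
      note jj = RC.functor_mor(4,5)[OF F b]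
      note t = IA[OF b] IB[OF jj(1)] IB[OF jj(2)] M
      have "?F (d ?l) \<odot>\<^bsub>?C\<^esub> ?F (u ?l b) = ?F (d ?l \<odot>\<^bsub>Cat D ?l\<^esub> u ?l b)"
        by (rule Fun_comp[symmetric]) (use a g(3-5) t in simp_all)
      also have "\<dots> = ?F (v ?l (Cod J b) \<odot>\<^bsub>Cat D ?l\<^esub> cm (FMor F b) ?l) \<boxplus>\<^bsub>?C\<^esub> ?F (neg (Cat D ?l) (v ?l (Dom J b)))"
        unfolding g(6)[OF b] by (rule Fun_add) (use a v t in simp_all)
      also have "?F (v ?l (Cod J b) \<odot>\<^bsub>Cat D ?l\<^esub> cm (FMor F b) ?l) = ?F (v ?l (Cod J b)) \<odot>\<^bsub>?C\<^esub> ?F (cm (FMor F b) ?l)"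
        by (rule Fun_comp) (use a t in simp_all)
      also have "?F (neg (Cat D ?l) (v ?l (Dom J b))) = neg ?C (?F (v ?l (Dom J b)))"
        by (rule Fun_neg) (use a t in simp_all)
      finally show "?F (d ?l) \<odot>\<^bsub>?C\<^esub> ?F (u ?l b) = (?F (v ?l (Cod J b)) \<odot>\<^bsub>?C\<^esub> FMor (FF a) b) \<boxplus>\<^bsub>?C\<^esub> neg ?C (?F (v ?l (Dom J b)))"
        by (simp add: FF_def)
    qed
    moreover have "Cod ?C (?F (c ?l)) = FOb (Fun D (arr a)) (L ?l)" using a L.cokernelD[OF g(7)] by (simp add: L_def)
    moreover have "?F (c ?l) \<odot>\<^bsub>?C\<^esub> ?F (v ?l j) = ?F (p ?l j)" if j: "j \<in> Ob J" for j
      unfolding p_def by (rule Fun_comp[symmetric]) (use a L.cokernelD[OF g(7)] g(5) IB[OF j] in simp_all)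
    ultimately show ?thesis unfolding is_colimit_def is_cocone_def by (simp add: F.source.Cod_in_Ob F.source.Dom_in_Ob)
  qed
  have "\<exists>m. m \<in> Hom (Cat D (head G a)) (FOb (Fun D (arr a)) (L (tail G a))) (L (head G a)) \<and>
     (\<forall>j\<in>Ob J. m \<odot>\<^bsub>Cat D (head G a)\<^esub> FMor (Fun D (arr a)) (p (tail G a) j) = p (head G a) j \<odot>\<^bsub>Cat D (head G a)\<^esub> RMor (FOb F j) (arr a))"
    if a: "a \<in> arcs G" for a
  proof -
    let ?k = "head G a" and ?l = "tail G a" and ?F = "FMor (Fun D (arr a))"
    let ?C = "Cat D ?k" and ?q = "\<lambda>j. p (head G a) j \<odot>\<^bsub>Cat D (head G a)\<^esub> RMor (FOb F j) (arr a)"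
    have v: "?k \<in> verts G" "?l \<in> verts G" using a by simp_all
    have "is_cocone J ?C (FF a) (L ?k) ?q" unfolding is_cocone_def
    proof (intro conjI ballI)
      show "L ?k \<in> Ob ?C" using v LO by simp
      show "?q j \<in> Hom ?C (FOb (FF a) j) (L ?k)" if "j \<in> Ob J" for j
        using a v p[OF v(1) that] FO[OF that] by (simp add: Hom_iff FF_def)
      fix b assume b: "b \<in> Mor J"
      note B = RC_functor_mor[OF F b] and jj = RC.functor_mor(4,5)[OF F b]
      note M = RC_MorD[OF B(1), unfolded B(2,3)]
      have "?q (Cod J b) \<odot>\<^bsub>?C\<^esub> ?F (cm (FMor F b) ?l) = p ?k (Cod J b) \<odot>\<^bsub>?C\<^esub> (RMor (FOb F (Cod J b)) (arr a) \<odot>\<^bsub>?C\<^esub> ?F (cm (FMor F b) ?l))"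
        by (rule C_assoc) (use a v p[OF v(1) jj(2)] M(1,2) M(3-5)[OF v(2)] in simp_all)
      also have "\<dots> = (p ?k (Cod J b) \<odot>\<^bsub>?C\<^esub> cm (FMor F b) ?k) \<odot>\<^bsub>?C\<^esub> RMor (FOb F (Dom J b)) (arr a)"
        unfolding M(6)[OF a, symmetric] by (rule C_assoc[symmetric]) (use a v p[OF v(1) jj(2)] M(1,2) M(3-5)[OF v(1)] in simp_all)
      finally show "?q (Cod J b) \<odot>\<^bsub>?C\<^esub> FMor (FF a) b = ?q (Dom J b)" using pc[OF v(1) b] by (simp add: FF_def)
    qed
    from category.colimit_lift[OF cat_Cat[OF v(1)] Flim[OF a] this]
    obtain m where "m \<in> Mor ?C" "Dom ?C m = FOb (Fun D (arr a)) (L ?l)" "Cod ?C m = L ?k"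
        "\<And>j. j \<in> Ob J \<Longrightarrow> m \<odot>\<^bsub>?C\<^esub> ?F (p ?l j) = ?q j" by blast
    then show ?thesis by (intro exI[of _ m]) (simp add: Hom_iff)
  qed
  then obtain m where m: "\<And>a. a \<in> arcs G \<Longrightarrow> m a \<in> Hom (Cat D (head G a)) (FOb (Fun D (arr a)) (L (tail G a))) (L (head G a))"
     "\<And>a j. \<lbrakk>a \<in> arcs G; j \<in> Ob J\<rbrakk> \<Longrightarrow> m a \<odot>\<^bsub>Cat D (head G a)\<^esub> FMor (Fun D (arr a)) (p (tail G a) j) = p (head G a) j \<odot>\<^bsub>Cat D (head G a)\<^esub> RMor (FOb F j) (arr a)"
    by metis
  obtain M where M: "isrep M" "\<And>i. i \<in> verts G \<Longrightarrow> ROb M i = L i" "\<And>a. a \<in> arcs G \<Longrightarrow> RMor M (arr a) = m a"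
    by (rule ex_rep_of_arrows[of L m]) (use LO m(1) in simp_all)
  let ?p = "\<lambda>j. mk (FOb F j) (\<lambda>i. p i j) M"
  have pm: "?p j \<in> Mor RC" if j: "j \<in> Ob J" for j
    by (rule mk_Mor) (use M FO[OF j] p j m(2) in simp_all)
  have "is_colimit J RC F M ?p" unfolding is_colimit_def
  proof (intro conjI allI impI)
    show "is_cocone J RC F M ?p" unfolding is_cocone_def
    proof (intro conjI ballI)
      show "?p j \<in> Hom RC (FOb F j) M" if "j \<in> Ob J" for j using pm[OF that] by (simp add: Hom_iff)
      fix b assume b: "b \<in> Mor J"
      note B = RC_functor_mor[OF F b] and jj = RC.functor_mor(4,5)[OF F b]
      show "Comp RC (?p (Cod J b)) (FMor F b) = ?p (Dom J b)"
        by (rule RC_ext) (use pm[OF jj(1)] pm[OF jj(2)] B pc b in simp_all)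
    qed (use M in simp)
    fix T q assume q: "is_cocone J RC F T q"
    have T: "isrep T" using q by (simp add: is_cocone_def)
    note Q = RC.cocone_mor[OF q]
    have qc: "Comp RC (q (Cod J b)) (FMor F b) = q (Dom J b)" if "b \<in> Mor J" for b using q that by (simp add: is_cocone_def)
    have "\<exists>h. h \<in> Mor (Cat D i) \<and> Dom (Cat D i) h = L i \<and> Cod (Cat D i) h = ROb T i \<and> (\<forall>j\<in>Ob J. h \<odot>\<^bsub>Cat D i\<^esub> p i j = cm (q j) i)"
      if i: "i \<in> verts G" for i
    proof -
      have "is_cocone J (Cat D i) (comp_at F i) (ROb T i) (\<lambda>j. cm (q j) i)" unfolding is_cocone_def
      proof (intro conjI ballI)
        show "cm (q j) i \<in> Hom (Cat D i) (FOb (comp_at F i) j) (ROb T i)" if "j \<in> Ob J" for j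
          using RC_MorD(3-5)[OF Q(1)[OF that] i] Q(2,3)[OF that] by (simp add: Hom_iff)
        fix b assume "b \<in> Mor J"
        from arg_cong[OF qc[OF this], of "\<lambda>x. cm x i"] show "cm (q (Cod J b)) i \<odot>\<^bsub>Cat D i\<^esub> FMor (comp_at F i) b = cm (q (Dom J b)) i"
          using i by simp
      qed (use T i in simp)
      then obtain h where "h \<in> Mor (Cat D i)" "Dom (Cat D i) h = L i" "Cod (Cat D i) h = ROb T i" "\<And>j. j \<in> Ob J \<Longrightarrow> h \<odot>\<^bsub>Cat D i\<^esub> p i j = cm (q j) i"
        by (rule category.colimit_lift[OF cat_Cat[OF i] lim[OF i]]) (rule that)
      then show ?thesis by (intro exI[of _ h]) simp
    qed
    then obtain h where h: "\<And>i. i \<in> verts G \<Longrightarrow> h i \<in> Mor (Cat D i) \<and> Dom (Cat D i) (h i) = L i \<and> Cod (Cat D i) (h i) = ROb T i"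
        "\<And>i j. \<lbrakk>i \<in> verts G; j \<in> Ob J\<rbrakk> \<Longrightarrow> h i \<odot>\<^bsub>Cat D i\<^esub> p i j = cm (q j) i" by metis
    have H: "mk M h T \<in> Mor RC"
    proof (rule mk_Mor[OF M(1) T])
      show "h i \<in> Mor (Cat D i) \<and> Dom (Cat D i) (h i) = ROb M i \<and> Cod (Cat D i) (h i) = ROb T i" if "i \<in> verts G" for i
        using h(1)[OF that] M(2)[OF that] by simp
      fix a assume a: "a \<in> arcs G"
      let ?k = "head G a" and ?l = "tail G a" and ?F = "FMor (Fun D (arr a))"
      let ?C = "Cat D ?k"
      have v: "?k \<in> verts G" "?l \<in> verts G" using a by simp_all
      have ma: "m a \<in> Mor ?C" "Dom ?C (m a) = FOb (Fun D (arr a)) (L ?l)" "Cod ?C (m a) = L ?k" using m(1)[OF a] by (simp_all add: Hom_iff)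
      \<comment> \<open>Both sides start at \<open>D_a\<close> of the colimit at the tail. By
        \<open>Flim\<close> they may be compared on \<open>D_a\<close> of its legs.\<close>
      show "h ?k \<odot>\<^bsub>?C\<^esub> RMor M (arr a) = RMor T (arr a) \<odot>\<^bsub>?C\<^esub> ?F (h ?l)"
      proof (rule category.colimit_ext[OF cat_Cat[OF v(1)] FFf[OF a] Flim[OF a]])
        fix j assume j: "j \<in> Ob J"
        note qj = RC_MorD[OF Q(1)[OF j], unfolded Q(2,3)[OF j]]
        have "(h ?k \<odot>\<^bsub>?C\<^esub> m a) \<odot>\<^bsub>?C\<^esub> ?F (p ?l j) = h ?k \<odot>\<^bsub>?C\<^esub> (m a \<odot>\<^bsub>?C\<^esub> ?F (p ?l j))"
          by (rule C_assoc) (use a v T ma h(1)[OF v(1)] p[OF v(2) j] in simp_all)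
        also have "\<dots> = (h ?k \<odot>\<^bsub>?C\<^esub> p ?k j) \<odot>\<^bsub>?C\<^esub> RMor (FOb F j) (arr a)"
          unfolding m(2)[OF a j] by (rule C_assoc[symmetric]) (use a v FO[OF j] h(1)[OF v(1)] p[OF v(1) j] in simp_all)
        also have "\<dots> = RMor T (arr a) \<odot>\<^bsub>?C\<^esub> ?F (cm (q j) ?l)" using h(2)[OF v(1) j] qj(6)[OF a] by simp
        also have "?F (cm (q j) ?l) = ?F (h ?l) \<odot>\<^bsub>?C\<^esub> ?F (p ?l j)"
          unfolding h(2)[OF v(2) j, symmetric] by (rule Fun_comp) (use a v h(1)[OF v(2)] p[OF v(2) j] in simp_all)
        also have "RMor T (arr a) \<odot>\<^bsub>?C\<^esub> \<dots> = (RMor T (arr a) \<odot>\<^bsub>?C\<^esub> ?F (h ?l)) \<odot>\<^bsub>?C\<^esub> ?F (p ?l j)"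
          by (rule C_assoc[symmetric]) (use a v T h(1)[OF v(2)] p[OF v(2) j] in simp_all)
        finally show "(h ?k \<odot>\<^bsub>?C\<^esub> RMor M (arr a)) \<odot>\<^bsub>?C\<^esub> ?F (p ?l j) = (RMor T (arr a) \<odot>\<^bsub>?C\<^esub> ?F (h ?l)) \<odot>\<^bsub>?C\<^esub> ?F (p ?l j)"
          unfolding M(3)[OF a] .
      qed (use a v T ma M h(1)[OF v(1)] h(1)[OF v(2)] in simp_all)
    qed
    show "\<exists>!h. h \<in> Hom RC M T \<and> (\<forall>j\<in>Ob J. Comp RC h (?p j) = q j)"
    proof (rule ex1I[of _ "mk M h T"])
      have "Comp RC (mk M h T) (?p j) = q j" if j: "j \<in> Ob J" for j
        by (rule RC_ext) (use pm[OF j] H Q[OF j] h(2) j in simp_all)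
      then show "mk M h T \<in> Hom RC M T \<and> (\<forall>j\<in>Ob J. Comp RC (mk M h T) (?p j) = q j)" using H by (simp add: Hom_iff)
      fix g assume g0: "g \<in> Hom RC M T \<and> (\<forall>j\<in>Ob J. Comp RC g (?p j) = q j)"
      then have g: "g \<in> Mor RC" "Dom RC g = M" "Cod RC g = T" by (simp_all add: Hom_iff)
      show "g = mk M h T"
      proof (rule RC_ext)
        fix i assume i: "i \<in> verts G"
        note gi = RC_MorD(3-5)[OF g(1) i]
        show "cm g i = cm (mk M h T) i"
        proof (rule category.colimit_ext[OF cat_Cat[OF i] Fi[OF i] lim[OF i]])
          fix j assume j: "j \<in> Ob J"
          have "cm (Comp RC g (?p j)) i = cm (q j) i" using g0 j by simp
          then show "cm g i \<odot>\<^bsub>Cat D i\<^esub> p i j = cm (mk M h T) i \<odot>\<^bsub>Cat D i\<^esub> p i j" using i h(2)[OF i j] by simp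
        qed (use gi g h(1)[OF i] M i in simp_all)
      qed (use g H in simp_all)
    qed
  qed
  then show "\<exists>L u. is_colimit J RC F L u" by blast
qed

end

section \<open>Cotorsion pairs of representations\<close>

definition arc_rel :: "('v, 'a) pre_digraph \<Rightarrow> 'v rel" where
  "arc_rel G = {(tail G a, head G a) | a. a \<in> arcs G}"

text \<open>Induction along the well-order puts every \<open>V \<chi>\<close> into the accessible
  part of \<open>arc_rel G\<close>: a vertex of a successor stage receives arrows only from earlier
  stages.\<close>

lemma wf_arc_rel:
  assumes "wf_digraph G" "left_rooted G"
  shows "wf (arc_rel G)"
proof -
  interpret wf_digraph G by fact
  obtain r :: "'a set rel" and V \<zeta> where r: "Well_order r" and V: "rooting_sequence G r V" and \<zeta>: "\<zeta> \<in> Field r" "V \<zeta> = verts G"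
    using assms(2) unfolding left_rooted_def by blast
  have "wf (r - Relation.Id)" using r by (simp add: well_order_on_def)
  then have "\<chi> \<in> Field r \<longrightarrow> V \<chi> \<subseteq> Wellfounded.acc (arc_rel G)" for \<chi>
  proof (induction \<chi> rule: wf_induct_rule)
    case (less \<chi>)
    show ?case
    proof
      assume \<chi>: "\<chi> \<in> Field r"
      have IH: "V \<mu> \<subseteq> Wellfounded.acc (arc_rel G)" if "\<mu> \<in> underS r \<chi>" for \<mu>
        using less[of \<mu>] that by (auto simp: underS_def Field_def)
      consider "underS r \<chi> = {}" | \<pi> where "\<pi> \<in> Field r" "underS r \<chi> = under r \<pi>"
        | "underS r \<chi> \<noteq> {}" "\<forall>\<pi>\<in>Field r. underS r \<chi> \<noteq> under r \<pi>" by blast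
      then show "V \<chi> \<subseteq> Wellfounded.acc (arc_rel G)"
      proof cases
        case 1
        then have "V \<chi> = {}" using V \<chi> unfolding rooting_sequence_def by blast
        then show ?thesis by simp
      next
        case 2
        then have "V \<chi> = {i \<in> verts G. \<not> (\<exists>a\<in>arcs G. head G a = i \<and> tail G a \<notin> (\<Union>\<mu>\<in>under r \<pi>. V \<mu>))}"
          using V \<chi> unfolding rooting_sequence_def by blast
        then have "(j, i) \<in> arc_rel G \<Longrightarrow> j \<in> Wellfounded.acc (arc_rel G)" if "i \<in> V \<chi>" for i j
          using that IH 2(2) by (fastforce simp: arc_rel_def)
        then show ?thesis by (auto intro: acc.accI)
      next
        case 3
        then have "V \<chi> = (\<Union>\<mu>\<in>underS r \<chi>. V \<mu>)" using V \<chi> unfolding rooting_sequence_def by blast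
        then show ?thesis using IH by blast
      qed
    qed
  qed
  then have acc: "verts G \<subseteq> Wellfounded.acc (arc_rel G)" using \<zeta> by blast
  \<comment> \<open>Elements outside \<open>verts G\<close> are covered as well, since every
    predecessor is the tail of an arc and hence a vertex.\<close>
  have "x \<in> Wellfounded.acc (arc_rel G)" for x
  proof (rule acc.accI)
    fix y assume "(y, x) \<in> arc_rel G"
    then show "y \<in> Wellfounded.acc (arc_rel G)" using acc by (auto simp: arc_rel_def)
  qed
  then show ?thesis by (intro acc_wfI) simp
qed

lemma is_coproduct_cong:
  assumes "\<And>i. i \<in> S \<Longrightarrow> X i = X' i"
  shows "is_coproduct C S X P u \<longleftrightarrow> is_coproduct C S X' P u"
proof -
  have "(\<forall>i\<in>S. v i \<in> Hom C (X i) T) \<longleftrightarrow> (\<forall>i\<in>S. v i \<in> Hom C (X' i) T)" for v T using assms by simp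
  then show ?thesis unfolding is_coproduct_def by simp
qed

text \<open>The condition that \<open>\<Phi>(X)\<close> imposes at a single vertex, \<open>S\<close> being the set of arcs into it.\<close>

definition monic_from_coproduct ::
    "('o, 'm, 'z) ab_cat_scheme \<Rightarrow> 'o set \<Rightarrow> 'i set \<Rightarrow> ('i \<Rightarrow> 'o) \<Rightarrow> 'o \<Rightarrow> ('i \<Rightarrow> 'm) \<Rightarrow> bool" where
  "monic_from_coproduct C X S Z T x \<longleftrightarrow>
     (\<exists>P u \<phi> c. is_coproduct C S Z P u \<and> \<phi> \<in> Mor C \<and> Dom C \<phi> = P \<and> Cod C \<phi> = T \<and>
        (\<forall>i\<in>S. \<phi> \<odot>\<^bsub>C\<^esub> u i = x i) \<and> monic C \<phi> \<and> is_cokernel C \<phi> c \<and> Cod C c \<in> X)"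

text \<open>Only the values on \<open>S\<close> matter. The choice along the arrows requires its
  predicate to depend on the sources of arrows into the vertex only, and this rule verifies
  that.\<close>

lemma monic_from_coproduct_cong:
  assumes "\<And>i. i \<in> S \<Longrightarrow> Z i = Z' i" "\<And>i. i \<in> S \<Longrightarrow> x i = x' i"
  shows "monic_from_coproduct C X S Z T x \<longleftrightarrow> monic_from_coproduct C X S Z' T x'"
proof -
  have "(\<forall>i\<in>S. \<phi> \<odot>\<^bsub>C\<^esub> u i = x i) \<longleftrightarrow> (\<forall>i\<in>S. \<phi> \<odot>\<^bsub>C\<^esub> u i = x' i)" for \<phi> u using assms(2) by simp
  then show ?thesis unfolding monic_from_coproduct_def using is_coproduct_cong[of S Z Z' C, OF assms(1)] by simp
qed

lemma monic_from_coproductE: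
  assumes "monic_from_coproduct C X S Z T x"
  obtains P u \<phi> c where "is_coproduct C S Z P u" "\<phi> \<in> Mor C" "Dom C \<phi> = P" "Cod C \<phi> = T"
    "\<And>i. i \<in> S \<Longrightarrow> \<phi> \<odot>\<^bsub>C\<^esub> u i = x i" "monic C \<phi>" "is_cokernel C \<phi> c" "Cod C c \<in> X"
  using assms unfolding monic_from_coproduct_def by blast

lemma monic_from_coproductI:
  assumes "is_coproduct C S Z P u" "\<phi> \<in> Mor C" "Dom C \<phi> = P" "Cod C \<phi> = T"
    "\<And>i. i \<in> S \<Longrightarrow> \<phi> \<odot>\<^bsub>C\<^esub> u i = x i" "monic C \<phi>" "is_cokernel C \<phi> c" "Cod C c \<in> X"
  shows "monic_from_coproduct C X S Z T x"
  unfolding monic_from_coproduct_def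
  by (rule exI[of _ P], rule exI[of _ u], rule exI[of _ \<phi>], rule exI[of _ c]) (simp add: assms)

lemma small_subset: "\<lbrakk>small U B; A \<subseteq> B\<rbrakk> \<Longrightarrow> small U A"
  unfolding small_def by (meson lesspoll_trans1 subset_imp_lepoll)

lemma monic_from_coproduct_mono:
  "\<lbrakk>monic_from_coproduct C X S Z T x; X \<subseteq> X'\<rbrakk> \<Longrightarrow> monic_from_coproduct C X' S Z T x"
  unfolding monic_from_coproduct_def by blast

text \<open>One setting for both cotorsion pairs of a Hovey triple. Coproducts are required over the
  arcs into a vertex only, which keeps the universe type \<open>'u\<close> out of the statement, and
  compatibility is required along single arcs.\<close>

locale quiver_cotorsion = quiver_diagram G D
  for G :: "('v, 'a) pre_digraph" and D :: "('v, ('v, 'a) path, 'o, 'm) diagram" +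
  fixes X Y :: "'v \<Rightarrow> 'o set"
  assumes wf_arcs: "wf (arc_rel G)"
    and ex_coproduct_In: "\<And>i Z. \<lbrakk>i \<in> verts G; \<And>a. \<lbrakk>a \<in> arcs G; head G a = i\<rbrakk> \<Longrightarrow> Z a \<in> Ob (Cat D i)\<rbrakk> \<Longrightarrow>
        \<exists>P u. is_coproduct (Cat D i) {a \<in> arcs G. head G a = i} Z P u"
    and cotorsion: "i \<in> verts G \<Longrightarrow> complete_cotorsion_pair (Cat D i) (X i) (Y i)"
    and compat: "\<lbrakk>a \<in> arcs G; A \<in> X (tail G a)\<rbrakk> \<Longrightarrow> FOb (Fun D (arc_path G a)) A \<in> X (head G a)"
begin

abbreviation In where "In i \<equiv> {a \<in> arcs G. head G a = i}"

lemma arc_relI: "a \<in> arcs G \<Longrightarrow> (tail G a, head G a) \<in> arc_rel G"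
  by (auto simp: arc_rel_def)

lemma Phi_iff: "M \<in> Phi G D X \<longleftrightarrow> isrep M \<and> (\<forall>i\<in>verts G. monic_from_coproduct (Cat D i) (X i) (In i)
     (\<lambda>a. FOb (Fun D (arr a)) (ROb M (tail G a))) (ROb M i) (\<lambda>a. RMor M (arr a)))"
  unfolding Phi_def is_phi_def monic_from_coproduct_def by (fastforce simp: Hom_iff)

lemma cotorsion_at:
  assumes "i \<in> verts G"
  shows "X i \<subseteq> Ob (Cat D i)" "Y i \<subseteq> Ob (Cat D i)" "\<lbrakk>A \<in> X i; B \<in> Y i\<rbrakk> \<Longrightarrow> Ext1_vanishes (Cat D i) A B"
  using complete_cotorsion_pairD[OF cotorsion[OF assms]] by simp_all

text \<open>By induction along the arrows the coproduct \<open>P\<close> lies in the left class,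
  which is closed under coproducts, and \<open>M_i\<close> is an extension of the cokernel of
  \<open>\<phi>\<close> by \<open>P\<close>.\<close>

lemma Phi_components:
  assumes M: "M \<in> Phi G D X"
  shows "i \<in> verts G \<Longrightarrow> ROb M i \<in> X i"
proof (induction i rule: wf_induct_rule[OF wf_arcs])
  case (1 i)
  interpret C: abelian_category "Cat D i" by (rule abelian_Cat[OF 1(2)])
  obtain P u \<phi> c where P: "is_coproduct (Cat D i) (In i) (\<lambda>a. FOb (Fun D (arr a)) (ROb M (tail G a))) P u"
    and \<phi>: "\<phi> \<in> Mor (Cat D i)" "Dom (Cat D i) \<phi> = P" "Cod (Cat D i) \<phi> = ROb M i" "monic (Cat D i) \<phi>"
      "is_cokernel (Cat D i) \<phi> c" "Cod (Cat D i) c \<in> X i"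
    using M 1(2) unfolding Phi_iff monic_from_coproduct_def by blast
  have "P \<in> X i"
  proof (rule C.cotorsion_pair_coproduct[OF cotorsion[OF 1(2)] P])
    fix a assume a: "a \<in> In i"
    then have "ROb M (tail G a) \<in> X (tail G a)" using 1(1)[of "tail G a"] arc_relI[of a] by auto
    then show "FOb (Fun D (arr a)) (ROb M (tail G a)) \<in> X i" using compat[of a] a by auto
  qed
  then show ?case using C.cotorsion_pair_extension[OF cotorsion[OF 1(2)] \<phi>(4,5)] \<phi> by simp
qed

lemma Phi_Rep_sub_orthogonal:
  assumes M: "M \<in> Phi G D X" and N: "N \<in> Rep_sub PC D Y"
  shows "Ext1_vanishes RC M N"
proof (rule RC.Ext1_vanishesI)
  have Mr: "isrep M" and Nr: "isrep N" using M N by (simp_all add: Phi_iff)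
  show "M \<in> Ob RC" "N \<in> Ob RC" using Mr Nr by simp_all
  fix f g assume fg: "short_exact RC f g" "Dom RC f = N" "Cod RC g = M"
  define E where "E = Cod RC f"
  have t: "f \<in> Mor RC" "g \<in> Mor RC" "Dom RC g = E" and se: "\<And>i. i \<in> verts G \<Longrightarrow> short_exact (Cat D i) (cm f i) (cm g i)"
    using fg(1) by (simp_all add: RC_short_exact_iff E_def)
  note F = RC_MorD[OF t(1), unfolded fg(2) E_def[symmetric]] and GG = RC_MorD[OF t(2), unfolded fg(3) t(3)]
  \<comment> \<open>\<open>r\<close> is a section of \<open>g\<close> at \<open>i\<close> that
    commutes with the arcs into \<open>i\<close>, given the sections \<open>s\<close> at their
    sources. Outside \<open>verts G\<close> nothing is asked, so the choice can be made over the
    whole type.\<close>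
  define Q where "Q s i r \<longleftrightarrow> (i \<in> verts G \<longrightarrow> r \<in> Mor (Cat D i) \<and> Dom (Cat D i) r = ROb M i \<and> Cod (Cat D i) r = ROb E i \<and>
      cm g i \<odot>\<^bsub>Cat D i\<^esub> r = Id (Cat D i) (ROb M i) \<and>
      (\<forall>a\<in>In i. r \<odot>\<^bsub>Cat D i\<^esub> RMor M (arr a) = RMor E (arr a) \<odot>\<^bsub>Cat D i\<^esub> FMor (Fun D (arr a)) (s (tail G a))))" for s i r
  have "\<exists>s. \<forall>i. Q s i (s i)"
  proof (rule dependent_wf_choice[OF wf_arcs])
    show "Q s i r = Q s' i r" if "\<And>j. (j, i) \<in> arc_rel G \<Longrightarrow> s j = s' j" for s s' i r
    proof -
      have "s (tail G a) = s' (tail G a)" if "a \<in> In i" for a using \<open>\<And>j. (j, i) \<in> arc_rel G \<Longrightarrow> s j = s' j\<close> that arc_relI[of a] by auto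
      then show ?thesis unfolding Q_def by simp
    qed
    fix i s assume IH: "\<And>j. (j, i) \<in> arc_rel G \<Longrightarrow> Q s j (s j)"
    show "\<exists>r. Q s i r"
    proof (cases "i \<in> verts G")
      case i: True
      let ?C = "Cat D i"
      interpret C: abelian_category ?C by (rule abelian_Cat[OF i])
      have s: "s (tail G a) \<in> Mor (Cat D (tail G a))" "Dom (Cat D (tail G a)) (s (tail G a)) = ROb M (tail G a)"
        "Cod (Cat D (tail G a)) (s (tail G a)) = ROb E (tail G a)"
        "cm g (tail G a) \<odot>\<^bsub>Cat D (tail G a)\<^esub> s (tail G a) = Id (Cat D (tail G a)) (ROb M (tail G a))" if "a \<in> In i" for a
        using IH[of "tail G a"] that arc_relI[of a] unfolding Q_def by auto
      obtain P u \<phi> c where P: "is_coproduct ?C (In i) (\<lambda>a. FOb (Fun D (arr a)) (ROb M (tail G a))) P u"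
        and \<phi>: "\<phi> \<in> Mor ?C" "Dom ?C \<phi> = P" "Cod ?C \<phi> = ROb M i" "\<And>a. a \<in> In i \<Longrightarrow> \<phi> \<odot>\<^bsub>?C\<^esub> u a = RMor M (arr a)" "monic ?C \<phi>"
          "is_cokernel ?C \<phi> c" "Cod ?C c \<in> X i"
        by (rule monic_from_coproductE[OF Phi_iff[THEN iffD1, OF M, THEN conjunct2, THEN bspec, OF i]]) (rule that)
      note I = C.coproduct_inj[OF P]
      have EO: "ROb E i \<in> Ob ?C" using F i by simp
      \<comment> \<open>The sections already chosen prescribe the new one on the coproduct, namely
        as \<open>w\<close>. The square \<open>sq\<close> states that the prescription is compatible
        with being a section.\<close>
      obtain w where w: "w \<in> Mor ?C" "Dom ?C w = P" "Cod ?C w = ROb E i"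
          "\<And>a. a \<in> In i \<Longrightarrow> w \<odot>\<^bsub>?C\<^esub> u a = RMor E (arr a) \<odot>\<^bsub>?C\<^esub> FMor (Fun D (arr a)) (s (tail G a))"
        by (rule C.coproduct_lift[OF P EO, of "\<lambda>a. RMor E (arr a) \<odot>\<^bsub>?C\<^esub> FMor (Fun D (arr a)) (s (tail G a))"])
          (use s i F(2) in \<open>auto simp: Hom_iff\<close>)
      have sq: "cm g i \<odot>\<^bsub>?C\<^esub> w = Id ?C (ROb M i) \<odot>\<^bsub>?C\<^esub> \<phi>"
      proof (rule C.coproduct_ext[OF P])
        fix a assume a: "a \<in> In i"
        have a': "a \<in> arcs G" "head G a = i" "tail G a \<in> verts G" using a by auto
        let ?F = "FMor (Fun D (arr a))"
        have "(cm g i \<odot>\<^bsub>?C\<^esub> w) \<odot>\<^bsub>?C\<^esub> u a = cm g i \<odot>\<^bsub>?C\<^esub> (w \<odot>\<^bsub>?C\<^esub> u a)"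
          by (rule C.comp_assoc) (use w(1-3) I[OF a] GG(3-5)[OF i] in simp_all)
        also have "\<dots> = (cm g i \<odot>\<^bsub>?C\<^esub> RMor E (arr a)) \<odot>\<^bsub>?C\<^esub> ?F (s (tail G a))"
          unfolding w(4)[OF a] by (rule C.comp_assoc[symmetric]) (use s[OF a] a' i F(2) GG(3-5)[OF i] in simp_all)
        also have "cm g i \<odot>\<^bsub>?C\<^esub> RMor E (arr a) = RMor M (arr a) \<odot>\<^bsub>?C\<^esub> ?F (cm g (tail G a))"
          using GG(6)[OF a'(1)] a' by simp
        also have "\<dots> \<odot>\<^bsub>?C\<^esub> ?F (s (tail G a)) = RMor M (arr a) \<odot>\<^bsub>?C\<^esub> (?F (cm g (tail G a)) \<odot>\<^bsub>?C\<^esub> ?F (s (tail G a)))"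
          by (rule C.comp_assoc) (use s[OF a] a' i Mr GG(3-5)[OF a'(3)] in simp_all)
        also have "?F (cm g (tail G a)) \<odot>\<^bsub>?C\<^esub> ?F (s (tail G a)) = ?F (Id (Cat D (tail G a)) (ROb M (tail G a)))"
          unfolding s(4)[OF a, symmetric] by (rule Fun_comp[symmetric]) (use s[OF a] a' GG(3-5)[OF a'(3)] in simp_all)
        also have "\<dots> = Id ?C (FOb (Fun D (arr a)) (ROb M (tail G a)))" using Fun_Id[of "arr a" "ROb M (tail G a)"] a' Mr by simp
        also have "RMor M (arr a) \<odot>\<^bsub>?C\<^esub> \<dots> = (Id ?C (ROb M i) \<odot>\<^bsub>?C\<^esub> \<phi>) \<odot>\<^bsub>?C\<^esub> u a"
          using a' i Mr \<phi>(1-3) \<phi>(4)[OF a] by simp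
        finally show "(cm g i \<odot>\<^bsub>?C\<^esub> w) \<odot>\<^bsub>?C\<^esub> u a = (Id ?C (ROb M i) \<odot>\<^bsub>?C\<^esub> \<phi>) \<odot>\<^bsub>?C\<^esub> u a" .
      qed (use w(1-3) \<phi>(1-3) GG(3-5)[OF i] i Mr in simp_all)
      have ext: "Ext1_vanishes ?C (Cod ?C c) (ROb N i)" by (rule cotorsion_at(3)[OF i \<phi>(7)]) (use N i in simp)
      \<comment> \<open>A lift in this square is at once a section of \<open>g\<close> and an
        extension of \<open>w\<close>; the latter is the commutation with the arcs into
        \<open>i\<close>.\<close>
      obtain r where r: "r \<in> Mor ?C" "Dom ?C r = Cod ?C \<phi>" "Cod ?C r = Cod ?C (cm f i)" "cm g i \<odot>\<^bsub>?C\<^esub> r = Id ?C (ROb M i)" "r \<odot>\<^bsub>?C\<^esub> \<phi> = w"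
        by (rule llpD[OF C.llp_if_Ext1_vanishes[OF \<phi>(5,6) ext] se[OF i] _ w(1) _ _ _ _ _ sq])
          (use w(2,3) \<phi>(1-3) F(3-5)[OF i] GG(3-5)[OF i] i Mr in simp_all)
      have "r \<odot>\<^bsub>?C\<^esub> RMor M (arr a) = RMor E (arr a) \<odot>\<^bsub>?C\<^esub> FMor (Fun D (arr a)) (s (tail G a))" if a: "a \<in> In i" for a
      proof -
        have "r \<odot>\<^bsub>?C\<^esub> (\<phi> \<odot>\<^bsub>?C\<^esub> u a) = (r \<odot>\<^bsub>?C\<^esub> \<phi>) \<odot>\<^bsub>?C\<^esub> u a"
          by (rule C.comp_assoc[symmetric]) (use r(1-3) \<phi>(1-3) I[OF a] in simp_all)
        then show ?thesis unfolding \<phi>(4)[OF a] r(5) w(4)[OF a] .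
      qed
      then have "Q s i r" unfolding Q_def using r(1-4) \<phi>(3) F(3-5)[OF i] by simp
      then show ?thesis by blast
    qed (simp add: Q_def)
  qed
  then obtain s where s: "\<And>i. Q s i (s i)" by blast
  have s': "s i \<in> Mor (Cat D i)" "Dom (Cat D i) (s i) = ROb M i" "Cod (Cat D i) (s i) = ROb E i"
      "cm g i \<odot>\<^bsub>Cat D i\<^esub> s i = Id (Cat D i) (ROb M i)"
      "\<And>a. \<lbrakk>a \<in> arcs G; head G a = i\<rbrakk> \<Longrightarrow> s i \<odot>\<^bsub>Cat D i\<^esub> RMor M (arr a) = RMor E (arr a) \<odot>\<^bsub>Cat D i\<^esub> FMor (Fun D (arr a)) (s (tail G a))"
    if "i \<in> verts G" for i using s[of i] that unfolding Q_def by simp_all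
  let ?s = "mk M s E"
  have S: "?s \<in> Mor RC" by (rule mk_Mor) (use Mr F(2) s' in simp_all)
  have "Comp RC g ?s = Id RC M" by (rule RC_ext) (use S t fg Mr s' in simp_all)
  then show "\<exists>s. s \<in> Mor RC \<and> Dom RC s = M \<and> Cod RC s = Cod RC f \<and> Comp RC g s = Id RC M"
    using S by (intro exI[of _ ?s]) (simp add: E_def)
qed

text \<open>\<open>s\<close> and \<open>r\<close> induce \<open>\<sigma>\<close> and
  \<open>\<rho>\<close> on the coproducts with \<open>\<rho> \<sigma> = 1\<close>, so the map
  \<open>\<phi>\<close> of \<open>M\<close> is a retract of the map \<open>\<phi>'\<close> of
  \<open>N\<close>. It is monic because \<open>cm s i\<close> after \<open>\<phi>\<close> equals the
  monomorphism \<open>\<phi>' \<sigma>\<close>, and its cokernel is a retract of that of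
  \<open>\<phi>'\<close>.\<close>

lemma Phi_retract:
  assumes ret: "retract RC M N" and N: "N \<in> Phi G D X"
  shows "M \<in> Phi G D X"
proof -
  obtain s r where s: "s \<in> Mor RC" "Dom RC s = M" "Cod RC s = N" and r: "r \<in> Mor RC" "Dom RC r = N" "Cod RC r = M"
    and rs: "Comp RC r s = Id RC M" using ret by (auto simp: retract_def Hom_iff)
  note S = RC_MorD[OF s(1), unfolded s(2,3)] and R = RC_MorD[OF r(1), unfolded r(2,3)]
  have rsi: "cm r i \<odot>\<^bsub>Cat D i\<^esub> cm s i = Id (Cat D i) (ROb M i)" if "i \<in> verts G" for i
    using arg_cong[OF rs, of "\<lambda>x. cm x i"] that by simp
  have "monic_from_coproduct (Cat D i) (X i) (In i) (\<lambda>a. FOb (Fun D (arr a)) (ROb M (tail G a))) (ROb M i) (\<lambda>a. RMor M (arr a))"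
    if i: "i \<in> verts G" for i
  proof -
    let ?C = "Cat D i" and ?F = "\<lambda>a. FMor (Fun D (arr a))"
    interpret C: abelian_category ?C by (rule abelian_Cat[OF i])
    obtain P' u' \<phi>' c' where P': "is_coproduct ?C (In i) (\<lambda>a. FOb (Fun D (arr a)) (ROb N (tail G a))) P' u'"
      and \<phi>': "\<phi>' \<in> Mor ?C" "Dom ?C \<phi>' = P'" "Cod ?C \<phi>' = ROb N i" "\<And>a. a \<in> In i \<Longrightarrow> \<phi>' \<odot>\<^bsub>?C\<^esub> u' a = RMor N (arr a)" "monic ?C \<phi>'"
        "is_cokernel ?C \<phi>' c'" "Cod ?C c' \<in> X i"
      by (rule monic_from_coproductE[OF Phi_iff[THEN iffD1, OF N, THEN conjunct2, THEN bspec, OF i]]) (rule that)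
    obtain P u where P: "is_coproduct ?C (In i) (\<lambda>a. FOb (Fun D (arr a)) (ROb M (tail G a))) P u"
      using ex_coproduct_In[OF i, of "\<lambda>a. FOb (Fun D (arr a)) (ROb M (tail G a))"] S(1) by auto
    note I = C.coproduct_inj[OF P] and I' = C.coproduct_inj[OF P']
    have a': "a \<in> arcs G" "head G a = i" "tail G a \<in> verts G" if "a \<in> In i" for a using that by auto
    have MO: "ROb M i \<in> Ob ?C" using S i by simp
    obtain \<phi> where \<phi>: "\<phi> \<in> Mor ?C" "Dom ?C \<phi> = P" "Cod ?C \<phi> = ROb M i" "\<And>a. a \<in> In i \<Longrightarrow> \<phi> \<odot>\<^bsub>?C\<^esub> u a = RMor M (arr a)"
      by (rule C.coproduct_lift[OF P MO, of "\<lambda>a. RMor M (arr a)"]) (use S(1) i in \<open>auto simp: Hom_iff\<close>)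
    obtain \<sigma> where \<sigma>: "\<sigma> \<in> Mor ?C" "Dom ?C \<sigma> = P" "Cod ?C \<sigma> = P'" "\<And>a. a \<in> In i \<Longrightarrow> \<sigma> \<odot>\<^bsub>?C\<^esub> u a = u' a \<odot>\<^bsub>?C\<^esub> ?F a (cm s (tail G a))"
      by (rule C.coproduct_lift[OF P C.coproduct_ob[OF P'], of "\<lambda>a. u' a \<odot>\<^bsub>?C\<^esub> ?F a (cm s (tail G a))"]) (use S(3-5) I' i in \<open>auto simp: Hom_iff\<close>)
    obtain \<rho> where \<rho>: "\<rho> \<in> Mor ?C" "Dom ?C \<rho> = P'" "Cod ?C \<rho> = P" "\<And>a. a \<in> In i \<Longrightarrow> \<rho> \<odot>\<^bsub>?C\<^esub> u' a = u a \<odot>\<^bsub>?C\<^esub> ?F a (cm r (tail G a))"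
      by (rule C.coproduct_lift[OF P' C.coproduct_ob[OF P], of "\<lambda>a. u a \<odot>\<^bsub>?C\<^esub> ?F a (cm r (tail G a))"]) (use R(3-5) I i in \<open>auto simp: Hom_iff\<close>)
    have "\<rho> \<odot>\<^bsub>?C\<^esub> \<sigma> = Id ?C P"
    proof (rule C.coproduct_ext[OF P])
      fix a assume a: "a \<in> In i"
      note A = a'[OF a]
      have "(\<rho> \<odot>\<^bsub>?C\<^esub> \<sigma>) \<odot>\<^bsub>?C\<^esub> u a = \<rho> \<odot>\<^bsub>?C\<^esub> (\<sigma> \<odot>\<^bsub>?C\<^esub> u a)" by (rule C.comp_assoc) (use \<rho>(1-3) \<sigma>(1-3) I[OF a] in simp_all)
      also have "\<dots> = (\<rho> \<odot>\<^bsub>?C\<^esub> u' a) \<odot>\<^bsub>?C\<^esub> ?F a (cm s (tail G a))"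
        unfolding \<sigma>(4)[OF a] by (rule C.comp_assoc[symmetric]) (use \<rho>(1-3) I'[OF a] A S(3-5)[OF A(3)] in simp_all)
      also have "\<dots> = u a \<odot>\<^bsub>?C\<^esub> (?F a (cm r (tail G a)) \<odot>\<^bsub>?C\<^esub> ?F a (cm s (tail G a)))"
        unfolding \<rho>(4)[OF a] by (rule C.comp_assoc) (use I[OF a] A S(3-5)[OF A(3)] R(3-5)[OF A(3)] in simp_all)
      also have "?F a (cm r (tail G a)) \<odot>\<^bsub>?C\<^esub> ?F a (cm s (tail G a)) = ?F a (Id (Cat D (tail G a)) (ROb M (tail G a)))"
        unfolding rsi[OF A(3), symmetric] by (rule Fun_comp[symmetric]) (use A S(3-5)[OF A(3)] R(3-5)[OF A(3)] in simp_all)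
      also have "\<dots> = Id ?C (FOb (Fun D (arr a)) (ROb M (tail G a)))" using Fun_Id[of "arr a" "ROb M (tail G a)"] A S(1) by simp
      finally show "(\<rho> \<odot>\<^bsub>?C\<^esub> \<sigma>) \<odot>\<^bsub>?C\<^esub> u a = Id ?C P \<odot>\<^bsub>?C\<^esub> u a" using I[OF a] by simp
    qed (use \<rho>(1-3) \<sigma>(1-3) C.coproduct_ob[OF P] in simp_all)
    then have "monic ?C (\<rho> \<odot>\<^bsub>?C\<^esub> \<sigma>)" using C.monic_Id[OF C.coproduct_ob[OF P]] by simp
    then have m\<sigma>: "monic ?C \<sigma>" by (rule C.monic_left_factor) (use \<rho>(1-3) \<sigma>(1-3) in simp_all)
    have e1: "\<phi>' \<odot>\<^bsub>?C\<^esub> \<sigma> = cm s i \<odot>\<^bsub>?C\<^esub> \<phi>"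
    proof (rule C.coproduct_ext[OF P])
      fix a assume a: "a \<in> In i"
      note A = a'[OF a]
      have "(\<phi>' \<odot>\<^bsub>?C\<^esub> \<sigma>) \<odot>\<^bsub>?C\<^esub> u a = \<phi>' \<odot>\<^bsub>?C\<^esub> (\<sigma> \<odot>\<^bsub>?C\<^esub> u a)" by (rule C.comp_assoc) (use \<phi>'(1-3) \<sigma>(1-3) I[OF a] in simp_all)
      also have "\<dots> = (\<phi>' \<odot>\<^bsub>?C\<^esub> u' a) \<odot>\<^bsub>?C\<^esub> ?F a (cm s (tail G a))"
        unfolding \<sigma>(4)[OF a] by (rule C.comp_assoc[symmetric]) (use \<phi>'(1-3) I'[OF a] A S(3-5)[OF A(3)] in simp_all)
      also have "\<dots> = cm s i \<odot>\<^bsub>?C\<^esub> (\<phi> \<odot>\<^bsub>?C\<^esub> u a)" unfolding \<phi>'(4)[OF a] \<phi>(4)[OF a] using S(6)[OF A(1)] A by simp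
      also have "\<dots> = (cm s i \<odot>\<^bsub>?C\<^esub> \<phi>) \<odot>\<^bsub>?C\<^esub> u a" by (rule C.comp_assoc[symmetric]) (use \<phi>(1-3) I[OF a] S(3-5)[OF i] in simp_all)
      finally show "(\<phi>' \<odot>\<^bsub>?C\<^esub> \<sigma>) \<odot>\<^bsub>?C\<^esub> u a = (cm s i \<odot>\<^bsub>?C\<^esub> \<phi>) \<odot>\<^bsub>?C\<^esub> u a" .
    qed (use \<phi>'(1-3) \<sigma>(1-3) \<phi>(1-3) S(3-5)[OF i] in simp_all)
    have e2: "\<phi> \<odot>\<^bsub>?C\<^esub> \<rho> = cm r i \<odot>\<^bsub>?C\<^esub> \<phi>'"
    proof (rule C.coproduct_ext[OF P'])
      fix a assume a: "a \<in> In i"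
      note A = a'[OF a]
      have "(\<phi> \<odot>\<^bsub>?C\<^esub> \<rho>) \<odot>\<^bsub>?C\<^esub> u' a = \<phi> \<odot>\<^bsub>?C\<^esub> (\<rho> \<odot>\<^bsub>?C\<^esub> u' a)" by (rule C.comp_assoc) (use \<phi>(1-3) \<rho>(1-3) I'[OF a] in simp_all)
      also have "\<dots> = (\<phi> \<odot>\<^bsub>?C\<^esub> u a) \<odot>\<^bsub>?C\<^esub> ?F a (cm r (tail G a))"
        unfolding \<rho>(4)[OF a] by (rule C.comp_assoc[symmetric]) (use \<phi>(1-3) I[OF a] A R(3-5)[OF A(3)] in simp_all)
      also have "\<dots> = cm r i \<odot>\<^bsub>?C\<^esub> (\<phi>' \<odot>\<^bsub>?C\<^esub> u' a)" unfolding \<phi>'(4)[OF a] \<phi>(4)[OF a] using R(6)[OF A(1)] A by simp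
      also have "\<dots> = (cm r i \<odot>\<^bsub>?C\<^esub> \<phi>') \<odot>\<^bsub>?C\<^esub> u' a" by (rule C.comp_assoc[symmetric]) (use \<phi>'(1-3) I'[OF a] R(3-5)[OF i] in simp_all)
      finally show "(\<phi> \<odot>\<^bsub>?C\<^esub> \<rho>) \<odot>\<^bsub>?C\<^esub> u' a = (cm r i \<odot>\<^bsub>?C\<^esub> \<phi>') \<odot>\<^bsub>?C\<^esub> u' a" .
    qed (use \<phi>'(1-3) \<rho>(1-3) \<phi>(1-3) R(3-5)[OF i] in simp_all)
    have "monic ?C (\<phi>' \<odot>\<^bsub>?C\<^esub> \<sigma>)" by (rule C.monic_comp[OF m\<sigma> \<phi>'(5)]) (use \<phi>' \<sigma> in simp)
    then have m\<phi>: "monic ?C \<phi>" unfolding e1 by (rule C.monic_left_factor) (use \<phi>(1-3) S(3-5)[OF i] in simp_all)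
    obtain c where c: "is_cokernel ?C \<phi> c" using C.ex_cokernel[OF \<phi>(1)] by blast
    note Cc = C.cokernelD[OF c] and Cc' = C.cokernelD[OF \<phi>'(6)]
    have z1: "(c' \<odot>\<^bsub>?C\<^esub> cm s i) \<odot>\<^bsub>?C\<^esub> \<phi> = Zero ?C (Dom ?C \<phi>) (Cod ?C (c' \<odot>\<^bsub>?C\<^esub> cm s i))"
    proof -
      have "(c' \<odot>\<^bsub>?C\<^esub> cm s i) \<odot>\<^bsub>?C\<^esub> \<phi> = c' \<odot>\<^bsub>?C\<^esub> (\<phi>' \<odot>\<^bsub>?C\<^esub> \<sigma>)"
        unfolding e1 by (rule C.comp_assoc) (use Cc' \<phi>' \<phi>(1-3) S(3-5)[OF i] in simp_all)
      also have "\<dots> = Zero ?C P (Cod ?C c')" using C.zero_factor[OF Cc'(4), of \<sigma>] Cc' \<phi>' \<sigma> by simp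
      finally show ?thesis using Cc' \<phi>'(1-3) \<phi>(1-3) S(3-5)[OF i] by simp
    qed
    obtain s' where s': "s' \<in> Mor ?C" "Cod ?C s' = Cod ?C (c' \<odot>\<^bsub>?C\<^esub> cm s i)" "Dom ?C s' = Cod ?C c" "s' \<odot>\<^bsub>?C\<^esub> c = c' \<odot>\<^bsub>?C\<^esub> cm s i"
      by (rule C.cokernel_lift[OF c _ _ z1]) (use Cc' \<phi>'(1-3) \<phi>(1-3) S(3-5)[OF i] in simp_all)
    have z2: "(c \<odot>\<^bsub>?C\<^esub> cm r i) \<odot>\<^bsub>?C\<^esub> \<phi>' = Zero ?C (Dom ?C \<phi>') (Cod ?C (c \<odot>\<^bsub>?C\<^esub> cm r i))"
    proof -
      have "(c \<odot>\<^bsub>?C\<^esub> cm r i) \<odot>\<^bsub>?C\<^esub> \<phi>' = c \<odot>\<^bsub>?C\<^esub> (\<phi> \<odot>\<^bsub>?C\<^esub> \<rho>)"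
        unfolding e2 by (rule C.comp_assoc) (use Cc \<phi>'(1-3) \<phi>(1-3) R(3-5)[OF i] in simp_all)
      also have "\<dots> = Zero ?C P' (Cod ?C c)" using C.zero_factor[OF Cc(4), of \<rho>] Cc \<phi>(1-3) \<rho> by simp
      finally show ?thesis using Cc \<phi>'(1-3) \<phi>(1-3) R(3-5)[OF i] by simp
    qed
    obtain r' where r': "r' \<in> Mor ?C" "Cod ?C r' = Cod ?C (c \<odot>\<^bsub>?C\<^esub> cm r i)" "Dom ?C r' = Cod ?C c'" "r' \<odot>\<^bsub>?C\<^esub> c' = c \<odot>\<^bsub>?C\<^esub> cm r i"
      by (rule C.cokernel_lift[OF \<phi>'(6) _ _ z2]) (use Cc \<phi>'(1-3) \<phi>(1-3) R(3-5)[OF i] in simp_all)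
    have t: "Cod ?C s' = Cod ?C c'" "Cod ?C r' = Cod ?C c" "Dom ?C c = ROb M i" "Dom ?C c' = ROb N i"
      using s'(2) r'(2) Cc Cc' \<phi>'(1-3) \<phi>(1-3) R(3-5)[OF i] S(3-5)[OF i] by simp_all
    have "r' \<odot>\<^bsub>?C\<^esub> s' = Id ?C (Cod ?C c)"
    proof (rule C.epicD[OF C.cokernel_epic[OF c]])
      have "(r' \<odot>\<^bsub>?C\<^esub> s') \<odot>\<^bsub>?C\<^esub> c = r' \<odot>\<^bsub>?C\<^esub> (c' \<odot>\<^bsub>?C\<^esub> cm s i)"
        unfolding s'(4)[symmetric] by (rule C.comp_assoc) (use r'(1,3) s'(1,3) t Cc(2) in simp_all)
      also have "\<dots> = (c \<odot>\<^bsub>?C\<^esub> cm r i) \<odot>\<^bsub>?C\<^esub> cm s i"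
        unfolding r'(4)[symmetric] by (rule C.comp_assoc[symmetric]) (use r'(1,3) t Cc'(2) S(3-5)[OF i] in simp_all)
      also have "\<dots> = c \<odot>\<^bsub>?C\<^esub> (cm r i \<odot>\<^bsub>?C\<^esub> cm s i)"
        by (rule C.comp_assoc) (use t Cc(2) S(3-5)[OF i] R(3-5)[OF i] in simp_all)
      finally show "(r' \<odot>\<^bsub>?C\<^esub> s') \<odot>\<^bsub>?C\<^esub> c = Id ?C (Cod ?C c) \<odot>\<^bsub>?C\<^esub> c" using rsi[OF i] t Cc(2) by simp
    qed (use r'(1,3) s'(1,3) t Cc(2) in simp_all)
    moreover have "s' \<in> Hom ?C (Cod ?C c) (Cod ?C c')" "r' \<in> Hom ?C (Cod ?C c') (Cod ?C c)" using r' s' t by (simp_all add: Hom_iff)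
    ultimately have "retract ?C (Cod ?C c) (Cod ?C c')" unfolding retract_def by blast
    then have "Cod ?C c \<in> X i" by (rule C.cotorsion_pair_retract_left[OF cotorsion[OF i] _ \<phi>'(7)])
    with \<phi>(4) show ?thesis by (rule monic_from_coproductI[OF P \<phi>(1-3) _ m\<phi> c])
  qed
  then show ?thesis using S(1) by (simp add: Phi_iff)
qed

lemma Rep_sub_retract:
  assumes ret: "retract RC M N" and N: "N \<in> Rep_sub PC D Y"
  shows "M \<in> Rep_sub PC D Y"
proof -
  obtain s r where s: "s \<in> Mor RC" "Dom RC s = M" "Cod RC s = N" and r: "r \<in> Mor RC" "Dom RC r = N" "Cod RC r = M"
    and rs: "Comp RC r s = Id RC M" using ret by (auto simp: retract_def Hom_iff)
  note S = RC_MorD[OF s(1), unfolded s(2,3)] and R = RC_MorD[OF r(1), unfolded r(2,3)]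
  have "ROb M i \<in> Y i" if i: "i \<in> verts G" for i
  proof -
    have "cm r i \<odot>\<^bsub>Cat D i\<^esub> cm s i = Id (Cat D i) (ROb M i)" using arg_cong[OF rs, of "\<lambda>x. cm x i"] i by simp
    moreover have "cm s i \<in> Hom (Cat D i) (ROb M i) (ROb N i)" "cm r i \<in> Hom (Cat D i) (ROb N i) (ROb M i)"
      using S(3-5)[OF i] R(3-5)[OF i] by (simp_all add: Hom_iff)
    ultimately have "retract (Cat D i) (ROb M i) (ROb N i)" unfolding retract_def by blast
    then show ?thesis
      by (rule abelian_category.cotorsion_pair_retract_right[OF abelian_Cat[OF i] cotorsion[OF i]]) (use N i in simp)
  qed
  then show ?thesis using S(1) by simp
qed

lemma ex_precover:
  assumes M: "isrep M"
  shows "\<exists>f g. short_exact RC f g \<and> Dom RC f \<in> Rep_sub PC D Y \<and> Cod RC f \<in> Phi G D X \<and> Cod RC g = M"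
proof -
  let ?F = "\<lambda>a. FMor (Fun D (arr a))"
  \<comment> \<open>A choice at \<open>i\<close> is a triple: the object of the cover, its maps
    along the arcs into \<open>i\<close>, and its projection onto \<open>M_i\<close>.\<close>
  define ob where "ob r = fst r" for r :: "'o \<times> ('a \<Rightarrow> 'm) \<times> 'm"
  define ma where "ma r = fst (snd r)" for r :: "'o \<times> ('a \<Rightarrow> 'm) \<times> 'm"
  define pr where "pr r = snd (snd r)" for r :: "'o \<times> ('a \<Rightarrow> 'm) \<times> 'm"
  define Q where "Q f i r \<longleftrightarrow> (i \<in> verts G \<longrightarrow> pr r \<in> Mor (Cat D i) \<and> Dom (Cat D i) (pr r) = ob r \<and> Cod (Cat D i) (pr r) = ROb M i \<and>
      epic (Cat D i) (pr r) \<and> (\<exists>k. is_kernel (Cat D i) (pr r) k \<and> Dom (Cat D i) k \<in> Y i) \<and>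
      (\<forall>a\<in>In i. ma r a \<in> Hom (Cat D i) (FOb (Fun D (arr a)) (ob (f (tail G a)))) (ob r) \<and>
         pr r \<odot>\<^bsub>Cat D i\<^esub> ma r a = RMor M (arr a) \<odot>\<^bsub>Cat D i\<^esub> ?F a (pr (f (tail G a)))) \<and>
      monic_from_coproduct (Cat D i) (X i) (In i) (\<lambda>a. FOb (Fun D (arr a)) (ob (f (tail G a)))) (ob r) (ma r))" for f i r
  have "\<exists>f. \<forall>i. Q f i (f i)"
  proof (rule dependent_wf_choice[OF wf_arcs])
    show "Q f i r = Q f' i r" if e: "\<And>j. (j, i) \<in> arc_rel G \<Longrightarrow> f j = f' j" for f f' i r
    proof -
      have eq: "f (tail G a) = f' (tail G a)" if "a \<in> In i" for a using e that arc_relI[of a] by auto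
      have "monic_from_coproduct (Cat D i) (X i) (In i) (\<lambda>a. FOb (Fun D (arr a)) (ob (f (tail G a)))) (ob r) (ma r) \<longleftrightarrow>
        monic_from_coproduct (Cat D i) (X i) (In i) (\<lambda>a. FOb (Fun D (arr a)) (ob (f' (tail G a)))) (ob r) (ma r)"
        by (rule monic_from_coproduct_cong) (use eq in simp_all)
      then show ?thesis unfolding Q_def using eq by simp
    qed
    fix i f assume IH: "\<And>j. (j, i) \<in> arc_rel G \<Longrightarrow> Q f j (f j)"
    show "\<exists>r. Q f i r"
    proof (cases "i \<in> verts G")
      case i: True
      let ?C = "Cat D i" and ?Z = "\<lambda>a. FOb (Fun D (arr a)) (ob (f (tail G a)))"
      interpret C: abelian_category ?C by (rule abelian_Cat[OF i])
      have p: "pr (f (tail G a)) \<in> Mor (Cat D (tail G a))" "Dom (Cat D (tail G a)) (pr (f (tail G a))) = ob (f (tail G a))"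
        "Cod (Cat D (tail G a)) (pr (f (tail G a))) = ROb M (tail G a)" if "a \<in> In i" for a
        using IH[of "tail G a"] that arc_relI[of a] unfolding Q_def by auto
      have ZO: "?Z a \<in> Ob ?C" if "a \<in> arcs G" "head G a = i" for a
      proof -
        have "ob (f (tail G a)) \<in> Ob (Cat D (tail G a))" using p[of a] that C_simps(9)[of "tail G a" "pr (f (tail G a))"] by simp
        then show ?thesis using that by simp
      qed
      obtain P u where P: "is_coproduct ?C (In i) ?Z P u" using ex_coproduct_In[OF i, of ?Z] ZO by auto
      note I = C.coproduct_inj[OF P]
      have MO: "ROb M i \<in> Ob ?C" using M i by simp
      \<comment> \<open>The composite that the cover has to realize: the earlier projections
        followed by the structure maps of \<open>M\<close>.\<close>
      obtain h where h: "h \<in> Mor ?C" "Dom ?C h = P" "Cod ?C h = ROb M i"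
          "\<And>a. a \<in> In i \<Longrightarrow> h \<odot>\<^bsub>?C\<^esub> u a = RMor M (arr a) \<odot>\<^bsub>?C\<^esub> ?F a (pr (f (tail G a)))"
        by (rule C.coproduct_lift[OF P MO, of "\<lambda>a. RMor M (arr a) \<odot>\<^bsub>?C\<^esub> ?F a (pr (f (tail G a)))"])
          (use p i M in \<open>auto simp: Hom_iff\<close>)
      \<comment> \<open>Both requirements are met by one factorization \<open>h = q j\<close>:
        \<open>j\<close> becomes the map of the cover from the coproduct, with cokernel in
        \<open>X i\<close>, and \<open>q\<close> becomes its projection, with kernel in
        \<open>Y i\<close>.\<close>
      obtain j q c k where j: "j \<in> Mor ?C" "q \<in> Mor ?C" "Dom ?C j = Dom ?C h" "Cod ?C q = Cod ?C h" "Dom ?C q = Cod ?C j" "q \<odot>\<^bsub>?C\<^esub> j = h"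
        "monic ?C j" "is_cokernel ?C j c" "Cod ?C c \<in> X i" "epic ?C q" "is_kernel ?C q k" "Dom ?C k \<in> Y i"
        by (rule C.cotorsion_pair_factorization[OF cotorsion[OF i] h(1)])
      have ju: "j \<odot>\<^bsub>?C\<^esub> u a \<in> Hom ?C (?Z a) (Cod ?C j)" if "a \<in> In i" for a using I[OF that] j h by (simp add: Hom_iff)
      have qju: "q \<odot>\<^bsub>?C\<^esub> (j \<odot>\<^bsub>?C\<^esub> u a) = RMor M (arr a) \<odot>\<^bsub>?C\<^esub> ?F a (pr (f (tail G a)))" if a: "a \<in> In i" for a
      proof -
        have "q \<odot>\<^bsub>?C\<^esub> (j \<odot>\<^bsub>?C\<^esub> u a) = (q \<odot>\<^bsub>?C\<^esub> j) \<odot>\<^bsub>?C\<^esub> u a" by (rule C.comp_assoc[symmetric]) (use I[OF a] j h in simp_all)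
        then show ?thesis using j(6) h(4)[OF a] by simp
      qed
      have "monic_from_coproduct ?C (X i) (In i) ?Z (Cod ?C j) (\<lambda>a. j \<odot>\<^bsub>?C\<^esub> u a)"
        by (rule monic_from_coproductI[OF P j(1) _ _ _ j(7,8,9)]) (use j h in simp_all)
      then have "Q f i (Cod ?C j, (\<lambda>a. j \<odot>\<^bsub>?C\<^esub> u a), q)"
        unfolding Q_def ob_def ma_def pr_def fst_conv snd_conv using j h(3) ju qju unfolding ob_def ma_def pr_def by auto
      then show ?thesis by blast
    qed (simp add: Q_def)
  qed
  then obtain f where f: "\<And>i. Q f i (f i)" by blast
  have q: "pr (f i) \<in> Mor (Cat D i)" "Dom (Cat D i) (pr (f i)) = ob (f i)" "Cod (Cat D i) (pr (f i)) = ROb M i"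
      "epic (Cat D i) (pr (f i))" "\<exists>k. is_kernel (Cat D i) (pr (f i)) k \<and> Dom (Cat D i) k \<in> Y i"
      "\<And>a. \<lbrakk>a \<in> arcs G; head G a = i\<rbrakk> \<Longrightarrow> ma (f i) a \<in> Hom (Cat D i) (FOb (Fun D (arr a)) (ob (f (tail G a)))) (ob (f i))"
      "\<And>a. \<lbrakk>a \<in> arcs G; head G a = i\<rbrakk> \<Longrightarrow> pr (f i) \<odot>\<^bsub>Cat D i\<^esub> ma (f i) a = RMor M (arr a) \<odot>\<^bsub>Cat D i\<^esub> ?F a (pr (f (tail G a)))"
      "monic_from_coproduct (Cat D i) (X i) (In i) (\<lambda>a. FOb (Fun D (arr a)) (ob (f (tail G a)))) (ob (f i)) (ma (f i))"
    if "i \<in> verts G" for i using f[of i] that unfolding Q_def by simp_all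
  have obO: "ob (f i) \<in> Ob (Cat D i)" if i: "i \<in> verts G" for i
    using C_simps(9)[of i "pr (f i)"] q(1,2)[OF i] i by simp
  obtain E where E: "isrep E" "\<And>i. i \<in> verts G \<Longrightarrow> ROb E i = ob (f i)" "\<And>a. a \<in> arcs G \<Longrightarrow> RMor E (arr a) = ma (f (head G a)) a"
    by (rule ex_rep_of_arrows[of "\<lambda>i. ob (f i)" "\<lambda>a. ma (f (head G a)) a"]) (use obO q(6) in simp_all)
  let ?g = "mk E (\<lambda>i. pr (f i)) M"
  have g: "?g \<in> Mor RC" by (rule mk_Mor) (use E M q in simp_all)
  have eg: "epic RC ?g" by (rule RC_epicI[OF g]) (use q(4) in simp)
  obtain k where k: "is_kernel RC ?g k" using RC.ex_kernel[OF g] by blast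
  note K = RC.kernelD[OF k]
  \<comment> \<open>\<open>k\<close> is some kernel of representations, so membership is transferred
    to its component from the kernel obtained at the vertex.\<close>
  have "ROb (Dom RC k) i \<in> Y i" if i: "i \<in> verts G" for i
  proof -
    obtain k' where k': "is_kernel (Cat D i) (pr (f i)) k'" "Dom (Cat D i) k' \<in> Y i" using q(5)[OF i] by blast
    have "is_kernel (Cat D i) (pr (f i)) (cm k i)" using RC_kernelD[OF k i] i by simp
    from abelian_category.cotorsion_pair_kernel_right[OF abelian_Cat[OF i] cotorsion[OF i] this k']
    show ?thesis using RC_MorD(4)[OF K(2) i] by simp
  qed
  then have "Dom RC k \<in> Rep_sub PC D Y" using RC_MorD(1)[OF K(2)] by simp
  moreover have "E \<in> Phi G D X"
  proof -
    have "monic_from_coproduct (Cat D i) (X i) (In i) (\<lambda>a. FOb (Fun D (arr a)) (ROb E (tail G a))) (ROb E i) (\<lambda>a. RMor E (arr a))"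
      if i: "i \<in> verts G" for i
    proof -
      have "monic_from_coproduct (Cat D i) (X i) (In i) (\<lambda>a. FOb (Fun D (arr a)) (ROb E (tail G a))) (ob (f i)) (\<lambda>a. RMor E (arr a)) \<longleftrightarrow>
         monic_from_coproduct (Cat D i) (X i) (In i) (\<lambda>a. FOb (Fun D (arr a)) (ob (f (tail G a)))) (ob (f i)) (ma (f i))"
        by (rule monic_from_coproduct_cong) (auto simp: E)
      then show ?thesis using q(8)[OF i] E(2)[OF i] by simp
    qed
    then show ?thesis using E(1) by (simp add: Phi_iff)
  qed
  ultimately show ?thesis using RC.short_exact_if_epic[OF eg k] K(3) by (intro exI[of _ k] exI[of _ ?g]) simp
qed

lemma ex_preenvelope:
  assumes M: "isrep M"
  shows "\<exists>f g. short_exact RC f g \<and> Dom RC f = M \<and> Cod RC f \<in> Rep_sub PC D Y \<and> Cod RC g \<in> Phi G D X"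
proof -
  let ?F = "\<lambda>a. FMor (Fun D (arr a))"
  \<comment> \<open>A choice at \<open>i\<close> records the embedding \<open>io\<close> of
    \<open>M_i\<close> and its cokernel \<open>qu\<close>, together with the maps along arcs of the
    envelope, \<open>ys\<close>, and of the quotient, \<open>xs\<close>: the quotient representation
    is built in the same recursion.\<close>
  define ys where "ys r = fst r" for r :: "('a \<Rightarrow> 'm) \<times> 'm \<times> 'm \<times> ('a \<Rightarrow> 'm)"
  define io where "io r = fst (snd r)" for r :: "('a \<Rightarrow> 'm) \<times> 'm \<times> 'm \<times> ('a \<Rightarrow> 'm)"
  define qu where "qu r = fst (snd (snd r))" for r :: "('a \<Rightarrow> 'm) \<times> 'm \<times> 'm \<times> ('a \<Rightarrow> 'm)"
  define xs where "xs r = snd (snd (snd r))" for r :: "('a \<Rightarrow> 'm) \<times> 'm \<times> 'm \<times> ('a \<Rightarrow> 'm)"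
  define Q where "Q f i r \<longleftrightarrow> (i \<in> verts G \<longrightarrow> short_exact (Cat D i) (io r) (qu r) \<and> Dom (Cat D i) (io r) = ROb M i \<and>
      Cod (Cat D i) (io r) \<in> Y i \<and> Cod (Cat D i) (qu r) \<in> X i \<and>
      (\<forall>a\<in>In i. ys r a \<in> Hom (Cat D i) (FOb (Fun D (arr a)) (Cod (Cat D (tail G a)) (io (f (tail G a))))) (Cod (Cat D i) (io r)) \<and>
         io r \<odot>\<^bsub>Cat D i\<^esub> RMor M (arr a) = ys r a \<odot>\<^bsub>Cat D i\<^esub> ?F a (io (f (tail G a))) \<and>
         xs r a \<in> Hom (Cat D i) (FOb (Fun D (arr a)) (Cod (Cat D (tail G a)) (qu (f (tail G a))))) (Cod (Cat D i) (qu r)) \<and>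
         qu r \<odot>\<^bsub>Cat D i\<^esub> ys r a = xs r a \<odot>\<^bsub>Cat D i\<^esub> ?F a (qu (f (tail G a)))) \<and>
      monic_from_coproduct (Cat D i) (X i) (In i) (\<lambda>a. FOb (Fun D (arr a)) (Cod (Cat D (tail G a)) (qu (f (tail G a))))) (Cod (Cat D i) (qu r)) (xs r))" for f i r
  have "\<exists>f. \<forall>i. Q f i (f i)"
  proof (rule dependent_wf_choice[OF wf_arcs])
    show "Q f i r = Q f' i r" if e: "\<And>j. (j, i) \<in> arc_rel G \<Longrightarrow> f j = f' j" for f f' i r
    proof -
      have eq: "f (tail G a) = f' (tail G a)" if "a \<in> In i" for a using e that arc_relI[of a] by auto
      have "monic_from_coproduct (Cat D i) (X i) (In i) (\<lambda>a. FOb (Fun D (arr a)) (Cod (Cat D (tail G a)) (qu (f (tail G a))))) (Cod (Cat D i) (qu r)) (xs r) \<longleftrightarrow>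
        monic_from_coproduct (Cat D i) (X i) (In i) (\<lambda>a. FOb (Fun D (arr a)) (Cod (Cat D (tail G a)) (qu (f' (tail G a))))) (Cod (Cat D i) (qu r)) (xs r)"
        by (rule monic_from_coproduct_cong) (use eq in simp_all)
      then show ?thesis unfolding Q_def using eq by simp
    qed
    fix i f assume IH: "\<And>j. (j, i) \<in> arc_rel G \<Longrightarrow> Q f j (f j)"
    show "\<exists>r. Q f i r"
    proof (cases "i \<in> verts G")
      case i: True
      let ?C = "Cat D i" and ?T = "\<lambda>a. Cat D (tail G a)"
      interpret C: abelian_category ?C by (rule abelian_Cat[OF i])
      define \<iota> \<kappa> where "\<iota> a = io (f (tail G a))" and "\<kappa> a = qu (f (tail G a))" for a
      have a': "a \<in> arcs G" "head G a = i" "tail G a \<in> verts G" if "a \<in> In i" for a using that by auto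
      have t: "short_exact (?T a) (\<iota> a) (\<kappa> a)" "Dom (?T a) (\<iota> a) = ROb M (tail G a)" "Cod (?T a) (\<kappa> a) \<in> X (tail G a)" if "a \<in> In i" for a
        using IH[of "tail G a"] that arc_relI[of a] unfolding Q_def \<iota>_def \<kappa>_def by auto
      have tm: "\<iota> a \<in> Mor (?T a)" "\<kappa> a \<in> Mor (?T a)" "Cod (?T a) (\<iota> a) = Dom (?T a) (\<kappa> a)" if "a \<in> In i" for a
        using preadditive_category.short_exactD[OF preadd_Cat[OF a'(3)[OF that]] t(1)[OF that]] by simp_all
      let ?A = "\<lambda>a. FOb (Fun D (arr a)) (ROb M (tail G a))" and ?B = "\<lambda>a. FOb (Fun D (arr a)) (Cod (?T a) (\<iota> a))"
        and ?E = "\<lambda>a. FOb (Fun D (arr a)) (Cod (?T a) (\<kappa> a))"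
      \<comment> \<open>Exactness moves the sequences at the sources to \<open>i\<close>, and
        compatibility puts their cokernels into \<open>X i\<close>.\<close>
      have F: "short_exact ?C (?F a (\<iota> a)) (?F a (\<kappa> a))" "?F a (\<iota> a) \<in> Mor ?C" "?F a (\<kappa> a) \<in> Mor ?C"
          "Dom ?C (?F a (\<iota> a)) = ?A a" "Cod ?C (?F a (\<iota> a)) = ?B a" "Dom ?C (?F a (\<kappa> a)) = ?B a" "Cod ?C (?F a (\<kappa> a)) = ?E a" "?E a \<in> X i" if a: "a \<in> In i" for a
        using Fun_short_exact[OF arr_path(1)[OF a'(1)[OF a]] arr_path(2,3) t(1)[OF a]] a'[OF a] tm[OF a] t[OF a] compat[OF a'(1)[OF a] t(3)[OF a]] by simp_all
      have O: "?A a \<in> Ob ?C" "?B a \<in> Ob ?C" "?E a \<in> Ob ?C" if "a \<in> arcs G" "head G a = i" for a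
        using F[of a] that C.Dom_Ob[of "?F a (\<iota> a)"] C.Cod_Ob[of "?F a (\<iota> a)"] C.Cod_Ob[of "?F a (\<kappa> a)"] by auto
      obtain PM u where PM: "is_coproduct ?C (In i) ?A PM u" using ex_coproduct_In[OF i, of ?A, OF O(1)] by blast
      obtain PY u' where PY: "is_coproduct ?C (In i) ?B PY u'" using ex_coproduct_In[OF i, of ?B, OF O(2)] by blast
      obtain PX u'' where PX: "is_coproduct ?C (In i) ?E PX u''" using ex_coproduct_In[OF i, of ?E, OF O(3)] by blast
      note I = C.coproduct_inj[OF PM] and I' = C.coproduct_inj[OF PY] and I'' = C.coproduct_inj[OF PX]
      obtain \<alpha> where \<alpha>: "\<alpha> \<in> Mor ?C" "Dom ?C \<alpha> = PM" "Cod ?C \<alpha> = PY" "\<And>a. a \<in> In i \<Longrightarrow> \<alpha> \<odot>\<^bsub>?C\<^esub> u a = u' a \<odot>\<^bsub>?C\<^esub> ?F a (\<iota> a)"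
        by (rule C.coproduct_lift[OF PM C.coproduct_ob[OF PY], of "\<lambda>a. u' a \<odot>\<^bsub>?C\<^esub> ?F a (\<iota> a)"]) (use F I' in \<open>simp_all add: Hom_iff\<close>)
      obtain \<beta> where \<beta>: "\<beta> \<in> Mor ?C" "Dom ?C \<beta> = PY" "Cod ?C \<beta> = PX" "\<And>a. a \<in> In i \<Longrightarrow> \<beta> \<odot>\<^bsub>?C\<^esub> u' a = u'' a \<odot>\<^bsub>?C\<^esub> ?F a (\<kappa> a)"
        by (rule C.coproduct_lift[OF PY C.coproduct_ob[OF PX], of "\<lambda>a. u'' a \<odot>\<^bsub>?C\<^esub> ?F a (\<kappa> a)"]) (use F I'' in \<open>simp_all add: Hom_iff\<close>)
      have ck\<alpha>: "is_cokernel ?C \<alpha> \<beta>"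
        by (rule C.coproduct_cokernel[OF PM PY PX _ \<alpha> \<beta>]) (use F C.short_exactD(2)[OF F(1)] in auto)
      \<comment> \<open>The coproduct of the embeddings is monic because all their cokernels lie in
        \<open>X i\<close>; this is the criterion for coproducts that comes with a complete
        cotorsion pair.\<close>
      have m\<alpha>: "monic ?C \<alpha>"
        by (rule C.cotorsion_pair_coproduct_monic[OF cotorsion[OF i] PM PY _ \<alpha>]) (use F in auto)
      have MO: "ROb M i \<in> Ob ?C" using M i by simp
      obtain m where m: "m \<in> Mor ?C" "Dom ?C m = PM" "Cod ?C m = ROb M i" "\<And>a. a \<in> In i \<Longrightarrow> m \<odot>\<^bsub>?C\<^esub> u a = RMor M (arr a)"
        by (rule C.coproduct_lift[OF PM MO, of "\<lambda>a. RMor M (arr a)"]) (use M i in \<open>auto simp: Hom_iff\<close>)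
      have dm: "Dom ?C m = Dom ?C \<alpha>" using m \<alpha> by simp
      \<comment> \<open>Pushing \<open>\<alpha>\<close> out along \<open>m\<close> enlarges
        \<open>M_i\<close> so that the envelopes at the sources can be mapped to it by
        \<open>e\<close>. The cokernel of \<open>p\<close> is still \<open>PX\<close>.\<close>
      obtain p e where p: "monic ?C p" "e \<in> Mor ?C" "p \<in> Mor ?C" "Dom ?C p = Cod ?C m" "Dom ?C e = Cod ?C \<alpha>" "Cod ?C e = Cod ?C p"
        "e \<odot>\<^bsub>?C\<^esub> \<alpha> = p \<odot>\<^bsub>?C\<^esub> m"
        and pc: "\<And>c. is_cokernel ?C \<alpha> c \<Longrightarrow> \<exists>c'. is_cokernel ?C p c' \<and> Cod ?C c' = Cod ?C c \<and> c' \<odot>\<^bsub>?C\<^esub> e = c"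
        by (rule C.ex_pushout[OF m\<alpha> m(1) dm]) blast
      obtain c' where c': "is_cokernel ?C p c'" "Cod ?C c' = PX" "c' \<odot>\<^bsub>?C\<^esub> e = \<beta>" using pc[OF ck\<alpha>] \<beta>(3) by auto
      note C' = C.cokernelD[OF c'(1)]
      \<comment> \<open>The pushout need not lie in \<open>Y i\<close>. Its special preenvelope
        does, at the cost of a further cokernel \<open>Cod ?C d\<close> in
        \<open>X i\<close>.\<close>
      obtain y d where y: "short_exact ?C y d" "Dom ?C y = Cod ?C p" "Cod ?C y \<in> Y i" "Cod ?C d \<in> X i"
        using complete_cotorsion_pairD(9)[OF cotorsion[OF i] C.Cod_Ob[OF p(3)]] by blast
      note Yd = C.short_exactD[OF y(1)]
      let ?io = "y \<odot>\<^bsub>?C\<^esub> p"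
      have iom: "monic ?C ?io" by (rule C.monic_comp[OF p(1) Yd(7) y(2)])
      have io: "?io \<in> Mor ?C" "Dom ?C ?io = ROb M i" "Cod ?C ?io = Cod ?C y" using p Yd y m by simp_all
      obtain q where q: "is_cokernel ?C ?io q" using C.ex_cokernel[OF io(1)] by blast
      note Qd = C.cokernelD[OF q]
      have z: "(q \<odot>\<^bsub>?C\<^esub> y) \<odot>\<^bsub>?C\<^esub> p = Zero ?C (Dom ?C p) (Cod ?C (q \<odot>\<^bsub>?C\<^esub> y))"
        using C.comp_assoc[of p y q] Qd p Yd y io m by simp
      obtain \<phi> where \<phi>: "\<phi> \<in> Mor ?C" "Cod ?C \<phi> = Cod ?C (q \<odot>\<^bsub>?C\<^esub> y)" "Dom ?C \<phi> = Cod ?C c'" "\<phi> \<odot>\<^bsub>?C\<^esub> c' = q \<odot>\<^bsub>?C\<^esub> y"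
        by (rule C.cokernel_lift[OF c'(1) _ _ z]) (use Qd p Yd y io in simp_all)
      have \<phi>C: "Cod ?C \<phi> = Cod ?C q" using \<phi>(2) Qd Yd io by simp
      \<comment> \<open>For \<open>M_i\<close> inside the pushout inside \<open>Cod ?C y\<close>:
        the lower quotient \<open>PX\<close> embeds by \<open>\<phi>\<close> into the total
        quotient, with cokernel object \<open>Cod ?C d\<close>. This \<open>\<phi>\<close> is the
        map out of the coproduct that \<open>Phi\<close> asks of the quotient
        representation.\<close>
      obtain d' where d': "monic ?C \<phi>" "is_cokernel ?C \<phi> d'" "Cod ?C d' = Cod ?C d"
        by (rule C.noether_third[OF p(1) c'(1) Yd(7,2) y(2) q \<phi>(1,3) \<phi>C \<phi>(4)])
      have PXX: "PX \<in> X i" by (rule C.cotorsion_pair_coproduct[OF cotorsion[OF i] PX]) (use F(8) in simp)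
      \<comment> \<open>Needed for the next vertices of the recursion, where \<open>Cod ?C q\<close>
        is one of the objects whose images under \<open>D_a\<close> have to lie in the left
        class.\<close>
      have qX: "Cod ?C q \<in> X i"
        using C.cotorsion_pair_extension[OF cotorsion[OF i] d'(1,2)] PXX d'(3) y(4) \<phi>(3) \<phi>C c'(2) by simp
      let ?ys = "\<lambda>a. y \<odot>\<^bsub>?C\<^esub> (e \<odot>\<^bsub>?C\<^esub> u' a)" and ?xs = "\<lambda>a. \<phi> \<odot>\<^bsub>?C\<^esub> u'' a"
      have se: "short_exact ?C ?io q" by (rule C.short_exact_if_monic[OF iom q])
      have ty: "?ys a \<in> Hom ?C (?B a) (Cod ?C ?io)" "?xs a \<in> Hom ?C (?E a) (Cod ?C q)" if a: "a \<in> In i" for a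
        using I'[OF a] I''[OF a] p \<alpha>(3) y Yd io \<phi> \<phi>C c' by (simp_all add: Hom_iff)
      have e1: "?io \<odot>\<^bsub>?C\<^esub> RMor M (arr a) = ?ys a \<odot>\<^bsub>?C\<^esub> ?F a (\<iota> a)" if a: "a \<in> In i" for a
      proof -
        have "?io \<odot>\<^bsub>?C\<^esub> RMor M (arr a) = y \<odot>\<^bsub>?C\<^esub> ((p \<odot>\<^bsub>?C\<^esub> m) \<odot>\<^bsub>?C\<^esub> u a)"
          unfolding m(4)[OF a, symmetric] using I[OF a] m(1-3) p(1-6) y Yd by (simp add: C.comp_assoc)
        also have "\<dots> = y \<odot>\<^bsub>?C\<^esub> (e \<odot>\<^bsub>?C\<^esub> (\<alpha> \<odot>\<^bsub>?C\<^esub> u a))"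
          unfolding p(7)[symmetric] using I[OF a] \<alpha>(1-3) p(1-6) by (simp add: C.comp_assoc)
        also have "\<dots> = ?ys a \<odot>\<^bsub>?C\<^esub> ?F a (\<iota> a)"
          unfolding \<alpha>(4)[OF a] using I'[OF a] F[OF a] \<alpha>(1-3) p(1-6) y Yd by (simp add: C.comp_assoc)
        finally show ?thesis .
      qed
      have e2: "q \<odot>\<^bsub>?C\<^esub> ?ys a = ?xs a \<odot>\<^bsub>?C\<^esub> ?F a (\<kappa> a)" if a: "a \<in> In i" for a
      proof -
        have "q \<odot>\<^bsub>?C\<^esub> ?ys a = (\<phi> \<odot>\<^bsub>?C\<^esub> c') \<odot>\<^bsub>?C\<^esub> (e \<odot>\<^bsub>?C\<^esub> u' a)"
          unfolding \<phi>(4) by (rule C.comp_assoc[symmetric]) (use I'[OF a] p \<alpha>(3) y Yd io Qd in simp_all)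
        also have "\<dots> = \<phi> \<odot>\<^bsub>?C\<^esub> ((c' \<odot>\<^bsub>?C\<^esub> e) \<odot>\<^bsub>?C\<^esub> u' a)"
          using I'[OF a] p(1-6) \<alpha>(3) \<phi>(1-3) C'(1-3) by (simp add: C.comp_assoc)
        also have "\<dots> = ?xs a \<odot>\<^bsub>?C\<^esub> ?F a (\<kappa> a)"
          unfolding c'(3) \<beta>(4)[OF a] by (rule C.comp_assoc[symmetric]) (use I''[OF a] F[OF a] \<phi>(1-3) c' in simp_all)
        finally show ?thesis .
      qed
      have mf: "monic_from_coproduct ?C (X i) (In i) ?E (Cod ?C q) ?xs"
        by (rule monic_from_coproductI[OF PX \<phi>(1) _ \<phi>C _ d'(1,2)]) (use \<phi> c' d' y in simp_all)
      have "Q f i (?ys, ?io, q, ?xs)"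
        unfolding Q_def ys_def io_def qu_def xs_def fst_conv snd_conv
        using se io(2,3) y(3) qX ty e1 e2 mf unfolding \<iota>_def \<kappa>_def ys_def io_def qu_def xs_def by simp
      then show ?thesis by blast
    qed (simp add: Q_def)
  qed
  then obtain f where f: "\<And>i. Q f i (f i)" by blast
  define \<iota> \<kappa> where "\<iota> i = io (f i)" and "\<kappa> i = qu (f i)" for i
  have q: "short_exact (Cat D i) (\<iota> i) (\<kappa> i)" "Dom (Cat D i) (\<iota> i) = ROb M i" "Cod (Cat D i) (\<iota> i) \<in> Y i"
      "\<And>a. \<lbrakk>a \<in> arcs G; head G a = i\<rbrakk> \<Longrightarrow> ys (f i) a \<in> Hom (Cat D i) (FOb (Fun D (arr a)) (Cod (Cat D (tail G a)) (\<iota> (tail G a)))) (Cod (Cat D i) (\<iota> i))"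
      "\<And>a. \<lbrakk>a \<in> arcs G; head G a = i\<rbrakk> \<Longrightarrow> \<iota> i \<odot>\<^bsub>Cat D i\<^esub> RMor M (arr a) = ys (f i) a \<odot>\<^bsub>Cat D i\<^esub> ?F a (\<iota> (tail G a))"
      "\<And>a. \<lbrakk>a \<in> arcs G; head G a = i\<rbrakk> \<Longrightarrow> xs (f i) a \<in> Hom (Cat D i) (FOb (Fun D (arr a)) (Cod (Cat D (tail G a)) (\<kappa> (tail G a)))) (Cod (Cat D i) (\<kappa> i))"
      "\<And>a. \<lbrakk>a \<in> arcs G; head G a = i\<rbrakk> \<Longrightarrow> \<kappa> i \<odot>\<^bsub>Cat D i\<^esub> ys (f i) a = xs (f i) a \<odot>\<^bsub>Cat D i\<^esub> ?F a (\<kappa> (tail G a))"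
      "monic_from_coproduct (Cat D i) (X i) (In i) (\<lambda>a. FOb (Fun D (arr a)) (Cod (Cat D (tail G a)) (\<kappa> (tail G a)))) (Cod (Cat D i) (\<kappa> i)) (xs (f i))"
    if "i \<in> verts G" for i using f[of i] that unfolding Q_def \<iota>_def \<kappa>_def by simp_all
  note S = preadditive_category.short_exactD[OF preadd_Cat q(1)]
  obtain N where N: "isrep N" "\<And>i. i \<in> verts G \<Longrightarrow> ROb N i = Cod (Cat D i) (\<iota> i)" "\<And>a. a \<in> arcs G \<Longrightarrow> RMor N (arr a) = ys (f (head G a)) a"
    by (rule ex_rep_of_arrows[of "\<lambda>i. Cod (Cat D i) (\<iota> i)" "\<lambda>a. ys (f (head G a)) a"]) (use S(3) q(4) in simp_all)
  obtain E where E: "isrep E" "\<And>i. i \<in> verts G \<Longrightarrow> ROb E i = Cod (Cat D i) (\<kappa> i)" "\<And>a. a \<in> arcs G \<Longrightarrow> RMor E (arr a) = xs (f (head G a)) a"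
    by (rule ex_rep_of_arrows[of "\<lambda>i. Cod (Cat D i) (\<kappa> i)" "\<lambda>a. xs (f (head G a)) a"]) (use S(4) q(6) in simp_all)
  let ?f = "mk M \<iota> N" and ?g = "mk N \<kappa> E"
  have fm: "?f \<in> Mor RC" by (rule mk_Mor[OF M N(1)]) (use N S(3) q in simp_all)
  have gm: "?g \<in> Mor RC" by (rule mk_Mor[OF N(1) E(1)]) (use N E S(4,5) q in simp_all)
  have "short_exact RC ?f ?g" unfolding RC_short_exact_iff using fm gm q(1) by simp
  moreover have "N \<in> Rep_sub PC D Y" using N q(3) by simp
  moreover have "E \<in> Phi G D X"
  proof -
    have "monic_from_coproduct (Cat D i) (X i) (In i) (\<lambda>a. FOb (Fun D (arr a)) (ROb E (tail G a))) (ROb E i) (\<lambda>a. RMor E (arr a))"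
      if i: "i \<in> verts G" for i
    proof -
      have "monic_from_coproduct (Cat D i) (X i) (In i) (\<lambda>a. FOb (Fun D (arr a)) (ROb E (tail G a))) (Cod (Cat D i) (\<kappa> i)) (\<lambda>a. RMor E (arr a)) \<longleftrightarrow>
         monic_from_coproduct (Cat D i) (X i) (In i) (\<lambda>a. FOb (Fun D (arr a)) (Cod (Cat D (tail G a)) (\<kappa> (tail G a)))) (Cod (Cat D i) (\<kappa> i)) (xs (f i))"
        by (rule monic_from_coproduct_cong) (auto simp: E)
      then show ?thesis using q(8)[OF i] E(2)[OF i] by simp
    qed
    then show ?thesis using E(1) by (simp add: Phi_iff)
  qed
  ultimately show ?thesis by (intro exI[of _ ?f] exI[of _ ?g]) simp
qed

lemma Phi_cotorsion_pair: "complete_cotorsion_pair RC (Phi G D X) (Rep_sub PC D Y)"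
proof (rule RC.complete_cotorsion_pairI)
  show "Phi G D X \<subseteq> Ob RC" "Rep_sub PC D Y \<subseteq> Ob RC" by (auto simp: Phi_iff)
qed (use Phi_Rep_sub_orthogonal ex_precover ex_preenvelope Phi_retract Rep_sub_retract in simp_all)

end

section \<open>The two cotorsion pairs assembled into a Hovey triple of representations\<close>

theorem theorem2:
  fixes U :: "'u itself"
    and G :: "('v, 'a) pre_digraph"
    and D :: "('v, ('v, 'a) path, 'o, 'm) diagram"
    and Q W R :: "'v \<Rightarrow> 'o set"
  assumes "small_quiver U G"
    and "left_rooted G"
    and "cat_diagram (path_category G) D"
    and "\<And>i. i \<in> verts G \<Longrightarrow> grothendieck_category U (Cat D i)"
    and "\<And>i. i \<in> verts G \<Longrightarrow> enough_projectives (Cat D i)"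
    and "\<And>i j \<alpha>. \<alpha> \<in> Hom (path_category G) i j \<Longrightarrow>
           preserves_small_coproducts U (Cat D i) (Cat D j) (Fun D \<alpha>)"
    and "exact_diagram (path_category G) D"
    and "\<And>i. i \<in> verts G \<Longrightarrow> hovey_triple U (Cat D i) (Q i) (W i) (R i)"
    and "compatible (path_category G) D Q"
    and "compatible (path_category G) D (\<lambda>i. Q i \<inter> W i)"
  shows "hovey_triple U (Rep (path_category G) D)
           (Phi G D Q) (Rep_sub (path_category G) D W) (Rep_sub (path_category G) D R) \<and>
         ((\<forall>i\<in>verts G. hereditary_hovey_triple U (Cat D i) (Q i) (W i) (R i)) \<longrightarrow>
          hereditary_hovey_triple U (Rep (path_category G) D)
            (Phi G D Q) (Rep_sub (path_category G) D W) (Rep_sub (path_category G) D R))"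
proof -
  interpret wf_digraph G using assms(1) by (simp add: small_quiver_def)
  note H = assms(8)[unfolded hovey_triple_def]
  interpret quiver_diagram G D
    by (intro quiver_diagram.intro wf_digraph_axioms assms(3) quiver_diagram_axioms.intro)
      (use H assms(7) in auto)
  have thick: "thick (Cat D i) (W i)" if "i \<in> verts G" for i using H[OF that] by blast
  have arrH: "arr a \<in> Hom PC (tail G a) (head G a)" if "a \<in> arcs G" for a using that by (simp add: Hom_iff)
  have coprod: "\<exists>P u. is_coproduct (Cat D i) {a \<in> arcs G. head G a = i} Z P u"
    if "i \<in> verts G" "\<And>a. \<lbrakk>a \<in> arcs G; head G a = i\<rbrakk> \<Longrightarrow> Z a \<in> Ob (Cat D i)" for i Z
  proof (rule category.ex_coproduct[OF cat_Cat[OF that(1)]])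
    show "cocomplete U (Cat D i)" using H[OF that(1)] by (simp add: bicomplete_def)
    show "small U {a \<in> arcs G. head G a = i}" by (rule small_subset[of U "arcs G"]) (use assms(1) in \<open>auto simp: small_quiver_def\<close>)
  qed (use that in simp)
  \<comment> \<open>\<open>cof\<close> pairs the cofibrant with the trivially fibrant objects,
    \<open>triv\<close> the trivially cofibrant with the fibrant ones.\<close>
  interpret cof: quiver_cotorsion G D Q "\<lambda>i. W i \<inter> R i"
  proof
    show "wf (arc_rel G)" by (rule wf_arc_rel[OF wf_digraph assms(2)])
    show "complete_cotorsion_pair (Cat D i) (Q i) (W i \<inter> R i)" if "i \<in> verts G" for i using H[OF that] by blast
    show "FOb (Fun D (arr a)) A \<in> Q (head G a)" if "a \<in> arcs G" "A \<in> Q (tail G a)" for a A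
      using assms(9) arrH[OF that(1)] that(2) unfolding compatible_def by blast
  qed (rule coprod)
  interpret triv: quiver_cotorsion G D "\<lambda>i. Q i \<inter> W i" R
  proof
    show "wf (arc_rel G)" by (rule wf_arc_rel[OF wf_digraph assms(2)])
    show "complete_cotorsion_pair (Cat D i) (Q i \<inter> W i) (R i)" if "i \<in> verts G" for i using H[OF that] by blast
    show "FOb (Fun D (arr a)) A \<in> Q (head G a) \<inter> W (head G a)" if "a \<in> arcs G" "A \<in> Q (tail G a) \<inter> W (tail G a)" for a A
      using assms(10) arrH[OF that(1)] that(2) unfolding compatible_def by blast
  qed (rule coprod)
  have WR: "Rep_sub PC D W \<inter> Rep_sub PC D R = Rep_sub PC D (\<lambda>i. W i \<inter> R i)" by auto
  have QW: "Phi G D Q \<inter> Rep_sub PC D W = Phi G D (\<lambda>i. Q i \<inter> W i)"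
  proof (intro equalityI subsetI)
    fix M assume M: "M \<in> Phi G D (\<lambda>i. Q i \<inter> W i)"
    have "monic_from_coproduct (Cat D i) (Q i) (cof.In i) (\<lambda>a. FOb (Fun D (arr a)) (ROb M (tail G a))) (ROb M i) (\<lambda>a. RMor M (arr a))"
      if i: "i \<in> verts G" for i
      by (rule monic_from_coproduct_mono[OF M[unfolded triv.Phi_iff, THEN conjunct2, THEN bspec, OF i]]) simp
    then have "M \<in> Phi G D Q" using M unfolding cof.Phi_iff triv.Phi_iff by blast
    \<comment> \<open>\<open>Phi_components\<close> for the trivial pair puts every
      \<open>M_i\<close> into \<open>Q i \<inter> W i\<close>.\<close>
    moreover have "M \<in> Rep_sub PC D W" using triv.Phi_components[OF M] M by (auto simp: triv.Phi_iff)
    ultimately show "M \<in> Phi G D Q \<inter> Rep_sub PC D W" by blast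
  next
    fix M assume MM: "M \<in> Phi G D Q \<inter> Rep_sub PC D W"
    then have M: "M \<in> Phi G D Q" "isrep M" "\<And>i. i \<in> verts G \<Longrightarrow> ROb M i \<in> W i" by auto
    have "monic_from_coproduct (Cat D i) (Q i \<inter> W i) (cof.In i) (\<lambda>a. FOb (Fun D (arr a)) (ROb M (tail G a))) (ROb M i) (\<lambda>a. RMor M (arr a))"
      if i: "i \<in> verts G" for i
    proof -
      interpret C: abelian_category "Cat D i" by (rule abelian_Cat[OF i])
      obtain P u \<phi> c where P: "is_coproduct (Cat D i) (cof.In i) (\<lambda>a. FOb (Fun D (arr a)) (ROb M (tail G a))) P u"
        and \<phi>: "\<phi> \<in> Mor (Cat D i)" "Dom (Cat D i) \<phi> = P" "Cod (Cat D i) \<phi> = ROb M i"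
          "\<And>a. a \<in> cof.In i \<Longrightarrow> \<phi> \<odot>\<^bsub>Cat D i\<^esub> u a = RMor M (arr a)" "monic (Cat D i) \<phi>"
          "is_cokernel (Cat D i) \<phi> c" "Cod (Cat D i) c \<in> Q i"
        by (rule monic_from_coproductE[OF cof.Phi_iff[THEN iffD1, OF M(1), THEN conjunct2, THEN bspec, OF i]]) (rule that)
      \<comment> \<open>A thick class need not contain the coproducts of its members, but
        \<open>Q i \<inter> W i\<close> is the left class of a cotorsion pair and does. Its own
        compatibility moves the objects along the arcs.\<close>
      have "P \<in> Q i \<inter> W i"
      proof (rule C.cotorsion_pair_coproduct[OF triv.cotorsion[OF i] P])
        fix a assume "a \<in> cof.In i"
        then show "FOb (Fun D (arr a)) (ROb M (tail G a)) \<in> Q i \<inter> W i"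
          using triv.compat[of a "ROb M (tail G a)"] cof.Phi_components[OF M(1), of "tail G a"] M(3)[of "tail G a"] by auto
      qed
      moreover have cl: "closed_cokernels_of_monos (Cat D i) (W i)" using thick[OF i] by (simp add: thick_def)
      \<comment> \<open>Both ends of the monomorphism \<open>\<phi>\<close> lie in
        \<open>W i\<close>, and thickness gives its cokernel.\<close>
      ultimately have "Cod (Cat D i) c \<in> W i"
        using cl[unfolded closed_cokernels_of_monos_def, rule_format, of \<phi> c] \<phi>(2,3,5,6) M(3)[OF i] by simp
      with \<phi>(4) show ?thesis
        by (intro monic_from_coproductI[OF P \<phi>(1-3) _ \<phi>(5,6)]) (use \<phi>(7) in simp_all)
    qed
    then show "M \<in> Phi G D (\<lambda>i. Q i \<inter> W i)" unfolding triv.Phi_iff using M(2) by blast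
  qed
  \<comment> \<open>Limits and colimits at the vertices are part of the given Hovey triples;
    preservation of coproducts is used along single arcs.\<close>
  have "bicomplete U RC"
    unfolding bicomplete_def
  proof
    show "complete U RC" by (rule RC_complete) (use H in \<open>simp add: bicomplete_def\<close>)
    show "cocomplete U RC" by (rule RC_cocomplete) (use H assms(6)[OF arrH] in \<open>simp_all add: bicomplete_def\<close>)
  qed
  then have hovey: "hovey_triple U RC (Phi G D Q) (Rep_sub PC D W) (Rep_sub PC D R)"
    unfolding hovey_triple_def WR QW
    using RC_abelian Rep_sub_thick[OF thick] cof.Phi_cotorsion_pair triv.Phi_cotorsion_pair
      complete_cotorsion_pairD(1)[OF cof.Phi_cotorsion_pair] by auto
  have "hereditary_cotorsion_pair RC (Phi G D Q) (Rep_sub PC D (\<lambda>i. W i \<inter> R i)) \<and>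
      hereditary_cotorsion_pair RC (Phi G D (\<lambda>i. Q i \<inter> W i)) (Rep_sub PC D R)"
    if h: "\<forall>i\<in>verts G. hereditary_hovey_triple U (Cat D i) (Q i) (W i) (R i)"
  proof -
    have "closed_cokernels_of_monos (Cat D i) (W i \<inter> R i)" "closed_cokernels_of_monos (Cat D i) (R i)" if "i \<in> verts G" for i
      using h that by (simp_all add: hereditary_hovey_triple_def hereditary_cotorsion_pair_def)
    then have cl: "closed_cokernels_of_monos RC (Rep_sub PC D (\<lambda>i. W i \<inter> R i))" "closed_cokernels_of_monos RC (Rep_sub PC D R)"
      by (auto intro: Rep_sub_closed_cokernels)
    then show ?thesis
      unfolding hereditary_cotorsion_pair_def
      using cof.Phi_cotorsion_pair triv.Phi_cotorsion_pair
        RC.closed_kernels_if_closed_cokernels[OF cof.Phi_cotorsion_pair cl(1)]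
        RC.closed_kernels_if_closed_cokernels[OF triv.Phi_cotorsion_pair cl(2)]
      by (simp add: complete_cotorsion_pair_def)
  qed
  then show ?thesis using hovey unfolding hereditary_hovey_triple_def WR QW by blast
qed

end
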